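(* If there is an algorithm solving $\mathsf{MAX}\text{-}\mathsf{SAT}$ on $n$ variables and $m$ clauses in time $2^{n-\Omega(n/\log m)}$, then $\mathsf{E}^{\mathsf{NP}}$ does not have $2^{o(\sqrt{n})}$-size $\mathsf{SYM}\circ\mathsf{AND}$ circuits.
   Context: $\mathsf{MAX}\text{-}\mathsf{SAT}$: given a CNF formula, find the maximum number of simultaneously satisfiable clauses. A $\mathsf{SYM}\circ\mathsf{AND}$ circuit has a symmetric output gate (computing $f(\sum_i z_i)$ for arbitrary $f$) over unbounded fan-in AND gates of input literals. $\mathsf{E}^{\mathsf{NP}}$: languages decidable in time $2^{O(n)}$ with an $\mathsf{NP}$ oracle; "$\mathsf{E}^{\mathsf{NP}}$ does not have $s(n)$-size $\mathcal{C}$ circuits" means some $f\in\mathsf{E}^{\mathsf{NP}}$ has, for infinitely many $n$, no $\mathcal{C}$ circuit of size $s(n)$ on inputs of length $n$. *)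

theory Defs
  imports Complex_Main "HOL-Library.Landau_Symbols" "HOL-Library.Log_Nat"
begin

section \<open>Random access machines with logarithmic cost and an oracle\<close>

text \<open>
  Registers are indexed by natural numbers, hold natural numbers and are initially 0. The input is
  a read-only bit string with random access. \<open>Append\<close> extends the pending query string by one bit;
  \<open>Query\<close> submits it to the oracle and resets it. A run ends when the program counter leaves the
  program, and its result is the content of register 0.
\<close>

datatype instr =
    Const nat nat
  | Add nat nat nat
  | Sub nat nat nat
  | Load nat nat
  | Store nat nat
  | Read nat nat
  | Append nat
  | Query nat
  | JumpZero nat nat

type_synonym ram = "instr list"

type_synonym bits = "bool list"

type_synonym config = "nat \<times> (nat \<Rightarrow> nat) \<times> bits"

fun step_instr :: "bits set \<Rightarrow> bits \<Rightarrow> instr \<Rightarrow> config \<Rightarrow> config" where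
  "step_instr A x (Const r k) (pc, M, q) = (Suc pc, M(r := k), q)"
| "step_instr A x (Add r s t) (pc, M, q) = (Suc pc, M(r := M s + M t), q)"
| "step_instr A x (Sub r s t) (pc, M, q) = (Suc pc, M(r := M s - M t), q)"
| "step_instr A x (Load r s) (pc, M, q) = (Suc pc, M(r := M (M s)), q)"
| "step_instr A x (Store r s) (pc, M, q) = (Suc pc, M(M r := M s), q)"
| "step_instr A x (Read r s) (pc, M, q) =
     (Suc pc, M(r := (if M s < length x then of_bool (x ! M s) else 2)), q)"
| "step_instr A x (Append s) (pc, M, q) = (Suc pc, M, q @ [M s \<noteq> 0])"
| "step_instr A x (Query r) (pc, M, q) = (Suc pc, M(r := of_bool (q \<in> A)), [])"
| "step_instr A x (JumpZero r l) (pc, M, q) = (if M r = 0 then l else Suc pc, M, q)"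

definition bit_cost :: "nat \<Rightarrow> nat" where
  "bit_cost n = max 1 (floorlog 2 n)"

fun cost_instr :: "instr \<Rightarrow> (nat \<Rightarrow> nat) \<Rightarrow> nat" where
  "cost_instr (Const r k) M = bit_cost k"
| "cost_instr (Add r s t) M = bit_cost (M s) + bit_cost (M t)"
| "cost_instr (Sub r s t) M = bit_cost (M s) + bit_cost (M t)"
| "cost_instr (Load r s) M = bit_cost (M s) + bit_cost (M (M s))"
| "cost_instr (Store r s) M = bit_cost (M r) + bit_cost (M s)"
| "cost_instr (Read r s) M = bit_cost (M s)"
| "cost_instr (Append s) M = bit_cost (M s)"
| "cost_instr (Query r) M = 1"
| "cost_instr (JumpZero r l) M = bit_cost (M r)"

text \<open>\<open>exec P A x c v t\<close>: with oracle \<open>A\<close> and input \<open>x\<close>, program \<open>P\<close> started in configuration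
  \<open>c\<close> halts with result \<open>v\<close> after total cost \<open>t\<close>.\<close>

inductive exec :: "ram \<Rightarrow> bits set \<Rightarrow> bits \<Rightarrow> config \<Rightarrow> nat \<Rightarrow> nat \<Rightarrow> bool"
  for P :: ram and A :: "bits set" and x :: bits where
  halt: "length P \<le> pc \<Longrightarrow> exec P A x (pc, M, q) (M 0) 0"
| step: "pc < length P \<Longrightarrow> exec P A x (step_instr A x (P ! pc) (pc, M, q)) v t \<Longrightarrow>
    exec P A x (pc, M, q) v (cost_instr (P ! pc) M + t)"

definition computes_in :: "ram \<Rightarrow> bits set \<Rightarrow> bits \<Rightarrow> nat \<Rightarrow> nat \<Rightarrow> bool" where
  "computes_in P A x v t \<longleftrightarrow> exec P A x (0, (\<lambda>_. 0), []) v t"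


section \<open>The classes P, NP and E with an NP oracle\<close>

definition decides_in_time :: "ram \<Rightarrow> bits set \<Rightarrow> bits set \<Rightarrow> (nat \<Rightarrow> real) \<Rightarrow> bool" where
  "decides_in_time P A L T \<longleftrightarrow>
     (\<forall>x. \<exists>t. computes_in P A x (of_bool (x \<in> L)) t \<and> real t \<le> T (length x))"

definition class_P :: "bits set set" where
  "class_P = {L. \<exists>P k. decides_in_time P {} L (\<lambda>n. real (n ^ k + k))}"

definition pair_code :: "bits \<Rightarrow> bits \<Rightarrow> bits" where
  "pair_code x w = concat (map (\<lambda>b. [b, b]) x) @ [False, True] @ w"

definition class_NP :: "bits set set" where
  "class_NP = {L. \<exists>R\<in>class_P. \<exists>k.
     L = {x. \<exists>w. length w \<le> length x ^ k + k \<and> pair_code x w \<in> R}}"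

definition class_E_NP :: "bits set set" where
  "class_E_NP = {L. \<exists>A\<in>class_NP. \<exists>P. \<exists>g\<in>O(\<lambda>n. real n).
     decides_in_time P A L (\<lambda>n. 2 powr g n)}"


section \<open>MAX-SAT\<close>

text \<open>The literal \<open>(i, b)\<close> is variable \<open>i\<close> if \<open>b\<close> holds, and its negation otherwise.\<close>

type_synonym literal = "nat \<times> bool"

type_synonym cnf = "literal list list"

definition clause_true :: "(nat \<Rightarrow> bool) \<Rightarrow> literal list \<Rightarrow> bool" where
  "clause_true \<alpha> C \<longleftrightarrow> (\<exists>(i, b)\<in>set C. \<alpha> i = b)"

definition max_sat :: "cnf \<Rightarrow> nat" where
  "max_sat F = Max (range (\<lambda>\<alpha>. length (filter (clause_true \<alpha>) F)))"

definition cnf_on :: "nat \<Rightarrow> cnf \<Rightarrow> bool" where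
  "cnf_on n F \<longleftrightarrow> (\<forall>C\<in>set F. \<forall>(i, b)\<in>set C. i < n)"

text \<open>Data bits are doubled; the pair 01 ends a number and the pair 10 ends a clause.\<close>

definition nat_code :: "nat \<Rightarrow> bits" where
  "nat_code n = concat (map (\<lambda>j. [bit n j, bit n j]) [0..<floorlog 2 n]) @ [False, True]"

definition clause_code :: "literal list \<Rightarrow> bits" where
  "clause_code C = concat (map (\<lambda>(i, b). [b, b] @ nat_code i) C) @ [True, False]"

definition cnf_code :: "nat \<Rightarrow> cnf \<Rightarrow> bits" where
  "cnf_code n F = nat_code n @ concat (map clause_code F)"

text \<open>
  As usual for exponential-time algorithms, the bound \<open>T n m\<close>, for \<open>n\<close> variables and \<open>m\<close> clauses,
  is understood up to a factor polynomial in the length of the input. Without it, a bound below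
  \<open>2 ^ n\<close> could not hold for formulas with \<open>m \<ge> 2 ^ n\<close> clauses, which take longer to read.
\<close>

definition solves_MAX_SAT_in_time :: "ram \<Rightarrow> (nat \<Rightarrow> nat \<Rightarrow> real) \<Rightarrow> bool" where
  "solves_MAX_SAT_in_time P T \<longleftrightarrow>
     (\<exists>k. \<forall>n F. cnf_on n F \<longrightarrow>
        (\<exists>t. computes_in P {} (cnf_code n F) (max_sat F) t \<and>
             real t \<le> real (length (cnf_code n F) ^ k + k) * T n (length F)))"


section \<open>Circuits with a symmetric gate over AND gates\<close>

text \<open>\<open>SymAnd f Gs\<close> has the AND gates \<open>Gs\<close>, each given by its input literals, and the output gate
  applying \<open>f\<close> to the number of true AND gates. Repeated AND gates are counted repeatedly.\<close>

datatype sym_and = SymAnd "nat \<Rightarrow> bool" "literal list list"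

fun circuit_on :: "nat \<Rightarrow> sym_and \<Rightarrow> bool" where
  "circuit_on n (SymAnd f Gs) \<longleftrightarrow> (\<forall>G\<in>set Gs. \<forall>(i, b)\<in>set G. i < n)"

fun circuit_size :: "sym_and \<Rightarrow> nat" where
  "circuit_size (SymAnd f Gs) = length Gs + 1"

fun circuit_eval :: "sym_and \<Rightarrow> bits \<Rightarrow> bool" where
  "circuit_eval (SymAnd f Gs) x = f (\<Sum>G\<leftarrow>Gs. of_bool (\<forall>(i, b)\<in>set G. x ! i = b))"

definition has_sym_and_circuit :: "bits set \<Rightarrow> nat \<Rightarrow> real \<Rightarrow> bool" where
  "has_sym_and_circuit L n s \<longleftrightarrow>
     (\<exists>C. circuit_on n C \<and> real (circuit_size C) \<le> s \<and>
          (\<forall>x. length x = n \<longrightarrow> circuit_eval C x = (x \<in> L)))"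

definition E_NP_lacks_sym_and_circuits :: "(nat \<Rightarrow> real) \<Rightarrow> bool" where
  "E_NP_lacks_sym_and_circuits s \<longleftrightarrow>
     (\<exists>L\<in>class_E_NP. \<exists>\<^sub>\<infinity>n. \<not> has_sym_and_circuit L n (s n))"

end

theory Submission
  imports Defs "HOL-Combinatorics.Orbits"
begin

text \<open>
  Williams' algorithmic method. Suppose that every language in E with an NP oracle had such circuits,
  and consider a machine \<open>V\<close> that, on a word \<open>w\<close> of length \<open>K\<close>, guesses bits and runs for less than
  \<open>2 ^ K\<close> steps. Whether \<open>V\<close> has an accepting run is expressed by a constraint system over a table with
  \<open>2 ^ K\<close> rows; rows that access the same memory cell are brought together by a Benes network, so every
  constraint compares at most five entries and is described by a pattern in \<open>K\<close> free bits. The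
  lexicographically first satisfying table lies in E with an NP oracle, hence is given by a
  SYM-AND circuit of size \<open>2 ^ o(sqrt K)\<close>, which can be guessed and verified: a violated
  constraint is an assignment of the \<open>K\<close> bits under which a few counts of true AND gates take
  prescribed values, and this is a MAX-SAT question with \<open>2 ^ o(sqrt K)\<close> clauses, since
  \<open>c\<^sup>2 + 2 * a * (s - c)\<close> is minimal exactly for \<open>c = a\<close>. The assumed algorithm saves a factor
  \<open>2 ^ \<omega>(sqrt K)\<close> over exhaustive search, and the verification takes less than \<open>2 ^ K\<close> steps.

  Diagonalisation follows Fortnow and Santhanam. \<open>V\<close> knows its own code. On \<open>w\<close> it guesses circuits
  for the systems of \<open>w0\<close> and \<open>w1\<close> and accepts if both are correct, until \<open>w\<close> is the start word followed by a
  full description of a circuit \<open>D\<close>; then it accepts iff \<open>D\<close> fails for the system of the start word.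
  So \<open>V\<close> accepts the start word iff all circuits fail for its system, that is, iff it does not accept it.
\<close>

section \<open>A tree machine and a structured language for it\<close>

datatype tree = Lf | Nd tree tree

primrec car :: "tree => tree" where
 "car Lf = Lf"
| "car (Nd a b) = a"

primrec cdr :: "tree => tree" where
 "cdr Lf = Lf"
| "cdr (Nd a b) = b"

definition tbool :: "bool => tree" where
 "tbool b = (if b then Nd Lf Lf else Lf)"

definition tnext :: "bits => tree" where
 "tnext i = tbool (i \<noteq> [] \<and> hd i)"

datatype tinstr =
  TNil nat
 | TCons nat nat nat
 | TCar nat nat
 | TCdr nat nat
 | TJumpLf nat nat
 | TNext nat
 | TEof nat
 | TEmit nat
 | TAsk nat

type_synonym tconf = "nat \<times> (nat => tree) \<times> bits \<times> bits"

fun tinstr_step :: "bits set => tinstr => tconf => tconf" where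
 "tinstr_step A (TNil r) (pc, R, i, q) = (Suc pc, R(r := Lf), i, q)"
| "tinstr_step A (TCons r s t) (pc, R, i, q) = (Suc pc, R(r := Nd (R s) (R t)), i, q)"
| "tinstr_step A (TCar r s) (pc, R, i, q) = (Suc pc, R(r := car (R s)), i, q)"
| "tinstr_step A (TCdr r s) (pc, R, i, q) = (Suc pc, R(r := cdr (R s)), i, q)"
| "tinstr_step A (TJumpLf r l) (pc, R, i, q) = (if R r = Lf then l else Suc pc, R, i, q)"
| "tinstr_step A (TNext r) (pc, R, i, q) = (Suc pc, R(r := tnext i), tl i, q)"
| "tinstr_step A (TEof r) (pc, R, i, q) = (Suc pc, R(r := tbool (i = [])), i, q)"
| "tinstr_step A (TEmit r) (pc, R, i, q) = (Suc pc, R, i, q @ [R r \<noteq> Lf])"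
| "tinstr_step A (TAsk r) (pc, R, i, q) = (Suc pc, R(r := tbool (q \<in> A)), i, [])"

definition tstep :: "bits set => tinstr list => tconf => tconf" where
 "tstep A P c = (if fst c < length P then tinstr_step A (P ! fst c) c else c)"

definition trun :: "bits set => tinstr list => nat => tconf => tconf" where
 "trun A P n = tstep A P ^^ n"

lemma trun_0 [simp]: "trun A P 0 c = c"
 by (simp add: trun_def)

lemma trun_add: "trun A P (m + n) c = trun A P n (trun A P m c)"
 unfolding trun_def by (metis add.commute comp_apply funpow_add)

lemma trun_Suc: "trun A P (Suc n) c = trun A P n (tstep A P c)"
 by (simp add: trun_def funpow_swap1)

datatype fn =
  FId
 | FNil
 | FCar
 | FCdr
 | FPair fn fn
 | FComp fn fn
 | FIf fn fn fn
 | FWhile fn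
 | FNext
 | FEof
 | FEmit
 | FAsk

type_synonym fstate = "tree \<times> bits \<times> bits"

inductive evals :: "bits set => fn => fstate => fstate => nat => bool" for A where
 evals_Id: "evals A FId s s 0"
| evals_Nil: "evals A FNil (x, i, q) (Lf, i, q) 1"
| evals_Car: "evals A FCar (x, i, q) (car x, i, q) 1"
| evals_Cdr: "evals A FCdr (x, i, q) (cdr x, i, q) 1"
| evals_Pair: "evals A F (x, i, q) (y, i', q') t ==> evals A G (x, i', q') (z, i'', q'') u ==>
  evals A (FPair F G) (x, i, q) (Nd y z, i'', q'') (t + u + 9)"
| evals_Comp: "evals A F s s' t ==> evals A G s' s'' u ==> evals A (FComp F G) s s'' (t + u)"
| evals_If_True: "evals A B (x, i, q) (y, i', q') t ==> y \<noteq> Lf ==> evals A F (x, i', q') s u ==>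
  evals A (FIf B F G) (x, i, q) s (t + u + 6)"
| evals_If_False: "evals A B (x, i, q) (Lf, i', q') t ==> evals A G (x, i', q') s u ==>
  evals A (FIf B F G) (x, i, q) s (t + u + 4)"
| evals_While_end: "car x = Lf ==> evals A (FWhile F) (x, i, q) (x, i, q) 2"
| evals_While: "car x \<noteq> Lf ==> evals A F (x, i, q) s t ==> evals A (FWhile F) s s' u ==>
  evals A (FWhile F) (x, i, q) s' (t + u + 4)"
| evals_Next: "evals A FNext (x, i, q) (tnext i, tl i, q) 1"
| evals_Eof: "evals A FEof (x, i, q) (tbool (i = []), i, q) 1"
| evals_Emit: "evals A FEmit (x, i, q) (x, i, q @ [x \<noteq> Lf]) 1"
| evals_Ask: "evals A FAsk (x, i, q) (tbool (q \<in> A), i, []) 1"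

primrec flen :: "fn => nat" where
 "flen FId = 0"
| "flen FNil = 1"
| "flen FCar = 1"
| "flen FCdr = 1"
| "flen (FPair F G) = flen F + flen G + 9"
| "flen (FComp F G) = flen F + flen G"
| "flen (FIf B F G) = flen B + flen F + flen G + 8"
| "flen (FWhile F) = flen F + 4"
| "flen FNext = 1"
| "flen FEof = 1"
| "flen FEmit = 1"
| "flen FAsk = 1"

text \<open>Register 0 is the accumulator, register 1 a stack of saved values (itself a tree), register 2
 a scratch register.\<close>

primrec fcode :: "nat => fn => tinstr list" where
 "fcode a FId = []"
| "fcode a FNil = [TNil 0]"
| "fcode a FCar = [TCar 0 0]"
| "fcode a FCdr = [TCdr 0 0]"
| "fcode a (FPair F G) = [TCons 1 0 1] @ fcode (a + 1) F @
   [TCar 2 1, TCdr 1 1, TCons 1 0 1, TCons 0 2 2, TCar 0 0] @ fcode (a + flen F + 6) G @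
   [TCar 2 1, TCdr 1 1, TCons 0 2 0]"
| "fcode a (FComp F G) = fcode a F @ fcode (a + flen F) G"
| "fcode a (FIf B F G) = [TCons 1 0 1] @ fcode (a + 1) B @
   [TJumpLf 0 (a + flen B + flen F + 6), TCar 0 1, TCdr 1 1] @ fcode (a + flen B + 4) F @
   [TNil 2, TJumpLf 2 (a + flen B + flen F + flen G + 8)] @
   [TCar 0 1, TCdr 1 1] @ fcode (a + flen B + flen F + 8) G"
| "fcode a (FWhile F) = [TCar 2 0, TJumpLf 2 (a + flen F + 4)] @ fcode (a + 2) F @
   [TNil 2, TJumpLf 2 a]"
| "fcode a FNext = [TNext 0]"
| "fcode a FEof = [TEof 0]"
| "fcode a FEmit = [TEmit 0]"
| "fcode a FAsk = [TAsk 0]"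

lemma length_fcode [simp]: "length (fcode a F) = flen F"
 by (induction F arbitrary: a) auto

definition code_at :: "'a list => nat => 'a list => bool" where
 "code_at P a cs \<longleftrightarrow> (\<exists>pre post. P = pre @ cs @ post \<and> length pre = a)"

lemma code_at_append: "code_at P a (cs @ ds) \<longleftrightarrow> code_at P a cs \<and> code_at P (a + length cs) ds"
proof
 assume "code_at P a (cs @ ds)"
 then obtain pre post where "P = pre @ (cs @ ds) @ post" "length pre = a"
  by (auto simp: code_at_def)
 then show "code_at P a cs \<and> code_at P (a + length cs) ds"
  unfolding code_at_def by (metis append.assoc length_append)
next
 assume "code_at P a cs \<and> code_at P (a + length cs) ds"
 then obtain pre post pre' post' where split: "P = pre @ cs @ post" "length pre = a"
  "P = pre' @ ds @ post'" "length pre' = a + length cs"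
  unfolding code_at_def by blast
 then have "(pre @ cs) @ post = pre' @ ds @ post'" "length (pre @ cs) = length pre'"
  by simp_all
 then have "post = ds @ post'"
  by (meson append_eq_append_conv)
 then show "code_at P a (cs @ ds)"
  unfolding code_at_def using split by auto
qed

lemma code_at_Cons: "code_at P a (c # ds) \<longleftrightarrow> a < length P \<and> P ! a = c \<and> code_at P (Suc a) ds"
proof -
 have "code_at P a [c] \<longleftrightarrow> a < length P \<and> P ! a = c"
  unfolding code_at_def
  by (auto simp: nth_append) (metis append_Cons append_Nil id_take_nth_drop length_take
   less_imp_le min.absorb2)
 then show ?thesis
  using code_at_append[of P a "[c]" ds] by simp
qed

lemma trun_Cons:
 "code_at P a (c # ds) ==> trun A P (Suc n) (a, R, i, q) = trun A P n (tinstr_step A c (a, R, i, q))"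
 by (simp add: code_at_Cons trun_Suc tstep_def)

definition segment :: "bits set => tinstr list => nat => nat => nat => fstate => fstate => bool" where
 "segment A P a b t s s' \<longleftrightarrow> (\<forall>R. R 0 = fst s -->
   (\<exists>R'. trun A P t (a, R, snd s) = (b, R', snd s') \<and> R' 0 = fst s' \<and> R' 1 = R 1))"

lemma segmentE:
 assumes "segment A P a b t s s'" "R 0 = fst s"
 obtains R' where "trun A P t (a, R, snd s) = (b, R', snd s')" "R' 0 = fst s'" "R' 1 = R 1"
 using assms unfolding segment_def by blast

lemma segment_pushedE:
 assumes "code_at P a (TCons 1 0 1 # ds)" "segment A P (a + 1) b t (x, i, q) (y, i', q')" "R 0 = x"
 obtains R' where "trun A P (1 + t) (a, R, i, q) = (b, R', i', q')" "R' 0 = y" "R' 1 = Nd x (R 1)"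
proof -
 let ?R = "R(1 := Nd x (R 1))"
 obtain R' where "trun A P t (a + 1, ?R, i, q) = (b, R', i', q')" "R' 0 = y" "R' 1 = Nd x (R 1)"
  using segmentE[OF assms(2), of ?R] assms(3) by auto
 then show thesis
  using that trun_Cons[OF assms(1), of A t R] assms(3) by simp
qed

lemma segment_append:
 assumes "segment A P a b t s s'" "segment A P b d u s' s''"
 shows "segment A P a d (t + u) s s''"
 using assms unfolding segment_def trun_add by metis

text \<open>The set \<open>code_simps\<close> turns placed code into the instructions at each address, and
 \<open>step_simps\<close> then executes any concrete number of steps.\<close>

lemmas code_simps = code_at_append code_at_Cons
lemmas step_simps = trun_def tstep_def eval_nat_numeral

lemma segment_Pair:
 assumes code: "code_at P a (fcode a (FPair F G))"
  and F: "segment A P (a + 1) (a + 1 + flen F) t (x, i, q) (y, i', q')"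
  and G: "segment A P (a + flen F + 6) (a + flen F + 6 + flen G) u (x, i', q') (z, i'', q'')"
 shows "segment A P a (a + flen (FPair F G)) (t + u + 9) (x, i, q) (Nd y z, i'', q'')"
 unfolding segment_def fst_conv snd_conv
proof (intro allI impI)
 fix R :: "nat => tree" assume "R 0 = x"
 obtain R1 where R1: "trun A P (1 + t) (a, R, i, q) = (a + 1 + flen F, R1, i', q')"
  "R1 0 = y" "R1 1 = Nd x (R 1)"
  using segment_pushedE[where R = R, OF _ F] code \<open>R 0 = x\<close> by (auto simp: code_at_append)
 let ?R2 = "R1(2 := x, 1 := Nd y (R 1), 0 := x)"
 have swap: "trun A P 5 (a + 1 + flen F, R1, i', q') = (a + flen F + 6, ?R2, i', q')"
  using code R1(2,3) by (simp add: code_simps step_simps fun_eq_iff)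
 obtain R3 where R3: "trun A P u (a + flen F + 6, ?R2, i', q') = (a + flen F + 6 + flen G, R3, i'', q'')"
  "R3 0 = z" "R3 1 = Nd y (R 1)"
  using segmentE[OF G, of ?R2] by auto
 have pair: "\<exists>R'. trun A P 3 (a + flen F + 6 + flen G, R3, i'', q'') = (a + flen (FPair F G), R', i'', q'')
   \<and> R' 0 = Nd y z \<and> R' 1 = R 1"
  using code R3(2,3) by (simp add: code_simps step_simps add.assoc)
 have "t + u + 9 = 1 + t + (5 + (u + 3))" by simp
 then have "trun A P (t + u + 9) (a, R, i, q) = trun A P 3 (a + flen F + 6 + flen G, R3, i'', q'')"
  by (simp only: trun_add[of A P "1 + t"] trun_add[of A P 5] trun_add[of A P u] R1(1) swap R3(1))
 then show "\<exists>R'. trun A P (t + u + 9) (a, R, i, q) = (a + flen (FPair F G), R', i'', q'') \<and>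
   R' 0 = Nd y z \<and> R' 1 = R 1" using pair by simp
qed

lemma segment_branch:
 assumes code: "code_at P a (fcode a (FIf B F G))"
  and B: "segment A P (a + 1) (a + 1 + flen B) t (x, i, q) (y, i', q')"
 shows "segment A P a (if y = Lf then a + flen B + flen F + 8 else a + flen B + 4) (t + 4) (x, i, q) (x, i', q')"
 unfolding segment_def fst_conv snd_conv
proof (intro allI impI)
 fix R :: "nat => tree" assume "R 0 = x"
 obtain R1 where R1: "trun A P (1 + t) (a, R, i, q) = (a + 1 + flen B, R1, i', q')"
  "R1 0 = y" "R1 1 = Nd x (R 1)"
  using segment_pushedE[where R = R, OF _ B] code \<open>R 0 = x\<close> by (auto simp: code_at_append)
 have "t + 4 = 1 + t + 3" by simp
 then show "\<exists>R'. trun A P (t + 4) (a, R, i, q) =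
   (if y = Lf then a + flen B + flen F + 8 else a + flen B + 4, R', i', q') \<and> R' 0 = x \<and> R' 1 = R 1"
  using code R1(2,3) unfolding trun_add[of A P "1 + t"] R1(1) \<open>t + 4 = 1 + t + 3\<close>
  by (simp add: code_simps step_simps)
qed

lemma segment_jump:
 assumes "code_at P a (TNil 2 # TJumpLf 2 b # ds)"
 shows "segment A P a b 2 s s"
 using assms by (cases s) (simp add: segment_def code_simps step_simps)

lemma segment_loop_test:
 assumes "code_at P a (TCar 2 0 # TJumpLf 2 b # ds)"
 shows "segment A P a (if car x = Lf then b else a + 2) 2 (x, i, q) (x, i, q)"
 using assms by (simp add: segment_def code_simps step_simps)

lemma segment_fcode:
 assumes "evals A F s s' t" "code_at P a (fcode a F)"
 shows "segment A P a (a + flen F) t s s'"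
 using assms
proof (induction arbitrary: a rule: evals.induct)
 case (evals_Pair F x i q y i' q' t G z i'' q'' u)
 have "code_at P (a + 1) (fcode (a + 1) F)" "code_at P (a + flen F + 6) (fcode (a + flen F + 6) G)"
  using evals_Pair.prems by (simp_all add: code_simps eval_nat_numeral)
 then show ?case using segment_Pair evals_Pair by blast
next
 case (evals_Comp F s s' t G s'' u)
 then show ?case using segment_append by (fastforce simp: code_at_append add.assoc)
next
 case (evals_If_True B x i q y i' q' t F s u G)
 have "code_at P (a + 1) (fcode (a + 1) B)" "code_at P (a + flen B + 4) (fcode (a + flen B + 4) F)"
  and "code_at P (a + flen B + 4 + flen F) (TNil 2 # TJumpLf 2 (a + flen (FIf B F G)) # TCar 0 1 # TCdr 1 1 # fcode (a + flen B + flen F + 8) G)"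
  using evals_If_True.prems by (simp_all add: code_simps eval_nat_numeral)
 note branch = segment_branch[OF evals_If_True.prems evals_If_True.IH(1)[OF this(1)]]
  and body = evals_If_True.IH(2)[OF this(2)] and jump = segment_jump[OF this(3)]
 have "segment A P a (a + flen (FIf B F G)) (t + 4 + (u + 2)) (x, i, q) s"
  by (rule segment_append[OF _ segment_append[OF body jump]]) (use branch evals_If_True.hyps(2) in simp)
 then show ?case by (simp add: algebra_simps)
next
 case (evals_If_False B x i q i' q' t G s u F)
 have "code_at P (a + 1) (fcode (a + 1) B)" "code_at P (a + flen B + flen F + 8) (fcode (a + flen B + flen F + 8) G)"
  using evals_If_False.prems by (simp_all add: code_simps eval_nat_numeral)
 note branch = segment_branch[OF evals_If_False.prems evals_If_False.IH(1)[OF this(1)]]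
  and body = evals_If_False.IH(2)[OF this(2)]
 have "segment A P a (a + flen (FIf B F G)) (t + 4 + u) (x, i, q) s"
  using segment_append[OF branch, of "a + flen (FIf B F G)" u s] body by (simp add: ac_simps)
 then show ?case by (simp add: algebra_simps)
next
 case (evals_While_end x F i q)
 then have "code_at P a (TCar 2 0 # TJumpLf 2 (a + flen (FWhile F)) # fcode (a + 2) F @ [TNil 2, TJumpLf 2 a])"
  by (simp add: add.assoc)
 from segment_loop_test[OF this, of A x i q] show ?case using evals_While_end.hyps by simp
next
 case (evals_While x F i q s t s' u)
 have "code_at P a (TCar 2 0 # TJumpLf 2 (a + flen F + 4) # fcode (a + 2) F @ [TNil 2, TJumpLf 2 a])"
  "code_at P (a + 2) (fcode (a + 2) F)" "code_at P (a + 2 + flen F) [TNil 2, TJumpLf 2 a]"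
  using evals_While.prems by (simp_all add: code_simps)
 note test = segment_loop_test[OF this(1), of A x i q] and body = evals_While.IH(1)[OF this(2)]
  and rewind = segment_jump[OF this(3)]
 have "segment A P a (a + flen (FWhile F)) (2 + (t + (2 + u))) (x, i, q) s'"
  by (rule segment_append[OF _ segment_append[OF body segment_append[OF rewind evals_While.IH(2)[OF evals_While.prems]]]])
   (use test evals_While.hyps(1) in simp)
 then show ?case by (simp add: algebra_simps eval_nat_numeral)
qed (simp_all add: segment_def trun_def tstep_def code_at_Cons)

section \<open>Time-bounded and polynomial-time functions\<close>

class enc =
 fixes enc :: "'a => tree"

instantiation tree :: enc
begin
definition enc_tree :: "tree => tree" where "enc_tree t = t"
instance ..
end

instantiation bool :: enc
begin
definition enc_bool :: "bool => tree" where "enc_bool = tbool"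
instance ..
end

instantiation nat :: enc
begin
primrec enc_nat :: "nat => tree" where
 "enc_nat 0 = Lf"
| "enc_nat (Suc n) = Nd Lf (enc_nat n)"
instance ..
end

instantiation list :: (enc) enc
begin
primrec enc_list :: "'a list => tree" where
 "enc_list [] = Lf"
| "enc_list (x # xs) = Nd (enc x) (enc_list xs)"
instance ..
end

instantiation prod :: (enc, enc) enc
begin
definition enc_prod :: "'a \<times> 'b => tree" where "enc_prod p = Nd (enc (fst p)) (enc (snd p))"
instance ..
end

lemma enc_Pair [simp]: "enc (a, b) = Nd (enc a) (enc b)"
 by (simp add: enc_prod_def)

lemma enc_True [simp]: "enc True = Nd Lf Lf" and enc_False [simp]: "enc False = Lf"
 by (simp_all add: enc_bool_def tbool_def)

lemma enc_tree [simp]: "enc (t :: tree) = t"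
 by (simp add: enc_tree_def)

lemma enc_bool_Lf_iff [simp]: "enc b = Lf \<longleftrightarrow> \<not> b"
 by (cases b) auto

lemma enc_list_Lf_iff [simp]: "enc l = Lf \<longleftrightarrow> l = []" for l :: "'a::enc list"
 by (cases l) auto

lemma enc_nat_Lf_iff [simp]: "enc n = Lf \<longleftrightarrow> n = (0 :: nat)"
 by (cases n) auto

lemma enc_replicate_Lf: "enc (replicate n Lf) = enc n"
 by (induction n) auto

definition esize :: "'a::enc => nat" where "esize x = size (enc x)"

lemma esize_simps [simp]:
 "esize (a, b) = Suc (esize a + esize b)"
 "esize ([] :: 'a::enc list) = 0"
 "esize (x # xs) = Suc (esize x + esize xs)"
 "esize (n :: nat) = n"
proof -
 show "esize (n :: nat) = n" by (induction n) (auto simp: esize_def)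
qed (auto simp: esize_def)

lemma esize_bool: "esize (b :: bool) \<le> 1"
 by (cases b) (auto simp: esize_def)

lemma esize_append [simp]: "esize (xs @ ys) = esize xs + esize ys"
 by (induction xs) auto

lemma esize_rev [simp]: "esize (rev xs) = esize xs"
 by (induction xs) auto

lemma esize_replicate_Lf [simp]: "esize (replicate n Lf) = n"
 by (induction n) (auto simp: esize_def)

lemma length_le_esize: "length xs \<le> esize xs"
 by (induction xs) auto

lemma esize_mem: "x \<in> set xs ==> esize x \<le> esize xs"
 by (induction xs) auto

lemma esize_list_le: "(\<And>x. x \<in> set xs ==> esize x \<le> b) ==> esize xs \<le> length xs * (b + 1)"
proof (induction xs)
 case (Cons x xs)
 have "esize x \<le> b" "esize xs \<le> length xs * (b + 1)" using Cons by auto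
 then show ?case by simp
qed simp

lemma esize_bits: "esize (x :: bits) \<le> 2 * length x"
 using esize_list_le[of x 1] esize_bool by simp

lemma esize_drop: "esize (drop n l) \<le> esize l"
 using esize_append[of "take n l" "drop n l"] by simp

lemma esize_concat: "esize (concat l) \<le> esize l"
 by (induction l) auto

primrec plain :: "fn => bool" where
 "plain FId = True"
| "plain FNil = True"
| "plain FCar = True"
| "plain FCdr = True"
| "plain (FPair F G) = (plain F \<and> plain G)"
| "plain (FComp F G) = (plain F \<and> plain G)"
| "plain (FIf B F G) = (plain B \<and> plain F \<and> plain G)"
| "plain (FWhile F) = plain F"
| "plain FNext = True"
| "plain FEof = False"
| "plain FEmit = False"
| "plain FAsk = False"

definition runs :: "fn => tree => tree => nat => bool" where
 "runs F x y t \<longleftrightarrow> (\<forall>A i q. \<exists>t'\<le>t. evals A F (x, i, q) (y, i, q) t')"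

lemma runs_mono: "runs F x y t ==> t \<le> u ==> runs F x y u"
 unfolding runs_def by (meson le_trans)

lemma runs_Id: "runs FId x x 0"
 unfolding runs_def by (auto intro: evals_Id)

lemma runs_Nil: "runs FNil x Lf 1"
 unfolding runs_def using evals_Nil by blast

lemma runs_Car: "runs FCar x (car x) 1"
 unfolding runs_def using evals_Car by blast

lemma runs_Cdr: "runs FCdr x (cdr x) 1"
 unfolding runs_def using evals_Cdr by blast

lemma runs_Pair: "runs F x y t ==> runs G x z u ==> runs (FPair F G) x (Nd y z) (t + u + 9)"
 unfolding runs_def by (meson add_le_mono evals_Pair le_refl)

lemma runs_Comp: "runs F x y t ==> runs G y z u ==> runs (FComp F G) x z (t + u)"
 unfolding runs_def by (meson add_le_mono evals_Comp)

lemma runs_If_True: "runs B x y t ==> y \<noteq> Lf ==> runs F x z u ==> runs (FIf B F G) x z (t + u + 6)"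
 unfolding runs_def by (meson add_le_mono evals_If_True le_refl)

lemma runs_If_False: "runs B x Lf t ==> runs G x z u ==> runs (FIf B F G) x z (t + u + 6)"
 unfolding runs_def
proof (intro allI)
 fix A i q
 assume "\<forall>A i q. \<exists>t'\<le>t. evals A B (x, i, q) (Lf, i, q) t'" "\<forall>A i q. \<exists>t'\<le>u. evals A G (x, i, q) (z, i, q) t'"
 then obtain t' u' where "t' \<le> t" "evals A B (x, i, q) (Lf, i, q) t'" "u' \<le> u" "evals A G (x, i, q) (z, i, q) u'"
  by meson
 then show "\<exists>t'\<le>t + u + 6. evals A (FIf B F G) (x, i, q) (z, i, q) t'"
  using evals_If_False[of A B x i q i q t' G "(z, i, q)" u' F]
  by (intro exI[of _ "t' + u' + 4"]) auto
qed

lemma runs_If: "runs B x y t ==> (y \<noteq> Lf ==> runs F x z u) ==> (y = Lf ==> runs G x z u) ==>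
  runs (FIf B F G) x z (t + u + 6)"
 by (cases "y = Lf") (auto intro: runs_If_True runs_If_False)

lemma runs_While_end: "car x = Lf ==> runs (FWhile F) x x 2"
 unfolding runs_def using evals_While_end by blast

lemma runs_While: "car x \<noteq> Lf ==> runs F x y t ==> runs (FWhile F) y z u ==> runs (FWhile F) x z (t + u + 4)"
 unfolding runs_def by (meson add_le_mono evals_While le_refl)

definition ctime :: "('a::enc => 'b::enc) => ('a => nat) => bool" where
 "ctime f \<tau> \<longleftrightarrow> (\<exists>F C. plain F \<and> (\<forall>x. runs F (enc x) (enc (f x)) (C * (\<tau> x + 1))))"

lemma ctimeI: "plain F ==> (\<And>x. runs F (enc x) (enc (f x)) (C * (\<tau> x + 1))) ==> ctime f \<tau>"
 unfolding ctime_def by blast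

lemma ctime_le:
 assumes "ctime f \<sigma>" "\<And>x. \<sigma> x \<le> D * (\<tau> x + 1)"
 shows "ctime f \<tau>"
proof -
 obtain F C where F: "plain F" "\<And>x. runs F (enc x) (enc (f x)) (C * (\<sigma> x + 1))"
  using assms(1) unfolding ctime_def by blast
 have "C * (\<sigma> x + 1) \<le> (C * D + C) * (\<tau> x + 1)" for x
 proof -
  have "C * (\<sigma> x + 1) \<le> C * (D * (\<tau> x + 1) + 1)" using assms(2)[of x] by simp
  also have "\<dots> \<le> (C * D + C) * (\<tau> x + 1)" by (simp add: algebra_simps)
  finally show ?thesis .
 qed
 then show ?thesis using F by (meson ctimeI runs_mono)
qed

lemma ctime_mono: "ctime f \<sigma> ==> (\<And>x. \<sigma> x \<le> \<tau> x) ==> ctime f \<tau>"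
 by (rule ctime_le[where D = 1]) (auto intro: le_SucI)

lemma ctime_cast: "ctime f \<tau> ==> (\<And>x. enc (g x) = enc (f x)) ==> ctime g \<tau>"
 unfolding ctime_def by simp

lemma ctime_id: "ctime (%x. x) \<tau>"
 by (rule ctimeI[of FId _ 0]) (auto intro: runs_Id)

lemma ctime_const: "ctime (%x. c) \<tau>"
proof -
 have "\<exists>F C. plain F \<and> (\<forall>x. runs F x t C)" for t
 proof (induction t)
  case Lf
  then show ?case by (intro exI[of _ FNil] exI[of _ 1]) (auto intro: runs_Nil[simplified])
 next
  case (Nd a b)
  then obtain F C G D where "plain F" "\<forall>x. runs F x a C" "plain G" "\<forall>x. runs G x b D"
   by blast
  then show ?case by (intro exI[of _ "FPair F G"] exI[of _ "C + D + 9"]) (auto intro: runs_Pair)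
 qed
 then obtain F C where F: "plain F" "\<And>x. runs F x (enc c) C" by blast
 have "runs F (enc x) (enc c) (C * (\<tau> x + 1))" for x by (rule runs_mono[OF F(2)]) simp
 then show ?thesis by (rule ctimeI[OF F(1)])
qed

lemma ctime_pair:
 assumes "ctime f \<tau>" "ctime g \<tau>"
 shows "ctime (%x. (f x, g x)) \<tau>"
proof -
 obtain F C G D where F: "plain F" "\<And>x. runs F (enc x) (enc (f x)) (C * (\<tau> x + 1))"
  "plain G" "\<And>x. runs G (enc x) (enc (g x)) (D * (\<tau> x + 1))"
  using assms unfolding ctime_def by metis
 have "runs (FPair F G) (enc x) (enc (f x, g x)) ((C + D + 9) * (\<tau> x + 1))" for x
  unfolding enc_Pair by (rule runs_mono[OF runs_Pair[OF F(2) F(4)]]) (simp add: algebra_simps)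
 then show ?thesis by (rule ctimeI[rotated]) (simp add: F)
qed

lemma ctime_comp:
 assumes "ctime g \<tau>" "ctime f \<sigma>" "\<And>x. \<sigma> (g x) \<le> D * (\<tau> x + 1)"
 shows "ctime (%x. f (g x)) \<tau>"
proof -
 obtain F C G E where F: "plain F" "\<And>x. runs F (enc x) (enc (f x)) (C * (\<sigma> x + 1))"
  "plain G" "\<And>x. runs G (enc x) (enc (g x)) (E * (\<tau> x + 1))"
  using assms unfolding ctime_def by metis
 have "runs (FComp G F) (enc x) (enc (f (g x))) ((E + C * D + C) * (\<tau> x + 1))" for x
 proof (rule runs_mono[OF runs_Comp[OF F(4) F(2)]])
  have "C * (\<sigma> (g x) + 1) \<le> C * (D * (\<tau> x + 1) + 1)" using assms(3)[of x] by simp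
  then show "E * (\<tau> x + 1) + C * (\<sigma> (g x) + 1) \<le> (E + C * D + C) * (\<tau> x + 1)"
   by (simp add: algebra_simps)
 qed
 then show ?thesis by (rule ctimeI[rotated]) (simp add: F)
qed

lemma ctime_comp0: "ctime g \<tau> ==> ctime f (%_. 0) ==> ctime (%x. f (g x)) \<tau>"
 by (rule ctime_comp[where D = 0 and \<sigma> = "%_. 0"]) auto

lemma ctime_if_le:
 assumes "ctime b \<tau>" "ctime f \<sigma>" "ctime g \<rho>"
  and true: "\<And>x. b x ==> \<sigma> x \<le> D * (\<tau> x + 1)" and false: "\<And>x. \<not> b x ==> \<rho> x \<le> D * (\<tau> x + 1)"
 shows "ctime (%x. if b x then f x else g x) \<tau>"
proof -
 obtain F C G H B E where F: "plain F" "\<And>x. runs F (enc x) (enc (f x)) (C * (\<sigma> x + 1))"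
  and G: "plain G" "\<And>x. runs G (enc x) (enc (g x)) (H * (\<rho> x + 1))"
  and B: "plain B" "\<And>x. runs B (enc x) (enc (b x)) (E * (\<tau> x + 1))"
  using assms unfolding ctime_def by metis
 let ?T = "%x. (C + H) * (D + 1) * (\<tau> x + 1)"
 have bound: "J * (t + 1) \<le> ?T x" if "t \<le> D * (\<tau> x + 1)" "J \<le> C + H" for J t x
 proof -
  have "J * (t + 1) \<le> (C + H) * (D * (\<tau> x + 1) + 1)" using that by (intro mult_le_mono) auto
  also have "\<dots> \<le> ?T x" by (simp add: algebra_simps)
  finally show ?thesis .
 qed
 have "runs (FIf B F G) (enc x) (enc (if b x then f x else g x)) ((E + (C + H) * (D + 1) + 6) * (\<tau> x + 1))" for x
 proof (rule runs_mono[OF runs_If[OF B(2)]])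
  show "runs F (enc x) (enc (if b x then f x else g x)) (?T x)" if "enc (b x) \<noteq> Lf"
   using that runs_mono[OF F(2) bound[OF true]] by simp
  show "runs G (enc x) (enc (if b x then f x else g x)) (?T x)" if "enc (b x) = Lf"
   using that runs_mono[OF G(2) bound[OF false]] by simp
 qed (simp add: algebra_simps)
 then show ?thesis by (rule ctimeI[rotated]) (simp add: F G B)
qed

lemma ctime_if: "ctime b \<tau> ==> ctime f \<tau> ==> ctime g \<tau> ==> ctime (%x. if b x then f x else g x) \<tau>"
 by (rule ctime_if_le[where D = 1]) auto

lemma ctime_fst: "ctime f \<tau> ==> ctime (%x. fst (f x)) \<tau>"
proof (erule ctime_comp0)
 have "runs FCar (enc x) (enc (fst x)) (1 * (0 + 1))" for x :: "'b \<times> 'c"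
  using runs_Car[of "enc x"] by (simp add: enc_prod_def)
 then show "ctime (fst :: 'b \<times> 'c => 'b) (%_. 0)"
  by (intro ctimeI[of FCar]) auto
qed

lemma ctime_snd: "ctime f \<tau> ==> ctime (%x. snd (f x)) \<tau>"
proof (erule ctime_comp0)
 have "runs FCdr (enc x) (enc (snd x)) (1 * (0 + 1))" for x :: "'b \<times> 'c"
  using runs_Cdr[of "enc x"] by (simp add: enc_prod_def)
 then show "ctime (snd :: 'b \<times> 'c => 'c) (%_. 0)"
  by (intro ctimeI[of FCdr]) auto
qed

lemma ctime_Cons: "ctime f \<tau> ==> ctime g \<tau> ==> ctime (%x. f x # g x) \<tau>"
 by (rule ctime_cast[OF ctime_pair]) auto

lemma ctime_tl: "ctime f \<tau> ==> ctime (%x. tl (f x)) \<tau>"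
proof (erule ctime_comp0)
 have "runs FCdr (enc x) (enc (tl x)) (1 * (0 + 1))" for x :: "'b list"
  using runs_Cdr[of "enc x"] by (cases x) auto
 then show "ctime (tl :: 'b list => 'b list) (%_. 0)"
  by (intro ctimeI[of FCdr]) auto
qed

lemma ctime_null: "ctime f \<tau> ==> ctime (%x. f x = []) \<tau>"
proof (erule ctime_comp0)
 have "runs (FIf FId FNil (FPair FNil FNil)) (enc x) (enc (x = [])) (17 * (0 + 1))" for x :: "'b list"
  by (rule runs_mono[OF runs_If[OF runs_Id, where u = 11]])
   (auto intro: runs_mono[OF runs_Nil] runs_mono[OF runs_Pair[OF runs_Nil runs_Nil]])
 then show "ctime (%x :: 'b list. x = []) (%_. 0)"
  by (intro ctimeI[of "FIf FId FNil (FPair FNil FNil)"]) auto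
qed

lemma ctime_case_list:
 assumes "ctime l \<tau>" "ctime n \<tau>" "ctime (%p. c (fst p) (fst (snd p)) (snd (snd p))) \<sigma>"
  and cons: "\<And>x y ys. l x = y # ys ==> \<sigma> (x, (y, ys)) \<le> D * (\<tau> x + 1)"
 shows "ctime (%x. case l x of [] => n x | y # ys => c x y ys) \<tau>"
proof -
 obtain F C G E L H where F: "plain F" "\<And>x. runs F (enc x) (enc (l x)) (C * (\<tau> x + 1))"
  and G: "plain G" "\<And>x. runs G (enc x) (enc (n x)) (E * (\<tau> x + 1))"
  and L: "plain L" "\<And>p. runs L (enc p) (enc (c (fst p) (fst (snd p)) (snd (snd p)))) (H * (\<sigma> p + 1))"
  using assms unfolding ctime_def by metis
 let ?P = "FIf F (FComp (FPair FId F) L) G"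
 let ?T = "%x. (E + C + H * D + H + 9) * (\<tau> x + 1)"
 have "runs ?P (enc x) (enc (case l x of [] => n x | y # ys => c x y ys))
   ((C + (E + C + H * D + H + 9) + 6) * (\<tau> x + 1))" for x
 proof (rule runs_mono[OF runs_If[OF F(2)]])
  show "runs (FComp (FPair FId F) L) (enc x) (enc (case l x of [] => n x | y # ys => c x y ys)) (?T x)"
   if nonempty: "enc (l x) \<noteq> Lf"
  proof -
   obtain y ys where l: "l x = y # ys" using nonempty by (cases "l x") auto
   have pair: "runs (FPair FId F) (enc x) (enc (x, (y, ys))) (C * (\<tau> x + 1) + 9)"
    using runs_Pair[OF runs_Id F(2)[of x]] l by simp
   have "H * (\<sigma> (x, (y, ys)) + 1) \<le> H * (D * (\<tau> x + 1) + 1)" using cons[OF l] by simp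
   then have "C * (\<tau> x + 1) + 9 + H * (\<sigma> (x, (y, ys)) + 1) \<le> ?T x"
    by (simp add: algebra_simps)
   then show ?thesis using runs_mono[OF runs_Comp[OF pair L(2)]] l by simp
  qed
  show "runs G (enc x) (enc (case l x of [] => n x | y # ys => c x y ys)) (?T x)" if "enc (l x) = Lf"
   using that by (auto intro!: runs_mono[OF G(2)[of x]] simp: algebra_simps)
 qed (simp add: algebra_simps)
 then show ?thesis by (rule ctimeI[rotated]) (simp add: F G L)
qed

definition foldl_loop :: "fn => fn" where
 "foldl_loop F = FWhile (FPair (FComp FCar FCdr) (FPair (FComp FCdr FCar)
   (FComp (FPair FCdr (FComp FCar FCar)) F)))"

lemma runs_foldl_loop:
 assumes "\<And>ys y zs. l = ys @ y # zs ==> runs F (enc ((x, foldl f a ys), y)) (enc (f (foldl f a ys) y)) d"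
 shows "runs (foldl_loop F) (Nd (enc l) (enc (x, a))) (Nd Lf (enc (x, foldl f a l))) (length l * (d + 40) + 2)"
 using assms
proof (induction l arbitrary: a)
 case Nil
 then show ?case using runs_While_end[of "Nd Lf (enc (x, a))"] by (simp add: foldl_loop_def numeral_2_eq_2)
next
 case (Cons y l)
 let ?s = "Nd (enc (y # l)) (enc (x, a))"
 have rest: "runs (FComp FCar FCdr) ?s (enc l) 2" and arg: "runs (FComp FCdr FCar) ?s (enc x) 2"
  using runs_Comp[OF runs_Car[of ?s] runs_Cdr] runs_Comp[OF runs_Cdr[of ?s] runs_Car]
  by (simp_all add: numeral_2_eq_2)
 have input: "runs (FPair FCdr (FComp FCar FCar)) ?s (enc ((x, a), y)) 12"
  using runs_Pair[OF runs_Cdr[of ?s] runs_Comp[OF runs_Car[of ?s] runs_Car]] by simp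
 have "runs F (enc ((x, a), y)) (enc (f a y)) d"
  using Cons.prems[of "[]" y l] by simp
 from runs_Pair[OF rest runs_Pair[OF arg runs_Comp[OF input this]]]
 have body: "runs (FPair (FComp FCar FCdr) (FPair (FComp FCdr FCar)
   (FComp (FPair FCdr (FComp FCar FCar)) F))) ?s (Nd (enc l) (enc (x, f a y))) (d + 34)"
  by (auto elim: runs_mono)
 have "runs (foldl_loop F) (Nd (enc l) (enc (x, f a y))) (Nd Lf (enc (x, foldl f (f a y) l)))
   (length l * (d + 40) + 2)"
 proof (rule Cons.IH)
  fix ys z zs assume "l = ys @ z # zs"
  then show "runs F (enc ((x, foldl f (f a y) ys), z)) (enc (f (foldl f (f a y) ys) z)) d"
   using Cons.prems[of "y # ys" z zs] by simp
 qed
 from runs_While[OF _ body this[unfolded foldl_loop_def]] show ?case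
  unfolding foldl_loop_def by (auto elim: runs_mono)
qed

lemma ctime_foldl:
 assumes "ctime l \<tau>" "ctime a \<tau>" "ctime (%p. f (fst (fst p)) (snd (fst p)) (snd p)) \<sigma>"
  and step: "\<And>x ys y zs. l x = ys @ y # zs ==> \<sigma> ((x, foldl (f x) (a x) ys), y) \<le> D x"
  and total: "\<And>x. length (l x) * (D x + 1) \<le> B * (\<tau> x + 1)"
 shows "ctime (%x. foldl (f x) (a x) (l x)) \<tau>"
proof -
 obtain L c1 I c2 F c3 where L: "plain L" "\<And>x. runs L (enc x) (enc (l x)) (c1 * (\<tau> x + 1))"
  and I: "plain I" "\<And>x. runs I (enc x) (enc (a x)) (c2 * (\<tau> x + 1))"
  and F: "plain F" "\<And>p. runs F (enc p) (enc (f (fst (fst p)) (snd (fst p)) (snd p))) (c3 * (\<sigma> p + 1))"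
  using assms(1-3) unfolding ctime_def by metis
 let ?P = "FComp (FPair L (FPair FId I)) (FComp (foldl_loop F) (FComp FCdr FCdr))"
 have "runs ?P (enc x) (enc (foldl (f x) (a x) (l x))) ((c1 + c2 + c3 * B + 40 * B + 22) * (\<tau> x + 1))" for x
 proof -
  let ?end = "Nd Lf (enc (x, foldl (f x) (a x) (l x)))"
  have init: "runs (FPair L (FPair FId I)) (enc x) (Nd (enc (l x)) (enc (x, a x)))
    (c1 * (\<tau> x + 1) + (c2 * (\<tau> x + 1) + 9) + 9)"
   using runs_Pair[OF L(2) runs_Pair[OF runs_Id I(2)]] by simp
  have loop: "runs (foldl_loop F) (Nd (enc (l x)) (enc (x, a x))) ?end (length (l x) * (c3 * (D x + 1) + 40) + 2)"
   by (rule runs_foldl_loop, rule runs_mono) (use F(2)[of "((x, _), _)"] step in auto)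
  have result: "runs (FComp FCdr FCdr) ?end (enc (foldl (f x) (a x) (l x))) 2"
   using runs_Comp[OF runs_Cdr[of ?end] runs_Cdr] by (simp add: numeral_2_eq_2)
  have "length (l x) * (c3 * (D x + 1) + 40) \<le> (c3 + 40) * (length (l x) * (D x + 1))"
   by (simp add: algebra_simps)
  also have "\<dots> \<le> (c3 + 40) * (B * (\<tau> x + 1))"
   using total by (intro mult_le_mono2)
  finally have "(c1 * (\<tau> x + 1) + (c2 * (\<tau> x + 1) + 9) + 9) + (length (l x) * (c3 * (D x + 1) + 40) + 2 + 2)
    \<le> (c1 + c2 + c3 * B + 40 * B + 22) * (\<tau> x + 1)"
   by (simp add: algebra_simps)
  then show ?thesis by (rule runs_mono[OF runs_Comp[OF init runs_Comp[OF loop result]]])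
 qed
 then show ?thesis by (rule ctimeI[rotated]) (simp add: L I F foldl_loop_def)
qed

lemma ctime_foldl0:
 assumes "ctime l \<tau>" "ctime a \<tau>" "ctime (%p. f (fst (fst p)) (snd (fst p)) (snd p)) (%_. 0)"
  and "\<And>x. length (l x) \<le> B * (\<tau> x + 1)"
 shows "ctime (%x. foldl (f x) (a x) (l x)) \<tau>"
 by (rule ctime_foldl[OF assms(1-3), where D = "%_. 0" and B = B]) (use assms(4) in auto)

definition pbound :: "('a::enc => nat) => bool" where
 "pbound h \<longleftrightarrow> (\<exists>k. \<forall>x. h x \<le> (esize x + 2) ^ k)"

lemma pbound_mono: "pbound h ==> (\<And>x. g x \<le> h x) ==> pbound g"
 unfolding pbound_def by (meson le_trans)

lemma pboundD: "pbound h ==> \<exists>k. \<forall>x b. esize x + 2 \<le> b --> h x \<le> b ^ k"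
 unfolding pbound_def by (meson le_trans power_mono zero_le)

lemma pbound_const: "pbound (%_. c)"
proof -
 have "c \<le> (esize x + 2) ^ c" for x :: "'a"
 proof -
  have "c \<le> 2 ^ c" by (simp add: less_imp_le)
  also have "\<dots> \<le> (esize x + 2) ^ c" by (intro power_mono) auto
  finally show ?thesis .
 qed
 then show ?thesis unfolding pbound_def by blast
qed

lemma pbound_esize: "pbound esize"
 unfolding pbound_def by (intro exI[of _ 1]) auto

lemma pbound_add:
 assumes "pbound g" "pbound h"
 shows "pbound (%x. g x + h x)"
proof -
 obtain k l where kl: "\<And>x. g x \<le> (esize x + 2) ^ k" "\<And>x. h x \<le> (esize x + 2) ^ l"
  using assms unfolding pbound_def by blast
 have "g x + h x \<le> (esize x + 2) ^ Suc (k + l)" for x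
 proof -
  have "(esize x + 2) ^ k \<le> (esize x + 2) ^ (k + l)" "(esize x + 2) ^ l \<le> (esize x + 2) ^ (k + l)"
   by (intro power_increasing; simp)+
  then have "g x + h x \<le> 2 * (esize x + 2) ^ (k + l)" using kl[of x] by linarith
  also have "\<dots> \<le> (esize x + 2) ^ Suc (k + l)" by simp
  finally show ?thesis .
 qed
 then show ?thesis unfolding pbound_def by blast
qed

lemma pbound_mult: "pbound g ==> pbound h ==> pbound (%x. g x * h x)"
 unfolding pbound_def by (metis mult_le_mono power_add)

lemma pbound_Suc: "pbound g ==> pbound (%x. Suc (g x))"
 using pbound_add[of g "%_. 1"] pbound_const[of 1] by simp

lemma pbound_power: "pbound g ==> pbound (%x. g x ^ n)"
 by (induction n) (auto intro: pbound_mult pbound_const)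

lemma pbound_comp:
 assumes "pbound h" "pbound (%x. esize (f x))"
 shows "pbound (%x. h (f x))"
proof -
 obtain k where k: "\<And>x. h x \<le> (esize x + 2) ^ k" using assms(1) unfolding pbound_def by blast
 have "pbound (%x. (esize (f x) + 2) ^ k)"
  by (intro pbound_power pbound_add pbound_const assms)
 then show ?thesis by (rule pbound_mono) (rule k)
qed

lemmas pbound_intros = pbound_add pbound_mult pbound_Suc pbound_power pbound_const pbound_esize

definition poly :: "('a::enc => 'b::enc) => bool" where
 "poly f \<longleftrightarrow> (\<exists>\<tau>. pbound \<tau> \<and> ctime f \<tau>) \<and> pbound (%x. esize (f x))"

lemma polyI: "pbound \<tau> ==> ctime f \<tau> ==> pbound (%x. esize (f x)) ==> poly f"
 unfolding poly_def by blast

lemma polyE: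
 assumes "poly f"
 obtains \<tau> where "pbound \<tau>" "ctime f \<tau>"
 using assms unfolding poly_def by blast

lemma poly_esize: "poly f ==> pbound (%x. esize (f x))"
 unfolding poly_def by blast

lemma pbound_length: "poly l ==> pbound (%x. length (l x))"
 by (rule pbound_mono[OF poly_esize]) (auto intro: length_le_esize)

lemma pbound_nat: "poly f ==> pbound (%x. f x :: nat)"
 using poly_esize[of f] by simp

lemma poly_cast: "poly f ==> (\<And>x. enc (g x) = enc (f x)) ==> poly g"
 unfolding poly_def esize_def using ctime_cast[of f _ g] by auto

lemma poly_const: "poly (%x. c)"
 by (rule polyI[OF pbound_const[of 0] ctime_const pbound_const])

lemma poly_id: "poly (%x. x)"
 by (rule polyI[OF pbound_const[of 0] ctime_id pbound_esize])

lemma poly_pair: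
 assumes f: "poly f" and g: "poly g"
 shows "poly (%x. (f x, g x))"
proof -
 obtain \<sigma> \<tau> where "pbound \<sigma>" and \<sigma>: "ctime f \<sigma>" and "pbound \<tau>" and \<tau>: "ctime g \<tau>"
  using f g by (elim polyE)
 from pbound_add[OF this(1,3)] show ?thesis
 proof (rule polyI)
  show "ctime (%x. (f x, g x)) (%x. \<sigma> x + \<tau> x)"
   by (intro ctime_pair ctime_mono[OF \<sigma>] ctime_mono[OF \<tau>]) auto
 qed (simp add: pbound_intros poly_esize f g)
qed

lemma poly_comp:
 assumes f: "poly f" and g: "poly g"
 shows "poly (%x. f (g x))"
proof -
 obtain \<sigma> \<tau> where "pbound \<sigma>" and \<sigma>: "ctime f \<sigma>" and "pbound \<tau>" and \<tau>: "ctime g \<tau>"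
  using f g by (elim polyE)
 from pbound_add[OF this(3) pbound_comp[OF this(1) poly_esize[OF g]]] show ?thesis
 proof (rule polyI)
  show "ctime (%x. f (g x)) (%x. \<tau> x + \<sigma> (g x))"
   by (rule ctime_comp[OF ctime_mono[OF \<tau>] \<sigma>, where D = 1]) auto
 qed (rule pbound_comp[OF poly_esize poly_esize]; fact)
qed

lemma poly2: "poly (case_prod h) ==> poly f ==> poly g ==> poly (%x. h (f x) (g x))"
 using poly_comp[of "case_prod h" "%x. (f x, g x)"] by (simp add: poly_pair)

lemma poly3: "poly (%(a, b, c). h a b c) ==> poly f ==> poly g ==> poly k ==> poly (%x. h (f x) (g x) (k x))"
 using poly_comp[of "%(a, b, c). h a b c" "%x. (f x, g x, k x)"] by (simp add: poly_pair)

lemma poly_if: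
 assumes b: "poly b" and f: "poly f" and g: "poly g"
 shows "poly (%x. if b x then f x else g x)"
proof -
 obtain \<rho> \<sigma> \<tau> where "pbound \<rho>" and \<rho>: "ctime b \<rho>" and "pbound \<sigma>" and \<sigma>: "ctime f \<sigma>"
  and "pbound \<tau>" and \<tau>: "ctime g \<tau>"
  using b f g by (elim polyE)
 from pbound_add[OF this(1) pbound_add[OF this(3,5)]] show ?thesis
 proof (rule polyI)
  show "ctime (%x. if b x then f x else g x) (%x. \<rho> x + (\<sigma> x + \<tau> x))"
   by (intro ctime_if ctime_mono[OF \<rho>] ctime_mono[OF \<sigma>] ctime_mono[OF \<tau>]) auto
  show "pbound (%x. esize (if b x then f x else g x))"
   by (rule pbound_mono[OF pbound_add[OF poly_esize[OF f] poly_esize[OF g]]]) auto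
 qed
qed

lemma poly_shrinking:
 assumes "ctime f (%_. 0)" "\<And>x. esize (f x) \<le> esize x + 1" "poly g"
 shows "poly (%x. f (g x))"
proof (rule poly_comp[OF polyI[OF _ assms(1)] assms(3)])
 have "pbound (%x. esize x + 1)" by (intro pbound_intros)
 then show "pbound (%x. esize (f x))" by (rule pbound_mono) (rule assms(2))
qed (rule pbound_const)

lemma poly_fst: "poly f ==> poly (%x. fst (f x))"
 by (rule poly_shrinking[OF ctime_fst[OF ctime_id]]) (auto simp: esize_def enc_prod_def)

lemma poly_snd: "poly f ==> poly (%x. snd (f x))"
 by (rule poly_shrinking[OF ctime_snd[OF ctime_id]]) (auto simp: esize_def enc_prod_def)

lemma poly_Cons: "poly f ==> poly g ==> poly (%x. f x # g x)"
 by (rule poly_cast[OF poly_pair]) auto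

lemma poly_Suc: "poly f ==> poly (%x. Suc (f x))"
 by (rule poly_cast[OF poly_pair[OF poly_const[of Lf]]]) auto

lemma poly_tl: "poly f ==> poly (%x. tl (f x))"
proof (rule poly_shrinking[OF ctime_tl[OF ctime_id]])
 show "esize (tl x) \<le> esize x + 1" for x :: "'b list" by (cases x) auto
qed

lemma poly_null: "poly f ==> poly (%x. f x = [])"
 by (rule poly_shrinking[OF ctime_null[OF ctime_id]]) (rule trans_le_add2[OF esize_bool])

lemma poly_case_list:
 assumes l: "poly l" and n: "poly n" and c: "poly (%p. c (fst p) (fst (snd p)) (snd (snd p)))"
 shows "poly (%x. case l x of [] => n x | y # ys => c x y ys)"
proof -
 obtain \<rho> \<sigma> \<tau> where "pbound \<rho>" and \<rho>: "ctime l \<rho>" and "pbound \<tau>" and \<tau>: "ctime n \<tau>"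
  and "pbound \<sigma>" and \<sigma>: "ctime (%p. c (fst p) (fst (snd p)) (snd (snd p))) \<sigma>"
  using l n c by (elim polyE)
 obtain j where j: "\<And>p b. esize p + 2 \<le> b ==> \<sigma> p \<le> b ^ j" using pboundD[OF \<open>pbound \<sigma>\<close>] by blast
 obtain k where k: "\<And>p b. esize p + 2 \<le> b ==> esize (c (fst p) (fst (snd p)) (snd (snd p))) \<le> b ^ k"
  using pboundD[OF poly_esize[OF c]] by blast
 let ?E = "%x. esize x + esize (l x) + 3"
 have time: "\<sigma> (x, (y, ys)) \<le> ?E x ^ j" and size: "esize (c x y ys) \<le> ?E x ^ k" if "l x = y # ys" for x y ys
  using j[of "(x, (y, ys))" "?E x"] k[of "(x, (y, ys))" "?E x"] that by simp_all
 have "pbound (%x. \<rho> x + (\<tau> x + ?E x ^ j))"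
  by (intro pbound_intros poly_esize l \<open>pbound \<rho>\<close> \<open>pbound \<tau>\<close>)
 then show ?thesis
 proof (rule polyI)
  show "ctime (%x. case l x of [] => n x | y # ys => c x y ys) (%x. \<rho> x + (\<tau> x + ?E x ^ j))"
  proof (rule ctime_case_list[OF ctime_mono[OF \<rho>] ctime_mono[OF \<tau>] \<sigma>, where D = 1])
   fix x y ys assume "l x = y # ys"
   then show "\<sigma> (x, y, ys) \<le> 1 * (\<rho> x + (\<tau> x + ?E x ^ j) + 1)" using time by fastforce
  qed auto
  have "pbound (%x. esize (n x) + ?E x ^ k)" by (intro pbound_intros poly_esize l n)
  then show "pbound (%x. esize (case l x of [] => n x | y # ys => c x y ys))"
  proof (rule pbound_mono)
   fix x
   show "esize (case l x of [] => n x | y # ys => c x y ys) \<le> esize (n x) + ?E x ^ k"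
    using size[of x] by (cases "l x") (auto simp del: esize_simps intro: trans_le_add2)
  qed
 qed
qed

lemma poly_foldl:
 assumes l: "poly l" and a: "poly a" and f: "poly (%p. f (fst (fst p)) (snd (fst p)) (snd p))"
  and B: "pbound B" "\<And>x ys zs. l x = ys @ zs ==> esize (foldl (f x) (a x) ys) \<le> B x"
 shows "poly (%x. foldl (f x) (a x) (l x))"
proof -
 obtain \<rho> \<sigma> \<tau> where "pbound \<rho>" and \<rho>: "ctime l \<rho>" and "pbound \<tau>" and \<tau>: "ctime a \<tau>"
  and "pbound \<sigma>" and \<sigma>: "ctime (%p. f (fst (fst p)) (snd (fst p)) (snd p)) \<sigma>"
  using l a f by (elim polyE)
 obtain k where k: "\<And>p b. esize p + 2 \<le> b ==> \<sigma> p \<le> b ^ k" using pboundD[OF \<open>pbound \<sigma>\<close>] by blast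
 let ?D = "%x. (esize x + B x + esize (l x) + 4) ^ k"
 have step: "\<sigma> ((x, foldl (f x) (a x) ys), y) \<le> ?D x" if "l x = ys @ y # zs" for x ys y zs
 proof (rule k)
  have "esize (foldl (f x) (a x) ys) \<le> B x" using B(2) that by blast
  moreover have "esize y \<le> esize (l x)" by (rule esize_mem) (use that in simp)
  ultimately show "esize ((x, foldl (f x) (a x) ys), y) + 2 \<le> esize x + B x + esize (l x) + 4" by simp
 qed
 have "pbound (%x. \<rho> x + (\<tau> x + length (l x) * (?D x + 1)))"
  by (intro pbound_intros pbound_length poly_esize l B(1) \<open>pbound \<rho>\<close> \<open>pbound \<tau>\<close>)
 then show ?thesis
 proof (rule polyI)
  show "ctime (%x. foldl (f x) (a x) (l x)) (%x. \<rho> x + (\<tau> x + length (l x) * (?D x + 1)))"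
   by (rule ctime_foldl[OF ctime_mono[OF \<rho>] ctime_mono[OF \<tau>] \<sigma> step, where B = 1]) auto
  show "pbound (%x. esize (foldl (f x) (a x) (l x)))"
   by (rule pbound_mono[OF B(1)]) (use B(2)[where zs = "[]"] in auto)
 qed
qed

named_theorems poly_intros

lemmas [poly_intros] = poly_const poly_id poly_pair poly_fst poly_snd poly_if poly_Cons poly_Suc
 poly_tl poly_null poly_case_list

lemma poly_case_prod [poly_intros]:
 "poly (%x. f x (fst (g x)) (snd (g x))) ==> poly (%x. case g x of (a, b) => f x a b)"
 by (simp add: case_prod_beta)

lemma poly_not [poly_intros]: "poly f ==> poly (%x. \<not> f x)"
 by (rule poly_cast[OF poly_if[of f "%_. False" "%_. True"]]) (auto intro: poly_const)

lemma poly_conj [poly_intros]: "poly f ==> poly g ==> poly (%x. f x \<and> g x)"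
 by (rule poly_cast[OF poly_if[of f g "%_. False"]]) (auto intro: poly_const)

lemma poly_disj [poly_intros]: "poly f ==> poly g ==> poly (%x. f x \<or> g x)"
 by (rule poly_cast[OF poly_if[of f "%_. True" g]]) (auto intro: poly_const)

lemma poly_eq_bool [poly_intros]: "poly f ==> poly g ==> poly (%x. f x = (g x :: bool))"
 by (rule poly_cast[OF poly_if[of f g "%x. \<not> g x"]]) (auto intro: poly_not)

lemma poly_rev [poly_intros]:
 assumes "poly f"
 shows "poly (%x. rev (f x))"
proof -
 have foldl: "foldl (%acc y. y # acc) a ys = rev ys @ a" for a ys :: "'b list"
  by (induction ys arbitrary: a) auto
 have "poly (%x. foldl (%acc y. y # acc) [] (f x))"
  by (rule poly_foldl[where B = "%x. esize (f x)"]) (intro poly_intros poly_esize assms | simp add: foldl)+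
 then show ?thesis by (simp add: foldl)
qed

lemma poly_append [poly_intros]:
 assumes "poly f" "poly g"
 shows "poly (%x. f x @ g x)"
proof -
 have foldl: "foldl (%acc y. y # acc) a ys = rev ys @ a" for a ys :: "'b list"
  by (induction ys arbitrary: a) auto
 have "poly (%x. foldl (%acc y. y # acc) (g x) (rev (f x)))"
 proof (rule poly_foldl[where B = "%x. esize (f x) + esize (g x)"])
  fix x ys zs assume "rev (f x) = ys @ zs"
  then have "esize (rev (f x)) = esize ys + esize zs" by simp
  then show "esize (foldl (%acc y. y # acc) (g x) ys) \<le> esize (f x) + esize (g x)" by (simp add: foldl)
 qed (intro poly_intros poly_esize assms pbound_intros)+
 then show ?thesis by (simp add: foldl)
qed

lemma poly_map [poly_intros]:
 assumes l: "poly l" and f: "poly (%p. f (fst p) (snd p))"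
 shows "poly (%x. map (%y. f x y) (l x))"
proof -
 have foldl: "foldl (%acc y. g y # acc) a ys = rev (map g ys) @ a" for a :: "'c list" and g and ys :: "'b list"
  by (induction ys arbitrary: a) auto
 obtain k where k: "\<And>p b. esize p + 2 \<le> b ==> esize (f (fst p) (snd p)) \<le> b ^ k"
  using pboundD[OF poly_esize[OF f]] by blast
 let ?B = "%x. (esize x + esize (l x) + 3) ^ k"
 have item: "esize (f x y) \<le> ?B x" if "y \<in> set (l x)" for x y
  using k[of "(x, y)"] esize_mem[OF that] by simp
 have bound: "pbound (%x. esize (l x) * (?B x + 1))"
  by (intro pbound_intros poly_esize l)
 have "poly (%x. foldl (%acc y. f x y # acc) [] (l x))"
 proof (rule poly_foldl[OF l poly_const _ bound])
  have "poly (%p. f (fst (fst p)) (snd p))"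
   using poly2[of f "%p. fst (fst p)" snd] f by (simp add: case_prod_unfold poly_intros)
  then show "poly (%p. f (fst (fst p)) (snd p) # snd (fst p))" by (intro poly_intros)
  fix x ys zs assume l: "l x = ys @ zs"
  then have "esize (map (f x) ys) \<le> length ys * (?B x + 1)"
   using esize_list_le[of "map (f x) ys" "?B x"] item[of _ x] by auto
  also have "\<dots> \<le> esize (l x) * (?B x + 1)"
   using length_le_esize[of "l x"] l by (intro mult_le_mono1) auto
  finally show "esize (foldl (%acc y. f x y # acc) [] ys) \<le> esize (l x) * (?B x + 1)"
   by (simp add: foldl)
 qed
 then have "poly (%x. rev (foldl (%acc y. f x y # acc) [] (l x)))" by (rule poly_rev)
 then show ?thesis by (simp add: foldl)
qed

lemma poly_concat [poly_intros]:
 assumes "poly l"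
 shows "poly (%x. concat (l x))"
proof -
 have foldl: "foldl (@) a ys = a @ concat ys" for a and ys :: "'b list list"
  by (induction ys arbitrary: a) auto
 have "poly (%x. foldl (%acc y. acc @ y) [] (l x))"
 proof (rule poly_foldl[where B = "%x. esize (l x)"])
  fix x ys zs assume "l x = ys @ zs"
  then show "esize (foldl (@) [] ys) \<le> esize (l x)" using esize_concat[of ys] by (simp add: foldl)
 qed (intro poly_intros poly_esize assms)+
 then show ?thesis by (simp add: foldl)
qed

lemma poly_filter [poly_intros]:
 assumes l: "poly l" and f: "poly (%p. P (fst p) (snd p))"
 shows "poly (%x. filter (%y. P x y) (l x))"
proof -
 have "poly (%x. concat (map (%y. if P x y then [y] else []) (l x)))"
  by (intro poly_intros l f)
 moreover have "concat (map (%y. if Q y then [y] else []) ys) = filter Q ys" for Q and ys :: "'b list"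
  by (induction ys) auto
 ultimately show ?thesis by simp
qed

lemma poly_ex [poly_intros]:
 assumes "poly l" "poly (%p. P (fst p) (snd p))"
 shows "poly (%x. \<exists>y\<in>set (l x). P x y)"
proof -
 have "poly (%x. \<not> (filter (%y. P x y) (l x) = []))" by (intro poly_intros assms)
 then show ?thesis by (simp add: filter_empty_conv Bex_def)
qed

lemma poly_all [poly_intros]:
 assumes "poly l" "poly (%p. P (fst p) (snd p))"
 shows "poly (%x. \<forall>y\<in>set (l x). P x y)"
proof -
 have "poly (%x. \<not> (\<exists>y\<in>set (l x). \<not> P x y))" by (intro poly_intros assms)
 then show ?thesis by simp
qed

lemma poly_replicate [poly_intros]:
 assumes f: "poly f" and g: "poly g"
 shows "poly (%x. replicate (f x) (g x))"
proof -
 have "poly (%x. replicate (f x) Lf)" by (rule poly_cast[OF f]) (rule enc_replicate_Lf)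
 then have "poly (%x. map (%_. g x) (replicate (f x) Lf))"
  by (intro poly_map poly_comp[OF g] poly_intros)
 then show ?thesis by (simp add: map_replicate)
qed

lemma poly_funpow:
 fixes f :: "'a::enc => 'b::enc => 'b"
 assumes n: "poly n" and a: "poly a" and f: "poly (case_prod f)"
  and B: "pbound B" "\<And>x i. i \<le> n x ==> esize ((f x ^^ i) (a x)) \<le> B x"
 shows "poly (%x. (f x ^^ n x) (a x))"
proof -
 have foldl: "foldl (%acc _. g acc) c ys = (g ^^ length ys) c" for g :: "'b => 'b" and c and ys :: "tree list"
  by (induction ys arbitrary: c) (auto simp: funpow_swap1)
 have "poly (%x. foldl (%acc _. f x acc) (a x) (replicate (n x) Lf))"
 proof (rule poly_foldl[OF _ a _ B(1)])
  show "poly (%p :: ('a \<times> 'b) \<times> tree. f (fst (fst p)) (snd (fst p)))"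
   by (rule poly2[OF f]; intro poly_intros)
  fix x and ys zs :: "tree list" assume "replicate (n x) Lf = ys @ zs"
  from arg_cong[OF this, of length] show "esize (foldl (%acc _. f x acc) (a x) ys) \<le> B x"
   unfolding foldl by (intro B(2)) simp
 qed (intro poly_intros n)
 then show ?thesis by (simp add: foldl)
qed

lemma poly_length [poly_intros]:
 assumes "poly f"
 shows "poly (%x. length (f x))"
proof (rule poly_cast)
 show "poly (%x. map (%_. Lf) (f x))" by (intro poly_intros assms)
 show "enc (length (f x)) = enc (map (%_. Lf) (f x))" for x
  by (simp add: map_replicate_const enc_replicate_Lf)
qed

lemma poly_plus [poly_intros]:
 assumes "poly f" "poly g"
 shows "poly (%x. f x + g x :: nat)"
proof -
 have "poly (%x. length (replicate (f x) Lf @ replicate (g x) Lf))"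
  by (intro poly_intros assms)
 then show ?thesis by simp
qed

lemma poly_times [poly_intros]:
 assumes "poly f" "poly g"
 shows "poly (%x. f x * g x :: nat)"
proof -
 have "poly (%x. length (concat (replicate (f x) (replicate (g x) Lf))))"
  by (intro poly_intros assms)
 then show ?thesis by (simp add: length_concat sum_list_replicate)
qed

lemma poly_drop [poly_intros]:
 assumes "poly f" "poly g"
 shows "poly (%x. drop (f x) (g x))"
proof -
 have tl: "(tl ^^ n) l = drop n l" for n and l :: "'b list"
  by (induction n) (auto simp: drop_Suc drop_tl)
 have "poly (%x. (tl ^^ f x) (g x))"
 proof (rule poly_funpow[where f = "%_. tl" and B = "%x. esize (g x)"])
  show "poly (%(x :: 'a, l :: 'b list). tl l)" by (intro poly_intros)
 qed (auto simp: tl esize_drop assms poly_esize)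
 then show ?thesis by (simp add: tl)
qed

lemma poly_minus [poly_intros]:
 assumes "poly f" "poly g"
 shows "poly (%x. f x - g x :: nat)"
proof -
 have "poly (%x. length (drop (g x) (replicate (f x) Lf)))"
  by (intro poly_intros assms)
 then show ?thesis by simp
qed

lemma poly_take [poly_intros]:
 assumes "poly f" "poly g"
 shows "poly (%x. take (f x) (g x))"
proof -
 have "poly (%x. rev (drop (length (g x) - f x) (rev (g x))))"
  by (intro poly_intros assms)
 moreover have "rev (drop (length l - n) (rev l)) = take n l" for n and l :: "'b list"
  by (cases "n \<le> length l") (auto simp: rev_drop)
 ultimately show ?thesis by simp
qed

lemma poly_le [poly_intros]:
 assumes "poly f" "poly g"
 shows "poly (%x. f x \<le> (g x :: nat))"
proof -
 have "poly (%x. drop (g x) (replicate (f x) Lf) = [])"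
  by (intro poly_intros assms)
 then show ?thesis by simp
qed

lemma poly_eq_nat [poly_intros]:
 assumes "poly f" "poly g"
 shows "poly (%x. f x = (g x :: nat))"
 unfolding order.eq_iff by (intro poly_intros assms)

lemma poly_upt [poly_intros]:
 assumes f: "poly f"
 shows "poly (%x. [0..<f x])"
proof -
 have upt: "((%l. l @ [length l]) ^^ n) [] = [0..<n]" for n
  by (induction n) auto
 have "poly (%x. ((%l. l @ [length l]) ^^ f x) [])"
 proof (rule poly_funpow[OF f poly_const, where f = "%_ l. l @ [length l]"])
  show "pbound (%x. f x * (f x + 1))" by (intro pbound_intros pbound_nat f)
  fix x i assume i: "i \<le> f x"
  have "esize [0..<i] \<le> i * (i + 1)" using esize_list_le[of "[0..<i]" i] by simp
  also have "\<dots> \<le> f x * (f x + 1)" using i by (intro mult_le_mono) auto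
  finally show "esize (((%l. l @ [length l]) ^^ i) []) \<le> f x * (f x + 1)" unfolding upt .
 qed (intro poly_intros)
 then show ?thesis unfolding upt .
qed

definition nth_or :: "'a => 'a list => nat => 'a" where
 "nth_or d l n = (case drop n l of [] => d | x # _ => x)"

lemma nth_or_nth: "n < length l ==> nth_or d l n = l ! n"
 by (simp add: nth_or_def Cons_nth_drop_Suc[symmetric])

lemma poly_nth_or [poly_intros]: "poly f ==> poly g ==> poly (%x. nth_or d (f x) (g x))"
 unfolding nth_or_def by (intro poly_intros)

lemma poly_zip [THEN poly2, poly_intros]: "poly (%(xs, ys). zip xs ys)"
proof -
 have "zip xs ys = map (%i. (nth_or undefined xs i, nth_or undefined ys i)) [0..<length xs - (length xs - length ys)]"
  for xs :: "'a list" and ys :: "'b list"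
  by (rule nth_equalityI) (auto simp: nth_or_nth)
 then show ?thesis by (simp, intro poly_intros)
qed

lemma poly_eq_bits [poly_intros]:
 fixes f g :: "'a::enc => bool list"
 assumes "poly f" "poly g"
 shows "poly (%x. f x = g x)"
 unfolding list_eq_iff_zip_eq by (intro poly_intros assms)

section \<open>Simulating a random access machine on trees\<close>

fun bin :: "nat => bits" where
 "bin n = (if n = 0 then [] else odd n # bin (n div 2))"

declare bin.simps [simp del]

primrec bval :: "bits => nat" where
 "bval [] = 0"
| "bval (b # bs) = of_bool b + 2 * bval bs"

lemma bin_0 [simp]: "bin 0 = []"
 by (simp add: bin.simps)

lemma bval_bin [simp]: "bval (bin n) = n"
proof (induction n rule: bin.induct)
 case (1 n)
 then show ?case by (subst bin.simps) auto
qed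

lemma bin_inj [simp]: "bin m = bin n \<longleftrightarrow> m = n"
 by (metis bval_bin)

lemma bin_Nil_iff [simp]: "bin n = [] \<longleftrightarrow> n = 0"
 using bin_inj[of n 0] by simp

lemma bin_double: "m \<noteq> 0 \<or> b ==> bin (of_bool b + 2 * m) = b # bin m"
 by (subst bin.simps) auto

lemma length_bin: "length (bin n) = floorlog 2 n"
proof (induction n rule: bin.induct)
 case (1 n)
 then show ?case by (subst bin.simps) (simp add: compute_floorlog)
qed

lemma length_bin_le: "length (bin n) \<le> bit_cost n"
 by (simp add: length_bin bit_cost_def)

lemma bit_cost_pos: "bit_cost n \<ge> 1"
 by (simp add: bit_cost_def)

lemma bval_less: "bval bs < 2 ^ length bs"
 by (induction bs) (auto simp: of_bool_def)

lemma bval_append: "bval (as @ bs) = bval as + 2 ^ length as * bval bs"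
 by (induction as) (auto simp: algebra_simps)

lemma bin_canonical: "bin n = [] \<or> last (bin n)"
proof (induction n rule: bin.induct)
 case (1 n)
 then show ?case by (subst (1 2) bin.simps) (auto simp: odd_pos)
qed

text \<open>Numbers are produced most significant bit first, then reversed and stripped.\<close>

definition strip :: "bits => bits" where
 "strip ds = foldl (%acc b. if acc = [] \<and> \<not> b then [] else b # acc) [] ds"

lemma strip_eq: "strip ds = bin (bval (rev ds))"
proof -
 have "foldl (%acc b. if acc = [] \<and> \<not> b then [] else b # acc) (bin n) ds = bin (bval (rev ds) + 2 ^ length ds * n)" for n
 proof (induction ds arbitrary: n)
  case (Cons b ds)
  have "(if bin n = [] \<and> \<not> b then [] else b # bin n) = bin (of_bool b + 2 * n)"
   by (auto simp: bin_double[symmetric])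
  then show ?case using Cons by (simp add: bval_append algebra_simps del: bin_Nil_iff)
 qed simp
 from this[of 0] show ?thesis by (simp add: strip_def)
qed

lemma bval_take_drop: "bval b = bval (take n b) + 2 ^ n * bval (drop n b)"
 using bval_append[of "take n b" "drop n b"] by (cases "n \<le> length b") (auto simp: min_def)

text \<open>One digit of an addition, or of a subtraction from the digits \<open>x\<close> if \<open>neg\<close> holds: the state is
 the rest of the second operand, the carry or borrow, and the digits produced so far.\<close>

definition digit_step :: "bool => bits \<times> bool \<times> bits => bool => bits \<times> bool \<times> bits" where
 "digit_step neg = (%(b, c, ds) x. case b of [] => ([], (x \<noteq> neg) \<and> c, (x \<noteq> c) # ds)
   | y # ys => (ys, ((x \<noteq> neg) \<and> y) \<or> ((x \<noteq> neg) \<and> c) \<or> (y \<and> c), (x \<noteq> (y \<noteq> c)) # ds))"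

lemma foldl_digit_step:
 "foldl (digit_step neg) (b, c, ds) a = (b', c', ds') ==>
  \<exists>d. ds' = rev d @ ds \<and> length d = length a \<and> b' = drop (length a) b \<and>
   (if neg then bval a + 2 ^ length a * of_bool c' = bval d + bval (take (length a) b) + of_bool c
    else bval a + bval (take (length a) b) + of_bool c = bval d + 2 ^ length a * of_bool c')"
proof (induction a arbitrary: b c ds)
 case (Cons x a)
 let ?y = "b \<noteq> [] \<and> hd b"
 obtain b1 c1 d1 where step: "digit_step neg (b, c, ds) x = (b1, c1, d1 # ds)" "b1 = tl b"
  and digit: "if neg then of_bool x + (2::nat) * of_bool c1 = of_bool d1 + of_bool ?y + of_bool c
   else of_bool x + of_bool ?y + of_bool c = of_bool d1 + (2::nat) * of_bool c1"
  by (cases b; cases neg) (auto simp: digit_step_def)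
 obtain d where d: "ds' = rev d @ d1 # ds" "length d = length a" "b' = drop (length a) b1"
  and rest: "if neg then bval a + 2 ^ length a * of_bool c' = bval d + bval (take (length a) b1) + of_bool c1
   else bval a + bval (take (length a) b1) + of_bool c1 = bval d + 2 ^ length a * of_bool c'"
  using Cons step(1) by fastforce
 have "bval (take (length (x # a)) b) = of_bool ?y + 2 * bval (take (length a) b1)"
  using step(2) by (cases b) auto
 then have "if neg
   then bval (x # a) + 2 ^ length (x # a) * of_bool c' = bval (d1 # d) + bval (take (length (x # a)) b) + of_bool c
   else bval (x # a) + bval (take (length (x # a)) b) + of_bool c = bval (d1 # d) + 2 ^ length (x # a) * of_bool c'"
  using digit rest by (auto simp: algebra_simps split: if_splits)
 then show ?case using d step(2) by (intro exI[of _ "d1 # d"]) (auto simp: drop_Suc)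
qed simp

lemma length_foldl_digit_step:
 "foldl (digit_step neg) s a = (b', c', ds') ==>
  length b' \<le> length (fst s) \<and> length ds' = length a + length (snd (snd s))"
 using foldl_digit_step[of neg "fst s" "fst (snd s)" "snd (snd s)" a] by auto

definition bin_add :: "bits => bits => bits" where
 "bin_add a b = (let s = foldl (digit_step False) (b, False, []) a; s' = foldl (digit_step False) ([], snd s) (fst s)
   in strip (if fst (snd s') then True # snd (snd s') else snd (snd s')))"

lemma bin_add_eq: "bin_add a b = bin (bval a + bval b)"
proof -
 obtain b' c d where low: "foldl (digit_step False) (b, False, []) a = (b', c, d)" by (metis prod_cases3)
 obtain b'' c' d' where high: "foldl (digit_step False) ([], c, d) b' = (b'', c', d')" by (metis prod_cases3)
 have d: "length d = length a" "b' = drop (length a) b"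
  "bval a + bval (take (length a) b) = bval (rev d) + 2 ^ length a * of_bool c"
  using foldl_digit_step[OF low] by auto
 obtain e where e: "d' = rev e @ d" "length e = length b'"
  "bval b' + of_bool c = bval e + 2 ^ length b' * of_bool c'"
  using foldl_digit_step[OF high] by auto
 have "bval a + bval b = bval (rev d) + 2 ^ length a * (bval b' + of_bool c)"
  using bval_take_drop[of b "length a"] d(2,3) by (simp add: distrib_left)
 then have "bval (rev (if c' then True # d' else d')) = bval a + bval b"
  unfolding e(3) using d(1) e by (simp add: bval_append)
 then show ?thesis by (auto simp: bin_add_def low high strip_eq Let_def)
qed

definition bin_sub :: "bits => bits => bits" where
 "bin_sub a b = (let s = foldl (digit_step True) (b, False, []) a
   in if fst s = [] \<and> \<not> fst (snd s) then strip (snd (snd s)) else [])"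

lemma bval_pos: "bs \<noteq> [] ==> last bs ==> bval bs \<ge> 1"
 by (induction bs) (auto split: if_splits)

lemma bin_sub_eq:
 assumes "b = [] \<or> last b"
 shows "bin_sub a b = bin (bval a - bval b)"
proof -
 obtain b' c d where fold: "foldl (digit_step True) (b, False, []) a = (b', c, d)" by (metis prod_cases3)
 have d: "length d = length a" "b' = drop (length a) b"
  "bval a + 2 ^ length a * of_bool c = bval (rev d) + bval (take (length a) b)"
  using foldl_digit_step[OF fold] by auto
 have b: "bval b = bval (take (length a) b) + 2 ^ length a * bval b'"
  unfolding d(2) by (rule bval_take_drop)
 consider (exact) "b' = []" "\<not> c" | (borrow) "b' = []" c | (longer) "b' \<noteq> []" by blast
 then show ?thesis
 proof cases
  case exact
  then have "bval (rev d) = bval a - bval b" using b d(3) by simp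
  then show ?thesis using exact by (simp add: bin_sub_def fold strip_eq)
 next
  case borrow
  then have "bval a + 2 ^ length a = bval (rev d) + bval b" using b d(3) by simp
  then have "bval a \<le> bval b" using bval_less[of "rev d"] d(1) by simp
  then show ?thesis using borrow by (simp add: bin_sub_def fold)
 next
  case longer
  then have "last b'" using assms d(2) by auto
  then have "1 \<le> bval b'" using bval_pos longer by blast
  then have "2 ^ length a \<le> 2 ^ length a * bval b'" by simp
  then have "bval a \<le> bval b" using b bval_less[of a] by linarith
  then show ?thesis using longer by (simp add: bin_sub_def fold)
 qed
qed

lemmas ctime_basic = ctime_const ctime_id ctime_pair ctime_fst ctime_snd ctime_if ctime_Cons ctime_tl ctime_null

lemma ctime_not: "ctime f \<tau> ==> ctime (%x. \<not> f x) \<tau>"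
 by (rule ctime_cast[OF ctime_if[of f _ "%_. False" "%_. True"]]) (auto intro: ctime_const)

lemma ctime_conj: "ctime f \<tau> ==> ctime g \<tau> ==> ctime (%x. f x \<and> g x) \<tau>"
 by (rule ctime_cast[OF ctime_if[of f _ g "%_. False"]]) (auto intro: ctime_const)

lemma ctime_disj: "ctime f \<tau> ==> ctime g \<tau> ==> ctime (%x. f x \<or> g x) \<tau>"
 by (rule ctime_cast[OF ctime_if[of f _ "%_. True" g]]) (auto intro: ctime_const)

lemma ctime_eq_bool: "ctime f \<tau> ==> ctime g \<tau> ==> ctime (%x. f x = (g x :: bool)) \<tau>"
 by (rule ctime_cast[OF ctime_if[of f _ g "%x. \<not> g x"]]) (auto intro: ctime_not)

lemma ctime_case_list0:
 "ctime l (%_. 0) ==> ctime n (%_. 0) ==> ctime (%p. c (fst p) (fst (snd p)) (snd (snd p))) (%_. 0) ==>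
  ctime (%x. case l x of [] => n x | y # ys => c x y ys) (%_. 0)"
 by (rule ctime_case_list[where D = 0]) auto

lemma ctime_case_prod:
 "ctime (%x. f x (fst (g x)) (snd (g x))) \<tau> ==> ctime (%x. case g x of (a, b) => f x a b) \<tau>"
 by (simp add: case_prod_beta)

lemmas ctime_intros = ctime_basic ctime_not ctime_conj ctime_disj ctime_eq_bool ctime_case_list0 ctime_case_prod

lemma ctime_foldl_digit_step:
 assumes "ctime s \<tau>" "ctime a \<tau>" "\<And>x. length (a x) \<le> \<tau> x"
 shows "ctime (%x. foldl (digit_step neg) (s x) (a x)) \<tau>"
proof (rule ctime_foldl0[where B = 1, OF assms(2,1)])
 show "ctime (%p :: ('a \<times> bits \<times> bool \<times> bits) \<times> bool. digit_step neg (snd (fst p)) (snd p)) (%_. 0)"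
  unfolding digit_step_def case_prod_beta by (intro ctime_intros)
qed (simp add: assms(3) le_SucI)

lemma ctime_strip:
 assumes "ctime f \<tau>" "\<And>x. length (f x) \<le> \<tau> x"
 shows "ctime (%x. strip (f x)) \<tau>"
 unfolding strip_def
 by (rule ctime_foldl0[where B = 1]) (intro ctime_intros assms(1) | simp add: assms(2) le_SucI)+

lemma ctime_bin_add:
 assumes f: "ctime f \<tau>" and g: "ctime g \<tau>" and le: "\<And>x. length (f x) + length (g x) \<le> \<tau> x"
 shows "ctime (%x. bin_add (f x) (g x)) \<tau>"
proof -
 let ?s = "%x. foldl (digit_step False) (g x, False, []) (f x)"
 let ?s' = "%x. foldl (digit_step False) ([], snd (?s x)) (fst (?s x))"
 have s: "length (fst (?s x)) \<le> length (g x)" "length (snd (snd (?s x))) = length (f x)" for x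
  using length_foldl_digit_step[of False "(g x, False, [])" "f x"] by (cases "?s x"; simp)+
 have s': "length (snd (snd (?s' x))) \<le> length (f x) + length (g x)" for x
  using length_foldl_digit_step[of False "([], snd (?s x))" "fst (?s x)"] s[of x] by (cases "?s' x") simp
 have fold: "ctime ?s \<tau>"
  using le by (intro ctime_foldl_digit_step ctime_intros f g) (meson add_leD1)
 have "ctime ?s' \<tau>"
  using s(1) le by (intro ctime_foldl_digit_step ctime_intros fold) (meson add_leD2 le_trans)
 moreover have "length (snd (snd (?s' x))) \<le> \<tau> x" for x using s'[of x] le[of x] by linarith
 ultimately have "ctime (%x. strip (if fst (snd (?s' x)) then True # snd (snd (?s' x)) else snd (snd (?s' x)))) (%x. \<tau> x + 1)"
  by (intro ctime_strip ctime_intros) (auto intro: ctime_mono le_SucI)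
 then show ?thesis unfolding bin_add_def Let_def by (rule ctime_le[where D = 2]) simp
qed

lemma ctime_bin_sub:
 assumes f: "ctime f \<tau>" and g: "ctime g \<tau>" and le: "\<And>x. length (f x) \<le> \<tau> x"
 shows "ctime (%x. bin_sub (f x) (g x)) \<tau>"
proof -
 let ?s = "%x. foldl (digit_step True) (g x, False, []) (f x)"
 have "length (snd (snd (?s x))) = length (f x)" for x
  using length_foldl_digit_step[of True "(g x, False, [])" "f x"] by (cases "?s x") simp
 moreover have "ctime ?s \<tau>" by (intro ctime_foldl_digit_step ctime_intros f g le)
 ultimately show ?thesis unfolding bin_sub_def Let_def by (intro ctime_intros ctime_strip) (simp_all add: le)
qed

datatype trie = TE | TN bits trie trie

instantiation trie :: enc
begin
primrec enc_trie :: "trie => tree" where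
 "enc_trie TE = Lf"
| "enc_trie (TN v l r) = Nd (enc v) (Nd (enc_trie l) (enc_trie r))"
instance ..
end

primrec root_val :: "trie => bits" where
 "root_val TE = []"
| "root_val (TN v l r) = v"

primrec child :: "bool => trie => trie" where
 "child b TE = TE"
| "child b (TN v l r) = (if b then r else l)"

definition lookup :: "bits => trie => bits" where
 "lookup bs t = root_val (foldl (%t b. child b t) t bs)"

definition set_child :: "bool => trie => trie => trie" where
 "set_child b new old = TN (root_val old) (if b then child False old else new) (if b then new else child True old)"

definition set_root :: "bits => trie => trie" where
 "set_root v t = TN v (child False t) (child True t)"

definition descend :: "bits => trie => trie \<times> (bool \<times> trie) list" where
 "descend bs t = foldl (%s b. (child b (fst s), (b, fst s) # snd s)) (t, []) bs"

definition update :: "bits => bits => trie => trie" where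
 "update bs v t = foldl (%new p. set_child (fst p) new (snd p)) (set_root v (fst (descend bs t))) (snd (descend bs t))"

lemma descend_Nil: "descend [] t = (t, [])"
 by (simp add: descend_def)

lemma descend_Cons:
 "descend (b # bs) t = (fst (descend bs (child b t)), snd (descend bs (child b t)) @ [(b, t)])"
proof -
 have "foldl (%s b. (child b (fst s), (b, fst s) # snd s)) (t, ps) bs =
   (fst (descend bs t), snd (descend bs t) @ ps)" for t ps
 proof (induction bs arbitrary: t ps)
  case (Cons b bs)
  show ?case unfolding descend_def by (simp add: Cons)
 qed (simp add: descend_def)
 from this[of "child b t" "[(b, t)]"] show ?thesis by (simp add: descend_def[of "b # bs"])
qed

lemma length_descend: "length (snd (descend bs t)) = length bs"
 by (induction bs arbitrary: t) (simp_all add: descend_Nil descend_Cons)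

lemma update_simps [simp]:
 "update [] v t = set_root v t"
 "update (b # bs) v t = set_child b (update bs v (child b t)) t"
 by (simp_all add: update_def descend_Nil descend_Cons)

lemma lookup_simps [simp]:
 "lookup [] t = root_val t"
 "lookup (b # bs) t = lookup bs (child b t)"
 by (simp_all add: lookup_def)

lemma lookup_update: "lookup bs' (update bs v t) = (if bs' = bs then v else lookup bs' t)"
proof (induction bs arbitrary: bs' t)
 case Nil
 then show ?case by (cases bs') (auto simp: set_root_def)
next
 case (Cons b bs)
 then show ?case by (cases bs') (auto simp: set_child_def)
qed

lemma lookup_TE [simp]: "lookup bs TE = []"
 by (induction bs) auto

lemma ctime_TN:
 assumes "ctime f \<tau>" "ctime g \<tau>" "ctime h \<tau>"
 shows "ctime (%x. TN (f x) (g x) (h x)) \<tau>"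
 by (rule ctime_cast[OF ctime_pair[OF assms(1) ctime_pair[OF assms(2,3)]]]) simp

lemma ctime_root_val: "ctime f \<tau> ==> ctime (%x. root_val (f x)) \<tau>"
proof (erule ctime_comp0)
 have "runs FCar (enc x) (enc (root_val x)) (1 * (0 + 1))" for x
  using runs_Car[of "enc x"] by (cases x) simp_all
 then show "ctime root_val (%_. 0)"
  by (intro ctimeI[of FCar]) auto
qed

lemma ctime_child_const: "ctime f \<tau> ==> ctime (%x. child b (f x)) \<tau>"
proof (erule ctime_comp0)
 show "ctime (child b) (%_. 0)"
 proof (cases b)
  case True
  have "runs (FComp FCdr FCdr) (enc x) (enc (child b x)) (2 * (0 + 1))" for x
   using runs_Comp[OF runs_Cdr[of "enc x"] runs_Cdr] True by (cases x) (simp_all add: numeral_2_eq_2)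
  then show ?thesis by (rule ctimeI[rotated]) simp
 next
  case False
  have "runs (FComp FCdr FCar) (enc x) (enc (child b x)) (2 * (0 + 1))" for x
   using runs_Comp[OF runs_Cdr[of "enc x"] runs_Car] False by (cases x) (simp_all add: numeral_2_eq_2)
  then show ?thesis by (rule ctimeI[rotated]) simp
 qed
qed

lemma ctime_child:
 assumes "ctime f \<tau>" "ctime g \<tau>"
 shows "ctime (%x. child (g x) (f x)) \<tau>"
 by (rule ctime_cast[OF ctime_if[OF assms(2) ctime_child_const[OF assms(1), of True] ctime_child_const[OF assms(1), of False]]])
  auto

lemmas trie_intros = ctime_intros ctime_TN ctime_root_val ctime_child

lemma ctime_lookup:
 assumes "ctime f \<tau>" "ctime g \<tau>" "\<And>x. length (f x) \<le> D * (\<tau> x + 1)"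
 shows "ctime (%x. lookup (f x) (g x)) \<tau>"
 unfolding lookup_def by (intro ctime_root_val ctime_foldl0[where B = D] trie_intros assms)

lemma ctime_update:
 assumes f: "ctime f \<tau>" and g: "ctime g \<tau>" and h: "ctime h \<tau>" and le: "\<And>x. length (f x) \<le> D * (\<tau> x + 1)"
 shows "ctime (%x. update (f x) (g x) (h x)) \<tau>"
proof -
 have "ctime (%x. descend (f x) (h x)) \<tau>"
  unfolding descend_def by (intro ctime_foldl0[where B = D] trie_intros f h le)
 then show ?thesis unfolding update_def set_child_def set_root_def
  by (intro ctime_foldl0[where B = D] trie_intros g) (simp_all only: length_descend le)
qed

lemma ctime_eq_const: "ctime f \<tau> ==> ctime (%x. f x = (c :: nat)) \<tau>"
proof (erule ctime_comp0)
 have zero: "ctime (%n. replicate n Lf = []) (%_. 0)"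
  by (intro ctime_null ctime_cast[OF ctime_id]) (rule enc_replicate_Lf)
 have "runs FCdr (enc n) (enc (n - 1)) (1 * (0 + 1))" for n :: nat
  using runs_Cdr[of "enc n"] by (cases n) auto
 then have pred: "ctime (%n. n - 1 :: nat) (%_. 0)" by (rule ctimeI[rotated]) simp
 show "ctime (%n. n = c) (%_. 0)"
 proof (induction c)
  case 0
  then show ?case using zero by simp
 next
  case (Suc c)
  have "ctime (%n. if replicate n Lf = [] then False else n - 1 = c) (%_. 0)"
   by (intro ctime_intros zero ctime_comp0[OF pred Suc])
  moreover have "enc (n = Suc c) = enc (if replicate n Lf = [] then False else n - 1 = c)" for n
   by (cases n) auto
  ultimately show ?case by (rule ctime_cast)
 qed
qed

text \<open>The program counter is shifted by one: 0 means that the machine has halted. The two tries hold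
 the input and the memory.\<close>

type_synonym sim_state = "nat \<times> trie \<times> trie"

definition pc_code :: "ram => nat => nat" where
 "pc_code P pc = (if pc < length P then Suc pc else 0)"

fun next_mem :: "instr => trie => trie => trie" where
 "next_mem (Const r k) it m = update (bin r) (bin k) m"
| "next_mem (Add r s t) it m = update (bin r) (bin_add (lookup (bin s) m) (lookup (bin t) m)) m"
| "next_mem (Sub r s t) it m = update (bin r) (bin_sub (lookup (bin s) m) (lookup (bin t) m)) m"
| "next_mem (Load r s) it m = update (bin r) (lookup (lookup (bin s) m) m) m"
| "next_mem (Store r s) it m = update (lookup (bin r) m) (lookup (bin s) m) m"
| "next_mem (Read r s) it m = update (bin r)
   (case lookup (lookup (bin s) m) it of [] => [False, True] | b # _ => if b then [True] else []) m"
| "next_mem (Append s) it m = m"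
| "next_mem (Query r) it m = update (bin r) [] m"
| "next_mem (JumpZero r l) it m = m"

fun next_pc :: "ram => instr => nat => trie => nat" where
 "next_pc P (JumpZero r l) pc m = (if lookup (bin r) m = [] then pc_code P l else pc_code P (Suc pc))"
| "next_pc P _ pc m = pc_code P (Suc pc)"

fun sim_cost :: "instr => trie => nat" where
 "sim_cost (Add r s t) m = length (lookup (bin s) m) + length (lookup (bin t) m)"
| "sim_cost (Sub r s t) m = length (lookup (bin s) m) + length (lookup (bin t) m)"
| "sim_cost (Load r s) m = length (lookup (bin s) m)"
| "sim_cost (Store r s) m = length (lookup (bin r) m)"
| "sim_cost (Read r s) m = length (lookup (bin s) m)"
| "sim_cost _ m = 0"

lemma ctime_lookup_const: "ctime f \<tau> ==> ctime (%x. lookup bs (f x)) \<tau>"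
 by (rule ctime_lookup[where D = "length bs"]) (auto intro: ctime_const)

lemma ctime_update_const: "ctime f \<tau> ==> ctime g \<tau> ==> ctime (%x. update bs (g x) (f x)) \<tau>"
 by (rule ctime_update[where D = "length bs"]) (auto intro: ctime_const)

lemma ctime_next_mem:
 assumes it: "ctime it \<tau>" and m: "ctime m \<tau>" and cost: "\<And>x. sim_cost ins (m x) \<le> \<tau> x"
 shows "ctime (%x. next_mem ins (it x) (m x)) \<tau>"
proof -
 have le: "n \<le> 1 * (\<tau> x + 1)" if "n \<le> sim_cost ins (m x)" for n x using that cost[of x] by simp
 note intros = ctime_update_const ctime_lookup_const ctime_lookup[where D = 1] ctime_intros it m
 show ?thesis
 proof (cases ins)
  case (Add r s t)
  then show ?thesis using cost by (auto intro!: ctime_bin_add intros)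
 next
  case (Sub r s t)
  then have "length (lookup (bin s) (m x)) \<le> \<tau> x" for x using cost[of x] by simp
  then show ?thesis using Sub by (auto intro!: ctime_bin_sub intros)
 next
  case (Load r s)
  then show ?thesis using le by (auto intro!: intros)
 next
  case (Store r s)
  then show ?thesis using le by (auto intro!: ctime_update[where D = 1] intros)
 next
  case (Read r s)
  have code: "ctime (%v. case v of [] => [False, True] | b # _ => if b then [True] else []) (%_. 0)"
   by (intro ctime_intros)
  show ?thesis using Read le by (auto intro!: ctime_comp0[OF _ code] intros)
 qed (auto intro!: intros)
qed

lemma ctime_next_pc: "ctime m \<tau> ==> ctime (%x. next_pc P ins pc (m x)) \<tau>"
 by (cases ins) (auto intro!: ctime_intros ctime_lookup_const)

definition step_cost :: "ram => sim_state => nat" where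
 "step_cost P s = (if fst s = 0 \<or> length P < fst s then 0 else sim_cost (P ! (fst s - 1)) (snd (snd s)))"

definition sim_step :: "ram => sim_state => sim_state" where
 "sim_step P s = (if fst s = 0 \<or> length P < fst s then s
   else (let ins = P ! (fst s - 1) in
    (next_pc P ins (fst s - 1) (snd (snd s)), fst (snd s), next_mem ins (fst (snd s)) (snd (snd s)))))"

lemma ctime_sim_step: "ctime (sim_step P) (step_cost P)"
proof -
 define T where "T = (%n (s :: sim_state). if fst s = 0 \<or> n < fst s then 0 else sim_cost (P ! (fst s - 1)) (snd (snd s)))"
 define S where "S = (%n s. if fst s = 0 \<or> n < fst s then s
   else (let ins = P ! (fst s - 1) in
    (next_pc P ins (fst s - 1) (snd (snd s)), fst (snd s), next_mem ins (fst (snd s)) (snd (snd s)))))"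
 have "ctime (S n) (T n)" for n
 proof (induction n)
  case 0
  have "S 0 = (%s. s)" by (auto simp: S_def)
  then show ?case by (simp add: ctime_id)
 next
  case (Suc n)
  let ?f = "%s :: sim_state. (next_pc P (P ! n) n (snd (snd s)), fst (snd s),
    next_mem (P ! n) (fst (snd s)) (snd (snd s)))"
  have "ctime ?f (%s. sim_cost (P ! n) (snd (snd s)))"
   by (intro ctime_intros ctime_next_pc ctime_next_mem order_refl)
  then have "ctime (%s. if fst s = Suc n then ?f s else S n s) (T (Suc n))"
   by (rule ctime_if_le[OF ctime_eq_const[OF ctime_fst[OF ctime_id]] _ Suc, where D = 1])
    (auto simp: T_def)
  moreover have "S (Suc n) = (%s. if fst s = Suc n then ?f s else S n s)"
   by (auto simp: S_def Let_def fun_eq_iff)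
  ultimately show ?case by simp
 qed
 moreover have "S (length P) = sim_step P" "T (length P) = step_cost P"
  by (auto simp: S_def sim_step_def T_def step_cost_def fun_eq_iff)
 ultimately show ?thesis by metis
qed

definition mem_repr :: "(nat => nat) => trie => bool" where
 "mem_repr M m \<longleftrightarrow> (\<forall>a. lookup (bin a) m = bin (M a))"

definition input_repr :: "bits => trie => bool" where
 "input_repr x it \<longleftrightarrow> (\<forall>a. lookup (bin a) it = (if a < length x then [x ! a] else []))"

lemma mem_repr_update: "mem_repr M m ==> mem_repr (M(r := k)) (update (bin r) (bin k) m)"
 by (auto simp: mem_repr_def lookup_update)

lemma bin_small: "bin (Suc 0) = [True]" "bin 2 = [False, True]"
 by (simp_all add: bin.simps)

lemma next_mem_step:
 assumes m: "mem_repr M m" and i: "input_repr x it" and s: "step_instr {} x ins (pc, M, q) = (pc', M', q')"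
 shows "mem_repr M' (next_mem ins it m) \<and> next_pc P ins pc m = pc_code P pc' \<and> sim_cost ins m \<le> cost_instr ins M"
proof -
 have reg: "lookup (bin a) m = bin (M a)" for a using m by (simp add: mem_repr_def)
 have bit: "(case lookup (bin a) it of [] => [False, True] | b # _ => if b then [True] else []) =
   bin (if a < length x then of_bool (x ! a) else 2)" for a
  using i by (auto simp: input_repr_def bin_small)
 have "bin_sub (bin k) (bin l) = bin (k - l)" for k l
  using bin_sub_eq[of "bin l"] bin_canonical[of l] by auto
 then show ?thesis
  using s mem_repr_update[OF m] mem_repr_update[OF m, of _ 0] m
  by (cases ins) (auto simp: reg bit bin_add_eq length_bin_le intro: add_mono trans_le_add1)
qed

lemma cost_instr_pos: "cost_instr ins M \<ge> 1"
 using bit_cost_pos by (cases ins) (auto intro: trans_le_add1)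

lemma runs_sim_loop:
 assumes F: "\<And>s. runs F (enc s) (enc (sim_step P s)) (C * (step_cost P s + 1))"
  and i: "input_repr x it"
 shows "exec P {} x c v t ==> c = (pc, M, q) ==> mem_repr M m ==>
  \<exists>m'. runs (FWhile F) (enc (pc_code P pc, it, m)) (enc (0 :: nat, it, m')) ((2 * C + 4) * t + 2) \<and> lookup [] m' = bin v"
proof (induction arbitrary: pc M q m rule: exec.induct)
 case (halt pc' M' q')
 then have stopped: "pc_code P pc = 0" by (auto simp: pc_code_def)
 have "lookup (bin 0) m = bin (M' 0)" using halt.prems unfolding mem_repr_def by blast
 then have "lookup [] m = bin (M' 0)" by simp
 moreover have "runs (FWhile F) (enc (0 :: nat, it, m)) (enc (0 :: nat, it, m)) 2"
  by (rule runs_While_end) simp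
 then have "runs (FWhile F) (enc (pc_code P pc, it, m)) (enc (0 :: nat, it, m)) ((2 * C + 4) * 0 + 2)"
  unfolding stopped by (rule runs_mono) simp
 ultimately show ?case by blast
next
 case (step pc0 M0 q0 v t)
 then have eq: "pc0 = pc" "M0 = M" "q0 = q" by auto
 let ?ins = "P ! pc"
 obtain pc' M' q' where s: "step_instr {} x ?ins (pc, M, q) = (pc', M', q')" by (metis prod_cases3)
 let ?m = "next_mem ?ins it m"
 have next_m: "mem_repr M' ?m" and pc': "next_pc P ?ins pc m = pc_code P pc'"
  and cost: "sim_cost ?ins m \<le> cost_instr ?ins M"
  using next_mem_step[OF step.prems(2) i s] by auto
 obtain m' where m': "runs (FWhile F) (enc (pc_code P pc', it, ?m)) (enc (0 :: nat, it, m')) ((2 * C + 4) * t + 2)"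
  "lookup [] m' = bin v"
  using step.IH[of pc' M' q' ?m] s next_m eq by auto
 have pc: "pc < length P" using step.hyps eq by simp
 then have "runs F (enc (pc_code P pc, it, m)) (enc (pc_code P pc', it, ?m)) (C * (sim_cost ?ins m + 1))"
  using F[of "(pc_code P pc, it, m)"] pc' by (simp add: sim_step_def step_cost_def pc_code_def Let_def)
 moreover have "car (enc (pc_code P pc, it, m)) \<noteq> Lf" using pc by (simp add: pc_code_def)
 ultimately have run: "runs (FWhile F) (enc (pc_code P pc, it, m)) (enc (0 :: nat, it, m'))
   (C * (sim_cost ?ins m + 1) + ((2 * C + 4) * t + 2) + 4)"
  using m'(1) runs_While by blast
 have "C * (sim_cost ?ins m + 1) \<le> C * (2 * cost_instr ?ins M)" "4 \<le> 4 * cost_instr ?ins M"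
  using cost cost_instr_pos[of ?ins M] mult_le_mono2[of "sim_cost ?ins m + 1" "2 * cost_instr ?ins M" C] by simp_all
 then have "C * (sim_cost ?ins m + 1) + ((2 * C + 4) * t + 2) + 4 \<le> (2 * C + 4) * (cost_instr ?ins M + t) + 2"
  by (simp add: algebra_simps)
 from runs_mono[OF run this] show ?case using m'(2) eq by blast
qed

lemma length_bin_bound: "n < 2 ^ k ==> length (bin n) \<le> k"
proof (induction k arbitrary: n)
 case (Suc k)
 then have "n div 2 < 2 ^ k" by simp
 then show ?case using Suc.IH[of "n div 2"] by (subst bin.simps) auto
qed simp

lemma length_bin_le_self: "length (bin n) \<le> n"
 by (rule length_bin_bound) simp

lemma length_bin_add: "length (bin_add a b) \<le> length a + length b + 1"
proof -
 have "bval a < 2 ^ (length a + length b)" "bval b < 2 ^ (length a + length b)"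
  using bval_less[of a] bval_less[of b]
  by (meson le_add1 le_add2 less_le_trans one_le_numeral power_increasing)+
 then have "bval a + bval b < 2 ^ (length a + length b + 1)" by simp
 then show ?thesis unfolding bin_add_eq by (rule length_bin_bound)
qed

lemma poly_bin_add [THEN poly2, poly_intros]: "poly (%(a, b). bin_add a b)"
 unfolding case_prod_unfold
proof (rule polyI)
 show "pbound (%p :: bits \<times> bits. length (fst p) + length (snd p))"
  by (intro pbound_intros pbound_length poly_intros)
 show "ctime (%p. bin_add (fst p) (snd p)) (%p. length (fst p) + length (snd p))"
  by (intro ctime_bin_add ctime_intros order_refl)
 have "esize (bin_add (fst p) (snd p)) \<le> 2 * (length (fst p) + length (snd p) + 1)" for p
  by (rule le_trans[OF esize_bits mult_le_mono2[OF length_bin_add]])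
 moreover have "pbound (%p :: bits \<times> bits. 2 * (length (fst p) + length (snd p) + 1))"
  by (intro pbound_intros pbound_length poly_intros)
 ultimately show "pbound (%p. esize (bin_add (fst p) (snd p)))" by (rule pbound_mono[rotated])
qed

lemma esize_bin: "esize (bin n) \<le> 2 * n"
 using esize_bits[of "bin n"] length_bin_le_self[of n] by simp

lemma poly_bin [poly_intros]:
 assumes f: "poly f"
 shows "poly (%x. bin (f x))"
proof -
 have bin: "(bin_add [True] ^^ n) [] = bin n" for n
  by (induction n) (auto simp: bin_add_eq)
 have "poly (%x. (bin_add [True] ^^ f x) [])"
 proof (rule poly_funpow[OF f poly_const, where f = "%_. bin_add [True]"])
  show "pbound (%x. 2 * f x)" by (intro pbound_intros pbound_nat f)
  show "esize ((bin_add [True] ^^ i) []) \<le> 2 * f x" if "i \<le> f x" for x i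
   using esize_bin[of i] that by (simp add: bin)
 qed (intro poly_intros)
 then show ?thesis unfolding bin .
qed

lemma esize_trie_simps [simp]: "esize TE = 0" "esize (TN v l r) = 2 + esize v + esize l + esize r"
 by (simp_all add: esize_def)

lemma esize_update: "esize (update bs v t) \<le> esize t + esize v + 5 * length bs + 5"
proof (induction bs arbitrary: t)
 case Nil
 then show ?case by (cases t) (auto simp: set_root_def)
next
 case (Cons b bs)
 show ?case using Cons[of "child b t"] by (cases t; cases b) (auto simp: set_child_def)
qed

lemma poly_update [THEN poly3, poly_intros]: "poly (%(bs, v, t). update bs v t)"
 unfolding case_prod_unfold
proof (rule polyI)
 show "pbound (%p :: bits \<times> bits \<times> trie. length (fst p))"
  by (intro pbound_length poly_intros)
 show "ctime (%p. update (fst p) (fst (snd p)) (snd (snd p))) (%p. length (fst p))"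
  by (intro ctime_update[where D = 1] ctime_intros) simp
 have "esize (update (fst p) (fst (snd p)) (snd (snd p))) \<le> 6 * esize p" for p :: "bits \<times> bits \<times> trie"
  using esize_update[of "fst p" "fst (snd p)" "snd (snd p)"] length_le_esize[of "fst p"] by (cases p) auto
 moreover have "pbound (%p :: bits \<times> bits \<times> trie. 6 * esize p)" by (intro pbound_intros)
 ultimately show "pbound (%p. esize (update (fst p) (fst (snd p)) (snd (snd p))))" by (rule pbound_mono[rotated])
qed

definition input_trie :: "bits => trie" where
 "input_trie x = snd (foldl (%s b. (Suc (fst s), update (bin (fst s)) [b] (snd s))) (0, TE) x)"

lemma foldl_input_trie:
 "foldl (%s b. (Suc (fst s), update (bin (fst s)) [b] (snd s))) (0, TE) x = (length x, input_trie x)"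
 by (induction x rule: rev_induct) (auto simp: input_trie_def prod_eq_iff)

lemma input_trie_snoc: "input_trie (x @ [b]) = update (bin (length x)) [b] (input_trie x)"
 unfolding input_trie_def[of "x @ [b]"] foldl_append foldl_input_trie by simp

lemma input_repr_input_trie: "input_repr x (input_trie x)"
proof (induction x rule: rev_induct)
 case Nil
 then show ?case by (simp add: input_trie_def input_repr_def)
next
 case (snoc b x)
 then show ?case by (auto simp: input_trie_snoc input_repr_def lookup_update nth_append)
qed

lemma esize_input_trie: "esize (input_trie x) \<le> length x * (5 * length x + 10)"
proof (induction x rule: rev_induct)
 case Nil
 then show ?case by (simp add: input_trie_def)
next
 case (snoc b x)
 have "esize (input_trie (x @ [b])) \<le> esize (input_trie x) + esize [b] + 5 * length (bin (length x)) + 5"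
  unfolding input_trie_snoc by (rule esize_update)
 also have "\<dots> \<le> length x * (5 * length x + 10) + 2 + 5 * length x + 5"
  using snoc length_bin_le_self[of "length x"] esize_bool[of b] by simp
 also have "\<dots> \<le> length (x @ [b]) * (5 * length (x @ [b]) + 10)" by (simp add: algebra_simps)
 finally show ?case .
qed

lemma poly_input_trie: "poly input_trie"
 unfolding input_trie_def
proof (rule poly_snd, rule poly_foldl[where B = "%x. length x + length x * (5 * length x + 10) + 1"])
 show "pbound (%x :: bits. length x + length x * (5 * length x + 10) + 1)"
  by (intro pbound_intros pbound_length poly_id)
 fix x ys zs :: bits assume x: "x = ys @ zs"
 have "length ys * (5 * length ys + 10) \<le> length x * (5 * length x + 10)" using x by (intro mult_le_mono) auto
 then show "esize (foldl (%s b. (Suc (fst s), update (bin (fst s)) [b] (snd s))) (0, TE) ys)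
  \<le> length x + length x * (5 * length x + 10) + 1"
  using esize_input_trie[of ys] x unfolding foldl_input_trie by simp
qed (intro poly_intros)+

theorem ram_simulation:
 "\<exists>F C k. plain F \<and> (\<forall>x v t. computes_in P {} x v t --> runs F (enc x) (enc (bin v)) (C * (t + (esize x + 2) ^ k)))"
proof -
 obtain F C where F: "plain F" "\<And>s. runs F (enc s) (enc (sim_step P s)) (C * (step_cost P s + 1))"
  using ctime_sim_step[of P] unfolding ctime_def by blast
 have "poly (%x. (pc_code P 0, input_trie x, TE))"
  by (intro poly_intros poly_input_trie)
 then obtain \<tau> where "pbound \<tau>" and \<tau>: "ctime (%x. (pc_code P 0, input_trie x, TE)) \<tau>" by (rule polyE)
 then obtain G D k where G: "plain G" "\<And>x. runs G (enc x) (enc (pc_code P 0, input_trie x, TE)) (D * (\<tau> x + 1))"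
  and k: "\<And>x. \<tau> x \<le> (esize x + 2) ^ k"
  unfolding ctime_def pbound_def by blast
 let ?H = "FComp G (FComp (FWhile F) (FComp FCdr (FComp FCdr FCar)))"
 have "runs ?H (enc x) (enc (bin v)) ((2 * C + 4 + 2 * D + 6) * (t + (esize x + 2) ^ k))"
  if run: "computes_in P {} x v t" for x v t
 proof -
  have "mem_repr (%_. 0) TE" by (simp add: mem_repr_def)
  then obtain m where loop: "runs (FWhile F) (enc (pc_code P 0, input_trie x, TE)) (enc (0 :: nat, input_trie x, m))
    ((2 * C + 4) * t + 2)" and "lookup [] m = bin v"
   using runs_sim_loop[OF F(2) input_repr_input_trie[of x]] run unfolding computes_in_def by blast
  then have "car (enc m) = enc (bin v)" by (cases m) auto
  then have result: "runs (FComp FCdr (FComp FCdr FCar)) (enc (0 :: nat, input_trie x, m)) (enc (bin v)) 3"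
   using runs_Comp[OF runs_Cdr[of "enc (0 :: nat, input_trie x, m)"] runs_Comp[OF runs_Cdr runs_Car]]
   by (simp add: numeral_3_eq_3)
  let ?E = "(esize x + 2) ^ k"
  have E: "1 \<le> ?E" by simp
  have "D * (\<tau> x + 1) \<le> D * (2 * ?E)" by (rule mult_le_mono2) (use k[of x] E in linarith)
  moreover have "(2 * C + 4 + 2 * D + 6) * (t + ?E) =
    (2 * C + 4) * t + (2 * C + 4) * ?E + (2 * D + 6) * t + D * (2 * ?E) + 6 * ?E"
   by (simp add: algebra_simps)
  ultimately have "D * (\<tau> x + 1) + ((2 * C + 4) * t + 2 + 3) \<le> (2 * C + 4 + 2 * D + 6) * (t + ?E)"
   using E by linarith
  then show ?thesis by (rule runs_mono[OF runs_Comp[OF G(2) runs_Comp[OF loop result]]])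
 qed
 moreover have "plain ?H" using F G by simp
 ultimately show ?thesis by blast
qed

section \<open>The pointer machine\<close>

text \<open>Trees are stored in cells; the cell created in step \<open>i\<close> has address \<open>i\<close>, so that no
 allocation counter is needed besides the clock. Address 0 is the empty tree.\<close>

type_synonym pconf = "nat \<times> (nat => nat) \<times> (nat => nat) \<times> (nat => nat) \<times> bits \<times> bits"

fun pinstr_step :: "bits set => nat => tinstr => pconf => pconf" where
 "pinstr_step A i (TNil r) (pc, R, h, t, x, q) = (Suc pc, R(r := 0), h, t, x, q)"
| "pinstr_step A i (TCons r s u) (pc, R, h, t, x, q) = (Suc pc, R(r := i), h(i := R s), t(i := R u), x, q)"
| "pinstr_step A i (TCar r s) (pc, R, h, t, x, q) = (Suc pc, R(r := h (R s)), h, t, x, q)"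
| "pinstr_step A i (TCdr r s) (pc, R, h, t, x, q) = (Suc pc, R(r := t (R s)), h, t, x, q)"
| "pinstr_step A i (TJumpLf r l) (pc, R, h, t, x, q) = (if R r = 0 then l else Suc pc, R, h, t, x, q)"
| "pinstr_step A i (TNext r) (pc, R, h, t, x, q) =
   (Suc pc, R(r := if x \<noteq> [] \<and> hd x then i else 0), h, t, tl x, q)"
| "pinstr_step A i (TEof r) (pc, R, h, t, x, q) = (Suc pc, R(r := if x = [] then i else 0), h, t, x, q)"
| "pinstr_step A i (TEmit r) (pc, R, h, t, x, q) = (Suc pc, R, h, t, x, q @ [R r \<noteq> 0])"
| "pinstr_step A i (TAsk r) (pc, R, h, t, x, q) = (Suc pc, R(r := if q \<in> A then i else 0), h, t, x, [])"

definition pstep :: "bits set => tinstr list => nat => pconf => pconf" where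
 "pstep A P i c = (if fst c < length P then pinstr_step A i (P ! fst c) c else c)"

primrec prun :: "bits set => tinstr list => nat => nat => pconf => pconf" where
 "prun A P 0 i c = c"
| "prun A P (Suc n) i c = pstep A P (i + n) (prun A P n i c)"

inductive prep :: "(nat => nat) => (nat => nat) => nat => nat => tree => bool" for h t i where
 prep_Lf: "prep h t i 0 Lf"
| prep_Nd: "0 < p ==> p < i ==> prep h t i (h p) a ==> prep h t i (t p) b ==> prep h t i p (Nd a b)"

lemma prep_mono:
 assumes "prep h t i p a"
 shows "prep h t (Suc i) p a" "prep (h(i := x)) (t(i := y)) (Suc i) p a"
 using assms by (induction) (auto intro: prep.intros)

lemma prep_0: "prep h t i p a ==> p = 0 \<longleftrightarrow> a = Lf"
 by (cases rule: prep.cases) auto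

lemma prep_car: "prep h t i p a ==> h 0 = 0 ==> prep h t i (h p) (car a)"
 by (cases rule: prep.cases) (auto intro: prep.intros)

lemma prep_cdr: "prep h t i p a ==> t 0 = 0 ==> prep h t i (t p) (cdr a)"
 by (cases rule: prep.cases) (auto intro: prep.intros)

fun pinv :: "nat => pconf => bool" where
 "pinv i (pc, R, h, t, x, q) \<longleftrightarrow> 1 \<le> i \<and> (\<forall>r. R r < i) \<and> (\<forall>p. h p < i \<and> t p < i) \<and>
   (\<forall>p\<ge>i. h p = 0 \<and> t p = 0) \<and> h 0 = 0 \<and> t 0 = 0"

fun psim :: "nat => pconf => tconf => bool" where
 "psim i (pc, R, h, t, x, q) (pc', T, x', q') \<longleftrightarrow> pc = pc' \<and> x = x' \<and> q = q' \<and>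
   (\<forall>r. prep h t i (R r) (T r))"

lemma pinv_step: "pinv i c ==> pinv (Suc i) (pstep A P i c)"
proof -
 assume inv: "pinv i c"
 obtain pc R h t x q where c: "c = (pc, R, h, t, x, q)" by (metis prod_cases6)
 have "R r < Suc i" "h p < Suc i" "t p < Suc i" for r p using inv c by (auto intro: less_SucI)
 then show ?thesis
  using inv unfolding c pstep_def by (cases "P ! pc") (auto simp: Suc_le_eq)
qed

lemma psim_step:
 assumes "pinv i c" "psim i c d"
 shows "psim (Suc i) (pstep A P i c) (tstep A P d)"
proof -
 obtain pc R h t x q where c: "c = (pc, R, h, t, x, q)" by (metis prod_cases6)
 obtain T where d: "d = (pc, T, x, q)" using assms(2) unfolding c by (cases d) auto
 have rep: "prep h t i (R r) (T r)" for r using assms(2) unfolding c d by auto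
 have nil: "h 0 = 0" "t 0 = 0" and fresh: "1 \<le> i" "h i = 0" "t i = 0" using assms(1) unfolding c by auto
 have later: "prep h t (Suc i) (R r) (T r)" "prep (h(i := y)) (t(i := z)) (Suc i) (R r) (T r)" for r y z
  using prep_mono[OF rep] by auto
 have bool: "prep h t (Suc i) i (tbool True)" "prep h t (Suc i) 0 (tbool False)" "prep h t (Suc i) 0 Lf"
  using nil fresh by (auto simp: tbool_def intro!: prep.intros)
 have cons: "prep (h(i := R r)) (t(i := R s)) (Suc i) i (Nd (T r) (T s))" for r s
  using later(2) fresh(1) by (intro prep_Nd) auto
 have parts: "prep h t (Suc i) (h (R s)) (car (T s))" "prep h t (Suc i) (t (R s)) (cdr (T s))" for s
  using prep_car[OF later(1)] prep_cdr[OF later(1)] nil by auto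
 show ?thesis
  unfolding c d pstep_def tstep_def using later bool cons parts prep_0[OF rep]
  by (cases "P ! pc") (auto simp: tnext_def simp del: fun_upd_apply simp add: fun_upd_def)
qed

definition pinit :: "bits => pconf" where
 "pinit x = (0, %_. 0, %_. 0, %_. 0, x, [])"

lemma pinv_prun: "pinv i c ==> pinv (i + n) (prun A P n i c)"
 by (induction n) (use pinv_step in auto)

lemma psim_prun: "pinv i c ==> psim i c d ==> psim (i + n) (prun A P n i c) (trun A P n d)"
proof (induction n)
 case (Suc n)
 then show ?case using psim_step[OF pinv_prun[OF Suc.prems(1)] Suc.IH[OF Suc.prems], of A P]
  by (simp add: trun_def)
qed simp

lemma pinv_pinit: "pinv 1 (pinit x)" and psim_pinit: "psim 1 (pinit x) (0, %_. Lf, x, [])"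
 by (auto simp: pinit_def intro: prep.intros)

section \<open>Compiling the pointer machine to a random access machine\<close>

text \<open>Register \<open>r < 4\<close> is kept in RAM register \<open>r + 1\<close>; RAM register 0 stays 0 until the end, 5 is the clock,
 6 and 7 hold the constants 1 and 20, 8 and 9 are scratch, 10 is the input position. A test with result
 0, 1 or 2 in register 8 is followed by loading one of the registers 11, 12 and 13, where 12 is set to the
 clock and the others are 0. Cell \<open>p\<close> occupies the RAM registers \<open>2 p + 20\<close> and \<open>2 p + 21\<close>.\<close>

definition select :: "nat => instr list" where
 "select r = [Add 12 5 0, Const 9 11, Add 9 9 8, Load (r + 1) 9]"

fun tbody :: "tinstr => instr list" where
 "tbody (TNil r) = [Const (r + 1) 0]"
| "tbody (TCons r s u) = [Add 8 5 5, Add 8 8 7, Store 8 (s + 1), Add 8 8 6, Store 8 (u + 1), Add (r + 1) 5 0]"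
| "tbody (TCar r s) = [Add 8 (s + 1) (s + 1), Add 8 8 7, Load (r + 1) 8]"
| "tbody (TCdr r s) = [Add 8 (s + 1) (s + 1), Add 8 8 7, Add 8 8 6, Load (r + 1) 8]"
| "tbody (TJumpLf r l) = []"
| "tbody (TNext r) = [Read 8 10, Add 10 10 6] @ select r"
| "tbody (TEof r) = [Read 8 10, Sub 8 8 6] @ select r"
| "tbody (TEmit r) = [Append (r + 1)]"
| "tbody (TAsk r) = Query 8 # select r"

definition tpadded :: "tinstr => instr list" where
 "tpadded c = Add 5 5 6 # tbody c @ replicate (6 - length (tbody c)) (Const 9 0)"

definition tblock :: "(nat => nat) => tinstr => instr list" where
 "tblock J c = tpadded c @ [case c of TJumpLf r l => JumpZero (r + 1) (J l) | _ => Const 9 0]"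

lemma length_tpadded [simp]: "length (tpadded c) = 7"
 by (cases c) (auto simp: tpadded_def select_def)

lemma length_tblock [simp]: "length (tblock J c) = 8"
 by (simp add: tblock_def)

definition taddr :: "tinstr list => nat => nat" where
 "taddr P l = 2 + 8 * min l (length P)"

definition ram_of :: "tinstr list => ram" where
 "ram_of P = [Const 6 1, Const 7 20] @ concat (map (tblock (taddr P)) P) @
   [JumpZero 1 (taddr P (length P) + 2), Const 0 1]"

lemma length_blocks: "length (concat (map (tblock J) P)) = 8 * length P"
 by (induction P) auto

lemma length_ram_of: "length (ram_of P) = 8 * length P + 4"
 by (simp add: ram_of_def length_blocks)

lemma code_at_tblock:
 assumes k: "k < length P"
 shows "code_at (ram_of P) (taddr P k) (tblock (taddr P) (P ! k))"
 unfolding code_at_def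
proof (intro exI conjI)
 let ?blocks = "%cs. concat (map (tblock (taddr P)) cs)"
 have "?blocks P = ?blocks (take k P) @ tblock (taddr P) (P ! k) @ ?blocks (drop (Suc k) P)"
  by (subst id_take_nth_drop[OF k]) simp
 then show "ram_of P = ([Const 6 1, Const 7 20] @ ?blocks (take k P)) @ tblock (taddr P) (P ! k) @
   ?blocks (drop (Suc k) P) @ [JumpZero 1 (taddr P (length P) + 2), Const 0 1]"
  by (simp add: ram_of_def)
 show "length ([Const 6 1, Const 7 20] @ ?blocks (take k P)) = taddr P k"
  using k by (simp add: length_blocks taddr_def)
qed

lemma code_at_ram_of_end:
 "code_at (ram_of P) (taddr P (length P)) [JumpZero 1 (taddr P (length P) + 2), Const 0 1]"
 unfolding code_at_def
 by (intro exI[of _ "[Const 6 1, Const 7 20] @ concat (map (tblock (taddr P)) P)"] exI[of _ "[]"])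
  (simp add: ram_of_def length_blocks taddr_def)

definition leads :: "ram => bits set => bits => config => config => nat => bool" where
 "leads Q A x c c' b \<longleftrightarrow> (\<forall>v t. exec Q A x c' v t --> (\<exists>t'. exec Q A x c v t' \<and> t' \<le> b + t))"

lemma leads_refl: "leads Q A x c c 0"
 by (auto simp: leads_def)

lemma leads_trans:
 assumes "leads Q A x c c' b" "leads Q A x c' c'' b'"
 shows "leads Q A x c c'' (b + b')"
 unfolding leads_def
proof (intro allI impI)
 fix v t assume "exec Q A x c'' v t"
 then obtain t1 where t1: "exec Q A x c' v t1" "t1 \<le> b' + t" using assms(2) unfolding leads_def by blast
 then obtain t2 where "exec Q A x c v t2" "t2 \<le> b + t1" using assms(1) unfolding leads_def by blast
 then show "\<exists>t'. exec Q A x c v t' \<and> t' \<le> b + b' + t" using t1(2) by (intro exI[of _ t2]) auto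
qed

lemma leads_mono: "leads Q A x c c' b ==> b \<le> b' ==> leads Q A x c c' b'"
 unfolding leads_def by (meson add_le_mono le_trans order_refl)

lemma leads_step:
 assumes "code_at Q pc (c # cs)" "cost_instr c M \<le> b"
 shows "leads Q A x (pc, M, q) (step_instr A x c (pc, M, q)) b"
 unfolding leads_def using exec.step[of pc Q] assms unfolding code_at_Cons by (metis add_le_mono order_refl)

definition straight :: "instr => bool" where
 "straight c \<longleftrightarrow> (\<forall>r l. c \<noteq> JumpZero r l)"

definition exec1 :: "bits set => bits => instr => (nat => nat) \<times> bits => (nat => nat) \<times> bits" where
 "exec1 A x c s = snd (step_instr A x c (0, s))"

primrec execs :: "bits set => bits => instr list => (nat => nat) \<times> bits => (nat => nat) \<times> bits" where
 "execs A x [] s = s"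
| "execs A x (c # cs) s = execs A x cs (exec1 A x c s)"

primrec cheap :: "bits set => bits => nat => instr list => (nat => nat) \<times> bits => bool" where
 "cheap A x b [] s = True"
| "cheap A x b (c # cs) s = (cost_instr c (fst s) \<le> b \<and> cheap A x b cs (exec1 A x c s))"

lemma step_straight: "straight c ==> step_instr A x c (pc, s) = (Suc pc, exec1 A x c s)"
 by (cases c; cases s) (auto simp: straight_def exec1_def)

lemma leads_execs:
 assumes "code_at Q a cs" "\<forall>c\<in>set cs. straight c" "cheap A x b cs s"
 shows "leads Q A x (a, s) (a + length cs, execs A x cs s) (length cs * b)"
 using assms
proof (induction cs arbitrary: a s)
 case Nil
 then show ?case by (simp add: leads_refl)
next
 case (Cons c cs)
 have "leads Q A x (a, s) (Suc a, exec1 A x c s) b"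
  using leads_step[OF Cons.prems(1), of "fst s" b A x "snd s"] Cons.prems(2,3) step_straight[of c A x a s] by simp
 moreover have "leads Q A x (Suc a, exec1 A x c s) (Suc a + length cs, execs A x cs (exec1 A x c s)) (length cs * b)"
  using Cons.prems by (intro Cons.IH) (auto simp: code_at_Cons)
 ultimately show ?case using leads_trans by fastforce
qed

lemma straight_tpadded: "c' \<in> set (tpadded c) ==> straight c'"
 by (cases c) (auto simp: straight_def tpadded_def select_def)

lemma bit_cost_le: "bit_cost n \<le> n + 1"
 using length_bin_le_self[of n] by (simp add: bit_cost_def length_bin)

definition small_regs :: "tinstr => bool" where
 "small_regs c = (case c of TNil r => r < 4 | TCons r s u => r < 4 \<and> s < 4 \<and> u < 4 | TCar r s => r < 4 \<and> s < 4
   | TCdr r s => r < 4 \<and> s < 4 | TJumpLf r l => r < 4 | TNext r => r < 4 | TEof r => r < 4 | TEmit r => r < 4 | TAsk r => r < 4)"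

fun mem_rel :: "bits => nat => pconf => (nat => nat) => bool" where
 "mem_rel x0 i (pc, R, h, t, x, q) M \<longleftrightarrow> M 0 = 0 \<and> (\<forall>r<4. M (Suc r) = R r) \<and> M 5 = i - 1 \<and> M 6 = 1 \<and> M 7 = 20 \<and>
   M 11 = 0 \<and> M 13 = 0 \<and> (\<forall>p. M (2 * p + 20) = h p \<and> M (2 * p + 21) = t p) \<and> x = drop (M 10) x0 \<and> M 10 < i"

context
 fixes x0 :: bits and i pc :: nat and R h t :: "nat => nat" and x q :: bits and M :: "nat => nat" and A :: "bits set"
 assumes rel: "mem_rel x0 i (pc, R, h, t, x, q) M" and inv: "pinv i (pc, R, h, t, x, q)"
begin

lemma mem_rel_facts:
 "M 0 = 0" "M 5 = i - 1" "M 6 = 1" "M 7 = 20" "M 11 = 0" "M 13 = 0" "x = drop (M 10) x0" "M 10 < i" "i \<ge> 1"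
 "r < 4 ==> M (Suc r) = R r" "M (2 * p + 20) = h p" "M (2 * p + 21) = t p"
 "M (R r + R r + 20) = h (R r)" "M (R r + R r + 21) = t (R r)" "M (Suc (R r + R r + 20)) = t (R r)"
 "R r < i" "h p < i" "t p < i"
proof -
 have "M (2 * R r + 20) = h (R r)" "M (2 * R r + 21) = t (R r)" using rel by auto
 then show "M (R r + R r + 20) = h (R r)" "M (R r + R r + 21) = t (R r)" "M (Suc (R r + R r + 20)) = t (R r)"
  by (simp_all add: mult_2 eval_nat_numeral)
qed (use rel inv in auto)

lemma low_register: "n < 4 ==> n \<noteq> 4 \<and> n \<noteq> 5 \<and> n \<noteq> 6 \<and> n \<noteq> 7 \<and> n \<noteq> 8 \<and> n \<noteq> 9 \<and> n \<noteq> 10 \<and> n \<noteq> 11 \<and> n \<noteq> 12" for n :: nat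
 by auto

lemma replicate_numeral: "replicate (numeral k) c = c # replicate (pred_numeral k) c"
 by (simp add: numeral_eq_Suc)

lemmas exec_simps = tpadded_def select_def exec1_def fun_upd_def Let_def small_regs_def replicate_numeral

lemma cheap_tpadded:
 assumes "small_regs c"
 shows "cheap A x0 (4 * i + 100) (tpadded c) (M, q)"
proof -
 have pair: "bit_cost m + bit_cost n \<le> 4 * i + 100" if "m \<le> 2 * i + 49" "n \<le> 2 * i + 49" for m n
  using bit_cost_le[of m] bit_cost_le[of n] that by linarith
 have single: "bit_cost m \<le> 4 * i + 100" if "m \<le> 2 * i + 49" for m
  using bit_cost_le[of m] that by linarith
 have small: "R r \<le> 2 * i + 49" "h p \<le> 2 * i + 49" "t p \<le> 2 * i + 49" "R r + R r \<le> 2 * i + 49"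
  "2 * R r \<le> 29 + 2 * i" "2 * R r \<le> 28 + 2 * i" for r p
  using mem_rel_facts(16)[of r] mem_rel_facts(17,18)[of p] by linarith+
 show ?thesis
  using assms low_register mem_rel_facts small
  by (cases c) (auto simp: exec_simps intro!: single pair)
qed

lemma execs_tpadded:
 assumes "small_regs c"
  and "(pc', R', h', t', x', q') = (case c of TJumpLf r l => (pc, R, h, t, x, q) | _ => pinstr_step A i c (pc, R, h, t, x, q))"
 shows "\<exists>M'. execs A x0 (tpadded c) (M, q) = (M', q') \<and> mem_rel x0 (Suc i) (pc', R', h', t', x', q') M'"
 using assms low_register mem_rel_facts
 by (cases c) (auto simp: exec_simps drop_Suc tl_drop hd_drop_conv_nth)

end

declare mem_rel.simps [simp del]

lemma leads_tblock:
 assumes rel: "mem_rel x0 i (pc, R, h, t, x, q) M" and inv: "pinv i (pc, R, h, t, x, q)"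
  and pc: "pc < length P" and c: "small_regs (P ! pc)"
  and step: "pinstr_step A i (P ! pc) (pc, R, h, t, x, q) = (pc', R', h', t', x', q')"
 shows "\<exists>M'. leads (ram_of P) A x0 (taddr P pc, M, q) (taddr P pc', M', q') (8 * (4 * i + 100)) \<and>
   mem_rel x0 (Suc i) (pc', R', h', t', x', q') M'"
proof -
 let ?c = "P ! pc" and ?b = "4 * i + 100" and ?Q = "ram_of P"
 have next_addr: "taddr P (Suc pc) = 8 + taddr P pc" using pc by (simp add: taddr_def)
 have code: "code_at ?Q (taddr P pc) (tpadded ?c)" "code_at ?Q (taddr P pc + 7)
   [case ?c of TJumpLf r l => JumpZero (r + 1) (taddr P l) | _ => Const 9 0]"
  using code_at_tblock[OF pc] by (auto simp: tblock_def code_at_append)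
 obtain M1 where M1: "execs A x0 (tpadded ?c) (M, q) = (M1, q')"
  and "case ?c of TJumpLf r l => mem_rel x0 (Suc i) (pc, R, h, t, x, q) M1
   | _ => mem_rel x0 (Suc i) (pc', R', h', t', x', q') M1"
  using execs_tpadded[OF rel inv c, of _ _ _ _ _ _ A] step by (cases ?c) (auto split: prod.splits)
 from leads_execs[OF code(1) _ cheap_tpadded[OF rel inv c, of A]] straight_tpadded
 have body: "leads ?Q A x0 (taddr P pc, M, q) (taddr P pc + 7, M1, q') (7 * ?b)" by (auto simp: M1)
 have finish: ?thesis if "leads ?Q A x0 (taddr P pc + 7, M1, q') (taddr P pc', M2, q') ?b"
  "mem_rel x0 (Suc i) (pc', R', h', t', x', q') M2" for M2
  using leads_mono[OF leads_trans[OF body that(1)], of "8 * ?b"] that(2) by auto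
 show ?thesis
 proof (cases "\<exists>r l. ?c = TJumpLf r l")
  case True
  then obtain r l where jump: "?c = TJumpLf r l" by blast
  then have M1': "mem_rel x0 (Suc i) (pc, R, h, t, x, q) M1" and "r < 4"
   using \<open>case ?c of TJumpLf r l => _ | _ => _\<close> c by (auto simp: small_regs_def)
  then have reg: "M1 (Suc r) = R r" by (auto simp: mem_rel.simps)
  have "R r < i" using inv by auto
  then have "cost_instr (JumpZero (r + 1) (taddr P l)) M1 \<le> ?b" using bit_cost_le[of "R r"] reg by simp
  from leads_step[OF code(2)[unfolded jump tinstr.case] this, of A x0 q']
  have "leads ?Q A x0 (taddr P pc + 7, M1, q') (taddr P pc', M1, q') ?b"
   using step jump reg next_addr by (auto split: if_splits)
  then show ?thesis by (rule finish) (use M1' step jump in \<open>auto simp: mem_rel.simps\<close>)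
 next
  case False
  then have M1': "mem_rel x0 (Suc i) (pc', R', h', t', x', q') M1" and "pc' = Suc pc"
   and "code_at ?Q (taddr P pc + 7) [Const 9 0]"
   using \<open>case ?c of TJumpLf r l => _ | _ => _\<close> step code(2) by (cases ?c; auto)+
  from leads_step[OF this(3), of M1 ?b A x0 q'] \<open>pc' = Suc pc\<close> next_addr
  have "leads ?Q A x0 (taddr P pc + 7, M1, q') (taddr P pc', M1(9 := 0), q') ?b"
   using bit_cost_le[of 0] by simp
  then show ?thesis by (rule finish) (use M1' in \<open>auto simp: mem_rel.simps\<close>)
 qed
qed

lemma leads_prun:
 assumes P: "\<forall>c\<in>set P. small_regs c" and inv: "pinv i (pc, R, h, t, x, q)" and rel: "mem_rel x0 i (pc, R, h, t, x, q) M"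
 shows "prun A P n i (pc, R, h, t, x, q) = (pc', R', h', t', x', q') ==>
  \<exists>M'. leads (ram_of P) A x0 (taddr P pc, M, q) (taddr P pc', M', q') (n * (8 * (4 * (i + n) + 100))) \<and>
   (\<exists>j. mem_rel x0 j (pc', R', h', t', x', q') M') \<and> (pc' < length P --> mem_rel x0 (i + n) (pc', R', h', t', x', q') M')"
proof (induction n arbitrary: pc' R' h' t' x' q')
 case 0
 then show ?case using rel by (intro exI[of _ M]) (auto simp: leads_refl)
next
 case (Suc n)
 obtain pc1 R1 h1 t1 x1 q1 where run: "prun A P n i (pc, R, h, t, x, q) = (pc1, R1, h1, t1, x1, q1)" by (metis prod_cases6)
 obtain M1 j where M1: "leads (ram_of P) A x0 (taddr P pc, M, q) (taddr P pc1, M1, q1) (n * (8 * (4 * (i + n) + 100)))"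
  "mem_rel x0 j (pc1, R1, h1, t1, x1, q1) M1" "pc1 < length P --> mem_rel x0 (i + n) (pc1, R1, h1, t1, x1, q1) M1"
  using Suc.IH[OF run] by blast
 have step: "pstep A P (i + n) (pc1, R1, h1, t1, x1, q1) = (pc', R', h', t', x', q')" using Suc.prems run by simp
 show ?case
 proof (cases "pc1 < length P")
  case True
  have "small_regs (P ! pc1)" using P True by simp
  moreover have "pinv (i + n) (pc1, R1, h1, t1, x1, q1)" using pinv_prun[OF inv, of n A P] run by simp
  ultimately obtain M2 where M2: "leads (ram_of P) A x0 (taddr P pc1, M1, q1) (taddr P pc', M2, q') (8 * (4 * (i + n) + 100))"
   "mem_rel x0 (Suc (i + n)) (pc', R', h', t', x', q') M2"
   using leads_tblock[of x0 "i + n" pc1 R1 h1 t1 x1 q1 M1 P A] M1(3) True step by (auto simp: pstep_def)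
  have "leads (ram_of P) A x0 (taddr P pc, M, q) (taddr P pc', M2, q') (Suc n * (8 * (4 * (i + Suc n) + 100)))"
   by (rule leads_mono[OF leads_trans[OF M1(1) M2(1)]]) (simp add: algebra_simps)
  then show ?thesis using M2(2) by (intro exI[of _ M2]) auto
 next
  case False
  then have "(pc', R', h', t', x', q') = (pc1, R1, h1, t1, x1, q1)" using step by (simp add: pstep_def)
  moreover have "leads (ram_of P) A x0 (taddr P pc, M, q) (taddr P pc1, M1, q1) (Suc n * (8 * (4 * (i + Suc n) + 100)))"
   by (rule leads_mono[OF M1(1)]) (simp add: algebra_simps)
  ultimately show ?thesis using M1(2) False by auto
 qed
qed

lemma leads_init: "leads (ram_of P) A x (0, %_. 0, []) (2, (%_. 0)(6 := 1, 7 := 20), []) 22"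
proof -
 have code: "code_at (ram_of P) 0 (Const 6 1 # Const 7 20 # drop 2 (ram_of P))"
  unfolding code_at_def by (intro exI[of _ "[]"]) (simp add: ram_of_def)
 have "leads (ram_of P) A x (0, %_. 0, []) (1, (%_. 0)(6 := 1), []) 1"
  using leads_step[OF code, of "%_. 0" 1 A x "[]"] by (simp add: bit_cost_def floorlog_def)
 moreover have "leads (ram_of P) A x (1, (%_. 0)(6 := 1), []) (2, (%_. 0)(6 := 1, 7 := 20), []) 21"
  using leads_step[of "ram_of P" 1 "Const 7 20" "drop 2 (ram_of P)" "(%_. 0)(6 := 1)" 21 A x "[]"] code bit_cost_le[of 20]
  by (simp add: code_at_Cons numeral_2_eq_2)
 ultimately show ?thesis using leads_trans by fastforce
qed

lemma exec_ram_of_end: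
 assumes "M 0 = 0" "M 1 \<le> n"
 shows "\<exists>t\<le>n + 3. exec (ram_of P) A x (taddr P (length P), M, q) (of_bool (M 1 \<noteq> 0)) t"
proof -
 let ?Q = "ram_of P" and ?a = "taddr P (length P)"
 have halt: "exec ?Q A x (?a + 2, M', q) (M' 0) 0" for M'
  by (rule exec.halt) (simp add: length_ram_of taddr_def)
 have test: "leads ?Q A x (?a, M, q) (if M 1 = 0 then ?a + 2 else ?a + 1, M, q) (n + 1)"
  using leads_step[OF code_at_ram_of_end, of P M "n + 1" A x q] bit_cost_le[of "M 1"] assms(2) by (simp split: if_splits)
 obtain s' where "leads ?Q A x (?a, M, q) s' (n + 3)" "exec ?Q A x s' (of_bool (M 1 \<noteq> 0)) 0"
 proof (cases "M 1 = 0")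
  case True
  then show thesis using that[OF leads_mono[OF test]] halt[of M] assms(1) by simp
 next
  case False
  have "code_at ?Q (?a + 1) [Const 0 1]" using code_at_ram_of_end[of P] by (simp add: code_at_Cons)
  from leads_step[OF this, of M 2 A x q] bit_cost_le[of 1]
  have "leads ?Q A x (?a + 1, M, q) (?a + 2, M(0 := 1), q) 2" by (simp add: numeral_2_eq_2)
  from leads_trans[OF test[unfolded if_not_P[OF False]] this] have "leads ?Q A x (?a, M, q) (?a + 2, M(0 := 1), q) (n + 3)"
   by (rule leads_mono) simp
  then show thesis using that halt[of "M(0 := 1)"] False by simp
 qed
 then show ?thesis unfolding leads_def by (metis add_0_right)
qed

theorem ram_of_correct:
 assumes P: "\<forall>c\<in>set P. small_regs c"
  and run: "trun A P n (0, %_. Lf, x, []) = (pc', T, x', q')" and halt: "length P \<le> pc'"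
 shows "\<exists>t. computes_in (ram_of P) A x (of_bool (T 0 \<noteq> Lf)) t \<and> t \<le> 50 * (n + 30) ^ 2"
proof -
 let ?Q = "ram_of P" and ?M = "(%_. 0)(6 := 1, 7 := 20) :: nat => nat"
 obtain R' h' t' where prun: "prun A P n 1 (pinit x) = (pc', R', h', t', x', q')"
  and rep: "prep h' t' (1 + n) (R' 0) (T 0)"
  using psim_prun[OF pinv_pinit psim_pinit[of x], where n = n and A = A and P = P] unfolding run by (cases "prun A P n 1 (pinit x)") auto
 have "mem_rel x 1 (0, %_. 0, %_. 0, %_. 0, x, []) ?M" by (auto simp: mem_rel.simps)
 then obtain M' j where M': "leads ?Q A x (taddr P 0, ?M, []) (taddr P pc', M', q') (n * (8 * (4 * (1 + n) + 100)))"
  and "mem_rel x j (pc', R', h', t', x', q') M'"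
  using leads_prun[OF P pinv_pinit[unfolded pinit_def] _ prun[unfolded pinit_def]] by blast
 then have regs: "M' 1 = R' 0" "M' 0 = 0" by (auto simp: mem_rel.simps)
 have "R' 0 < 1 + n" using pinv_prun[OF pinv_pinit[of x], where n = n and A = A and P = P] unfolding prun by auto
 then obtain t where t: "exec ?Q A x (taddr P pc', M', q') (of_bool (T 0 \<noteq> Lf)) t" "t \<le> n + 3"
  using exec_ram_of_end[of M' n P A x q'] regs prep_0[OF rep] halt by (auto simp: taddr_def)
 have "taddr P 0 = 2" by (simp add: taddr_def)
 from leads_trans[OF leads_init M'[unfolded this]] t(1) obtain t' where
  t': "exec ?Q A x (0, %_. 0, []) (of_bool (T 0 \<noteq> Lf)) t'" "t' \<le> 22 + n * (8 * (4 * (1 + n) + 100)) + t"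
  unfolding leads_def by blast
 have "22 + n * (8 * (4 * (1 + n) + 100)) + (n + 3) \<le> 50 * (n + 30) ^ 2"
  by (simp add: power2_eq_square algebra_simps)
 then show ?thesis using t' t(2) unfolding computes_in_def by (intro exI[of _ t']) linarith
qed

lemma small_regs_fcode: "c \<in> set (fcode a F) ==> small_regs c"
 by (induction F arbitrary: a) (auto simp: small_regs_def)

theorem ram_of_fcode:
 assumes "evals A F (Lf, x, []) (y, x', q') n"
 shows "\<exists>t. computes_in (ram_of (fcode 0 F)) A x (of_bool (y \<noteq> Lf)) t \<and> t \<le> 50 * (n + 30) ^ 2"
proof -
 have "code_at (fcode 0 F) 0 (fcode 0 F)" unfolding code_at_def by (metis append_Nil append_Nil2 list.size(3))
 from segmentE[OF segment_fcode[OF assms this], of "%_. Lf"]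
 obtain R' where R': "trun A (fcode 0 F) n (0, %_. Lf, x, []) = (flen F, R', x', q')" "R' 0 = y" by auto
 show ?thesis using ram_of_correct[OF _ R'(1)] small_regs_fcode R'(2) by auto
qed

section \<open>Routing permutations through a Benes network\<close>

lemma permutes_of_inj:
 assumes "finite X" "inj_on f X" "f ` X \<subseteq> X" "\<And>x. x \<notin> X ==> f x = x"
 shows "f permutes X"
 using assms by (intro bij_imp_permutes) (auto simp: bij_betw_def endo_inj_surj)

lemma extend_inj_permutes:
 assumes "finite S" "A \<subseteq> S" "inj_on f A" "f ` A \<subseteq> S"
 shows "\<exists>g. g permutes S \<and> (\<forall>x\<in>A. g x = f x)"
proof -
 have "finite A" "finite (f ` A)" using assms finite_subset by auto
 then have "card (S - A) = card (S - f ` A)" using assms by (simp add: card_Diff_subset card_image)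
 then obtain k where k: "bij_betw k (S - A) (S - f ` A)" using assms(1) finite_same_card_bij by blast
 let ?g = "%x. if x \<in> A then f x else if x \<in> S then k x else x"
 have "bij_betw ?g A (f ` A)" using assms(3) by (simp add: bij_betw_def inj_on_def)
 moreover have "bij_betw ?g (S - A) (S - f ` A)" by (rule iffD2[OF bij_betw_cong k]) auto
 ultimately have "bij_betw ?g (A \<union> (S - A)) (f ` A \<union> (S - f ` A))" by (rule bij_betw_combine) auto
 then have "bij_betw ?g S S" using assms(2,4) by (simp add: Un_absorb1)
 then have "?g permutes S" by (rule bij_imp_permutes) (use assms(2) in auto)
 then show ?thesis by (intro exI[of _ ?g]) simp
qed

text \<open>The orbits of \<open>s \<circ> t\<close> come in pairs: if a power of \<open>s \<circ> t\<close> mapped \<open>x\<close> to \<open>s x\<close>, then the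
 middle of the path from \<open>x\<close> to \<open>s x\<close> would be a fixed point of \<open>s\<close> or \<open>t\<close>.\<close>

lemma funpow_comp_ne:
 assumes s: "\<And>x. s (s x) = x" "\<And>x. x \<in> X ==> s x \<in> X" "\<And>x. x \<in> X ==> s x \<noteq> x"
  and t: "\<And>x. t (t x) = x" "\<And>x. x \<in> X ==> t x \<in> X" "\<And>x. x \<in> X ==> t x \<noteq> x"
 shows "x \<in> X ==> ((s \<circ> t) ^^ k) x \<noteq> s x"
proof (induction k arbitrary: x rule: induct_nat_012)
 case 0
 then show ?case using s(3)[OF 0] by auto
next
 case 1
 have "s (t x) \<noteq> s x" using s(1) t(3)[OF 1] by metis
 then show ?case by simp
next
 case (ge2 k)
 show ?case
 proof
  assume "((s \<circ> t) ^^ Suc (Suc k)) x = s x"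
  then have "s (t (((s \<circ> t) ^^ Suc k) x)) = s x" by simp
  then have "((s \<circ> t) ^^ Suc k) x = t x" by (metis s(1) t(1))
  then have "((s \<circ> t) ^^ k) (s (t x)) = s (s (t x))" by (simp add: funpow_swap1 s(1))
  then show False using ge2(1)[OF s(2)[OF t(2)[OF ge2(3)]]] by blast
 qed
qed

lemma two_involutions_coloring:
 assumes X: "finite X" and s: "s permutes X" "\<And>x. s (s x) = x" "\<And>x. x \<in> X ==> s x \<noteq> x"
  and t: "t permutes X" "\<And>x. t (t x) = x" "\<And>x. x \<in> X ==> t x \<noteq> x"
 shows "\<exists>c :: 'a => bool. \<forall>x\<in>X. c (s x) = (\<not> c x) \<and> c (t x) = (\<not> c x)"
proof -
 let ?orb = "orbit (s \<circ> t)"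
 have perm: "permutation (s \<circ> t)" using permutes_compose[OF t(1) s(1)] X permutation_permutes by blast
 have self: "x \<in> ?orb x" for x by (rule permutation_self_in_orbit[OF perm])
 have orb_eq: "?orb y = ?orb x" if "y \<in> ?orb x" for x y
  using orbit_cyclic_eq3[OF cyclic_on_orbit'[OF perm] that] .
 have orb_t: "?orb (t x) = ?orb (s x)" for x
  using orb_eq[OF orbit.base[of "s \<circ> t" "t x"]] by (simp add: t(2))
 have orb_st: "?orb (s (t x)) = ?orb x" for x using orb_eq[OF orbit.base[of "s \<circ> t" x]] by simp
 have disjoint: "?orb (s x) \<noteq> ?orb x" if "x \<in> X" for x
 proof
  assume "?orb (s x) = ?orb x"
  then obtain k where "((s \<circ> t) ^^ k) x = s x" using self[of "s x"] unfolding orbit_altdef by auto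
  moreover have "((s \<circ> t) ^^ k) x \<noteq> s x"
   by (rule funpow_comp_ne[OF s(2) _ s(3) t(2) _ t(3) that]) (simp_all add: permutes_in_image[OF s(1)] permutes_in_image[OF t(1)])
  ultimately show False by blast
 qed
 define rep where "rep x = (SOME r. r \<in> ?orb x \<union> ?orb (s x))" for x
 have rep: "rep x \<in> ?orb x \<union> ?orb (s x)" for x unfolding rep_def by (rule someI[of "%r. r \<in> ?orb x \<union> ?orb (s x)" x]) (simp add: self)
 have rep_s: "rep (s x) = rep x" for x by (simp add: rep_def s(2) disj_commute)
 have rep_t: "rep (t x) = rep x" for x by (simp add: rep_def orb_t orb_st disj_commute)
 have exactly_one: "rep x \<in> ?orb (s x) \<longleftrightarrow> rep x \<notin> ?orb x" if "x \<in> X" for x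
  using rep[of x] disjoint[OF that] orb_eq[of "rep x" x] orb_eq[of "rep x" "s x"] by auto
 show ?thesis
  by (rule exI[of _ "%x. rep x \<in> ?orb x"]) (use exactly_one in \<open>simp add: rep_s rep_t orb_t\<close>)
qed

definition flip :: "nat => bits => bits" where
 "flip d xs = xs[d := \<not> xs ! d]"

definition layer :: "nat => (bits => bits) => bool" where
 "layer d h \<longleftrightarrow> (\<forall>xs. h xs = xs \<or> h xs = flip d xs)"

primrec routes :: "nat list => (bits => bits) => bool" where
 "routes [] f \<longleftrightarrow> f = id"
| "routes (d # ds) f \<longleftrightarrow> (\<exists>h g. layer d h \<and> routes ds g \<and> f = h \<circ> g)"

lemma routes_append: "routes (ds @ ds2) f \<longleftrightarrow> (\<exists>g h. routes ds g \<and> routes ds2 h \<and> f = g \<circ> h)"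
proof (induction ds arbitrary: f)
 case (Cons d ds)
 have "routes ((d # ds) @ ds2) f \<longleftrightarrow> (\<exists>h g k. layer d h \<and> routes ds g \<and> routes ds2 k \<and> f = h \<circ> (g \<circ> k))"
  unfolding append_Cons routes.simps Cons.IH by blast
 also have "\<dots> \<longleftrightarrow> (\<exists>g h. routes (d # ds) g \<and> routes ds2 h \<and> f = g \<circ> h)"
  unfolding routes.simps by (metis comp_assoc)
 finally show ?case .
qed auto

definition rows :: "nat => bits set" where
 "rows K = {xs. length xs = K}"

lemma finite_rows: "finite (rows K)"
 using finite_lists_length_eq[OF finite, of "UNIV :: bool set" K] by (simp add: rows_def)

lemma flip_rows: "x \<in> rows K ==> flip d x \<in> rows K"
 by (simp add: rows_def flip_def)

lemma flip_flip: "x \<in> rows K ==> d < K ==> flip d (flip d x) = x"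
 by (simp add: flip_def rows_def)

lemma flip_ne: "x \<in> rows K ==> d < K ==> flip d x \<noteq> x"
proof -
 assume "x \<in> rows K" "d < K"
 then have "flip d x ! d = (\<not> x ! d)" by (simp add: flip_def rows_def)
 then show ?thesis by auto
qed

definition lift_fn :: "(bool => bits => bits) => bits => bits" where
 "lift_fn f xs = (case xs of [] => [] | b # bs => b # f b bs)"

lemma lift_fn_simps [simp]: "lift_fn f [] = []" "lift_fn f (b # bs) = b # f b bs"
 by (simp_all add: lift_fn_def)

lemma routes_lift:
 "(\<And>b. routes ds (f b)) ==> routes (map Suc ds) (lift_fn f)"
proof (induction ds arbitrary: f)
 case Nil
 then show ?case by (auto simp: lift_fn_def fun_eq_iff split: list.split)
next
 case (Cons d ds)
 then have "\<forall>b. \<exists>h g. layer d h \<and> routes ds g \<and> f b = h \<circ> g" by simp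
 then obtain h g where h: "\<And>b. layer d (h b)" and g: "\<And>b. routes ds (g b)" and f: "\<And>b. f b = h b \<circ> g b" by metis
 have "layer (Suc d) (lift_fn h)" using h unfolding layer_def lift_fn_def flip_def by (auto split: list.split)
 moreover have "routes (map Suc ds) (lift_fn g)" by (rule Cons.IH[OF g])
 moreover have "lift_fn f = lift_fn h \<circ> lift_fn g" by (auto simp: lift_fn_def f fun_eq_iff split: list.split)
 ultimately show ?case unfolding list.map routes.simps by blast
qed

primrec dims :: "nat => nat list" where
 "dims 0 = []"
| "dims (Suc K) = 0 # map Suc (dims K) @ [0]"

lemma length_dims: "length (dims K) = 2 * K"
 by (induction K) auto

lemma dims_less: "d \<in> set (dims K) ==> d < K"
 by (induction K arbitrary: d) auto

text \<open>The colour of a row selects the half of the network through which it is sent; rows with equal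
 tails, as well as rows whose images have equal tails, must go through different halves.\<close>

lemma row_coloring:
 assumes f: "f permutes rows (Suc K)"
 shows "\<exists>c. \<forall>x\<in>rows (Suc K). c (flip 0 x) = (\<not> c x) \<and>
   (\<forall>y\<in>rows (Suc K). f y = flip 0 (f x) --> c y = (\<not> c x))"
proof -
 let ?X = "rows (Suc K)" and ?s = "perm_restrict (flip 0) (rows (Suc K))"
 have s: "?s (?s x) = x" "x \<in> ?X ==> ?s x \<noteq> x" for x
  using flip_rows[of x "Suc K" 0] flip_flip[of x "Suc K" 0] flip_ne[of x "Suc K" 0] by (simp_all add: perm_restrict_def)
 have perm_s: "?s permutes ?X"
  by (intro permutes_of_inj finite_rows inj_on_inverseI[where g = ?s] s) (auto simp: perm_restrict_def flip_rows)
 let ?t = "inv f \<circ> ?s \<circ> f"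
 note f_inv = permutes_inverses[OF f]
 have perm_t: "?t permutes ?X" using permutes_compose[OF f permutes_compose[OF perm_s permutes_inv[OF f]]] by (simp add: comp_assoc)
 have t: "?t (?t x) = x" for x using s(1) by (simp add: f_inv)
 have t_ne: "?t x \<noteq> x" if "x \<in> ?X" for x
  using s(2)[of "f x"] that f_inv(1)[of "?s (f x)"] permutes_in_image[OF f] by (metis comp_apply)
 obtain c where c: "\<And>x. x \<in> ?X ==> c (?s x) = (\<not> c x)" "\<And>x. x \<in> ?X ==> c (?t x) = (\<not> c x)"
  using two_involutions_coloring[OF finite_rows perm_s s perm_t t t_ne] by blast
 show ?thesis
 proof (intro exI[of _ c] ballI conjI impI)
  fix x assume x: "x \<in> ?X"
  show "c (flip 0 x) = (\<not> c x)" using c(1)[OF x] x by (simp add: perm_restrict_def)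
  fix y assume "f y = flip 0 (f x)"
  then have "?t x = inv f (f y)" using x permutes_in_image[OF f] by (simp add: perm_restrict_def)
  then show "c y = (\<not> c x)" using c(2)[OF x] by (simp only: f_inv)
 qed
qed

lemma row_eq_or_flip:
 "x \<in> rows (Suc K) ==> y \<in> rows (Suc K) ==> tl x = tl y ==> y = x \<or> y = flip 0 x"
 by (cases x; cases y) (auto simp: rows_def flip_def)

lemma permutation_halves:
 assumes f: "f permutes rows (Suc K)"
 shows "\<exists>c g. (\<forall>b. g b permutes rows K) \<and>
   (\<forall>x\<in>rows (Suc K). c (flip 0 x) = (\<not> c x) \<and> g (c x) (tl x) = tl (f x))"
proof -
 let ?X = "rows (Suc K)"
 obtain c where c: "\<And>x. x \<in> ?X ==> c (flip 0 x) = (\<not> c x)"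
  "\<And>x y. x \<in> ?X ==> y \<in> ?X ==> f y = flip 0 (f x) ==> c y = (\<not> c x)"
  using row_coloring[OF f] by blast
 define pick where "pick b xs = (if c (False # xs) = b then False # xs else True # xs)" for b xs
 have pick: "pick b xs \<in> ?X" "c (pick b xs) = b" "tl (pick b xs) = xs" if "xs \<in> rows K" for b xs
  using that c(1)[of "False # xs"] by (auto simp: pick_def rows_def flip_def)
 have pick_tl: "pick (c x) (tl x) = x" if "x \<in> ?X" for x
  using that c(1)[of "False # tl x"] by (cases x; cases "hd x") (auto simp: pick_def rows_def flip_def)
 define g where "g b xs = (if xs \<in> rows K then tl (f (pick b xs)) else xs)" for b xs
 have fX: "f x \<in> ?X" if "x \<in> ?X" for x using that permutes_in_image[OF f] by simp
 have "g b permutes rows K" for b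
 proof (rule permutes_of_inj[OF finite_rows])
  show "g b ` rows K \<subseteq> rows K" using fX[OF pick(1), of _ b] by (auto simp: g_def rows_def)
  show "inj_on (g b) (rows K)"
  proof (rule inj_onI)
   fix xs ys assume xs: "xs \<in> rows K" and ys: "ys \<in> rows K" and "g b xs = g b ys"
   then have "tl (f (pick b xs)) = tl (f (pick b ys))" by (simp add: g_def)
   from row_eq_or_flip[OF fX[OF pick(1)[OF xs]] fX[OF pick(1)[OF ys]] this]
   have "f (pick b ys) = f (pick b xs) \<or> f (pick b ys) = flip 0 (f (pick b xs))" .
   moreover have "f (pick b ys) \<noteq> flip 0 (f (pick b xs))"
    using c(2)[OF pick(1)[OF xs] pick(1)[OF ys], of b b] pick(2)[OF xs, of b] pick(2)[OF ys, of b] by auto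
   ultimately have "f (pick b ys) = f (pick b xs)" by blast
   then have "pick b ys = pick b xs" by (rule injD[OF permutes_inj[OF f]])
   then show "xs = ys" using pick(3)[OF xs, of b] pick(3)[OF ys, of b] by simp
  qed
 qed (simp add: g_def)
 moreover have "g (c x) (tl x) = tl (f x)" if "x \<in> ?X" for x
  using that by (simp add: g_def pick_tl) (simp add: rows_def)
 ultimately show ?thesis using c(1) by blast
qed

theorem benes: "f permutes rows K ==> routes (dims K) f"
proof (induction K arbitrary: f)
 case 0
 then have "f x = x" for x using permutes_in_image[OF 0, of "[]"] permutes_not_in[OF 0] by (cases x) (auto simp: rows_def)
 then show ?case by auto
next
 case (Suc K)
 let ?X = "rows (Suc K)"
 obtain c g where c: "\<And>x. x \<in> ?X ==> c (flip 0 x) = (\<not> c x)" and g: "\<And>b. g b permutes rows K"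
  and gc: "\<And>x. x \<in> ?X ==> g (c x) (tl x) = tl (f x)"
  using permutation_halves[OF Suc.prems] by blast
 define h where "h x = (if x \<in> ?X then c x # tl x else x)" for x
 let ?L = "lift_fn g \<circ> h"
 have L: "?L = (%x. if x \<in> ?X then c x # tl (f x) else x)"
 proof
  fix x show "?L x = (if x \<in> ?X then c x # tl (f x) else x)"
   using gc[of x] permutes_not_in[OF g, of "tl x"] by (cases x) (auto simp: h_def rows_def)
 qed
 have fX: "f x \<in> ?X" if "x \<in> ?X" for x using that permutes_in_image[OF Suc.prems] by simp
 have L_perm: "?L permutes ?X"
 proof (rule permutes_of_inj[OF finite_rows])
  show "inj_on ?L ?X"
  proof (rule inj_onI)
   fix x y assume x: "x \<in> ?X" and y: "y \<in> ?X" and "?L x = ?L y"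
   then have "c x = c y" "tl (f x) = tl (f y)" unfolding L by auto
   then have "g (c x) (tl x) = g (c x) (tl y)" using gc[OF x] gc[OF y] by simp
   then have "tl x = tl y" by (rule injD[OF permutes_inj[OF g]])
   from row_eq_or_flip[OF x y this] show "x = y" using c[OF x] \<open>c x = c y\<close> by auto
  qed
  show "?L ` ?X \<subseteq> ?X" unfolding L using fX by (auto simp: rows_def)
 qed (simp add: L del: comp_apply)
 have in_layer: "layer 0 h" unfolding layer_def
 proof
  fix x show "h x = x \<or> h x = flip 0 x" by (cases x) (auto simp: h_def flip_def rows_def)
 qed
 have out_layer: "layer 0 (f \<circ> inv ?L)"
  unfolding layer_def
 proof
  fix y
  obtain x where y: "y = ?L x" using permutes_surj[OF L_perm] by blast
  have "(f \<circ> inv ?L) y = f x" using permutes_inverses(2)[OF L_perm] by (simp add: y)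
  moreover have "f x = y \<or> f x = flip 0 y"
  proof (cases "x \<in> ?X")
   case True
   then have "y = c x # tl (f x)" unfolding y L by simp
   then show ?thesis using fX[OF True] row_eq_or_flip[of y K "f x"] by (auto simp: rows_def)
  next
   case False
   then have "y = x" unfolding y L by simp
   then show ?thesis using permutes_not_in[OF Suc.prems False] by simp
  qed
  ultimately show "(f \<circ> inv ?L) y = y \<or> (f \<circ> inv ?L) y = flip 0 y" by simp
 qed
 have "routes (map Suc (dims K)) (lift_fn g)" using Suc.IH[OF g] by (rule routes_lift)
 then have "routes (map Suc (dims K) @ [0]) ?L" using in_layer unfolding routes_append by force
 moreover have "f = (f \<circ> inv ?L) \<circ> ?L" using permutes_inv_o(2)[OF L_perm] by (simp add: comp_assoc)
 ultimately show ?case using out_layer unfolding dims.simps routes.simps by blast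
qed

section \<open>Computations as locally checkable tables\<close>

definition rnum :: "bits => nat" where
 "rnum xs = bval (rev xs)"

definition row :: "nat => nat => bits" where
 "row K i = rev (map (bit i) [0..<K])"

lemma bval_horner: "bval bs = horner_sum of_bool 2 bs"
 by (induction bs) auto

lemma length_row [simp]: "length (row K i) = K"
 by (simp add: row_def)

lemma row_in [simp]: "row K i \<in> rows K"
 by (simp add: rows_def)

lemma row_0: "p < K ==> row K 0 ! p = False"
 by (simp add: row_def rev_nth)

lemma rnum_row: "i < 2 ^ K ==> rnum (row K i) = i"
 by (simp add: rnum_def row_def bval_horner horner_sum_bit_eq_take_bit take_bit_nat_eq_self)

lemma rnum_less: "xs \<in> rows K ==> rnum xs < 2 ^ K"
 using bval_less[of "rev xs"] by (simp add: rnum_def rows_def)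

lemma bval_inj:
 assumes "length xs = length ys" "bval xs = bval ys"
 shows "xs = ys"
proof (rule nth_equalityI[OF assms(1)])
 fix i assume "i < length xs"
 then show "xs ! i = ys ! i"
  using bit_horner_sum_bit_iff[where 'a = nat, of xs i] bit_horner_sum_bit_iff[where 'a = nat, of ys i] assms
  by (simp add: bval_horner)
qed

lemma rnum_inj: "xs \<in> rows K ==> ys \<in> rows K ==> rnum xs = rnum ys ==> xs = ys"
 using bval_inj[of "rev xs" "rev ys"] by (auto simp: rnum_def rows_def)

lemma row_rnum: "xs \<in> rows K ==> row K (rnum xs) = xs"
 by (rule rnum_inj[of _ K]) (auto simp: rnum_row rnum_less)

lemma row_inj: "i < 2 ^ K ==> j < 2 ^ K ==> row K i = row K j ==> i = j"
 by (metis rnum_row)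

lemma row_eq_0:
 assumes "i < 2 ^ K" "\<forall>k<K. \<not> row K i ! k"
 shows "i = 0"
proof -
 have "row K i = row K 0" by (rule nth_equalityI) (use assms(2) in \<open>auto simp: row_0\<close>)
 then show ?thesis using row_inj[OF assms(1), of 0] by simp
qed

lemma bval_replicate: "bval (replicate k True) + 1 = 2 ^ k" "bval (replicate k False) = 0"
 by (induction k) auto

lemma rnum_succ_form:
 "rnum (pre @ True # replicate k False) = rnum (pre @ False # replicate k True) + 1"
 using bval_replicate[of k] by (simp add: rnum_def bval_append)

lemma rnum_succ_ex:
 assumes "xs \<in> rows K" "rnum xs + 1 < 2 ^ K"
 obtains pre k where "xs = pre @ False # replicate k True"
proof -
 have "False \<in> set xs"
 proof (rule ccontr)
  assume "False \<notin> set xs"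
  then have "xs = replicate K True" 
   using assms(1) by (intro replicate_eqI) (auto simp: rows_def intro: ccontr)
  then show False using assms(2) bval_replicate(1)[of K] by (simp add: rnum_def)
 qed
 then obtain pre post where xs: "xs = pre @ False # post" and post: "False \<notin> set post" by (meson split_list_last)
 have "\<And>b. b \<in> set post ==> b = True" using post by metis
 then have "post = replicate (length post) True" by (rule replicate_eqI[OF refl])
 then show thesis using that[of pre "length post"] xs by argo
qed

definition num_of :: "nat => (nat => bool) => nat" where
 "num_of K b = rnum (map b [0..<K])"

lemma num_of_cong: "(\<And>p. p < K ==> b p = b' p) ==> num_of K b = num_of K b'"
 unfolding num_of_def by (rule arg_cong[of _ _ rnum]) (rule map_cong, auto)

lemma num_of_nth: "x \<in> rows K ==> num_of K ((!) x) = rnum x"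
 unfolding num_of_def rows_def using map_nth[of x] by simp

lemma num_of_row: "n < 2 ^ K ==> num_of K ((!) (row K n)) = n"
 by (simp add: num_of_nth rnum_row)

lemma num_of_less_lex:
 assumes "p < K" "\<And>k. k < p ==> a k = b k" "\<not> a p" "b p"
 shows "num_of K a < num_of K b"
proof -
 have upt: "[0..<K] = [0..<p] @ p # [Suc p..<K]" 
  using upt_add_eq_append[of 0 p "K - p"] upt_conv_Cons[of p K] assms(1) by simp
 have prefix: "map a [0..<p] = map b [0..<p]" using assms(2) by simp
 have lex: "rnum (xs @ False # ys) < rnum (xs @ True # zs)" if "length ys = length zs" for xs ys zs
  using bval_less[of "rev ys"] that by (simp add: rnum_def bval_append)
 show ?thesis unfolding num_of_def upt map_append list.map prefix using assms(3,4) by (simp add: lex)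
qed

text \<open>Comparison of binary numbers from the most significant bit on: \<open>e p\<close> says that the first \<open>p\<close> bits agree.\<close>

definition compares :: "nat => (nat => bool) => (nat => bool) => (nat => bool) => bool" where
 "compares K a b e \<longleftrightarrow> e 0 \<and> \<not> e K \<and> (\<forall>p<K. (e p \<and> a p --> b p) \<and> (e p \<and> a p = b p --> e (Suc p)))"

lemma compares_less:
 assumes "compares K a b e"
 shows "num_of K a < num_of K b"
proof -
 note e = assms[unfolded compares_def]
 have agree: "p \<le> K ==> \<forall>k<p. a k = b k ==> e p" for p
 proof (induction p)
  case 0
  then show ?case using e by blast
 next
  case (Suc p)
  then have "p < K" "e p" "a p = b p" by auto
  then show ?case using e by blast
 qed
 define p where "p = (LEAST p. a p \<noteq> b p)"
 have "\<exists>k<K. a k \<noteq> b k" using agree[of K] e by blast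
 then obtain k where k: "k < K" "a k \<noteq> b k" by blast
 have differ: "a p \<noteq> b p" unfolding p_def using LeastI[of "%p. a p \<noteq> b p", OF k(2)] .
 have "p < K" unfolding p_def using Least_le[of "%p. a p \<noteq> b p", OF k(2)] k(1) by linarith
 have prefix: "\<And>k. k < p ==> a k = b k" unfolding p_def using not_less_Least by blast
 have "e p" using agree[of p] \<open>p < K\<close> prefix by simp
 then have "\<not> a p" "b p" using e \<open>p < K\<close> differ by blast+
 show ?thesis by (rule num_of_less_lex[of p]) fact+
qed

lemma less_compares:
 assumes "num_of K a < num_of K b"
 shows "compares K a b (%p. \<forall>k<p. a k = b k)"
proof -
 have "\<not> (\<forall>k<K. a k = b k)" using num_of_cong[of K a b] assms by auto
 moreover have "b p" if "p < K" "\<forall>k<p. a k = b k" "a p" for p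
 proof (rule ccontr)
  assume "\<not> b p"
  then have "num_of K b < num_of K a" by (intro num_of_less_lex[OF that(1)]) (use that in auto)
  then show False using assms by simp
 qed
 ultimately show ?thesis unfolding compares_def All_less_Suc by blast
qed

subsection \<open>Patterns and relations between rows\<close>

text \<open>A symbol \<open>(True, b)\<close> of a pattern is the constant \<open>b\<close>, \<open>(False, _)\<close> is a wildcard.\<close>

type_synonym pattern = "(bool \<times> bool) list"

definition inst :: "pattern => bits => bits" where
 "inst \<pi> y = map2 (%(fixed, b) z. if fixed then b else z) \<pi> y"

definition stars :: "nat => pattern" where
 "stars n = replicate n (False, False)"

definition const_pat :: "bits => pattern" where
 "const_pat bs = map (%b. (True, b)) bs"

lemma length_stars [simp]: "length (stars n) = n" and length_const_pat [simp]: "length (const_pat bs) = length bs"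
 by (simp_all add: stars_def const_pat_def)

lemma inst_append: "length \<pi> = length y ==> inst (\<pi> @ \<pi>') (y @ y') = inst \<pi> y @ inst \<pi>' y'"
 by (simp add: inst_def)

lemma inst_Cons: "inst ((fixed, b) # \<pi>) (z # y) = (if fixed then b else z) # inst \<pi> y"
 by (simp add: inst_def)

lemma inst_stars: "length y = n ==> inst (stars n) y = y"
 by (rule nth_equalityI) (auto simp: inst_def stars_def)

lemma inst_const_pat: "length y = length bs ==> inst (const_pat bs) y = bs"
 by (rule nth_equalityI) (auto simp: inst_def const_pat_def)

lemma length_inst: "length \<pi> = length y ==> length (inst \<pi> y) = length y"
 by (simp add: inst_def)

type_synonym shape = "pattern \<times> pattern"

definition shape_rel :: "nat => shape list => (bits \<times> bits) set" where
 "shape_rel K S = (\<Union>(\<pi>, \<pi>')\<in>set S. (%y. (inst \<pi> y, inst \<pi>' y)) ` rows K)"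

definition allS :: "nat => shape list" where
 "allS K = [(stars K, stars K)]"

definition constS :: "bits => shape list" where
 "constS bs = [(const_pat bs, const_pat bs)]"

definition bit_pat :: "nat => nat => bool => pattern" where
 "bit_pat K p b = stars p @ (True, b) # stars (K - p - 1)"

definition bitS :: "nat => nat => bool => shape list" where
 "bitS K p b = [(bit_pat K p b, bit_pat K p b)]"

definition flipS :: "nat => nat => shape list" where
 "flipS K d = [(bit_pat K d False, bit_pat K d True), (bit_pat K d True, bit_pat K d False)]"

definition tail_pat :: "nat => bits => pattern" where
 "tail_pat K bs = stars (K - length bs) @ const_pat bs"

definition stepS :: "nat => shape list" where
 "stepS K = map (%k. (tail_pat K (False # replicate k True), tail_pat K (True # replicate k False))) [0..<K]"

lemma inst_bit_pat:
 assumes "y \<in> rows K" "p < K"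
 shows "inst (bit_pat K p b) y = y[p := b]"
proof -
 have len: "length y = K" using assms(1) by (simp add: rows_def)
 then have "y = take p y @ y ! p # drop (Suc p) y" using id_take_nth_drop assms(2) by blast
 then have "inst (bit_pat K p b) y = inst (bit_pat K p b) (take p y @ y ! p # drop (Suc p) y)" by simp
 also have "\<dots> = take p y @ b # drop (Suc p) y"
  unfolding bit_pat_def using len assms(2) by (subst inst_append) (auto simp: inst_Cons inst_stars)
 also have "\<dots> = y[p := b]" using upd_conv_take_nth_drop[of p y b] len assms(2) by simp
 finally show ?thesis .
qed

lemma inst_tail_pat:
 assumes "y \<in> rows K" "length bs \<le> K"
 shows "inst (tail_pat K bs) y = take (K - length bs) y @ bs"
proof -
 have "inst (tail_pat K bs) (take (K - length bs) y @ drop (K - length bs) y) = take (K - length bs) y @ bs"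
  unfolding tail_pat_def using assms by (subst inst_append) (auto simp: rows_def inst_stars inst_const_pat)
 then show ?thesis by simp
qed

lemma shape_rel_allS: "shape_rel K (allS K) = {(x, x) | x. x \<in> rows K}"
proof -
 have "(inst (stars K) y, inst (stars K) y) = (y, y)" if "y \<in> rows K" for y using that by (simp add: rows_def inst_stars)
 then show ?thesis unfolding shape_rel_def allS_def by (auto cong: image_cong)
qed

lemma shape_rel_constS:
 assumes "length bs = K"
 shows "shape_rel K (constS bs) = {(bs, bs)}"
proof -
 have "inst (const_pat bs) y = bs" if "y \<in> rows K" for y using that assms by (simp add: rows_def inst_const_pat)
 moreover have "bs \<in> rows K" using assms by (simp add: rows_def)
 ultimately show ?thesis unfolding shape_rel_def constS_def by force
qed

lemma shape_rel_bitS: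
 assumes "p < K"
 shows "shape_rel K (bitS K p b) = {(x, x) | x. x \<in> rows K \<and> x ! p = b}"
proof -
 have rel: "shape_rel K (bitS K p b) = (%y. (y[p := b], y[p := b])) ` rows K"
  unfolding shape_rel_def bitS_def by (simp add: inst_bit_pat[OF _ assms] cong: image_cong)
 show ?thesis
 proof (intro equalityI subsetI)
  fix z assume "z \<in> shape_rel K (bitS K p b)"
  then obtain y where "y \<in> rows K" "z = (y[p := b], y[p := b])" unfolding rel by blast
  then show "z \<in> {(x, x) | x. x \<in> rows K \<and> x ! p = b}" using assms by (simp add: rows_def)
 next
  fix z assume "z \<in> {(x, x) | x. x \<in> rows K \<and> x ! p = b}"
  then obtain x where x: "x \<in> rows K" "z = (x, x)" "x ! p = b" by blast
  then have "z = (x[p := b], x[p := b])" using list_update_id[of x p] by simp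
  then show "z \<in> shape_rel K (bitS K p b)" unfolding rel using x(1) by blast
 qed
qed

lemma shape_rel_flipS:
 assumes "d < K"
 shows "shape_rel K (flipS K d) = {(x, flip d x) | x. x \<in> rows K}"
proof -
 have rel: "shape_rel K (flipS K d) = (\<Union>b. (%y. (y[d := b], y[d := \<not> b])) ` rows K)"
  unfolding shape_rel_def flipS_def UNIV_bool by (simp add: inst_bit_pat[OF _ assms] cong: image_cong)
 show ?thesis
 proof (intro equalityI subsetI)
  fix z assume "z \<in> shape_rel K (flipS K d)"
  then obtain b y where "y \<in> rows K" "z = (y[d := b], y[d := \<not> b])" unfolding rel by blast
  then show "z \<in> {(x, flip d x) | x. x \<in> rows K}" using assms by (simp add: rows_def flip_def)
 next
  fix z assume "z \<in> {(x, flip d x) | x. x \<in> rows K}"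
  then obtain x where x: "x \<in> rows K" "z = (x[d := x ! d], x[d := \<not> x ! d])" by (auto simp: flip_def)
  then show "z \<in> shape_rel K (flipS K d)" unfolding rel by blast
 qed
qed

lemma shape_rel_stepS: "shape_rel K (stepS K) = {(x, y). x \<in> rows K \<and> y \<in> rows K \<and> rnum y = rnum x + 1}"
proof (intro equalityI subsetI)
 fix z assume "z \<in> shape_rel K (stepS K)"
 then obtain k y where k: "k < K" and y: "y \<in> rows K"
  and z: "z = (inst (tail_pat K (False # replicate k True)) y, inst (tail_pat K (True # replicate k False)) y)"
  unfolding shape_rel_def stepS_def by auto
 have "z = (take (K - Suc k) y @ False # replicate k True, take (K - Suc k) y @ True # replicate k False)"
  unfolding z using inst_tail_pat[OF y] k by simp
 then show "z \<in> {(x, y). x \<in> rows K \<and> y \<in> rows K \<and> rnum y = rnum x + 1}"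
  using k y by (auto simp: rnum_succ_form rows_def)
next
 fix z assume "z \<in> {(x, y). x \<in> rows K \<and> y \<in> rows K \<and> rnum y = rnum x + 1}"
 then obtain x y where z: "z = (x, y)" and x: "x \<in> rows K" and y: "y \<in> rows K" and num: "rnum y = rnum x + 1" by auto
 then obtain pre k where pre: "x = pre @ False # replicate k True" using rnum_succ_ex[of x K] rnum_less[of y K] by auto
 have len: "length pre + k + 1 = K" using pre x by (simp add: rows_def)
 have y_eq: "y = pre @ True # replicate k False"
  by (rule rnum_inj[OF y]) (use len num pre rnum_succ_form[of pre k] in \<open>auto simp: rows_def\<close>)
 have "take (K - Suc k) x = pre" using len by (simp add: pre)
 then have "inst (tail_pat K (False # replicate k True)) x = x" "inst (tail_pat K (True # replicate k False)) x = y"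
  using inst_tail_pat[OF x] len by (simp_all add: y_eq) (simp add: pre)
 moreover have "(tail_pat K (False # replicate k True), tail_pat K (True # replicate k False)) \<in> set (stepS K)"
  using len by (simp add: stepS_def)
 ultimately show "z \<in> shape_rel K (stepS K)" unfolding shape_rel_def z using x by force
qed

subsection \<open>Constraints on pairs of rows\<close>

type_synonym tag = "nat \<times> nat \<times> nat \<times> nat"

definition tag_code :: "nat => tag => bits" where
 "tag_code n = (%(a, b, c, d). let s = replicate a True @ False # replicate b True @ False #
   replicate c True @ False # replicate d True @ [False] in s @ replicate (n - length s) False)"

definition tag_weight :: "tag => nat" where
 "tag_weight = (%(a, b, c, d). a + b + c + d + 4)"

lemma length_tag_code: "tag_weight t \<le> n ==> length (tag_code n t) = n"
 by (cases t) (simp add: tag_code_def tag_weight_def Let_def)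

lemma unary_split: "replicate a True @ False # xs = replicate b True @ False # ys ==> a = b \<and> xs = ys"
proof (induction a arbitrary: b)
 case 0
 then show ?case by (cases b) auto
next
 case (Suc a)
 then show ?case by (cases b) auto
qed

lemma tag_code_inj: "tag_code n t = tag_code n t' ==> t = t'"
 by (cases t; cases t') (auto simp: tag_code_def Let_def dest!: unary_split)

abbreviation (input) "IX p \<equiv> (0::nat, p::nat, 0::nat, 0::nat)"
abbreviation (input) "PC l \<equiv> (1::nat, l::nat, 0::nat, 0::nat)"
abbreviation (input) "REG r p \<equiv> (2::nat, r::nat, p::nat, 0::nat)"
abbreviation (input) "CR \<equiv> (3::nat, 0::nat, 0::nat, 0::nat)"
abbreviation (input) "REC l f p \<equiv> (4::nat, l::nat, f::nat, p::nat)"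
abbreviation (input) "SW l \<equiv> (5::nat, l::nat, 0::nat, 0::nat)"
abbreviation (input) "EQ p \<equiv> (6::nat, p::nat, 0::nat, 0::nat)"
abbreviation (input) "ZR p \<equiv> (7::nat, p::nat, 0::nat, 0::nat)"
abbreviation (input) "GS \<equiv> (8::nat, 0::nat, 0::nat, 0::nat)"

text \<open>A literal \<open>(r, t, s)\<close> says that the entry \<open>t\<close> of the first or second row has value \<open>s\<close>.\<close>

type_synonym clit = "bool \<times> tag \<times> bool"

definition holds :: "(bits => tag => bool) => bits => bits => clit list => bool" where
 "holds w x y cl \<longleftrightarrow> (\<exists>(r, t, s)\<in>set cl. w (if r then y else x) t = s)"

lemma holds_Cons [simp]: "holds w x y ((r, t, s) # cl) \<longleftrightarrow> w (if r then y else x) t = s \<or> holds w x y cl"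
 and holds_Nil [simp]: "holds w x y [] \<longleftrightarrow> False"
 by (auto simp: holds_def)

definition eq_cls :: "clit list => bool \<times> tag => bool \<times> tag => clit list list" where
 "eq_cls c = (%(ra, ta) (rb, tb). [(ra, ta, False) # (rb, tb, True) # c, (ra, ta, True) # (rb, tb, False) # c])"

lemma eq_cls_holds: "(\<forall>cl\<in>set (eq_cls c (ra, ta) (rb, tb)). holds w x y cl) \<longleftrightarrow>
  holds w x y c \<or> w (if ra then y else x) ta = w (if rb then y else x) tb"
 by (auto simp: eq_cls_def)

type_synonym icode = "nat \<times> nat \<times> nat \<times> nat"

definition keep_cls :: "nat => nat => nat => clit list list" where
 "keep_cls K l r = concat (map (%p. concat (map (%r'. eq_cls [(False, PC l, False)] (False, REG r' p) (True, REG r' p))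
   (filter (%r'. r' \<noteq> r) [0..<4]))) [0..<K])"

definition next_cls :: "nat => clit list list" where
 "next_cls l = [[(False, PC l, False), (True, PC (Suc l), True)]]"

definition read_cls :: "nat => nat => nat => nat => nat => clit list list" where
 "read_cls K l r s f = (let n = (False, PC l, False) in next_cls l @ keep_cls K l r @ [[n, (False, CR, False)]] @
   concat (map (%p. eq_cls [n] (False, REC 0 0 p) (False, REG s p) @ eq_cls [n] (True, REG r p) (False, REC 0 f p)) [0..<K]))"

definition instr_cls :: "nat => nat => icode => clit list list" where
 "instr_cls K l = (%(op, r, s, u). let n = (False, PC l, False) in
  if op = 0 then next_cls l @ keep_cls K l r @ map (%p. [n, (True, REG r p, False)]) [0..<K]
  else if op = 1 then next_cls l @ keep_cls K l r @ concat (map (%p. eq_cls [n] (False, REC 0 2 p) (False, REG s p) @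
   eq_cls [n] (False, REC 0 3 p) (False, REG u p) @ eq_cls [n] (True, REG r p) (False, IX p)) [0..<K])
  else if op = 2 then read_cls K l r s 2
  else if op = 3 then read_cls K l r s 3
  else if op = 4 then keep_cls K l 4 @ map (%p. [n, (False, REG r p, False), (True, PC (Suc l), True)]) [0..<K] @
   map (%p. [n, (False, ZR p, False), (False, REG r p, True), (False, ZR (Suc p), True)]) [0..<K] @
   [[n, (False, ZR K, False), (True, PC s, True)]]
  else next_cls l @ keep_cls K l r @ concat (map (%p. [[n, (False, REC 0 2 p, False)], [n, (False, REC 0 3 p, False)],
   [n, (True, REG r p, False), (False, GS, True)], [n, (True, REG r p, False), (False, IX p, True)],
   [n, (False, GS, False), (False, IX p, False), (True, REG r p, True)]]) [0..<K]))"

fun icode_of :: "tinstr => icode" where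
 "icode_of (TNil r) = (0, r, 0, 0)"
| "icode_of (TCons r s u) = (1, r, s, u)"
| "icode_of (TCar r s) = (2, r, s, 0)"
| "icode_of (TCdr r s) = (3, r, s, 0)"
| "icode_of (TJumpLf r l) = (4, r, l, 0)"
| "icode_of (TNext r) = (5, r, 0, 0)"
| "icode_of _ = (0, 0, 0, 0)"

definition keep :: "nat => (bits => tag => bool) => bits => bits => nat => bool" where
 "keep K w x y r \<longleftrightarrow> (\<forall>p<K. \<forall>r'<4. r' \<noteq> r --> w x (REG r' p) = w y (REG r' p))"

definition read_ok :: "nat => (bits => tag => bool) => nat => nat => nat => nat => bits => bits => bool" where
 "read_ok K w l r s f x y \<longleftrightarrow> w y (PC (Suc l)) \<and> keep K w x y r \<and> \<not> w x CR \<and>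
   (\<forall>p<K. w x (REC 0 0 p) = w x (REG s p) \<and> w y (REG r p) = w x (REC 0 f p))"

fun instr_ok :: "nat => (bits => tag => bool) => nat => tinstr => bits => bits => bool" where
 "instr_ok K w l (TNil r) x y \<longleftrightarrow> w y (PC (Suc l)) \<and> keep K w x y r \<and> (\<forall>p<K. \<not> w y (REG r p))"
| "instr_ok K w l (TCons r s u) x y \<longleftrightarrow> w y (PC (Suc l)) \<and> keep K w x y r \<and>
   (\<forall>p<K. w x (REC 0 2 p) = w x (REG s p) \<and> w x (REC 0 3 p) = w x (REG u p) \<and> w y (REG r p) = w x (IX p))"
| "instr_ok K w l (TCar r s) x y \<longleftrightarrow> read_ok K w l r s 2 x y"
| "instr_ok K w l (TCdr r s) x y \<longleftrightarrow> read_ok K w l r s 3 x y"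
| "instr_ok K w l (TJumpLf r l') x y \<longleftrightarrow> keep K w x y 4 \<and> (\<forall>p<K. w x (REG r p) --> w y (PC (Suc l))) \<and>
   (\<forall>p<K. w x (ZR p) \<and> \<not> w x (REG r p) --> w x (ZR (Suc p))) \<and> (w x (ZR K) --> w y (PC l'))"
| "instr_ok K w l (TNext r) x y \<longleftrightarrow> w y (PC (Suc l)) \<and> keep K w x y r \<and>
   (\<forall>p<K. \<not> w x (REC 0 2 p) \<and> \<not> w x (REC 0 3 p) \<and> w y (REG r p) = (w x GS \<and> w x (IX p)))"
| "instr_ok K w l _ x y \<longleftrightarrow> False"

definition tplain :: "tinstr => bool" where
 "tplain c = (case c of TEof r => False | TEmit r => False | TAsk r => False | _ => True)"

lemma ball_concat_map: "(\<forall>c\<in>set (concat (map f xs)). Q c) \<longleftrightarrow> (\<forall>x\<in>set xs. \<forall>c\<in>set (f x). Q c)"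
 by auto

lemma keep_cls_holds: "(\<forall>cl\<in>set (keep_cls K l r). holds w x y cl) \<longleftrightarrow> \<not> w x (PC l) \<or> keep K w x y r"
 unfolding keep_cls_def keep_def by (simp add: ball_concat_map eq_cls_holds del: set_concat) auto

lemma read_cls_holds: "(\<forall>cl\<in>set (read_cls K l r s f). holds w x y cl) \<longleftrightarrow> (w x (PC l) --> read_ok K w l r s f x y)"
 unfolding read_cls_def read_ok_def
 by (simp add: Let_def next_cls_def ball_Un keep_cls_holds ball_concat_map eq_cls_holds del: set_concat) auto

lemma instr_cls_holds:
 assumes "tplain c"
 shows "(\<forall>cl\<in>set (instr_cls K l (icode_of c)). holds w x y cl) \<longleftrightarrow> (w x (PC l) --> instr_ok K w l c x y)"
proof -
 note simps = instr_cls_def Let_def next_cls_def ball_Un keep_cls_holds ball_concat_map eq_cls_holds read_cls_holds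
 show ?thesis
 proof (cases c)
  case (TNil r)
  then show ?thesis by (simp add: simps) auto
 next
  case (TCons r s u)
  then show ?thesis by (simp add: simps del: set_concat) auto
 next
  case (TJumpLf r l)
  then show ?thesis by (simp add: simps) auto
 next
  case (TNext r)
  then show ?thesis by (simp add: simps del: set_concat) auto
 qed (use assms in \<open>auto simp: tplain_def simps\<close>)
qed

text \<open>A record has the fields 0 address, 1 time, 2 head, 3 tail. The network brings to a row that reads a cell
 the record of the previous row with the same address; its time is compared bit by bit with the current time.\<close>

definition row_ok :: "nat => nat => (bits => tag => bool) => bits => bool" where
 "row_ok K rej w x \<longleftrightarrow> w x (ZR 0) \<and> \<not> w x (PC rej) \<and>
   (\<forall>p<K. w x (REC 0 1 p) = w x (IX p) \<and> (w x CR --> w x (REC 0 0 p) = w x (IX p))) \<and>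
   (\<not> w x CR --> compares K (%p. w x (REC (2 * K) 1 p)) (%p. w x (IX p)) (%p. w x (EQ p)) \<and>
    (\<forall>f\<in>{0, 2, 3}. \<forall>p<K. w x (REC (2 * K) f p) = w x (REC 0 f p)))"

definition network_ok :: "nat => (bits => tag => bool) => bool" where
 "network_ok K w \<longleftrightarrow> (\<forall>l<2 * K. \<forall>x\<in>rows K. \<forall>f<4. \<forall>p<K. w x (REC (Suc l) f p) =
   (if w x (SW l) then w (flip (dims K ! l) x) (REC l f p) else w x (REC l f p)))"

definition start_ok :: "nat => (bits => tag => bool) => bool" where
 "start_ok K w \<longleftrightarrow> w (row K 1) (PC 0) \<and> (\<forall>r<4. \<forall>p<K. \<not> w (row K 1) (REG r p)) \<and>
   (\<forall>p<K. \<not> w (row K 0) (REC 0 2 p) \<and> \<not> w (row K 0) (REC 0 3 p))"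

definition table_ok :: "nat => tinstr list => nat => (bits => tag => bool) => bool" where
 "table_ok K Pg rej w \<longleftrightarrow> (\<forall>x\<in>rows K. \<forall>p<K. w x (IX p) = x ! p) \<and> start_ok K w \<and>
   (\<forall>x\<in>rows K. row_ok K rej w x) \<and> network_ok K w \<and>
   (\<forall>x\<in>rows K. \<forall>y\<in>rows K. rnum y = Suc (rnum x) --> (\<forall>l<length Pg. w x (PC l) --> instr_ok K w l (Pg ! l) x y))"

subsection \<open>Soundness\<close>

lemma network_source:
 assumes "network_ok K w"
 shows "x \<in> rows K ==> l \<le> 2 * K ==> \<exists>z\<in>rows K. \<forall>f<4. \<forall>p<K. w x (REC l f p) = w z (REC 0 f p)"
proof (induction l arbitrary: x)
 case (Suc l)
 let ?y = "if w x (SW l) then flip (dims K ! l) x else x"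
 have "?y \<in> rows K" using Suc.prems(1) flip_rows by simp
 then obtain z where z: "z \<in> rows K" "\<forall>f<4. \<forall>p<K. w ?y (REC l f p) = w z (REC 0 f p)"
  using Suc.IH[of ?y] Suc.prems(2) by auto
 have "\<forall>f<4. \<forall>p<K. w x (REC (Suc l) f p) = w ?y (REC l f p)"
  using assms Suc.prems unfolding network_ok_def by auto
 then show ?case using z by auto
qed auto

definition cell_addr :: "nat => (bits => tag => bool) => bits => nat" where
 "cell_addr K w x = num_of K (%p. w x (REC 0 0 p))"

definition good_cell :: "nat => (bits => tag => bool) => (nat => nat) => (nat => nat) => nat => bool" where
 "good_cell K w h t p \<longleftrightarrow> (\<forall>k<K. w (row K p) (REC 0 2 k) = row K (h p) ! k \<and> w (row K p) (REC 0 3 k) = row K (t p) ! k)"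

definition table_inv :: "nat => (bits => tag => bool) => nat => nat => (nat => nat) => (nat => nat) => (nat => nat) => bool" where
 "table_inv K w i pc R h t \<longleftrightarrow> w (row K i) (PC pc) \<and> (\<forall>r<4. \<forall>p<K. w (row K i) (REG r p) = row K (R r) ! p) \<and>
   (\<forall>r. good_cell K w h t (R r)) \<and> (\<forall>p. good_cell K w h t (h p) \<and> good_cell K w h t (t p))"

lemma good_cell_upd: "p \<noteq> i ==> good_cell K w (h(i := a)) (t(i := b)) p \<longleftrightarrow> good_cell K w h t p"
 by (simp add: good_cell_def)

context
 fixes K Pg rej w
 assumes table: "table_ok K Pg rej w"
begin

lemma table_index: "x \<in> rows K ==> p < K ==> w x (IX p) = x ! p"
 using table unfolding table_ok_def by blast

lemma table_row: "x \<in> rows K ==> row_ok K rej w x"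
 using table unfolding table_ok_def by blast

lemma table_not_rej: "\<not> w (row K i) (PC rej)"
 using table_row[of "row K i"] unfolding row_ok_def by simp

lemma table_source:
 assumes x: "x \<in> rows K" "\<not> w x CR"
 shows "\<exists>z\<in>rows K. rnum z < rnum x \<and> (\<forall>f\<in>{0, 2, 3}. \<forall>p<K. w x (REC 0 f p) = w z (REC 0 f p))"
proof -
 have "network_ok K w" using table unfolding table_ok_def by blast
 then obtain z where z: "z \<in> rows K" and rec: "\<And>f p. f < 4 ==> p < K ==> w x (REC (2 * K) f p) = w z (REC 0 f p)"
  using network_source[OF _ x(1)] by blast
 note row_x = table_row[OF x(1), unfolded row_ok_def] and row_z = table_row[OF z, unfolded row_ok_def]
 have "num_of K (%p. w x (REC (2 * K) 1 p)) = num_of K ((!) z)"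
  by (rule num_of_cong) (use rec[of 1] row_z table_index[OF z] in auto)
 moreover have "num_of K (%p. w x (IX p)) = num_of K ((!) x)"
  by (rule num_of_cong) (rule table_index[OF x(1)])
 moreover have "compares K (%p. w x (REC (2 * K) 1 p)) (%p. w x (IX p)) (%p. w x (EQ p))" using row_x x(2) by blast
 ultimately have "rnum z < rnum x" using compares_less num_of_nth x(1) z by metis
 moreover have "\<forall>f\<in>{0, 2, 3}. \<forall>p<K. w x (REC 0 f p) = w z (REC 0 f p)" using row_x x(2) rec by auto
 ultimately show ?thesis using z by blast
qed

lemma created_addr:
 assumes "x \<in> rows K" "w x CR"
 shows "cell_addr K w x = rnum x"
proof -
 have "cell_addr K w x = num_of K ((!) x)"
  unfolding cell_addr_def using table_row[OF assms(1)] table_index[OF assms(1)] assms(2)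
  by (intro num_of_cong) (simp add: row_ok_def)
 then show ?thesis using num_of_nth[OF assms(1)] by simp
qed

lemma table_read:
 "x \<in> rows K ==> \<not> w x CR ==> f \<in> {2, 3} ==> p < K ==> w x (REC 0 f p) = w (row K (cell_addr K w x)) (REC 0 f p)"
proof (induction "rnum x" arbitrary: x rule: less_induct)
 case less
 obtain z where z: "z \<in> rows K" "rnum z < rnum x" and rec: "\<forall>f\<in>{0, 2, 3}. \<forall>p<K. w x (REC 0 f p) = w z (REC 0 f p)"
  using table_source[OF less.prems(1,2)] by blast
 have addr: "cell_addr K w x = cell_addr K w z" unfolding cell_addr_def using rec by (intro num_of_cong) simp
 have "w z (REC 0 f p) = w (row K (cell_addr K w z)) (REC 0 f p)"
 proof (cases "w z CR")
  case True
  then show ?thesis using created_addr[OF z(1)] row_rnum[OF z(1)] by simp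
 next
  case False
  then show ?thesis using less.hyps[OF z(2,1)] less.prems(3,4) by blast
 qed
 then show ?case using rec less.prems(3,4) unfolding addr by auto
qed

lemma table_inv_init: "K \<ge> 1 ==> table_inv K w 1 0 (%_. 0) (%_. 0) (%_. 0)"
 using table unfolding table_inv_def good_cell_def table_ok_def start_ok_def by (auto simp: row_0)

context
 fixes i pc R h t x
 assumes inv: "table_inv K w i pc R h t" and pinv: "pinv i (pc, R, h, t, x, [])" and i: "Suc i < 2 ^ K"
begin

lemma inv_cells: "good_cell K w h t (R r)" "good_cell K w h t (h p)" "good_cell K w h t (t p)" "good_cell K w h t 0"
 using inv pinv table unfolding table_inv_def table_ok_def start_ok_def by (auto simp: good_cell_def row_0)

lemma table_inv_next:
 assumes "w (row K (Suc i)) (PC pc')" "keep K w (row K i) (row K (Suc i)) r"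
  and "\<forall>p<K. w (row K (Suc i)) (REG r p) = row K n ! p" "good_cell K w h t n"
 shows "table_inv K w (Suc i) pc' (R(r := n)) h t"
 using assms inv inv_cells unfolding table_inv_def keep_def by (metis fun_upd_apply)

lemma table_inv_TCons:
 assumes ok: "instr_ok K w pc (TCons r s u) (row K i) (row K (Suc i))" and regs: "s < 4" "u < 4"
 shows "table_inv K w (Suc i) (Suc pc) (R(r := i)) (h(i := R s)) (t(i := R u))"
proof -
 have reg: "w (row K i) (REG q p) = row K (R q) ! p" if "q < 4" "p < K" for q p using inv that unfolding table_inv_def by blast
 have "R q < i" "h p < i" "t p < i" for q p using pinv by auto
 then have old: "good_cell K w (h(i := R s)) (t(i := R u)) n" if "n \<in> range R \<union> range h \<union> range t" for n
  using that inv_cells good_cell_upd[of n i] by (metis (no_types, lifting) UnE imageE less_irrefl)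
 have new: "good_cell K w (h(i := R s)) (t(i := R u)) i"
  using ok reg[OF regs(1)] reg[OF regs(2)] by (simp add: good_cell_def)
 have "w (row K (Suc i)) (PC (Suc pc))" using ok by simp
 moreover have "\<forall>q<4. \<forall>p<K. w (row K (Suc i)) (REG q p) = row K ((R(r := i)) q) ! p"
  using ok reg table_index[of "row K i"] by (auto simp: keep_def)
 ultimately show ?thesis unfolding table_inv_def using old new by auto
qed

lemma read_ok_value:
 assumes "read_ok K w pc r s f (row K i) (row K (Suc i))" "f \<in> {2, 3}" "s < 4" "p < K"
 shows "w (row K (Suc i)) (REG r p) = row K (if f = 2 then h (R s) else t (R s)) ! p"
proof -
 note ok = assms(1)[unfolded read_ok_def]
 have "R s < 2 ^ K" using pinv i by (auto intro: less_trans)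
 moreover have "cell_addr K w (row K i) = num_of K ((!) (row K (R s)))"
  unfolding cell_addr_def using ok inv assms(3) by (intro num_of_cong) (simp add: table_inv_def)
 ultimately have "cell_addr K w (row K i) = R s" using num_of_row by simp
 then show ?thesis using table_read[of "row K i" f p] ok inv_cells(1)[of s] assms(2,4) by (auto simp: good_cell_def)
qed

lemma jump_target:
 assumes ok: "instr_ok K w pc (TJumpLf r l) (row K i) (row K (Suc i))" and r: "r < 4"
 shows "w (row K (Suc i)) (PC (if R r = 0 then l else Suc pc))"
proof -
 have "w (row K i) (REG r p) = row K (R r) ! p" if "p < K" for p using inv that r unfolding table_inv_def by blast
 then have nonzero: "row K (R r) ! p ==> w (row K (Suc i)) (PC (Suc pc))"
  and zeros: "w (row K i) (ZR p) ==> \<not> row K (R r) ! p ==> w (row K i) (ZR (Suc p))" if "p < K" for p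
  using ok that unfolding instr_ok.simps by blast+
 have all_zero: "w (row K i) (ZR K) ==> w (row K (Suc i)) (PC l)" using ok by simp
 show ?thesis
 proof (cases "R r = 0")
  case True
  have "w (row K i) (ZR k)" if "k \<le> K" for k
   using that
  proof (induction k)
   case 0
   then show ?case using table_row[of "row K i"] unfolding row_ok_def by simp
  next
   case (Suc k)
   then show ?case using zeros[of k] row_0[of k K] True by simp
  qed
  then show ?thesis using all_zero True by simp
 next
  case False
  have "R r < 2 ^ K" using pinv i by (auto intro: less_trans)
  then obtain p where "p < K" "row K (R r) ! p" using row_eq_0[of "R r" K] False by blast
  then show ?thesis using nonzero False by simp
 qed
qed

lemma table_inv_step:
 assumes pc: "pc < length Pg" and c: "small_regs (Pg ! pc)" "tplain (Pg ! pc)"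
  and step: "pinstr_step {} i (Pg ! pc) (pc, R, h, t, x, []) = (pc', R', h', t', x', q')"
  and guess: "(\<exists>r. Pg ! pc = TNext r) ==> x \<noteq> [] \<and> hd x = w (row K i) GS"
 shows "table_inv K w (Suc i) pc' R' h' t' \<and> q' = []"
proof -
 let ?X = "row K i" and ?Y = "row K (Suc i)"
 have "rnum ?Y = Suc (rnum ?X)" using i by (simp add: rnum_row)
 then have ok: "instr_ok K w pc (Pg ! pc) ?X ?Y" using table pc inv row_in unfolding table_ok_def table_inv_def by blast
 show ?thesis
 proof (cases "Pg ! pc")
  case (TNil r)
  then show ?thesis using ok step table_inv_next[of "Suc pc" r 0] inv_cells(4) by (auto simp: row_0)
 next
  case (TCons r s u)
  then have "s < 4" "u < 4" using c(1) by (auto simp: small_regs_def)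
  then show ?thesis using table_inv_TCons[of r s u] ok step TCons by auto
 next
  case (TCar r s)
  then have s: "s < 4" and read: "read_ok K w pc r s 2 ?X ?Y" using c(1) ok by (auto simp: small_regs_def)
  show ?thesis using table_inv_next[of "Suc pc" r "h (R s)"] read_ok_value[OF read _ s] read inv_cells(2) step TCar
   by (auto simp: read_ok_def)
 next
  case (TCdr r s)
  then have s: "s < 4" and read: "read_ok K w pc r s 3 ?X ?Y" using c(1) ok by (auto simp: small_regs_def)
  show ?thesis using table_inv_next[of "Suc pc" r "t (R s)"] read_ok_value[OF read _ s] read inv_cells(3) step TCdr
   by (auto simp: read_ok_def)
 next
  case (TJumpLf r l)
  then have "r < 4" using c(1) by (auto simp: small_regs_def)
  then have "w ?Y (PC pc')" using jump_target[of r l] ok step TJumpLf by auto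
  moreover have "\<forall>q<4. \<forall>p<K. w ?Y (REG q p) = w ?X (REG q p)" using ok TJumpLf by (auto simp: keep_def)
  ultimately show ?thesis using inv step TJumpLf by (auto simp: table_inv_def)
 next
  case (TNext r)
  have "h i = 0" "t i = 0" using pinv by auto
  then have "good_cell K w h t i" using ok TNext by (simp add: good_cell_def row_0)
  moreover have "\<forall>p<K. w ?Y (REG r p) = row K (if w ?X GS then i else 0) ! p"
   using ok TNext table_index[of ?X] by (auto simp: row_0)
  ultimately show ?thesis using table_inv_next[of "Suc pc" r "if w ?X GS then i else 0"] ok step guess TNext inv_cells(4)
   by (auto split: if_splits)
 qed (use c(2) in \<open>auto simp: tplain_def\<close>)
qed

end

end

lemma pinstr_step_input:
 assumes "tplain c" "e = (if \<exists>r. c = TNext r then [b] else [])"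
 shows "\<exists>pc' R' h' t'. \<forall>x. pinstr_step {} i c (pc, R, h, t, e @ x, q) = (pc', R', h', t', x, q)"
 using assms by (cases c) (auto simp: tplain_def)

lemma table_sound:
 assumes table: "table_ok K Pg rej w" and K: "K \<ge> 1" and P: "\<forall>c\<in>set Pg. small_regs c \<and> tplain c"
 shows "n + 1 < 2 ^ K ==> \<exists>xs pc R h t. (\<forall>x. prun {} Pg n 1 (pinit (xs @ x)) = (pc, R, h, t, x, [])) \<and>
   (pc < length Pg --> table_inv K w (n + 1) pc R h t) \<and> pc \<noteq> rej"
proof (induction n)
 case 0
 note init = table_inv_init[OF table K]
 have "rej \<noteq> 0" using init table_not_rej[OF table, of 1] unfolding table_inv_def by metis
 then show ?case using init
  by (intro exI[of _ "[]"] exI[of _ 0] exI[of _ "%_. 0"]) (auto simp: pinit_def)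
next
 case (Suc n)
 have "n + 1 < 2 ^ K" using Suc.prems by simp
 from Suc.IH[OF this] obtain xs pc R h t where run: "\<And>x. prun {} Pg n 1 (pinit (xs @ x)) = (pc, R, h, t, x, [])"
  and inv: "pc < length Pg ==> table_inv K w (n + 1) pc R h t" and rej: "pc \<noteq> rej" by blast
 show ?case
 proof (cases "pc < length Pg")
  case False
  then show ?thesis using run rej by (intro exI[of _ xs] exI[of _ pc] exI[of _ R] exI[of _ h] exI[of _ t]) (auto simp: pstep_def)
 next
  case True
  have c: "small_regs (Pg ! pc)" "tplain (Pg ! pc)" using P True by auto
  let ?e = "if \<exists>r. Pg ! pc = TNext r then [w (row K (n + 1)) GS] else []"
  obtain pc' R' h' t' where step: "\<And>x. pinstr_step {} (n + 1) (Pg ! pc) (pc, R, h, t, ?e @ x, []) = (pc', R', h', t', x, [])"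
   using pinstr_step_input[OF c(2) refl] by blast
  have "pinv (n + 1) (pc, R, h, t, ?e @ [], [])"
   using pinv_prun[OF pinv_pinit[of "xs @ ?e @ []"], where n = n and A = "{}" and P = Pg] run[of "?e @ []"] by simp
  from table_inv_step[OF table inv[OF True] this _ True c step]
  have inv': "table_inv K w (Suc (n + 1)) pc' R' h' t'" using Suc.prems by auto
  then have "pc' \<noteq> rej" using table_not_rej[OF table, of "Suc (n + 1)"] unfolding table_inv_def by metis
  moreover have "prun {} Pg (Suc n) 1 (pinit ((xs @ ?e) @ x)) = (pc', R', h', t', x, [])" for x
   using run[of "?e @ x"] step[of x] True by (simp add: pstep_def)
  ultimately show ?thesis using inv' by (intro exI[of _ "xs @ ?e"]) auto
 qed
qed

subsection \<open>Completeness\<close>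

lemma routes_layers:
 "routes ds f ==> \<exists>G. G 0 = id \<and> G (length ds) = f \<and>
   (\<forall>l<length ds. \<forall>x. G (Suc l) x = G l x \<or> G (Suc l) x = G l (flip (ds ! l) x))"
proof (induction ds arbitrary: f)
 case Nil
 then show ?case by (intro exI[of _ "%_. id"]) simp
next
 case (Cons d ds)
 then obtain h g where h: "layer d h" and g: "routes ds g" and f: "f = h \<circ> g" by auto
 from Cons.IH[OF g] obtain G where G: "G 0 = id" "G (length ds) = g"
  and step: "\<And>l x. l < length ds ==> G (Suc l) x = G l x \<or> G (Suc l) x = G l (flip (ds ! l) x)" by blast
 define G' where "G' = case_nat id (%m. h \<circ> G m)"
 have "G' (Suc l) x = G' l x \<or> G' (Suc l) x = G' l (flip ((d # ds) ! l) x)" if "l < length (d # ds)" for l x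
 proof (cases l)
  case 0
  then show ?thesis using h G(1) unfolding G'_def layer_def by auto
 next
  case (Suc m)
  then show ?thesis using step[of m x] that unfolding G'_def by auto
 qed
 then show ?case using G f by (intro exI[of _ G']) (auto simp: G'_def)
qed

locale traced =
 fixes K :: nat and Pg :: "tinstr list" and rej :: nat and x0 :: bits
 assumes K_pos: "K \<ge> 1" and Pg: "\<forall>c\<in>set Pg. small_regs c \<and> tplain c"
  and not_rej: "\<And>n. fst (prun {} Pg n 1 (pinit x0)) \<noteq> rej"
begin

definition cfg :: "nat => pconf" where "cfg i = prun {} Pg (i - 1) 1 (pinit x0)"

definition pcs :: "nat => nat" where "pcs i = fst (cfg i)"
definition Rs :: "nat => nat => nat" where "Rs i = fst (snd (cfg i))"
definition hs :: "nat => nat => nat" where "hs i = fst (snd (snd (cfg i)))"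
definition ts :: "nat => nat => nat" where "ts i = fst (snd (snd (snd (cfg i))))"
definition xs :: "nat => bits" where "xs i = fst (snd (snd (snd (snd (cfg i)))))"
definition qs :: "nat => bits" where "qs i = snd (snd (snd (snd (snd (cfg i)))))"

lemma cfg_eq: "cfg i = (pcs i, Rs i, hs i, ts i, xs i, qs i)"
 by (simp add: pcs_def Rs_def hs_def ts_def xs_def qs_def)

lemma cfg_Suc: "i \<ge> 1 ==> cfg (Suc i) = pstep {} Pg i (cfg i)"
 unfolding cfg_def by (cases i) auto

lemma cfg_inv: "i \<ge> 1 ==> pinv i (pcs i, Rs i, hs i, ts i, xs i, qs i)"
 using pinv_prun[OF pinv_pinit[of x0], where n = "i - 1" and A = "{}" and P = Pg] cfg_eq[of i] by (simp add: cfg_def)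

definition active :: "nat => bool" where "active i \<longleftrightarrow> i \<ge> 1 \<and> pcs i < length Pg"
definition ins :: "nat => tinstr" where "ins i = Pg ! pcs i"

lemma cfg_step: "active i ==> (pcs (Suc i), Rs (Suc i), hs (Suc i), ts (Suc i), xs (Suc i), qs (Suc i)) =
  pinstr_step {} i (ins i) (pcs i, Rs i, hs i, ts i, xs i, qs i)"
 using cfg_Suc[of i] cfg_eq[of i] cfg_eq[of "Suc i"] unfolding active_def ins_def pstep_def by auto

lemma cfg_idle: "i \<ge> 1 ==> \<not> active i ==> cfg (Suc i) = cfg i"
 using cfg_Suc[of i] unfolding active_def pstep_def by (simp add: pcs_def)

definition src :: "tinstr => nat option" where
 "src c = (case c of TCar r s => Some s | TCdr r s => Some s | _ => None)"

definition reads :: "nat => bool" where "reads i \<longleftrightarrow> active i \<and> src (ins i) \<noteq> None"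
definition addr :: "nat => nat" where "addr i = (if reads i then Rs i (the (src (ins i))) else i)"

lemma not_reads_0: "\<not> reads 0"
 by (simp add: reads_def active_def)

lemma heap_step:
 assumes "i \<ge> 1" "p \<noteq> i"
 shows "hs (Suc i) p = hs i p \<and> ts (Suc i) p = ts i p"
proof (cases "active i")
 case True
 then show ?thesis using cfg_step[OF True] assms by (cases "ins i") auto
next
 case False
 then show ?thesis using cfg_idle[OF assms(1) False] by (simp add: hs_def ts_def)
qed

lemma heap_later:
 assumes "1 \<le> i" "i \<le> j" "p < i"
 shows "hs j p = hs i p \<and> ts j p = ts i p"
 using assms(2)
proof (induction rule: dec_induct)
 case (step j)
 then show ?case using heap_step[of j p] assms by auto
qed simp

text \<open>Pointers lead to rows that create a cell: no chain of reads has to be followed.\<close>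

lemma not_reads_pointers: "i \<ge> 1 ==> \<not> reads (Rs i r) \<and> \<not> reads (hs i p) \<and> \<not> reads (ts i p)"
proof (induction i arbitrary: r p rule: nat_induct_at_least[of 1])
 case base
 then show ?case using not_reads_0 by (simp add: Rs_def hs_def ts_def cfg_def pinit_def)
next
 case (Suc i)
 show ?case
 proof (cases "active i")
  case True
  have "\<not> reads i" if "\<nexists>r s. ins i = TCar r s" "\<nexists>r s. ins i = TCdr r s"
   using that by (cases "ins i") (auto simp: reads_def src_def)
  then show ?thesis using cfg_step[OF True] Suc.IH not_reads_0 by (cases "ins i") (auto split: if_splits)
 next
  case False
  then show ?thesis using cfg_idle[of i] Suc by (simp add: Rs_def hs_def ts_def)
 qed
qed

lemma addr_less: "reads i ==> addr i < i"
 using cfg_inv[of i] unfolding addr_def reads_def active_def by auto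

lemma addr_addr: "addr (addr i) = addr i"
proof (cases "reads i")
 case True
 then have "\<not> reads (addr i)" using not_reads_pointers[of i] unfolding addr_def reads_def active_def by auto
 then show ?thesis by (simp add: addr_def[of "addr i"])
qed (simp add: addr_def)

definition prev :: "nat => nat" where "prev i = Max {j. j < i \<and> addr j = addr i}"

lemma prev:
 assumes "reads i"
 shows "prev i < i" "addr (prev i) = addr i"
proof -
 have "addr i \<in> {j. j < i \<and> addr j = addr i}" using addr_less[OF assms] addr_addr by auto
 then have "prev i \<in> {j. j < i \<and> addr j = addr i}" unfolding prev_def by (intro Max_in) auto
 then show "prev i < i" "addr (prev i) = addr i" by auto
qed

lemma prev_inj: "inj_on prev {i. reads i}"
proof -
 have "prev i \<noteq> prev j" if "reads i" "reads j" "i < j" for i j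
 proof
  assume eq: "prev i = prev j"
  then have "addr i = addr j" using prev that by metis
  then have "i \<le> prev j" unfolding prev_def using that by (intro Max_ge) auto
  then show False using prev(1)[OF that(1)] eq by simp
 qed
 then show ?thesis unfolding inj_on_def by (metis linorder_neqE_nat mem_Collect_eq)
qed

definition final_hd :: "nat => nat" where "final_hd = hs (2 ^ K)"
definition final_tl :: "nat => nat" where "final_tl = ts (2 ^ K)"

lemma final_heap: "1 \<le> i ==> i \<le> 2 ^ K ==> p < i ==> final_hd p = hs i p \<and> final_tl p = ts i p"
 unfolding final_hd_def final_tl_def by (rule heap_later)

definition field :: "nat => nat => nat" where
 "field f i = (if f = 0 then addr i else if f = 1 then i else if f = 2 then final_hd (addr i) else final_tl (addr i))"

definition tested :: "nat => nat" where
 "tested i = (case ins i of TJumpLf r l => r | _ => 0)"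

text \<open>\<open>G l x\<close> is the row whose record is on line \<open>x\<close> after \<open>l\<close> layers of the network.\<close>

definition table :: "(nat => bits => bits) => bits => tag => bool" where
 "table G x = (%(k, a, b, c). let i = rnum x in
   if k = 0 then x ! a
   else if k = 1 then i \<ge> 1 \<and> pcs i = a
   else if k = 2 then row K (Rs i a) ! b
   else if k = 3 then \<not> reads i
   else if k = 4 then row K (field b (rnum (G a x))) ! c
   else if k = 5 then G (Suc a) x \<noteq> G a x
   else if k = 6 then \<forall>p<a. G (2 * K) x ! p = x ! p
   else if k = 7 then \<forall>p<a. \<not> row K (Rs i (tested i)) ! p
   else xs i \<noteq> [] \<and> hd (xs i))"

lemma table_simps:
 "table G x (IX p) = x ! p"
 "table G x (PC l) \<longleftrightarrow> rnum x \<ge> 1 \<and> pcs (rnum x) = l"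
 "table G x (REG r p) = row K (Rs (rnum x) r) ! p"
 "table G x CR \<longleftrightarrow> \<not> reads (rnum x)"
 "table G x (REC l f p) = row K (field f (rnum (G l x))) ! p"
 "table G x (SW l) \<longleftrightarrow> G (Suc l) x \<noteq> G l x"
 "table G x (EQ p) \<longleftrightarrow> (\<forall>k<p. G (2 * K) x ! k = x ! k)"
 "table G x (ZR p) \<longleftrightarrow> (\<forall>k<p. \<not> row K (Rs (rnum x) (tested (rnum x))) ! k)"
 "table G x GS \<longleftrightarrow> xs (rnum x) \<noteq> [] \<and> hd (xs (rnum x))"
 by (simp_all add: table_def Let_def)

lemmas table_simps' = table_simps table_simps(2)[unfolded One_nat_def]

lemma final_cell:
 assumes "active i" "Suc i < 2 ^ K"
 shows "final_hd i = hs (Suc i) i" "final_tl i = ts (Suc i) i"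
  and "p < i ==> final_hd p = hs i p" "p < i ==> final_tl p = ts i p"
 using final_heap[of "Suc i" i] final_heap[of i p] assms unfolding active_def by auto

lemma read_ok_table:
 assumes G0: "G 0 = id" and x: "x \<in> rows K" and y: "rnum y = Suc (rnum x)" "Suc (rnum x) < 2 ^ K" and i: "active (rnum x)"
  and src: "src (ins (rnum x)) = Some s" and f: "f \<in> {2, 3}"
  and step: "pcs (Suc (rnum x)) = Suc (pcs (rnum x))"
   "Rs (Suc (rnum x)) = (Rs (rnum x))(r := if f = 2 then hs (rnum x) (Rs (rnum x) s) else ts (rnum x) (Rs (rnum x) s))"
 shows "read_ok K (table G) (pcs (rnum x)) r s f x y"
proof -
 let ?i = "rnum x"
 have reads: "reads ?i" "addr ?i = Rs ?i s" using i src by (simp_all add: reads_def addr_def)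
 have "Rs ?i s < ?i" using addr_less[OF reads(1)] reads(2) by simp
 then have "field f ?i = Rs (Suc ?i) r" using final_cell(3,4)[OF i y(2)] f reads(2) step(2) by (auto simp: field_def)
 then show ?thesis unfolding read_ok_def keep_def using reads step by (simp add: table_simps' G0 y(1)) (simp add: field_def)
qed

lemma instr_ok_table:
 assumes G0: "G 0 = id" and xy: "x \<in> rows K" "y \<in> rows K" "rnum y = Suc (rnum x)" and pc: "table G x (PC l)" "l < length Pg"
 shows "instr_ok K (table G) l (Pg ! l) x y"
proof -
 let ?i = "rnum x"
 have i: "active ?i" "l = pcs ?i" "Pg ! l = ins ?i" "?i \<ge> 1" "Suc ?i < 2 ^ K"
  using pc xy rnum_less[OF xy(2)] unfolding active_def ins_def by (auto simp: table_simps')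
 note step = cfg_step[OF i(1)]
 have c: "small_regs (ins ?i)" "tplain (ins ?i)" using Pg i(3) pc(2) nth_mem by metis+
 have inv: "pinv ?i (pcs ?i, Rs ?i, hs ?i, ts ?i, xs ?i, qs ?i)" by (rule cfg_inv[OF i(4)])
 have keep: "keep K (table G) x y r" if "\<And>q. q \<noteq> r ==> Rs (Suc ?i) q = Rs ?i q" for r
  using that unfolding keep_def by (simp add: table_simps' xy)
 note entries = table_simps' G0 xy row_rnum[OF xy(1)]
 show ?thesis
 proof (cases "ins ?i")
  case (TNil r)
  then show ?thesis using step i keep[of r] by (auto simp: entries row_0)
 next
  case (TCons r s u)
  then have "\<not> reads ?i" by (simp add: reads_def src_def)
  then show ?thesis using TCons step i keep[of r] final_cell(1,2)[OF i(1,5)] by (auto simp: entries field_def addr_def)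
 next
  case (TCar r s)
  then show ?thesis using read_ok_table[of G x y s 2 r] G0 xy step i by (auto simp: src_def)
 next
  case (TCdr r s)
  then show ?thesis using read_ok_table[of G x y s 3 r] G0 xy step i by (auto simp: src_def)
 next
  case (TJumpLf r l')
  have "Rs (Suc ?i) = Rs ?i" "pcs (Suc ?i) = (if Rs ?i r = 0 then l' else Suc (pcs ?i))" using step TJumpLf by auto
  moreover have "tested ?i = r" by (simp add: tested_def TJumpLf)
  moreover have "Rs ?i r < ?i" using inv by simp
  then have "Rs ?i r < 2 ^ K" using i(5) by simp
  ultimately show ?thesis using TJumpLf i keep[of 4] row_eq_0[of "Rs ?i r" K] by (auto simp: entries less_Suc_eq row_0)
 next
  case (TNext r)
  then have "\<not> reads ?i" by (simp add: reads_def src_def)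
  moreover have "final_hd ?i = 0" "final_tl ?i = 0" using final_cell(1,2)[OF i(1,5)] step TNext inv by auto
  ultimately show ?thesis using TNext step i keep[of r] by (auto simp: entries field_def addr_def row_0)
 qed (use c in \<open>auto simp: tplain_def\<close>)
qed

lemma routing:
 "\<exists>G. G 0 = id \<and> (\<forall>l<2 * K. \<forall>x. G (Suc l) x = G l x \<or> G (Suc l) x = G l (flip (dims K ! l) x)) \<and>
   (\<forall>x\<in>rows K. reads (rnum x) --> G (2 * K) x = row K (prev (rnum x)))"
proof -
 let ?A = "{x \<in> rows K. reads (rnum x)}"
 have "prev (rnum x) < 2 ^ K" if "x \<in> ?A" for x using prev(1)[of "rnum x"] rnum_less[of x K] that by auto
 then have "inj_on (%x. row K (prev (rnum x))) ?A"
  using row_inj prev_inj rnum_inj unfolding inj_on_def by (metis (no_types, lifting) mem_Collect_eq)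
 then obtain f where "f permutes rows K" and f: "\<forall>x\<in>?A. f x = row K (prev (rnum x))"
  using extend_inj_permutes[OF finite_rows, of ?A K "%x. row K (prev (rnum x))"] by (auto simp: image_subset_iff)
 then have "routes (dims K) f" using benes by blast
 from routes_layers[OF this] obtain G where "G 0 = id" "G (2 * K) = f"
  "\<forall>l<2 * K. \<forall>x. G (Suc l) x = G l x \<or> G (Suc l) x = G l (flip (dims K ! l) x)"
  unfolding length_dims by blast
 then show ?thesis using f by (intro exI[of _ G]) simp
qed

lemma row_ok_table:
 assumes G0: "G 0 = id" and x: "x \<in> rows K" and route: "reads (rnum x) ==> G (2 * K) x = row K (prev (rnum x))"
 shows "row_ok K rej (table G) x"
proof -
 let ?i = "rnum x"
 have "pcs ?i \<noteq> rej" using not_rej[of "?i - 1"] by (simp add: pcs_def cfg_def)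
 moreover have "compares K (%p. table G x (REC (2 * K) 1 p)) (%p. table G x (IX p)) (%p. table G x (EQ p)) \<and>
   (\<forall>f\<in>{0, 2, 3}. \<forall>p<K. table G x (REC (2 * K) f p) = table G x (REC 0 f p))" if reads: "reads ?i"
 proof -
  have "prev ?i < 2 ^ K" using prev(1)[OF reads] rnum_less[OF x] by simp
  then have z: "G (2 * K) x = row K (prev ?i)" "rnum (G (2 * K) x) = prev ?i" using route[OF reads] by (simp_all add: rnum_row)
  have "num_of K ((!) (G (2 * K) x)) < num_of K ((!) x)" using prev(1)[OF reads] z by (simp add: num_of_nth x)
  from less_compares[OF this] have "compares K (%p. table G x (REC (2 * K) 1 p)) (%p. table G x (IX p)) (%p. table G x (EQ p))"
   unfolding table_simps' z(2) by (simp add: field_def z(1))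
  moreover have "field f (prev ?i) = field f ?i" if "f \<in> {0, 2, 3}" for f using prev(2)[OF reads] that by (auto simp: field_def)
  ultimately show ?thesis by (auto simp: table_simps' z(2) G0)
 qed
 ultimately show ?thesis unfolding row_ok_def by (auto simp: table_simps' G0 field_def addr_def row_rnum[OF x])
qed

lemma start_ok_table:
 assumes "G 0 = id"
 shows "start_ok K (table G)"
proof -
 have "1 < (2 :: nat) ^ K" using K_pos one_less_power[of "2 :: nat" K] by simp
 then have "rnum (row K 0) = 0" "rnum (row K 1) = 1" using rnum_row[of 0 K] rnum_row[of 1 K] by auto
 moreover have "Rs 1 r = 0" "pcs 1 = 0" for r by (simp_all add: Rs_def pcs_def cfg_def pinit_def)
 moreover have "final_hd 0 = 0" "final_tl 0 = 0" using cfg_inv[of "2 ^ K"] unfolding final_hd_def final_tl_def by auto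
 ultimately show ?thesis
  unfolding start_ok_def table_simps' assms by (simp add: field_def addr_def not_reads_0 row_0)
qed

lemma table_complete: "\<exists>w. table_ok K Pg rej w"
proof -
 obtain G where G0: "G 0 = id" and step: "\<forall>l<2 * K. \<forall>x. G (Suc l) x = G l x \<or> G (Suc l) x = G l (flip (dims K ! l) x)"
  and route: "\<forall>x\<in>rows K. reads (rnum x) --> G (2 * K) x = row K (prev (rnum x))"
  using routing by blast
 have "network_ok K (table G)" unfolding network_ok_def table_simps' using step by metis
 moreover have "\<forall>x\<in>rows K. \<forall>p<K. table G x (IX p) = x ! p" unfolding table_simps' by blast
 ultimately have "table_ok K Pg rej (table G)"
  unfolding table_ok_def using start_ok_table[of G] row_ok_table[of G] instr_ok_table[of G] G0 route by blast
 then show ?thesis by blast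
qed

end

section \<open>The constraint system of a computation\<close>

type_synonym family = "(pattern \<times> bool) list"

definition fam_ok :: "(bits => bool) => nat => family => bool" where
 "fam_ok W L fam \<longleftrightarrow> (\<forall>y\<in>rows L. \<exists>(\<pi>, b)\<in>set fam. W (inst \<pi> y) = b)"

definition sat :: "nat => family list => (bits => bool) => bool" where
 "sat L \<Phi> W \<longleftrightarrow> (\<forall>fam\<in>set \<Phi>. fam_ok W L fam)"

definition clause_family :: "nat => shape => clit list => family" where
 "clause_family n = (%(\<pi>, \<pi>') cl. map (%(r, t, b). ((if r then \<pi>' else \<pi>) @ const_pat (tag_code n t), b)) cl)"

text \<open>Clauses have at most five literals, and the tags in them have codes of bounded length.\<close>

definition small_clause :: "nat => clit list => bool" where
 "small_clause b cl \<longleftrightarrow> length cl \<le> 5 \<and> (\<forall>(r, t, s)\<in>set cl. tag_weight t \<le> b)"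

lemma small_clause_mono: "small_clause a cl ==> a \<le> b ==> small_clause b cl"
 unfolding small_clause_def by fastforce

lemma ball_upt: "(\<forall>i\<in>set [0..<n]. Q i) \<longleftrightarrow> (\<forall>i<n. Q i)"
 by auto

lemma ball_rows_add: "(\<forall>y\<in>rows (K + n). Q y) \<longleftrightarrow> (\<forall>y\<in>rows K. \<forall>z\<in>rows n. Q (y @ z))"
proof
 assume all: "\<forall>y\<in>rows K. \<forall>z\<in>rows n. Q (y @ z)"
 show "\<forall>y\<in>rows (K + n). Q y"
 proof
  fix y assume "y \<in> rows (K + n)"
  then have "take K y \<in> rows K" "drop K y \<in> rows n" by (auto simp: rows_def)
  then have "Q (take K y @ drop K y)" using all by blast
  then show "Q y" by simp
 qed
qed (auto simp: rows_def)

lemma fam_ok_clause_family: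
 assumes len: "length \<pi> = K" "length \<pi>' = K" and small: "small_clause n cl"
  and W: "\<And>x t. x \<in> rows K ==> tag_weight t \<le> n ==> W (x @ tag_code n t) = w x t"
 shows "fam_ok W (K + n) (clause_family n (\<pi>, \<pi>') cl) \<longleftrightarrow> (\<forall>y\<in>rows K. holds w (inst \<pi> y) (inst \<pi>' y) cl)"
proof -
 have inst: "W (inst (\<rho> @ const_pat (tag_code n t)) (y @ z)) = w (inst \<rho> y) t"
  if "length \<rho> = K" "y \<in> rows K" "z \<in> rows n" "tag_weight t \<le> n" for \<rho> t y z
 proof -
  have "inst (\<rho> @ const_pat (tag_code n t)) (y @ z) = inst \<rho> y @ tag_code n t"
   using that length_tag_code[of t n] by (simp add: inst_append inst_const_pat rows_def)
  then show ?thesis using W[of "inst \<rho> y" t] that by (simp add: rows_def length_inst)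
 qed
 have "(\<exists>(\<rho>, b)\<in>set (clause_family n (\<pi>, \<pi>') cl). W (inst \<rho> (y @ z)) = b) \<longleftrightarrow> holds w (inst \<pi> y) (inst \<pi>' y) cl"
  if "y \<in> rows K" "z \<in> rows n" for y z
 proof -
  have "(\<exists>(\<rho>, b)\<in>set (clause_family n (\<pi>, \<pi>') cl). W (inst \<rho> (y @ z)) = b) \<longleftrightarrow>
    (\<exists>c\<in>set cl. W (inst ((if fst c then \<pi>' else \<pi>) @ const_pat (tag_code n (fst (snd c)))) (y @ z)) = snd (snd c))"
   by (simp add: clause_family_def split_def)
  also have "\<dots> \<longleftrightarrow> holds w (inst \<pi> y) (inst \<pi>' y) cl"
   unfolding holds_def split_def
  proof (rule bex_cong[OF refl])
   fix c assume "c \<in> set cl"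
   then have "tag_weight (fst (snd c)) \<le> n" using small unfolding small_clause_def by (auto simp: split_def)
   then show "W (inst ((if fst c then \<pi>' else \<pi>) @ const_pat (tag_code n (fst (snd c)))) (y @ z)) = snd (snd c) \<longleftrightarrow>
     w (if fst c then inst \<pi>' y else inst \<pi> y) (fst (snd c)) = snd (snd c)"
    using inst[OF _ that] len by simp
  qed
  finally show ?thesis .
 qed
 moreover have "replicate n False \<in> rows n" by (simp add: rows_def)
 ultimately show ?thesis unfolding fam_ok_def ball_rows_add by blast
qed

definition record_cls :: "nat => nat => clit list list" where
 "record_cls K p = eq_cls [] (False, REC 0 1 p) (False, IX p) @
   eq_cls [(False, CR, False)] (False, REC 0 0 p) (False, IX p) @
   eq_cls [(False, CR, True)] (False, REC (2 * K) 0 p) (False, REC 0 0 p) @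
   eq_cls [(False, CR, True)] (False, REC (2 * K) 2 p) (False, REC 0 2 p) @
   eq_cls [(False, CR, True)] (False, REC (2 * K) 3 p) (False, REC 0 3 p) @
   [[(False, CR, True), (False, EQ p, False), (False, REC (2 * K) 1 p, False), (False, IX p, True)],
    [(False, CR, True), (False, EQ p, False), (False, REC (2 * K) 1 p, False), (False, IX p, False), (False, EQ (Suc p), True)],
    [(False, CR, True), (False, EQ p, False), (False, REC (2 * K) 1 p, True), (False, IX p, True), (False, EQ (Suc p), True)]]"

definition row_cls :: "nat => nat => clit list list" where
 "row_cls K rej = [[(False, ZR 0, True)], [(False, PC rej, False)], [(False, CR, True), (False, EQ 0, True)],
   [(False, CR, True), (False, EQ K, False)]] @ concat (map (record_cls K) [0..<K])"

lemma record_cls_holds: "(\<forall>cl\<in>set (record_cls K p). holds w x y cl) \<longleftrightarrow>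
  w x (REC 0 1 p) = w x (IX p) \<and> (w x CR --> w x (REC 0 0 p) = w x (IX p)) \<and>
  (\<not> w x CR --> (\<forall>f\<in>{0, 2, 3}. w x (REC (2 * K) f p) = w x (REC 0 f p)) \<and>
   (w x (EQ p) \<and> w x (REC (2 * K) 1 p) --> w x (IX p)) \<and>
   (w x (EQ p) \<and> w x (REC (2 * K) 1 p) = w x (IX p) --> w x (EQ (Suc p))))"
 unfolding record_cls_def set_append ball_Un eq_cls_holds by (cases "w x CR") auto

lemma row_cls_holds: "(\<forall>cl\<in>set (row_cls K rej). holds w x y cl) \<longleftrightarrow> row_ok K rej w x"
proof -
 have "(\<forall>cl\<in>set (row_cls K rej). holds w x y cl) \<longleftrightarrow> w x (ZR 0) \<and> \<not> w x (PC rej) \<and> (w x CR \<or> w x (EQ 0)) \<and>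
   (w x CR \<or> \<not> w x (EQ K)) \<and> (\<forall>p<K. \<forall>cl\<in>set (record_cls K p). holds w x y cl)"
  unfolding row_cls_def set_append ball_Un ball_concat_map ball_upt by simp
 then show ?thesis unfolding row_ok_def compares_def record_cls_holds by blast
qed

definition net_cls :: "nat => nat => clit list list" where
 "net_cls K l = concat (map (%f. concat (map (%p.
   eq_cls [(False, SW l, False)] (True, REC l f p) (False, REC (Suc l) f p) @
   eq_cls [(False, SW l, True)] (False, REC l f p) (False, REC (Suc l) f p)) [0..<K])) [0..<4])"

lemma net_cls_holds: "(\<forall>cl\<in>set (net_cls K l). holds w x y cl) \<longleftrightarrow>
  (\<forall>f<4. \<forall>p<K. w x (REC (Suc l) f p) = (if w x (SW l) then w y (REC l f p) else w x (REC l f p)))"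
 unfolding net_cls_def ball_concat_map set_append ball_Un eq_cls_holds by auto

definition init_cls :: "nat => clit list list" where
 "init_cls K = [(False, PC 0, True)] # concat (map (%r. map (%p. [(False, REG r p, False)]) [0..<K]) [0..<4])"

definition zero_cls :: "nat => clit list list" where
 "zero_cls K = concat (map (%p. [[(False, REC 0 2 p, False)], [(False, REC 0 3 p, False)]]) [0..<K])"

definition program_cls :: "nat => icode list => clit list list" where
 "program_cls K cs = concat (map (%l. instr_cls K l (cs ! l)) [0..<length cs])"

type_synonym group = "shape list \<times> clit list list"

definition index_groups :: "nat => group list" where
 "index_groups K = concat (map (%p. map (%b. (bitS K p b, [[(False, IX p, b)]])) [False, True]) [0..<K])"

definition network_groups :: "nat => group list" where
 "network_groups K = map (%l. (flipS K (dims K ! l), net_cls K l)) [0..<2 * K]"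

definition groups :: "nat => icode list => nat => group list" where
 "groups K cs rej = index_groups K @
   [(constS (replicate (K - 1) False @ [True]), init_cls K), (constS (replicate K False), zero_cls K),
    (allS K, row_cls K rej), (stepS K, program_cls K cs)] @ network_groups K"

definition csp :: "nat => nat => icode list => nat => family list" where
 "csp K n cs rej = concat (map (%(S, C). concat (map (%sh. map (clause_family n sh) C) S)) (groups K cs rej))"

subsection \<open>The meaning of the clauses\<close>

definition group_ok :: "nat => (bits => tag => bool) => group => bool" where
 "group_ok K w = (%(S, C). \<forall>(x, y)\<in>shape_rel K S. \<forall>cl\<in>set C. holds w x y cl)"

lemma row_one:
 assumes "K \<ge> 1"
 shows "replicate (K - 1) False @ [True] = row K 1"
proof (rule rnum_inj[of _ K])
 show "replicate (K - 1) False @ [True] \<in> rows K" using assms by (simp add: rows_def)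
 have "1 < (2 :: nat) ^ K" using assms one_less_power[of "2 :: nat" K] by simp
 then have "rnum (row K 1) = 1" by (rule rnum_row)
 then show "rnum (replicate (K - 1) False @ [True]) = rnum (row K 1)" by (simp add: rnum_def bval_replicate)
qed simp

lemma row_zero: "replicate K False = row K 0"
 by (rule nth_equalityI) (auto simp: row_0)

lemma index_groups_ok: "(\<forall>g\<in>set (index_groups K). group_ok K w g) \<longleftrightarrow> (\<forall>x\<in>rows K. \<forall>p<K. w x (IX p) = x ! p)"
proof -
 have "group_ok K w (bitS K p b, [[(False, IX p, b)]]) \<longleftrightarrow> (\<forall>x\<in>rows K. x ! p = b --> w x (IX p) = b)" if "p < K" for p b
  unfolding group_ok_def by (auto simp: shape_rel_bitS[OF that])
 then have "(\<forall>g\<in>set (index_groups K). group_ok K w g) \<longleftrightarrow> (\<forall>p<K. \<forall>b. \<forall>x\<in>rows K. x ! p = b --> w x (IX p) = b)"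
  unfolding index_groups_def ball_concat_map ball_upt by (simp add: all_bool_eq conj_commute)
 then show ?thesis by blast
qed

lemma start_groups_ok:
 assumes "K \<ge> 1"
 shows "group_ok K w (constS (replicate (K - 1) False @ [True]), init_cls K) \<and>
   group_ok K w (constS (replicate K False), zero_cls K) \<longleftrightarrow> start_ok K w"
 unfolding row_one[OF assms] row_zero[of K] group_ok_def start_ok_def init_cls_def zero_cls_def
 by (simp add: shape_rel_constS ball_concat_map del: set_concat) auto

lemma ball_program_cls:
 "(\<forall>cl\<in>set (program_cls K cs). Q cl) \<longleftrightarrow> (\<forall>l<length cs. \<forall>cl\<in>set (instr_cls K l (cs ! l)). Q cl)"
 unfolding program_cls_def ball_concat_map ball_upt ..

lemma program_cls_holds:
 assumes "\<forall>c\<in>set Pg. tplain c"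
 shows "(\<forall>cl\<in>set (program_cls K (map icode_of Pg)). holds w x y cl) \<longleftrightarrow>
   (\<forall>l<length Pg. w x (PC l) --> instr_ok K w l (Pg ! l) x y)"
 unfolding ball_program_cls using assms instr_cls_holds[simplified] by simp

lemma nth_dims_less: "l < 2 * K ==> dims K ! l < K"
 using dims_less[of "dims K ! l" K] by (simp add: length_dims)

lemma network_groups_ok: "(\<forall>g\<in>set (network_groups K). group_ok K w g) \<longleftrightarrow> network_ok K w"
proof -
 have "group_ok K w (flipS K (dims K ! l), net_cls K l) \<longleftrightarrow> (\<forall>x\<in>rows K. \<forall>f<4. \<forall>p<K. w x (REC (Suc l) f p) =
   (if w x (SW l) then w (flip (dims K ! l) x) (REC l f p) else w x (REC l f p)))" if "l < 2 * K" for l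
  unfolding group_ok_def split_conv net_cls_holds shape_rel_flipS[OF nth_dims_less[OF that]] by auto
 then show ?thesis unfolding network_groups_def network_ok_def set_map ball_simps ball_upt by simp
qed

lemma groups_ok:
 assumes "K \<ge> 1" "\<forall>c\<in>set Pg. tplain c"
 shows "(\<forall>g\<in>set (groups K (map icode_of Pg) rej). group_ok K w g) \<longleftrightarrow> table_ok K Pg rej w"
proof -
 have "group_ok K w (allS K, row_cls K rej) \<longleftrightarrow> (\<forall>x\<in>rows K. row_ok K rej w x)"
  unfolding group_ok_def by (auto simp: shape_rel_allS row_cls_holds)
 moreover have "group_ok K w (stepS K, program_cls K (map icode_of Pg)) \<longleftrightarrow>
   (\<forall>x\<in>rows K. \<forall>y\<in>rows K. rnum y = Suc (rnum x) --> (\<forall>l<length Pg. w x (PC l) --> instr_ok K w l (Pg ! l) x y))"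
  unfolding group_ok_def by (auto simp: shape_rel_stepS program_cls_holds[OF assms(2)])
 ultimately show ?thesis
  unfolding table_ok_def groups_def set_append ball_Un index_groups_ok network_groups_ok start_groups_ok[OF assms(1), symmetric]
  by simp blast
qed

subsection \<open>The size of the clauses\<close>

definition icode_bounded :: "nat => icode => bool" where
 "icode_bounded m = (%(op, r, s, u). r < 4 \<and> s \<le> m + 3 \<and> u < 4)"

lemmas small_clause_simps = small_clause_def tag_weight_def eq_cls_def

lemma small_keep_cls: "cl \<in> set (keep_cls K i r) ==> small_clause (K + i + 15) cl"
 unfolding keep_cls_def by (auto simp: small_clause_simps)

lemma small_instr_cls:
 assumes "icode_bounded m c" "i \<le> m" "cl \<in> set (instr_cls K i c)"
 shows "small_clause (K + m + 20) cl"
proof -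
 obtain op r s u where c: "c = (op, r, s, u)" by (metis prod_cases4)
 have bounds: "r < 4" "s \<le> m + 3" "u < 4" using assms(1) by (simp_all add: c icode_bounded_def)
 show ?thesis
 proof (cases "cl \<in> set (keep_cls K i r) \<union> set (keep_cls K i 4)")
  case True
  then have "small_clause (K + i + 15) cl" using small_keep_cls by blast
  then show ?thesis by (rule small_clause_mono) (use assms(2) in simp)
 next
  case False
  then show ?thesis using assms(2,3) bounds unfolding c instr_cls_def read_cls_def next_cls_def Let_def
   by (auto simp: small_clause_simps split: if_splits)
 qed
qed

lemma small_program_cls:
 assumes "\<forall>c\<in>set cs. icode_bounded m c" "length cs \<le> m" "cl \<in> set (program_cls K cs)"
 shows "small_clause (K + m + 20) cl"
proof -
 have "small_clause (K + m + 20) c" if "l < length cs" "c \<in> set (instr_cls K l (cs ! l))" for l c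
  using small_instr_cls[OF _ _ that(2)] that(1) assms(1,2) by simp
 then have "\<forall>c\<in>set (program_cls K cs). small_clause (K + m + 20) c" unfolding ball_program_cls by blast
 then show ?thesis using assms(3) by blast
qed

lemma small_groups:
 assumes cs: "\<forall>c\<in>set cs. icode_bounded m c" "length cs \<le> m" "rej \<le> m + 3"
  and cl: "(S, C) \<in> set (groups K cs rej)" "cl \<in> set C"
 shows "small_clause (4 * K + m + 30) cl"
proof -
 have index: "small_clause (4 * K + m + 30) cl" if "(S, C) \<in> set (index_groups K)"
  using that cl(2) by (auto simp: index_groups_def small_clause_simps)
 have start: "small_clause (4 * K + m + 30) cl" if "cl \<in> set (init_cls K) \<union> set (zero_cls K)"
  using that by (auto simp: init_cls_def zero_cls_def small_clause_simps)
 have row: "small_clause (4 * K + m + 30) cl" if "cl \<in> set (row_cls K rej)"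
  using that cs(3) by (auto simp: row_cls_def record_cls_def small_clause_simps)
 have program: "small_clause (4 * K + m + 30) cl" if "cl \<in> set (program_cls K cs)"
  using small_clause_mono[OF small_program_cls[OF cs(1,2) that]] by simp
 have network: "small_clause (4 * K + m + 30) cl" if group: "(S, C) \<in> set (network_groups K)"
 proof -
  obtain l where "l < 2 * K" "cl \<in> set (net_cls K l)"
   using group cl(2) by (auto simp: network_groups_def)
  then show ?thesis by (auto simp: net_cls_def small_clause_simps)
 qed
 show ?thesis using cl index start row program network unfolding groups_def by auto
qed

lemma length_groups_shape:
 assumes "(S, C) \<in> set (groups K cs rej)" "K \<ge> 1" "(\<pi>, \<pi>') \<in> set S"
 shows "length \<pi> = K" "length \<pi>' = K"
proof -
 have "length (bit_pat K p b) = K" if "p < K" for p b using that by (simp add: bit_pat_def)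
 then show "length \<pi> = K" "length \<pi>' = K"
  using assms nth_dims_less unfolding groups_def index_groups_def
  by (auto simp: network_groups_def bitS_def constS_def allS_def stepS_def tail_pat_def flipS_def)
qed

lemma csp_sat_iff:
 assumes K: "K \<ge> 1" and Pg: "\<forall>c\<in>set Pg. tplain c" "\<forall>c\<in>set Pg. icode_bounded (length Pg) (icode_of c)" "rej \<le> length Pg + 3"
  and n: "4 * K + length Pg + 30 \<le> n"
  and W: "\<And>x t. x \<in> rows K ==> tag_weight t \<le> n ==> W (x @ tag_code n t) = w x t"
 shows "sat (K + n) (csp K n (map icode_of Pg) rej) W \<longleftrightarrow> table_ok K Pg rej w"
proof -
 let ?G = "groups K (map icode_of Pg) rej"
 have family: "fam_ok W (K + n) (clause_family n (\<pi>, \<pi>') cl) \<longleftrightarrow> (\<forall>y\<in>rows K. holds w (inst \<pi> y) (inst \<pi>' y) cl)"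
  if "(S, C) \<in> set ?G" "(\<pi>, \<pi>') \<in> set S" "cl \<in> set C" for S C \<pi> \<pi>' cl
 proof (rule fam_ok_clause_family)
  have "small_clause (4 * K + length Pg + 30) cl" using small_groups[OF _ _ Pg(3) that(1,3)] Pg(2) by simp
  then show "small_clause n cl" using n by (rule small_clause_mono)
 qed (use length_groups_shape[OF that(1) K that(2)] W in auto)
 have "sat (K + n) (csp K n (map icode_of Pg) rej) W \<longleftrightarrow>
   (\<forall>(S, C)\<in>set ?G. \<forall>(\<pi>, \<pi>')\<in>set S. \<forall>cl\<in>set C. fam_ok W (K + n) (clause_family n (\<pi>, \<pi>') cl))"
  unfolding sat_def csp_def ball_concat_map by fastforce
 also have "\<dots> \<longleftrightarrow> (\<forall>(S, C)\<in>set ?G. \<forall>(\<pi>, \<pi>')\<in>set S. \<forall>cl\<in>set C. \<forall>y\<in>rows K. holds w (inst \<pi> y) (inst \<pi>' y) cl)"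
  using family by fastforce
 also have "\<dots> \<longleftrightarrow> (\<forall>g\<in>set ?G. group_ok K w g)" unfolding group_ok_def shape_rel_def by fastforce
 finally show ?thesis unfolding groups_ok[OF K Pg(1)] .
qed

subsection \<open>Correctness\<close>

definition csp_program :: "tinstr list => bool" where
 "csp_program Pg \<longleftrightarrow> (\<forall>c\<in>set Pg. small_regs c \<and> tplain c) \<and> (\<forall>r l. TJumpLf r l \<in> set Pg --> l \<le> length Pg + 3)"

lemma icode_bounded_icode_of:
 assumes "csp_program Pg" "c \<in> set Pg"
 shows "icode_bounded (length Pg) (icode_of c)"
proof -
 have "small_regs c" "tplain c" and "\<And>r l. c = TJumpLf r l ==> l \<le> length Pg + 3" using assms by (auto simp: csp_program_def)
 then show ?thesis by (cases c) (auto simp: small_regs_def icode_bounded_def tplain_def)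
qed

definition start :: "bits => tconf" where
 "start x = (0, %_. Lf, x, [])"

lemma fst_prun_pinit: "fst (prun {} Pg k 1 (pinit x)) = fst (trun {} Pg k (start x))"
 using psim_prun[OF pinv_pinit psim_pinit[of x], where n = k and A = "{}" and P = Pg] unfolding start_def
 by (cases "prun {} Pg k 1 (pinit x)"; cases "trun {} Pg k (0, %_. Lf, x, [])") auto

context
 fixes K n rej Pg
 assumes K: "K \<ge> 1" and Pg: "csp_program Pg" "rej \<le> length Pg + 3" and n: "4 * K + length Pg + 30 \<le> n"
begin

lemma csp_sat_iff_table:
 assumes "\<And>x t. x \<in> rows K ==> tag_weight t \<le> n ==> W (x @ tag_code n t) = w x t"
 shows "sat (K + n) (csp K n (map icode_of Pg) rej) W \<longleftrightarrow> table_ok K Pg rej w"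
 using csp_sat_iff[where W = W and w = w, OF K _ _ Pg(2) n assms] icode_bounded_icode_of[OF Pg(1)] Pg(1) unfolding csp_program_def by blast

lemma csp_sound:
 assumes "sat (K + n) (csp K n (map icode_of Pg) rej) W"
 shows "\<exists>xs. \<forall>x. fst (trun {} Pg (2 ^ K - 2) (start (xs @ x))) \<noteq> rej"
proof -
 have table: "table_ok K Pg rej (%x t. W (x @ tag_code n t))"
  using csp_sat_iff_table[of W "%x t. W (x @ tag_code n t)"] assms by simp
 have code: "\<forall>c\<in>set Pg. small_regs c \<and> tplain c" using Pg(1) unfolding csp_program_def by blast
 have "1 < (2 :: nat) ^ K" using K one_less_power[of "2 :: nat" K] by simp
 then have "2 ^ K - 2 + 1 < (2 :: nat) ^ K" by simp
 from table_sound[OF table K code this] show ?thesis unfolding fst_prun_pinit[symmetric] by (metis fst_conv)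
qed

lemma csp_complete:
 assumes "\<And>k. fst (trun {} Pg k (start x)) \<noteq> rej"
 shows "\<exists>W. sat (K + n) (csp K n (map icode_of Pg) rej) W"
proof -
 have "traced K Pg rej x" by unfold_locales (use K Pg(1) assms in \<open>auto simp: csp_program_def fst_prun_pinit[simplified]\<close>)
 then obtain w where table: "table_ok K Pg rej w" using traced.table_complete by blast
 define W where "W s \<longleftrightarrow> (\<exists>x\<in>rows K. \<exists>t. s = x @ tag_code n t \<and> w x t)" for s
 have "W (x @ tag_code n t) = w x t" if "x \<in> rows K" for x t
 proof -
  have "x' = x \<and> t' = t" if "x' \<in> rows K" "x @ tag_code n t = x' @ tag_code n t'" for x' t'
   using that \<open>x \<in> rows K\<close> tag_code_inj[of n t t'] by (simp add: rows_def)
  then show ?thesis unfolding W_def using that by blast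
 qed
 then show ?thesis using csp_sat_iff_table[of W w] table by blast
qed

end

lemma csp_families:
 assumes K: "K \<ge> 1" and Pg: "csp_program Pg" "rej \<le> length Pg + 3" and n: "4 * K + length Pg + 30 \<le> n"
  and fam: "fam \<in> set (csp K n (map icode_of Pg) rej)"
 shows "length fam \<le> 5 \<and> (\<forall>(\<pi>, b)\<in>set fam. length \<pi> = K + n \<and> (\<forall>i\<ge>K. i < K + n --> fst (\<pi> ! i)))"
proof -
 obtain S C \<pi> \<pi>' cl where group: "(S, C) \<in> set (groups K (map icode_of Pg) rej)" and shape: "(\<pi>, \<pi>') \<in> set S"
  and cl: "cl \<in> set C" and fam_eq: "fam = clause_family n (\<pi>, \<pi>') cl"
  using fam by (auto simp: csp_def)
 have "\<forall>c\<in>set (map icode_of Pg). icode_bounded (length Pg) c" using icode_bounded_icode_of[OF Pg(1)] by simp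
 from small_clause_mono[OF small_groups[OF this _ Pg(2) group cl] n] have small: "small_clause n cl" by simp
 then have code: "length (tag_code n t) = n" if "(r, t, b) \<in> set cl" for r t b
  using that unfolding small_clause_def by (auto intro!: length_tag_code)
 have "length fam \<le> 5" using small by (simp add: fam_eq clause_family_def small_clause_def)
 moreover have "length \<rho> = K + n \<and> (\<forall>i\<ge>K. i < K + n --> fst (\<rho> ! i))" if lit: "(\<rho>, b) \<in> set fam" for \<rho> b
 proof -
  obtain r t where "(r, t, b) \<in> set cl" "\<rho> = (if r then \<pi>' else \<pi>) @ const_pat (tag_code n t)"
   using lit by (auto simp: fam_eq clause_family_def)
  then show ?thesis using code length_groups_shape[OF group K shape] by (auto simp: nth_append const_pat_def)
 qed
 ultimately show ?thesis by blast
qed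

subsection \<open>The program of a stage\<close>

definition shift_icode :: "nat => icode => icode" where
 "shift_icode a = (%(op, r, s, u). (op, r, if op = 4 then s + a else s, u))"

fun shift_tinstr :: "nat => tinstr => tinstr" where
 "shift_tinstr a (TJumpLf r l) = TJumpLf r (l + a)"
| "shift_tinstr a c = c"

lemma icode_shift: "icode_of (shift_tinstr a c) = shift_icode a (icode_of c)"
 by (cases c) (auto simp: shift_icode_def)

lemma fcode_shift: "fcode (b + a) F = map (shift_tinstr a) (fcode b F)"
proof (induction F arbitrary: b)
 case (FPair F G)
 show ?case using FPair.IH(1)[of "b + 1"] FPair.IH(2)[of "b + flen F + 6"] by (simp add: algebra_simps)
next
 case (FComp F G)
 show ?case using FComp.IH(1)[of b] FComp.IH(2)[of "b + flen F"] by (simp add: algebra_simps)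
next
 case (FIf B F G)
 show ?case using FIf.IH(1)[of "b + 1"] FIf.IH(2)[of "b + flen B + 4"] FIf.IH(3)[of "b + flen B + flen F + 8"]
  by (simp add: algebra_simps)
next
 case (FWhile F)
 show ?case using FWhile.IH[of "b + 2"] by (simp add: algebra_simps)
qed auto

definition push_icode :: "nat => bool => icode list" where
 "push_icode r b = (if b then [(0, 2, 0, 0), (1, 2, 2, 2), (1, r, 2, r)] else [(0, 2, 0, 0), (1, r, 2, r)])"

definition load_bits :: "nat => bits => icode list" where
 "load_bits r bs = (0, r, 0, 0) # concat (map (push_icode r) (rev bs))"

definition loader :: "bits => bits => icode list" where
 "loader as bs = load_bits 0 as @ load_bits 1 bs @ [(1, 0, 0, 1)]"

definition full_code :: "icode list => bits => bits => icode list" where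
 "full_code e as bs = (let ld = loader as bs in
   ld @ map (shift_icode (length ld)) e @ [(4, 0, length ld + length e + 2, 0)])"

definition stage_csp :: "nat => nat => icode list => bits => bits => family list" where
 "stage_csp K n e as bs = csp K n (full_code e as bs) (length (loader as bs) + length e + 2)"

definition push_code :: "nat => bool => tinstr list" where
 "push_code r b = (if b then [TNil 2, TCons 2 2 2, TCons r 2 r] else [TNil 2, TCons r 2 r])"

definition load_bits_code :: "nat => bits => tinstr list" where
 "load_bits_code r bs = TNil r # concat (map (push_code r) (rev bs))"

definition loader_code :: "bits => bits => tinstr list" where
 "loader_code as bs = load_bits_code 0 as @ load_bits_code 1 bs @ [TCons 0 0 1]"

definition stage_code :: "fn => bits => bits => tinstr list" where
 "stage_code F as bs = (let l = length (loader_code as bs) in loader_code as bs @ fcode l F @ [TJumpLf 0 (l + flen F + 2)])"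

lemma load_bits_code_icode: "map icode_of (load_bits_code r bs) = load_bits r bs"
 unfolding load_bits_code_def load_bits_def by (induction bs rule: rev_induct) (auto simp: push_code_def push_icode_def)

lemma loader_code_icode: "map icode_of (loader_code as bs) = loader as bs"
 by (simp add: loader_code_def loader_def load_bits_code_icode)

lemma set_load_bits_code: "c \<in> set (load_bits_code r bs) ==> c \<in> {TNil r, TNil 2, TCons 2 2 2, TCons r 2 r}"
 by (auto simp: load_bits_code_def push_code_def split: if_splits)

lemma length_load_bits_code: "length (load_bits_code r bs) \<le> 3 * length bs + 1"
 unfolding load_bits_code_def by (induction bs rule: rev_induct) (auto simp: push_code_def)

lemma length_loader_code: "length (loader_code as bs) \<le> 3 * length as + 3 * length bs + 3"
 using length_load_bits_code[of 0 as] length_load_bits_code[of 1 bs] by (simp add: loader_code_def)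

lemma length_stage_code: "length (stage_code F as bs) = length (loader_code as bs) + flen F + 1"
 by (simp add: stage_code_def Let_def)

lemma stage_csp_eq: "stage_csp K n (map icode_of (fcode 0 F)) as bs =
  csp K n (map icode_of (stage_code F as bs)) (length (stage_code F as bs) + 1)"
proof -
 have len: "length (loader as bs) = length (loader_code as bs)" unfolding loader_code_icode[symmetric] by simp
 have "full_code (map icode_of (fcode 0 F)) as bs = map icode_of (stage_code F as bs)"
  using fcode_shift[of 0 "length (loader_code as bs)" F]
  by (simp add: full_code_def stage_code_def Let_def len loader_code_icode icode_shift comp_def)
 then show ?thesis by (simp add: stage_csp_def len length_stage_code)
qed

lemma plain_fcode: "plain F ==> c \<in> set (fcode a F) ==> tplain c"
 by (induction F arbitrary: a) (auto simp: tplain_def)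

lemma fcode_jumps: "TJumpLf r l \<in> set (fcode a F) ==> l \<le> a + flen F"
 by (induction F arbitrary: a) (force simp: algebra_simps)+

lemma csp_program_stage_code:
 assumes "plain F"
 shows "csp_program (stage_code F as bs)"
 unfolding csp_program_def
proof (intro conjI ballI allI impI)
 let ?l = "length (loader_code as bs)"
 have set_code: "set (stage_code F as bs) \<subseteq> {TNil 0, TNil 1, TNil 2, TCons 2 2 2, TCons 0 2 0, TCons 1 2 1, TCons 0 0 1} \<union>
   set (fcode ?l F) \<union> {TJumpLf 0 (?l + flen F + 2)}"
  using set_load_bits_code[of _ 0 as] set_load_bits_code[of _ 1 bs] by (auto simp: stage_code_def Let_def loader_code_def)
 fix c assume "c \<in> set (stage_code F as bs)"
 then show "small_regs c" "tplain c"
  using set_code small_regs_fcode[of c ?l F] plain_fcode[OF assms, of c ?l] by (auto simp: small_regs_def tplain_def)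
next
 fix r l assume "TJumpLf r l \<in> set (stage_code F as bs)"
 then show "l \<le> length (stage_code F as bs) + 3"
  using set_load_bits_code[of "TJumpLf r l" 0 as] set_load_bits_code[of "TJumpLf r l" 1 bs]
   fcode_jumps[of r l "length (loader_code as bs)" F]
  unfolding length_stage_code by (auto simp: stage_code_def Let_def loader_code_def)
qed

lemma trun_push:
 assumes "code_at P a (push_code r b)" "R r = enc cs" "r \<noteq> 2"
 shows "trun A P (length (push_code r b)) (a, R, i, q) = (a + length (push_code r b), R(2 := enc b, r := enc (b # cs)), i, q)"
 using assms by (cases b) (simp_all add: push_code_def code_simps step_simps fun_upd_twist)

lemma trun_pushes:
 assumes "code_at P a (concat (map (push_code r) bs))" "R r = enc cs" "r \<noteq> 2"
 shows "\<exists>R'. trun A P (length (concat (map (push_code r) bs))) (a, R, i, q) =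
   (a + length (concat (map (push_code r) bs)), R', i, q) \<and> R' r = enc (rev bs @ cs) \<and> (\<forall>s. s \<noteq> r \<and> s \<noteq> 2 --> R' s = R s)"
 using assms(1,2)
proof (induction bs arbitrary: a R cs)
 case Nil
 then show ?case by auto
next
 case (Cons b bs)
 let ?R = "R(2 := enc b, r := enc (b # cs))"
 have code: "code_at P a (push_code r b)" "code_at P (a + length (push_code r b)) (concat (map (push_code r) bs))"
  using Cons.prems(1) by (simp_all add: code_at_append)
 have "?R r = enc (b # cs)" by simp
 from Cons.IH[where R = ?R and cs = "b # cs", OF code(2) this] obtain R' where "trun A P (length (concat (map (push_code r) bs))) (a + length (push_code r b), ?R, i, q) =
   (a + length (push_code r b) + length (concat (map (push_code r) bs)), R', i, q)"
  "R' r = enc (rev bs @ b # cs)" "\<forall>s. s \<noteq> r \<and> s \<noteq> 2 --> R' s = ?R s" by blast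
 then show ?case using trun_push[where R = R and cs = cs, OF code(1) Cons.prems(2) assms(3), of A i q] by (intro exI[of _ R']) (simp add: trun_add add.assoc)
qed

lemma trun_load_bits_code:
 assumes "code_at P a (load_bits_code r bs)" "r \<noteq> 2"
 shows "\<exists>R'. trun A P (length (load_bits_code r bs)) (a, R, i, q) = (a + length (load_bits_code r bs), R', i, q) \<and>
  R' r = enc bs \<and> (\<forall>s. s \<noteq> r \<and> s \<noteq> 2 --> R' s = R s)"
proof -
 let ?n = "length (concat (map (push_code r) (rev bs)))"
 have code: "code_at P (Suc a) (concat (map (push_code r) (rev bs)))"
  using assms(1) by (simp add: load_bits_code_def code_at_Cons)
 have "(R(r := Lf)) r = enc ([] :: bits)" by simp
 from trun_pushes[where R = "R(r := Lf)" and cs = "[]", OF code this assms(2), of A i q] obtain R' where "trun A P ?n (Suc a, R(r := Lf), i, q) = (Suc a + ?n, R', i, q)"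
  "R' r = enc bs" "\<forall>s. s \<noteq> r \<and> s \<noteq> 2 --> R' s = (R(r := Lf)) s" by auto
 moreover have "trun A P (Suc ?n) (a, R, i, q) = trun A P ?n (Suc a, R(r := Lf), i, q)"
  using trun_Cons[OF assms(1)[unfolded load_bits_code_def]] by simp
 ultimately show ?thesis unfolding load_bits_code_def by (intro exI[of _ R']) simp
qed

lemma trun_loader_code:
 assumes "code_at P 0 (loader_code as bs)"
 shows "\<exists>R'. trun A P (length (loader_code as bs)) (0, R, i, q) = (length (loader_code as bs), R', i, q) \<and> R' 0 = enc (as, bs)"
proof -
 let ?a = "length (load_bits_code 0 as)" and ?b = "length (load_bits_code 1 bs)"
 have code: "code_at P 0 (load_bits_code 0 as)" "code_at P ?a (load_bits_code 1 bs)" "code_at P (?a + ?b) [TCons 0 0 1]"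
  using assms unfolding loader_code_def by (auto simp: code_at_append)
 obtain R1 where R1: "trun A P ?a (0, R, i, q) = (?a, R1, i, q)" "R1 0 = enc as"
  using trun_load_bits_code[OF code(1), of A R i q] by auto
 obtain R2 where R2: "trun A P ?b (?a, R1, i, q) = (?a + ?b, R2, i, q)" "R2 1 = enc bs" "R2 0 = enc as"
  using trun_load_bits_code[OF code(2), of A R1 i q] R1(2) by auto
 have "trun A P (?a + (?b + 1)) (0, R, i, q) = trun A P 1 (?a + ?b, R2, i, q)" by (simp only: trun_add R1(1) R2(1))
 then show ?thesis using R2 code(3) by (simp add: loader_code_def code_simps step_simps)
qed

lemma trun_idle: "length P \<le> pc ==> trun A P n (pc, R, i, q) = (pc, R, i, q)"
 by (induction n) (auto simp: trun_Suc tstep_def)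

lemma trun_halted:
 assumes "length P \<le> fst (trun A P j c)" "j \<le> k"
 shows "trun A P k c = trun A P j c"
proof -
 have "trun A P (j + (k - j)) c = trun A P j c"
  unfolding trun_add using assms(1) trun_idle by (cases "trun A P j c") simp
 then show ?thesis using assms(2) by simp
qed

lemma trun_stage_code:
 assumes run: "evals {} F (enc (as, bs), x, []) (y, i, q) t"
 shows "\<exists>k R. k \<le> 3 * length as + 3 * length bs + t + 3 \<and> trun {} (stage_code F as bs) k (start x) = (length (stage_code F as bs) - 1, R, i, q) \<and>
   trun {} (stage_code F as bs) (Suc k) (start x) = (length (stage_code F as bs) + of_bool (y = Lf), R, i, q)"
proof -
 let ?P = "stage_code F as bs" and ?l = "length (loader_code as bs)"
 have code: "code_at ?P 0 (loader_code as bs)" "code_at ?P ?l (fcode ?l F)" "code_at ?P (?l + flen F) [TJumpLf 0 (?l + flen F + 2)]"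
 proof -
  have "code_at ?P 0 ?P" unfolding code_at_def by (intro exI[of _ "[]"]) simp
  then show "code_at ?P 0 (loader_code as bs)" "code_at ?P ?l (fcode ?l F)" "code_at ?P (?l + flen F) [TJumpLf 0 (?l + flen F + 2)]"
   unfolding stage_code_def Let_def by (simp_all add: code_at_append)
 qed
 obtain R1 where R1: "trun {} ?P ?l (start x) = (?l, R1, x, [])" "R1 0 = enc (as, bs)"
  using trun_loader_code[OF code(1), of "{}" "%_. Lf" x "[]"] unfolding start_def by auto
 obtain R2 where R2: "trun {} ?P t (?l, R1, x, []) = (?l + flen F, R2, i, q)" "R2 0 = y"
  using segmentE[OF segment_fcode[OF run code(2)], of R1] R1(2) by auto
 have body: "trun {} ?P (?l + t) (start x) = (?l + flen F, R2, i, q)" by (simp only: trun_add R1(1) R2(1))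
 have "trun {} ?P (Suc (?l + t)) (start x) = trun {} ?P 1 (?l + flen F, R2, i, q)"
  unfolding Suc_eq_plus1 trun_add[of _ _ "?l + t"] body ..
 then have "trun {} ?P (Suc (?l + t)) (start x) = (length ?P + of_bool (y = Lf), R2, i, q)"
  using code(3) R2(2) by (simp add: code_simps step_simps length_stage_code)
 then show ?thesis using body length_loader_code[of as bs]
  by (intro exI[of _ "?l + t"] exI[of _ R2]) (simp add: length_stage_code)
qed

lemma stage_code_rejects_iff:
 assumes run: "evals {} F (enc (as, bs), x, []) (y, i, q) t" and j: "3 * length as + 3 * length bs + t + 4 \<le> j"
 shows "fst (trun {} (stage_code F as bs) j (start x)) = length (stage_code F as bs) + 1 \<longleftrightarrow> y = Lf"
proof -
 obtain k R where k: "k \<le> 3 * length as + 3 * length bs + t + 3"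
  and "trun {} (stage_code F as bs) (Suc k) (start x) = (length (stage_code F as bs) + of_bool (y = Lf), R, i, q)"
  using trun_stage_code[OF run] by blast
 then show ?thesis using trun_halted[of "stage_code F as bs" "{}" "Suc k" "start x" j] j by simp
qed

lemma stage_code_never_rejects:
 assumes run: "evals {} F (enc (as, bs), x, []) (y, i, q) t" and y: "y \<noteq> Lf"
 shows "fst (trun {} (stage_code F as bs) j (start x)) \<noteq> length (stage_code F as bs) + 1"
proof
 let ?P = "stage_code F as bs" and ?m = "3 * length as + 3 * length bs + t + 4 + j"
 assume rej: "fst (trun {} ?P j (start x)) = length ?P + 1"
 then have "trun {} ?P ?m (start x) = trun {} ?P j (start x)" by (intro trun_halted) auto
 then show False using stage_code_rejects_iff[OF run, of ?m] rej y by simp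
qed

theorem stage_csp_correct:
 assumes F: "plain F" and K: "K \<ge> 1" and n: "4 * K + 3 * length as + 3 * length bs + flen F + 40 \<le> n"
  and halts: "\<And>x. length x \<ge> m ==> \<exists>t y i q. evals {} F (enc (as, bs), x, []) (y, i, q) t \<and> (y \<noteq> Lf \<longleftrightarrow> acc x) \<and>
    3 * length as + 3 * length bs + t + 10 < 2 ^ K"
 shows "(\<exists>W. sat (K + n) (stage_csp K n (map icode_of (fcode 0 F)) as bs) W) \<longleftrightarrow> (\<exists>x. length x \<ge> m \<and> acc x)"
proof -
 let ?P = "stage_code F as bs"
 have n': "4 * K + length ?P + 30 \<le> n" using n length_loader_code[of as bs] by (simp add: length_stage_code)
 have rej: "length ?P + 1 \<le> length ?P + 3" by simp
 note sound = csp_sound[OF K csp_program_stage_code[OF F] rej n'] and complete = csp_complete[OF K csp_program_stage_code[OF F] rej n']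
 show ?thesis
  unfolding stage_csp_eq
 proof
  assume "\<exists>W. sat (K + n) (csp K n (map icode_of ?P) (length ?P + 1)) W"
  then obtain xs where xs: "\<And>x. fst (trun {} ?P (2 ^ K - 2) (start (xs @ x))) \<noteq> length ?P + 1" using sound by metis
  let ?x = "xs @ replicate m False"
  obtain t y i q where run: "evals {} F (enc (as, bs), ?x, []) (y, i, q) t" and acc: "y \<noteq> Lf \<longleftrightarrow> acc ?x"
   and time: "3 * length as + 3 * length bs + t + 10 < 2 ^ K" using halts[of ?x] by auto
  have "acc ?x" using stage_code_rejects_iff[OF run, of "2 ^ K - 2"] time xs acc by simp
  then show "\<exists>x. length x \<ge> m \<and> acc x" by (intro exI[of _ ?x]) simp
 next
  assume "\<exists>x. length x \<ge> m \<and> acc x"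
  then obtain x t y i q where "evals {} F (enc (as, bs), x, []) (y, i, q) t" "y \<noteq> Lf" using halts by blast
  from complete[OF stage_code_never_rejects[OF this]] show "\<exists>W. sat (K + n) (csp K n (map icode_of ?P) (length ?P + 1)) W" .
 qed
qed

lemma stage_csp_families:
 assumes "plain F" "K \<ge> 1" "4 * K + 3 * length as + 3 * length bs + flen F + 40 \<le> n"
  and "fam \<in> set (stage_csp K n (map icode_of (fcode 0 F)) as bs)"
 shows "length fam \<le> 5 \<and> (\<forall>(\<pi>, b)\<in>set fam. length \<pi> = K + n \<and> (\<forall>i\<ge>K. i < K + n --> fst (\<pi> ! i)))"
 using assms length_loader_code[of as bs] unfolding stage_csp_eq
 by (intro csp_families[OF assms(2) csp_program_stage_code[OF assms(1)]]) (simp_all add: length_stage_code)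

section \<open>Checking a circuit against a constraint system with MAX-SAT\<close>

text \<open>A gate assigns to every input position a pair: \<open>(True, b)\<close> for the literal with value \<open>b\<close>,
 \<open>(False, False)\<close> for no literal, and \<open>(False, True)\<close> makes the gate constantly false.\<close>

type_synonym gate = "(bool \<times> bool) list"

definition gate_eval :: "gate => bits => bool" where
 "gate_eval g x \<longleftrightarrow> (\<forall>((used, b), z)\<in>set (zip g x). if used then b = z else \<not> b)"

definition desc_eval :: "gate list \<times> bits => bits => bool" where
 "desc_eval = (%(gs, vs) x. nth_or False vs (length (filter (%g. gate_eval g x) gs)))"

subsection \<open>Restriction of gates to a pattern\<close>

definition dead :: "gate => pattern => bool" where
 "dead g \<pi> \<longleftrightarrow> (\<exists>((used, b), (fixed, c))\<in>set (zip g \<pi>). \<not> used \<and> b \<or> used \<and> fixed \<and> b \<noteq> c)"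

definition live_lits :: "gate => pattern => literal list" where
 "live_lits g \<pi> = map (%(((used, b), (fixed, c)), i). (i, b))
   (filter (%(((used, b), (fixed, c)), i). used \<and> \<not> fixed) (zip (zip g \<pi>) [0..<length g]))"

definition restrict_gates :: "gate list => pattern => literal list list" where
 "restrict_gates gs \<pi> = map (%g. live_lits g \<pi>) (filter (%g. \<not> dead g \<pi>) gs)"

definition conj_true :: "(nat => bool) => literal list => bool" where
 "conj_true \<alpha> u \<longleftrightarrow> (\<forall>(i, b)\<in>set u. \<alpha> i = b)"

lemma zip_eq_map_nth: "length xs = length ys ==> zip xs ys = map (%i. (xs ! i, ys ! i)) [0..<length xs]"
 by (intro nth_equalityI) auto

lemma gate_eval_nth:
 "length g = length x ==> gate_eval g x \<longleftrightarrow> (\<forall>i<length g. if fst (g ! i) then snd (g ! i) = x ! i else \<not> snd (g ! i))"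
 unfolding gate_eval_def by (auto simp: zip_eq_map_nth split_def)

lemma dead_nth:
 "length g = length \<pi> ==> dead g \<pi> \<longleftrightarrow> (\<exists>i<length g. \<not> fst (g ! i) \<and> snd (g ! i) \<or>
   fst (g ! i) \<and> fst (\<pi> ! i) \<and> snd (g ! i) \<noteq> snd (\<pi> ! i))"
 unfolding dead_def by (auto simp: zip_eq_map_nth split_def)

lemma conj_true_live_lits:
 assumes "length g = length \<pi>"
 shows "conj_true \<alpha> (live_lits g \<pi>) \<longleftrightarrow> (\<forall>i<length g. fst (g ! i) \<and> \<not> fst (\<pi> ! i) --> \<alpha> i = snd (g ! i))"
proof -
 have zip: "zip (zip g \<pi>) [0..<length g] = map (%i. ((g ! i, \<pi> ! i), i)) [0..<length g]"
  using assms by (intro nth_equalityI) auto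
 show ?thesis unfolding conj_true_def live_lits_def zip filter_map split_def comp_def by auto
qed

lemma live_lits_less: "(i, b) \<in> set (live_lits g \<pi>) ==> i < length g"
 by (auto simp: live_lits_def dest!: set_zip_rightD)

lemma gate_eval_inst:
 assumes "length g = L" "length \<pi> = L" "length y = L"
 shows "gate_eval g (inst \<pi> y) \<longleftrightarrow> \<not> dead g \<pi> \<and> conj_true ((!) y) (live_lits g \<pi>)"
proof -
 have "inst \<pi> y ! i = (if fst (\<pi> ! i) then snd (\<pi> ! i) else y ! i)" if "i < L" for i
  using assms that by (simp add: inst_def split_def)
 then have gate: "gate_eval g (inst \<pi> y) \<longleftrightarrow>
   (\<forall>i<L. if fst (g ! i) then snd (g ! i) = (if fst (\<pi> ! i) then snd (\<pi> ! i) else y ! i) else \<not> snd (g ! i))"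
  using gate_eval_nth[of g "inst \<pi> y"] assms by (simp add: length_inst)
 have len: "length g = length \<pi>" using assms by simp
 show ?thesis unfolding gate dead_nth[OF len] conj_true_live_lits[OF len] assms(1) by auto
qed

definition true_count :: "(nat => bool) => literal list list => nat" where
 "true_count \<alpha> Gs = length (filter (conj_true \<alpha>) Gs)"

lemma true_count_Nil [simp]: "true_count \<alpha> [] = 0"
 and true_count_Cons [simp]: "true_count \<alpha> (u # Gs) = of_bool (conj_true \<alpha> u) + true_count \<alpha> Gs"
 by (simp_all add: true_count_def)

lemma true_count_le: "true_count \<alpha> Gs \<le> length Gs"
 by (simp add: true_count_def)

lemma desc_eval_inst:
 assumes "\<forall>g\<in>set gs. length g = L" "length \<pi> = L" "length y = L"
 shows "desc_eval (gs, vs) (inst \<pi> y) = nth_or False vs (true_count ((!) y) (restrict_gates gs \<pi>))"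
proof -
 have "length (filter (%g. gate_eval g (inst \<pi> y)) gs) = true_count ((!) y) (restrict_gates gs \<pi>)"
  using assms(1)
 proof (induction gs)
  case (Cons g gs)
  then show ?case using gate_eval_inst[of g L \<pi> y] assms(2,3) by (simp add: restrict_gates_def)
 qed (simp add: restrict_gates_def)
 then show ?thesis by (simp add: desc_eval_def)
qed

subsection \<open>Prescribed counts as a MAX-SAT question\<close>

text \<open>A slot \<open>(Gs, a)\<close> asks for an assignment under which exactly \<open>a\<close> of the conjunctions in \<open>Gs\<close> are true.\<close>

type_synonym slot = "literal list list \<times> nat"

definition negate :: "literal list => literal list" where
 "negate u = map (%(i, b). (i, \<not> b)) u"

definition conj_cnf :: "literal list => cnf" where
 "conj_cnf u = map (%j. negate (take j u) @ take 1 (drop j u)) [0..<length u]"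

definition slot_cnf :: "slot => cnf" where
 "slot_cnf = (%(Gs, a). concat (map (%u. map (%v. negate u @ negate v) Gs) Gs) @ concat (replicate (2 * a) (concat (map conj_cnf Gs))))"

definition slots_cnf :: "slot list => cnf" where
 "slots_cnf S = [[], []] @ concat (map slot_cnf S)"

definition slots_loss :: "slot list => nat" where
 "slots_loss S = (\<Sum>(Gs, a)\<leftarrow>S. a * (2 * length Gs - a)) + 2"

definition unsat :: "(nat => bool) => cnf => nat" where
 "unsat \<alpha> F = length (filter (%C. \<not> clause_true \<alpha> C) F)"

lemma unsat_append: "unsat \<alpha> (F @ G) = unsat \<alpha> F + unsat \<alpha> G"
 by (simp add: unsat_def)

lemma unsat_Nil [simp]: "unsat \<alpha> [] = 0"
 by (simp add: unsat_def)

lemma unsat_concat: "unsat \<alpha> (concat Fs) = sum_list (map (unsat \<alpha>) Fs)"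
 by (induction Fs) (simp_all add: unsat_append)

lemma clause_negate: "clause_true \<alpha> (negate u @ C) \<longleftrightarrow> \<not> conj_true \<alpha> u \<or> clause_true \<alpha> C"
 by (simp add: clause_true_def negate_def conj_true_def split_def bex_Un)

lemma unsat_conj_cnf: "unsat \<alpha> (conj_cnf u) = of_bool (\<not> conj_true \<alpha> u)"
proof (induction u rule: rev_induct)
 case Nil
 then show ?case by (simp add: conj_cnf_def unsat_def conj_true_def)
next
 case (snoc l u)
 have "conj_cnf (u @ [l]) = conj_cnf u @ [negate u @ [l]]" unfolding conj_cnf_def by (simp add: negate_def)
 moreover have "unsat \<alpha> [negate u @ [l]] = of_bool (conj_true \<alpha> u \<and> \<alpha> (fst l) \<noteq> snd l)"
  by (simp add: unsat_def clause_negate) (simp add: clause_true_def split_def)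
 moreover have "conj_true \<alpha> (u @ [l]) \<longleftrightarrow> conj_true \<alpha> u \<and> \<alpha> (fst l) = snd l" by (auto simp: conj_true_def split_def)
 ultimately show ?case using snoc by (auto simp: unsat_append)
qed

lemma unsat_conj_cnfs: "unsat \<alpha> (concat (map conj_cnf Gs)) = length Gs - true_count \<alpha> Gs"
 by (induction Gs) (use true_count_le in \<open>auto simp: unsat_append unsat_conj_cnf Suc_diff_le\<close>)

lemma unsat_pairs: "unsat \<alpha> (concat (map (%u. map (%v. negate u @ negate v) Gs) Gs)) = (true_count \<alpha> Gs)\<^sup>2"
proof -
 have "clause_true \<alpha> (negate v) \<longleftrightarrow> \<not> conj_true \<alpha> v" for v
  using clause_negate[of \<alpha> v "[]"] by (simp add: clause_true_def[of _ "[]"])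
 then have "unsat \<alpha> (map (%v. negate u @ negate v) Gs) = of_bool (conj_true \<alpha> u) * true_count \<alpha> Gs" for u
  by (simp add: unsat_def filter_map comp_def clause_negate true_count_def)
 then have "unsat \<alpha> (concat (map (%u. map (%v. negate u @ negate v) Gs) Hs)) = true_count \<alpha> Hs * true_count \<alpha> Gs" for Hs
  by (induction Hs) (simp_all add: unsat_append add_mult_distrib)
 then show ?thesis by (simp add: power2_eq_square)
qed

lemma unsat_slot: "unsat \<alpha> (slot_cnf (Gs, a)) = (true_count \<alpha> Gs)\<^sup>2 + 2 * a * (length Gs - true_count \<alpha> Gs)"
proof -
 have "unsat \<alpha> (concat (replicate k F)) = k * unsat \<alpha> F" for k F by (induction k) (simp_all add: unsat_append)
 then show ?thesis by (simp add: slot_cnf_def unsat_append unsat_pairs unsat_conj_cnfs)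
qed

lemma slot_loss_minimal:
 fixes a c s :: nat
 assumes "a \<le> s" "c \<le> s"
 shows "a * (2 * s - a) \<le> c\<^sup>2 + 2 * a * (s - c)" "c\<^sup>2 + 2 * a * (s - c) = a * (2 * s - a) \<longleftrightarrow> c = a"
proof -
 have diff: "int (2 * s - a) = 2 * int s - int a" "int (s - c) = int s - int c" using assms by auto
 have eq: "int (c\<^sup>2 + 2 * a * (s - c)) = int (a * (2 * s - a)) + (int c - int a)\<^sup>2"
  unfolding of_nat_add of_nat_mult of_nat_power diff by (simp add: power2_eq_square algebra_simps)
 have "int (a * (2 * s - a)) \<le> int (c\<^sup>2 + 2 * a * (s - c))" unfolding eq by simp
 then show "a * (2 * s - a) \<le> c\<^sup>2 + 2 * a * (s - c)" by linarith
 have "c\<^sup>2 + 2 * a * (s - c) = a * (2 * s - a) \<longleftrightarrow> int (c\<^sup>2 + 2 * a * (s - c)) = int (a * (2 * s - a))" by linarith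
 also have "\<dots> \<longleftrightarrow> c = a" unfolding eq by simp
 finally show "c\<^sup>2 + 2 * a * (s - c) = a * (2 * s - a) \<longleftrightarrow> c = a" .
qed

lemma unsat_slots_cnf: "unsat \<alpha> (slots_cnf S) = (\<Sum>p\<leftarrow>S. unsat \<alpha> (slot_cnf p)) + 2"
 unfolding slots_cnf_def unsat_append unsat_concat by (simp add: unsat_def[of _ "[[], []]"] clause_true_def comp_def)

lemma unsat_slots:
 assumes "\<forall>(Gs, a)\<in>set S. a \<le> length Gs"
 shows "slots_loss S \<le> unsat \<alpha> (slots_cnf S) \<and>
  (unsat \<alpha> (slots_cnf S) = slots_loss S \<longleftrightarrow> (\<forall>(Gs, a)\<in>set S. true_count \<alpha> Gs = a))"
 using assms unfolding unsat_slots_cnf slots_loss_def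
proof (induction S)
 case (Cons p S)
 obtain Gs a where p: "p = (Gs, a)" by (cases p)
 let ?loss = "a * (2 * length Gs - a)" and ?unsat = "unsat \<alpha> (slot_cnf p)"
 have "?loss \<le> ?unsat" "?unsat = ?loss \<longleftrightarrow> true_count \<alpha> Gs = a"
  using slot_loss_minimal[of a "length Gs" "true_count \<alpha> Gs"] true_count_le[of \<alpha> Gs] Cons.prems by (auto simp: p unsat_slot)
 then show ?case using Cons by (auto simp: p)
qed simp

lemma max_sat_unsat:
 assumes "\<And>\<alpha>. k \<le> unsat \<alpha> F"
 shows "max_sat F = length F - k \<longleftrightarrow> (\<exists>\<alpha>. unsat \<alpha> F = k)"
proof -
 have count: "length (filter (clause_true \<alpha>) F) = length F - unsat \<alpha> F" "unsat \<alpha> F \<le> length F" for \<alpha>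
  using sum_length_filter_compl[of "clause_true \<alpha>" F] by (auto simp: unsat_def)
 let ?R = "range (%\<alpha>. length (filter (clause_true \<alpha>) F))"
 have fin: "finite ?R" by (rule finite_subset[of _ "{..length F}"]) auto
 show ?thesis
 proof
  assume max: "max_sat F = length F - k"
  have "max_sat F \<in> ?R" unfolding max_sat_def using fin by (intro Max_in) auto
  then obtain \<alpha> where "max_sat F = length F - unsat \<alpha> F" using count by auto
  then have "unsat \<alpha> F = k" using max count(2)[of \<alpha>] assms[of \<alpha>] by linarith
  then show "\<exists>\<alpha>. unsat \<alpha> F = k" by blast
 next
  assume "\<exists>\<alpha>. unsat \<alpha> F = k"
  then have "length F - k \<in> ?R" using count(1) by (metis rangeI)
  moreover have "x \<le> length F - k" if "x \<in> ?R" for x using that count(1) assms diff_le_mono2 by auto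
  ultimately show "max_sat F = length F - k" unfolding max_sat_def using fin by (intro Max_eqI) auto
 qed
qed

lemma max_sat_slots:
 assumes "\<forall>(Gs, a)\<in>set S. a \<le> length Gs"
 shows "max_sat (slots_cnf S) = length (slots_cnf S) - slots_loss S \<longleftrightarrow> (\<exists>\<alpha>. \<forall>(Gs, a)\<in>set S. true_count \<alpha> Gs = a)"
proof -
 have "slots_loss S \<le> unsat \<alpha> (slots_cnf S)" for \<alpha> using unsat_slots[OF assms] by blast
 from max_sat_unsat[OF this] show ?thesis using unsat_slots[OF assms] by simp
qed

subsection \<open>Violated families\<close>

definition choices :: "gate list \<times> bits => pattern \<times> bool => slot list" where
 "choices = (%(gs, vs) (\<pi>, b). let Gs = restrict_gates gs \<pi> in
   map (%a. (Gs, a)) (filter (%a. nth_or False vs a \<noteq> b) [0..<Suc (length Gs)]))"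

text \<open>Constraints have at most five literals; the explicit bound makes the number of tuples polynomial.\<close>

definition tuples :: "gate list \<times> bits => family => slot list list" where
 "tuples D fam = product_lists (map (choices D) (take 5 fam))"

lemma product_lists_ex: "(\<exists>xs\<in>set (product_lists xss). \<forall>x\<in>set xs. Q x) \<longleftrightarrow> (\<forall>ys\<in>set xss. \<exists>x\<in>set ys. Q x)"
 by (induction xss) auto

lemma tuples_choices: "S \<in> set (tuples D fam) ==> p \<in> set S ==> \<exists>l\<in>set fam. p \<in> set (choices D l)"
 unfolding tuples_def product_lists_set by (force simp: list_all2_conv_all_nth in_set_conv_nth)

lemma choices_less: "(Gs, a) \<in> set (choices D l) ==> a \<le> length Gs"
 by (auto simp: choices_def Let_def split: prod.splits simp del: upt_Suc)

lemma choices_gates: "(Gs, a) \<in> set (choices D l) ==> Gs = restrict_gates (fst D) (fst l)"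
 by (auto simp: choices_def Let_def split: prod.splits)

lemma desc_eval_choices:
 assumes "\<forall>g\<in>set (fst D). length g = L" "length \<pi> = L" "length y = L"
 shows "desc_eval D (inst \<pi> y) \<noteq> b \<longleftrightarrow> (\<exists>(Gs, a)\<in>set (choices D (\<pi>, b)). true_count ((!) y) Gs = a)"
proof -
 obtain gs vs where D: "D = (gs, vs)" by (cases D)
 let ?Gs = "restrict_gates gs \<pi>"
 have "desc_eval D (inst \<pi> y) = nth_or False vs (true_count ((!) y) ?Gs)"
  unfolding D using assms by (intro desc_eval_inst) (auto simp: D)
 moreover have "true_count ((!) y) ?Gs < Suc (length ?Gs)" using true_count_le by (simp add: less_Suc_eq_le)
 ultimately show ?thesis by (auto simp: D choices_def Let_def simp del: upt_Suc)
qed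

lemma conj_true_prefix:
 assumes "\<And>i b. (i, b) \<in> set u ==> i < L"
 shows "conj_true \<alpha> u \<longleftrightarrow> conj_true ((!) (map \<alpha> [0..<L])) u"
 using assms unfolding conj_true_def by fastforce

lemma true_count_prefix:
 assumes "\<forall>g\<in>set gs. length g = L"
 shows "true_count \<alpha> (restrict_gates gs \<pi>) = true_count ((!) (map \<alpha> [0..<L])) (restrict_gates gs \<pi>)"
 unfolding true_count_def
proof (rule arg_cong[of _ _ length], rule filter_cong[OF refl])
 fix u assume "u \<in> set (restrict_gates gs \<pi>)"
 then obtain g where "g \<in> set gs" "u = live_lits g \<pi>" by (auto simp: restrict_gates_def)
 then show "conj_true \<alpha> u = conj_true ((!) (map \<alpha> [0..<L])) u"
  using assms by (intro conj_true_prefix) (use live_lits_less in \<open>fastforce\<close>)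
qed

theorem fam_ok_tuples:
 assumes D: "\<forall>g\<in>set (fst D). length g = L" and fam: "length fam \<le> 5" "\<forall>(\<pi>, b)\<in>set fam. length \<pi> = L"
 shows "fam_ok (desc_eval D) L fam \<longleftrightarrow>
  (\<forall>S\<in>set (tuples D fam). max_sat (slots_cnf S) \<noteq> length (slots_cnf S) - slots_loss S)"
proof -
 have "\<not> fam_ok (desc_eval D) L fam \<longleftrightarrow> (\<exists>y\<in>rows L. \<forall>(\<pi>, b)\<in>set fam. desc_eval D (inst \<pi> y) \<noteq> b)"
  unfolding fam_ok_def by blast
 also have "\<dots> \<longleftrightarrow> (\<exists>y\<in>rows L. \<forall>l\<in>set fam. \<exists>(Gs, a)\<in>set (choices D l). true_count ((!) y) Gs = a)"
 proof -
  have "(case l of (\<pi>, b) => desc_eval D (inst \<pi> y) \<noteq> b) \<longleftrightarrow> (\<exists>(Gs, a)\<in>set (choices D l). true_count ((!) y) Gs = a)"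
   if "l \<in> set fam" "y \<in> rows L" for l y
  proof -
   obtain \<pi> b where l: "l = (\<pi>, b)" by (cases l)
   have "length \<pi> = L" "length y = L" using that fam(2) by (auto simp: l rows_def)
   from desc_eval_choices[OF D this] show ?thesis by (simp add: l)
  qed
  then show ?thesis by (intro bex_cong ball_cong refl)
 qed
 also have "\<dots> \<longleftrightarrow> (\<exists>y\<in>rows L. \<exists>S\<in>set (tuples D fam). \<forall>(Gs, a)\<in>set S. true_count ((!) y) Gs = a)"
  unfolding tuples_def product_lists_ex using fam(1) by simp
 also have "\<dots> \<longleftrightarrow> (\<exists>S\<in>set (tuples D fam). \<exists>\<alpha>. \<forall>(Gs, a)\<in>set S. true_count \<alpha> Gs = a)"
 proof -
  have prefix: "true_count \<alpha> Gs = true_count ((!) (map \<alpha> [0..<L])) Gs" if mem: "S \<in> set (tuples D fam)" "(Gs, a) \<in> set S" for S Gs a \<alpha>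
  proof -
   obtain l where "(Gs, a) \<in> set (choices D l)" using tuples_choices[OF mem] by blast
   then have Gs: "Gs = restrict_gates (fst D) (fst l)" by (rule choices_gates)
   show ?thesis unfolding Gs by (rule true_count_prefix[OF D])
  qed
  have "(\<exists>y\<in>rows L. \<forall>(Gs, a)\<in>set S. true_count ((!) y) Gs = a) \<longleftrightarrow> (\<exists>\<alpha>. \<forall>(Gs, a)\<in>set S. true_count \<alpha> Gs = a)"
   if S: "S \<in> set (tuples D fam)" for S
  proof
   assume "\<exists>\<alpha>. \<forall>(Gs, a)\<in>set S. true_count \<alpha> Gs = a"
   then obtain \<alpha> where "\<forall>(Gs, a)\<in>set S. true_count \<alpha> Gs = a" by blast
   then have "\<forall>(Gs, a)\<in>set S. true_count ((!) (map \<alpha> [0..<L])) Gs = a" using prefix[OF S, of _ _ \<alpha>] by auto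
   moreover have "map \<alpha> [0..<L] \<in> rows L" by (simp add: rows_def)
   ultimately show "\<exists>y\<in>rows L. \<forall>(Gs, a)\<in>set S. true_count ((!) y) Gs = a" by blast
  qed blast
  then show ?thesis by blast
 qed
 also have "\<dots> \<longleftrightarrow> (\<exists>S\<in>set (tuples D fam). max_sat (slots_cnf S) = length (slots_cnf S) - slots_loss S)"
 proof -
  have "\<forall>(Gs, a)\<in>set S. a \<le> length Gs" if "S \<in> set (tuples D fam)" for S
   using tuples_choices[OF that] choices_less by blast
  then show ?thesis using max_sat_slots by blast
 qed
 finally show ?thesis by blast
qed

section \<open>The stages as polynomial-time functions\<close>

definition desc_len :: "nat => nat => nat" where
 "desc_len s L = s * (2 * L) + s + 1"

definition decode_gate :: "nat => bits => gate" where
 "decode_gate L b = zip (take L b) (take L (drop L b))"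

definition decode_desc :: "nat => nat => bits => gate list \<times> bits" where
 "decode_desc s L b = (map (%i. decode_gate L (drop (2 * L * i) b)) [0..<s], drop (2 * L * s) b)"

definition is_desc :: "nat => nat => gate list \<times> bits => bool" where
 "is_desc s L = (%(gs, vs). length gs = s \<and> (\<forall>g\<in>set gs. length g = L) \<and> length vs = s + 1)"

lemma is_desc_decode_desc:
 assumes "length b = desc_len s L"
 shows "is_desc s L (decode_desc s L b)"
proof -
 have "length (decode_gate L (drop (2 * L * i) b)) = L" if "i < s" for i
 proof -
  have "2 * L * Suc i \<le> 2 * L * s" using that by (intro mult_le_mono2) simp
  then show ?thesis using assms by (simp add: decode_gate_def desc_len_def mult_ac)
 qed
 moreover have "length (drop (2 * L * s) b) = s + 1" using assms by (simp add: desc_len_def mult_ac)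
 ultimately show ?thesis by (auto simp: is_desc_def decode_desc_def)
qed

definition encode_gate :: "gate => bits" where
 "encode_gate g = map fst g @ map snd g"

lemma decode_encode_gate: "length g = L ==> decode_gate L (encode_gate g @ b) = g"
 by (auto simp: decode_gate_def encode_gate_def zip_map_fst_snd)

lemma drop_encode_gates:
 "\<forall>g\<in>set gs. length g = L ==> i \<le> length gs ==>
  drop (2 * L * i) (concat (map encode_gate gs) @ b) = concat (map encode_gate (drop i gs)) @ b"
proof (induction gs arbitrary: i)
 case (Cons g gs)
 then show ?case by (cases i) (simp_all add: encode_gate_def)
qed simp

lemma decode_desc_surj:
 assumes "is_desc s L D"
 shows "\<exists>b. length b = desc_len s L \<and> decode_desc s L b = D"
proof -
 obtain gs vs where D: "D = (gs, vs)" by (cases D)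
 have gs: "length gs = s" "\<forall>g\<in>set gs. length g = L" and vs: "length vs = s + 1" using assms by (auto simp: D is_desc_def)
 let ?b = "concat (map encode_gate gs) @ vs"
 have "length (concat (map encode_gate hs)) = 2 * L * length hs" if "\<forall>g\<in>set hs. length g = L" for hs
  using that by (induction hs) (auto simp: encode_gate_def)
 then have "length ?b = desc_len s L" using gs vs by (simp add: desc_len_def mult_ac)
 moreover have "decode_gate L (drop (2 * L * i) ?b) = gs ! i" if "i < s" for i
 proof -
  have "drop i gs = gs ! i # drop (Suc i) gs" using that gs(1) by (simp add: Cons_nth_drop_Suc)
  then have "drop (2 * L * i) ?b = encode_gate (gs ! i) @ concat (map encode_gate (drop (Suc i) gs)) @ vs"
   using drop_encode_gates[OF gs(2), of i vs] that gs(1) by simp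
  then show ?thesis using decode_encode_gate gs that by simp
 qed
 then have "map (%i. decode_gate L (drop (2 * L * i) ?b)) [0..<s] = gs" using gs(1) by (intro nth_equalityI) auto
 moreover have "drop (2 * L * s) ?b = vs" using drop_encode_gates[OF gs(2), of s vs] gs(1) by simp
 ultimately show ?thesis by (intro exI[of _ ?b]) (simp add: decode_desc_def D)
qed

definition gate_of :: "bits => nat => literal list => gate" where
 "gate_of w L G = map (%p. if (\<exists>(i, b)\<in>set G. i < length w \<and> w ! i \<noteq> b) \<or>
    ((length w + p, True) \<in> set G \<and> (length w + p, False) \<in> set G) then (False, True)
   else if (length w + p, True) \<in> set G then (True, True)
   else if (length w + p, False) \<in> set G then (True, False) else (False, False)) [0..<L]"

lemma literals_append:
 assumes "\<forall>(i, b)\<in>set G. i < length w + L"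
 shows "(\<forall>(i, b)\<in>set G. (w @ x) ! i = b) \<longleftrightarrow>
   \<not> (\<exists>(i, b)\<in>set G. i < length w \<and> w ! i \<noteq> b) \<and> (\<forall>p<L. \<forall>b. (length w + p, b) \<in> set G --> x ! p = b)" (is "?all \<longleftrightarrow> ?split")
proof
 assume all: ?all
 then have "\<not> (\<exists>(i, b)\<in>set G. i < length w \<and> w ! i \<noteq> b)" by (force simp: nth_append)
 moreover have "x ! p = b" if "(length w + p, b) \<in> set G" for p b using bspec[OF all that] by (simp add: nth_append)
 ultimately show ?split by blast
next
 assume split: ?split
 show ?all
 proof clarify
  fix i b assume lit: "(i, b) \<in> set G"
  show "(w @ x) ! i = b"
  proof (cases "i < length w")
   case True
   then show ?thesis using split lit by (auto simp: nth_append)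
  next
   case False
   then have "(length w + (i - length w), b) \<in> set G" "i - length w < L" using lit assms by auto
   then show ?thesis using split False by (auto simp: nth_append)
  qed
 qed
qed

lemma gate_eval_gate_of:
 assumes "length x = L" "L \<ge> 1" "\<forall>(i, b)\<in>set G. i < length w + L"
 shows "gate_eval (gate_of w L G) x \<longleftrightarrow> (\<forall>(i, b)\<in>set G. (w @ x) ! i = b)"
proof -
 let ?g = "gate_of w L G" and ?bad = "\<exists>(i, b)\<in>set G. i < length w \<and> w ! i \<noteq> b" and ?m = "%p b. (length w + p, b) \<in> set G"
 have position: "(if fst (?g ! p) then snd (?g ! p) = x ! p else \<not> snd (?g ! p)) \<longleftrightarrow> \<not> ?bad \<and> (\<forall>b. ?m p b --> x ! p = b)"
  if "p < L" for p
  using that unfolding gate_of_def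
  by (cases ?bad; cases "?m p True"; cases "?m p False") (simp_all add: all_bool_eq)
 have "length ?g = L" by (simp add: gate_of_def)
 then have "gate_eval ?g x \<longleftrightarrow> (\<forall>p<L. if fst (?g ! p) then snd (?g ! p) = x ! p else \<not> snd (?g ! p))"
  using gate_eval_nth[of ?g x] assms(1) by simp
 also have "\<dots> \<longleftrightarrow> (\<forall>p<L. \<not> ?bad \<and> (\<forall>b. ?m p b --> x ! p = b))" using position by (simp only: cong: imp_cong)
 also have "\<dots> \<longleftrightarrow> \<not> ?bad \<and> (\<forall>p<L. \<forall>b. ?m p b --> x ! p = b)" using assms(2) by auto
 also have "\<dots> \<longleftrightarrow> (\<forall>(i, b)\<in>set G. (w @ x) ! i = b)" unfolding literals_append[OF assms(3)] ..
 finally show ?thesis .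
qed

lemma circuit_is_desc:
 assumes circuit: "circuit_on (length w + L) (SymAnd f Gs)" and L: "L \<ge> 1" and s: "length Gs \<le> s"
 shows "\<exists>D. is_desc s L D \<and> (\<forall>x. length x = L --> desc_eval D x = circuit_eval (SymAnd f Gs) (w @ x))"
proof -
 define gs where "gs = map (gate_of w L) Gs @ replicate (s - length Gs) (replicate L (False, True))"
 have len: "length gs = s" using s by (simp add: gs_def)
 have "is_desc s L (gs, map f [0..<s + 1])" using len by (auto simp: is_desc_def gs_def gate_of_def)
 moreover have "desc_eval (gs, map f [0..<s + 1]) x = circuit_eval (SymAnd f Gs) (w @ x)" if x: "length x = L" for x
 proof -
  have "\<not> gate_eval (replicate L (False, True)) x" using x L by (simp add: gate_eval_nth Suc_le_eq) blast
  then have "filter (%g. gate_eval g x) gs = filter (%g. gate_eval g x) (map (gate_of w L) Gs)"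
   by (auto simp: gs_def filter_empty_conv)
  moreover have "length (filter (%g. gate_eval g x) (map (gate_of w L) Gs)) = (\<Sum>G\<leftarrow>Gs. of_bool (\<forall>(i, b)\<in>set G. (w @ x) ! i = b))"
   using circuit
  proof (induction Gs)
   case (Cons G Gs)
   have "gate_eval (gate_of w L G) x \<longleftrightarrow> (\<forall>(i, b)\<in>set G. (w @ x) ! i = b)"
    using Cons.prems by (intro gate_eval_gate_of[OF x L]) auto
   then show ?case using Cons by simp
  qed simp
  ultimately have "length (filter (%g. gate_eval g x) gs) = (\<Sum>G\<leftarrow>Gs. of_bool (\<forall>(i, b)\<in>set G. (w @ x) ! i = b))" by simp
  moreover have "length (filter (%g. gate_eval g x) gs) < s + 1"
   using length_filter_le[of "%g. gate_eval g x" gs] len by linarith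
  ultimately show ?thesis by (simp add: desc_eval_def nth_or_nth del: upt_Suc)
 qed
 ultimately show ?thesis by blast
qed

lemma bin_bits: "bin n = map (bit n) [0..<floorlog 2 n]"
proof (induction n rule: bin.induct)
 case (1 n)
 show ?case
 proof (cases "n = 0")
  case False
  have len: "floorlog 2 n = Suc (floorlog 2 (n div 2))"
   using False by (subst compute_floorlog) simp
  have "map (bit n) [0..<floorlog 2 n] = bit n 0 # map (%j. bit n (Suc j)) [0..<floorlog 2 (n div 2)]"
   unfolding len by (simp add: upt_conv_Cons map_Suc_upt[symmetric] comp_def del: upt_Suc)
  also have "\<dots> = odd n # map (bit (n div 2)) [0..<floorlog 2 (n div 2)]" by (simp add: bit_0 bit_Suc)
  finally show ?thesis using 1 False by (subst bin.simps) simp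
 qed (simp add: floorlog_def)
qed

lemma nat_code_bin: "nat_code n = concat (map (%b. [b, b]) (bin n)) @ [False, True]"
 by (simp add: nat_code_def bin_bits comp_def)

lemma poly_nat_code [poly_intros]: "poly f ==> poly (%x. nat_code (f x))"
 unfolding nat_code_bin by (intro poly_intros)

lemma poly_clause_code [poly_intros]: "poly f ==> poly (%x. clause_code (f x))"
 unfolding clause_code_def case_prod_beta by (intro poly_intros)

lemma poly_cnf_code [poly_intros]: "poly f ==> poly g ==> poly (%x. cnf_code (f x) (g x))"
 unfolding cnf_code_def by (intro poly_intros)

lemma poly_dead [poly_intros]: "poly f ==> poly g ==> poly (%x. dead (f x) (g x))"
 unfolding dead_def case_prod_unfold by (intro poly_intros)

lemma poly_live_lits [poly_intros]: "poly f ==> poly g ==> poly (%x. live_lits (f x) (g x))"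
 unfolding live_lits_def case_prod_unfold by (intro poly_intros)

lemma poly_restrict_gates [THEN poly2, poly_intros]: "poly (%(gs, \<pi>). restrict_gates gs \<pi>)"
 unfolding restrict_gates_def case_prod_unfold by (intro poly_intros)

lemma poly_negate [poly_intros]: "poly f ==> poly (%x. negate (f x))"
 unfolding negate_def case_prod_unfold by (intro poly_intros)

lemma poly_conj_cnf [THEN poly_comp, poly_intros]: "poly conj_cnf"
 unfolding conj_cnf_def by (intro poly_intros)

lemma poly_slot_cnf [THEN poly_comp, poly_intros]: "poly slot_cnf"
 unfolding slot_cnf_def case_prod_unfold by (intro poly_intros)

lemma poly_slots_cnf [poly_intros]: "poly f ==> poly (%x. slots_cnf (f x))"
 unfolding slots_cnf_def by (intro poly_intros)

lemma poly_sum_list [THEN poly_comp, poly_intros]: "poly (sum_list :: nat list => nat)"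
proof -
 have sum_eq: "sum_list = (%ns :: nat list. length (concat (map (%n. replicate n Lf) ns)))"
  by (simp add: length_concat comp_def)
 show ?thesis unfolding sum_eq by (intro poly_intros)
qed

lemma poly_slots_loss [poly_intros]: "poly f ==> poly (%x. slots_loss (f x))"
 unfolding slots_loss_def case_prod_unfold by (intro poly_intros)

lemma poly_choices [THEN poly2, poly_intros]: "poly (%(D, l). choices D l)"
 unfolding choices_def Let_def case_prod_unfold by (intro poly_intros)

lemma poly_product_lists: "poly (%xss :: 'a :: enc list list. product_lists (take k xss))"
proof (induction k)
 case 0
 show ?case by (simp, intro poly_intros)
next
 case (Suc k)
 have "product_lists (take (Suc k) xss) = (case xss of [] => [[]]
   | xs # yss => concat (map (%x. map (%ys. x # ys) (product_lists (take k yss))) xs))" for xss :: "'a list list"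
  by (cases xss) auto
 then show ?case by (simp only:) (intro poly_intros poly_comp[OF Suc])
qed

lemma poly_tuples [THEN poly2, poly_intros]: "poly (%(D, fam). tuples D fam)"
 unfolding tuples_def take_map[symmetric] case_prod_unfold by (intro poly_comp[OF poly_product_lists] poly_intros)

lemma poly_decode_gate [poly_intros]: "poly f ==> poly g ==> poly (%x. decode_gate (f x) (g x))"
 unfolding decode_gate_def by (intro poly_intros)

lemma poly_decode_desc [THEN poly3, poly_intros]: "poly (%(s, L, b). decode_desc s L b)"
 unfolding decode_desc_def case_prod_unfold by (intro poly_intros)

lemma poly_desc_len [poly_intros]: "poly f ==> poly g ==> poly (%x. desc_len (f x) (g x))"
 unfolding desc_len_def by (simp, intro poly_intros)

lemma poly_eq_cls [poly_intros]: "poly f ==> poly g ==> poly h ==> poly (%x. eq_cls (f x) (g x) (h x))"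
 unfolding eq_cls_def case_prod_unfold by (intro poly_intros)

lemma poly_tag_code [THEN poly2, poly_intros]: "poly (%(n, t). tag_code n t)"
 unfolding tag_code_def Let_def case_prod_unfold by (intro poly_intros)

lemma poly_patterns [poly_intros]:
 "poly b ==> poly (%x. const_pat (b x))" "poly f ==> poly (%x. stars (f x))"
 unfolding const_pat_def stars_def by (intro poly_intros; assumption)+

lemma poly_bit_pat [poly_intros]: "poly f ==> poly g ==> poly h ==> poly (%x. bit_pat (f x) (g x) (h x))"
 and poly_tail_pat [poly_intros]: "poly f ==> poly b ==> poly (%x. tail_pat (f x) (b x))"
 unfolding bit_pat_def tail_pat_def by (intro poly_intros; assumption)+

lemma poly_shapes [poly_intros]:
 "poly b ==> poly (%x. constS (b x))" "poly f ==> poly (%x. allS (f x))"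
 "poly f ==> poly g ==> poly h ==> poly (%x. bitS (f x) (g x) (h x))"
 "poly f ==> poly g ==> poly (%x. flipS (f x) (g x))"
 unfolding constS_def allS_def bitS_def flipS_def by (intro poly_intros; assumption)+

lemma poly_stepS [THEN poly_comp, poly_intros]: "poly stepS"
 unfolding stepS_def by (intro poly_intros)

lemma poly_clause_family [THEN poly3, poly_intros]: "poly (%(n, sh, cl). clause_family n sh cl)"
 unfolding clause_family_def case_prod_unfold by (intro poly_intros)

lemma poly_record_cls [THEN poly2, poly_intros]: "poly (%(K, p). record_cls K p)"
 unfolding record_cls_def case_prod_unfold by (intro poly_intros)

lemma poly_row_cls [THEN poly2, poly_intros]: "poly (%(K, rej). row_cls K rej)"
 unfolding row_cls_def case_prod_unfold by (intro poly_intros)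

lemma poly_net_cls [THEN poly2, poly_intros]: "poly (%(K, l). net_cls K l)"
 unfolding net_cls_def case_prod_unfold by (intro poly_intros)

lemma poly_init_cls [THEN poly_comp, poly_intros]: "poly init_cls"
 unfolding init_cls_def by (intro poly_intros)

lemma poly_zero_cls [poly_intros]: "poly f ==> poly (%x. zero_cls (f x))"
 unfolding zero_cls_def by (intro poly_intros)

lemma poly_keep_cls [THEN poly3, poly_intros]: "poly (%(K, l, r). keep_cls K l r)"
 unfolding keep_cls_def case_prod_unfold by (intro poly_intros)

lemma poly_next_cls [poly_intros]: "poly f ==> poly (%x. next_cls (f x))"
 unfolding next_cls_def by (intro poly_intros)

lemma poly_read_cls [poly_intros]:
 assumes "poly f" "poly g" "poly h" "poly k" "poly l"
 shows "poly (%x. read_cls (f x) (g x) (h x) (k x) (l x))"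
proof -
 have "poly (%(K, l, r, s, f). read_cls K l r s f)" unfolding read_cls_def Let_def case_prod_unfold by (intro poly_intros)
 from poly_comp[OF this, of "%x. (f x, g x, h x, k x, l x)"] show ?thesis using assms by (simp add: poly_pair)
qed

lemma poly_instr_cls [THEN poly3, poly_intros]: "poly (%(K, l, c). instr_cls K l c)"
 unfolding instr_cls_def Let_def case_prod_unfold by (intro poly_intros)

lemma poly_program_cls [THEN poly2, poly_intros]: "poly (%(K, cs). program_cls K cs)"
proof -
 have "program_cls K cs = concat (map (%(l, c). instr_cls K l c) (zip [0..<length cs] cs))" for K cs
  unfolding program_cls_def by (rule arg_cong[of _ _ concat], rule nth_equalityI) auto
 moreover have "poly (%(K, cs). concat (map (%(l, c). instr_cls K l c) (zip [0..<length cs] cs)))"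
  unfolding case_prod_unfold by (intro poly_intros)
 ultimately show ?thesis by simp
qed

lemma dims_eq: "dims K = [0..<K] @ rev [0..<K]"
proof (induction K)
 case (Suc K)
 have "0 # map Suc [0..<K] = [0..<Suc K]" by (simp add: map_Suc_upt upt_conv_Cons)
 moreover have "map Suc (rev [0..<K]) @ [0] = rev [0..<Suc K]"
  by (simp add: rev_map[symmetric] map_Suc_upt upt_conv_Cons del: upt_Suc)
 ultimately show ?case using Suc by (metis append_Cons append_assoc dims.simps(2) map_append)
qed simp

lemma poly_network_groups [THEN poly_comp, poly_intros]: "poly network_groups"
proof -
 have "network_groups K = map (%(l, d). (flipS K d, net_cls K l)) (zip [0..<2 * K] (dims K))" for K
  unfolding network_groups_def by (rule nth_equalityI) (auto simp: length_dims)
 then have groups_eq: "network_groups = (%K. map (%(l, d). (flipS K d, net_cls K l)) (zip [0..<2 * K] (dims K)))" ..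
 show ?thesis unfolding groups_eq dims_eq case_prod_unfold by (intro poly_intros)
qed

lemma poly_index_groups [THEN poly_comp, poly_intros]: "poly index_groups"
 unfolding index_groups_def by (intro poly_intros)

lemma poly_groups [THEN poly3, poly_intros]: "poly (%(K, cs, rej). groups K cs rej)"
 unfolding groups_def case_prod_unfold by (intro poly_intros)

lemma poly_csp [poly_intros]:
 assumes "poly f" "poly g" "poly h" "poly k"
 shows "poly (%x. csp (f x) (g x) (h x) (k x))"
proof -
 have "poly (%(K, n, cs, rej). csp K n cs rej)" unfolding csp_def case_prod_unfold by (intro poly_intros)
 from poly_comp[OF this, of "%x. (f x, g x, h x, k x)"] show ?thesis using assms by (simp add: poly_pair)
qed

lemma poly_shift_icode [poly_intros]: "poly f ==> poly g ==> poly (%x. shift_icode (f x) (g x))"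
 unfolding shift_icode_def case_prod_unfold by (intro poly_intros)

lemma poly_push_icode [poly_intros]: "poly f ==> poly g ==> poly (%x. push_icode (f x) (g x))"
 unfolding push_icode_def by (intro poly_intros)

lemma poly_load_bits [THEN poly2, poly_intros]: "poly (%(r, bs). load_bits r bs)"
 unfolding load_bits_def case_prod_unfold by (intro poly_intros)

lemma poly_loader [poly_intros]: "poly f ==> poly g ==> poly (%x. loader (f x) (g x))"
 unfolding loader_def by (intro poly_intros)

lemma poly_full_code [THEN poly3, poly_intros]: "poly (%(e, as, bs). full_code e as bs)"
 unfolding full_code_def Let_def case_prod_unfold by (intro poly_intros)

lemma poly_stage_csp [poly_intros]: "poly f ==> poly g ==> poly h ==> poly k ==> poly l ==>
  poly (%x. stage_csp (f x) (g x) (h x) (k x) (l x))"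
 unfolding stage_csp_def by (intro poly_intros)

subsection \<open>Tokens\<close>

text \<open>A token describes a stage: the exponent of the circuit size and the code of the verifier, as numbers in unary.\<close>

definition nums :: "bits => nat list" where
 "nums tk = rev (snd (foldl (%(n, ns) b. if b then (Suc n, ns) else (0, n # ns)) (0, []) tk))"

definition unums :: "nat list => bits" where
 "unums ns = concat (map (%n. replicate n True @ [False]) ns)"

lemma nums_unums: "nums (unums ns) = ns"
proof -
 let ?f = "%(n :: nat, ns) b. if b then (Suc n, ns) else (0, n # ns)"
 have block: "foldl ?f (a, l) (replicate n True) = (a + n, l)" for a n l by (induction n arbitrary: a) auto
 have "foldl ?f (0, l) (unums ns) = (0, rev ns @ l)" for l
  by (induction ns arbitrary: l) (auto simp: unums_def block)
 then show ?thesis by (simp add: nums_def)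
qed

lemma poly_nums [THEN poly_comp, poly_intros]: "poly nums"
proof -
 let ?f = "%(n :: nat, ns) b. if b then (Suc n, ns) else (0, n # ns)"
 have size: "esize (foldl ?f (0, []) ys) \<le> 10 * length ys + 10" for ys
 proof (induction ys rule: rev_induct)
  case (snoc b ys)
  then show ?case by (cases "foldl ?f (0, []) ys") auto
 qed simp
 have "poly (%tk. foldl ?f (0, []) tk)"
 proof (rule poly_foldl[where B = "%x. 10 * length x + 10"])
  show "esize (foldl ?f (0, []) ys) \<le> 10 * length x + 10" if "x = ys @ zs" for x ys zs :: bits
   using size[of ys] that by simp
 qed (unfold case_prod_unfold, (intro poly_intros pbound_intros pbound_length)+)
 then show ?thesis unfolding nums_def by (intro poly_intros)
qed

definition flat :: "icode list => nat list" where
 "flat e = concat (map (%(a, b, c, d). [a, b, c, d]) e)"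

definition quads :: "nat => nat list => icode list" where
 "quads n ns = map (%i. (nth_or 0 ns (4 * i), nth_or 0 ns (4 * i + 1), nth_or 0 ns (4 * i + 2), nth_or 0 ns (4 * i + 3))) [0..<n]"

lemma drop_flat: "drop (4 * i) (flat e) = flat (drop i e)"
proof (induction e arbitrary: i)
 case (Cons c e)
 show ?case
 proof (cases i)
  case (Suc j)
  have "drop (4 * i) (flat (c # e)) = drop (4 * j) (drop 4 (flat (c # e)))" by (simp add: Suc add.commute)
  also have "drop 4 (flat (c # e)) = flat e" by (cases c) (simp add: flat_def)
  finally show ?thesis using Cons Suc by simp
 qed simp
qed (simp add: flat_def)

lemma quads_flat: "quads (length e) (flat e) = e"
proof (rule nth_equalityI)
 fix i assume i: "i < length (quads (length e) (flat e))"
 then have "drop i e = e ! i # drop (Suc i) e" by (simp add: quads_def Cons_nth_drop_Suc)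
 then have drop: "drop (4 * i) (flat e) = (case e ! i of (a, b, c, d) => [a, b, c, d]) @ flat (drop (Suc i) e)"
  using drop_flat[of i e] by (simp add: flat_def)
 have "nth_or 0 (flat e) (4 * i + k) = nth_or 0 (drop (4 * i) (flat e)) k" for k
  by (simp add: nth_or_def add.commute)
 from this[of 0] this[of 1] this[of 2] this[of 3] show "quads (length e) (flat e) ! i = e ! i"
  using i by (cases "e ! i") (simp add: quads_def drop nth_or_def numeral_2_eq_2 numeral_3_eq_3)
qed (simp add: quads_def)

lemma poly_quads [THEN poly2, poly_intros]: "poly (%(n, ns). quads n ns)"
 unfolding quads_def case_prod_unfold by (intro poly_intros)

definition tok_exp :: "bits => nat" where "tok_exp tk = nth_or 0 (nums tk) 0"
definition tok_code :: "bits => icode list" where "tok_code tk = quads (nth_or 0 (nums tk) 1) (drop 2 (nums tk))"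

definition token :: "nat => icode list => bits" where "token q e = unums (q # length e # flat e)"

lemma token_simps [simp]: "tok_exp (token q e) = q" "tok_code (token q e) = e"
 by (simp_all add: tok_exp_def tok_code_def token_def nums_unums nth_or_def quads_flat)

definition tag_len :: "bits => nat => nat" where
 "tag_len tk K = 7 * K + 3 * length tk + length (tok_code tk) + 40"

definition size_exp :: "nat => nat => nat" where
 "size_exp q K = length (filter (%x. q * Suc x * (q * Suc x) \<le> K) [0..<K])"

definition max_gates :: "tree list => nat => nat" where
 "max_gates U x = length (filter (%i. length (bin i) \<le> x) [0..<length U])"

definition stage :: "bits => bits => family list" where
 "stage tk w = stage_csp (length w) (tag_len tk (length w)) (tok_code tk) tk w"

definition start_len :: "bits => nat" where
 "start_len w = Suc (length (filter (%i. \<forall>b\<in>set (take (Suc i) w). b) [0..<length w]))"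

definition stage_desc_len :: "tree list => bits => nat => nat" where
 "stage_desc_len U tk K = desc_len (max_gates U (size_exp (tok_exp tk) K)) (K + tag_len tk K)"

definition stage_desc :: "tree list => bits => nat => bits => gate list \<times> bits" where
 "stage_desc U tk K b = decode_desc (max_gates U (size_exp (tok_exp tk) K)) (K + tag_len tk K) b"

definition diag_word :: "tree list => bits => bits => bool" where
 "diag_word U tk w \<longleftrightarrow> length w = start_len w + stage_desc_len U tk (start_len w)"

definition guess_len :: "tree list => bits => bits => nat" where
 "guess_len U tk w = (if diag_word U tk w then 0 else 2 * stage_desc_len U tk (Suc (length w)))"

definition stage_checks :: "bits => bits => gate list \<times> bits => (bits \<times> bits) list" where
 "stage_checks tk w D = concat (map (%fam. map (%S. (cnf_code (length w) (slots_cnf S),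
   bin (length (slots_cnf S) - slots_loss S))) (tuples D fam)) (stage tk w))"

definition checks :: "tree list => bits => bits => bits => (bits \<times> bits) list" where
 "checks U tk w b = (if diag_word U tk w then stage_checks tk (take (start_len w) w) (stage_desc U tk (start_len w) (drop (start_len w) w))
   else let s = stage_desc_len U tk (Suc (length w)) in
    stage_checks tk (w @ [False]) (stage_desc U tk (Suc (length w)) (take s b)) @
    stage_checks tk (w @ [True]) (stage_desc U tk (Suc (length w)) (drop s b)))"

lemma poly_tok_exp [poly_intros]: "poly f ==> poly (%x. tok_exp (f x))"
 and poly_tok_code [poly_intros]: "poly f ==> poly (%x. tok_code (f x))"
 unfolding tok_exp_def tok_code_def by (intro poly_intros; assumption)+

lemma poly_tag_len [poly_intros]: "poly f ==> poly g ==> poly (%x. tag_len (f x) (g x))"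
 unfolding tag_len_def by (intro poly_intros)

lemma poly_size_exp [THEN poly2, poly_intros]: "poly (%(a, b). size_exp a b)"
 unfolding size_exp_def case_prod_unfold by (intro poly_intros)

lemma poly_max_gates [THEN poly2, poly_intros]: "poly (%(a, b). max_gates a b)"
 unfolding max_gates_def case_prod_unfold by (intro poly_intros)

lemma poly_stage [poly_intros]: "poly f ==> poly g ==> poly (%x. stage (f x) (g x))"
 unfolding stage_def by (intro poly_intros)

lemma poly_start_len [THEN poly_comp, poly_intros]: "poly start_len"
 unfolding start_len_def by (intro poly_intros)

lemma poly_stage_desc_len [poly_intros]: "poly f ==> poly g ==> poly h ==> poly (%x. stage_desc_len (f x) (g x) (h x))"
 unfolding stage_desc_len_def by (intro poly_intros)

lemma poly_stage_desc [poly_intros]: "poly f ==> poly g ==> poly h ==> poly k ==> poly (%x. stage_desc (f x) (g x) (h x) (k x))"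
 unfolding stage_desc_def by (intro poly_intros)

lemma poly_diag_word [poly_intros]: "poly f ==> poly g ==> poly h ==> poly (%x. diag_word (f x) (g x) (h x))"
 unfolding diag_word_def by (intro poly_intros)

lemma poly_guess_len [poly_intros]: "poly f ==> poly g ==> poly h ==> poly (%x. guess_len (f x) (g x) (h x))"
 unfolding guess_len_def by (intro poly_intros)

lemma poly_stage_checks [THEN poly3, poly_intros]: "poly (%(a, b, c). stage_checks a b c)"
 unfolding stage_checks_def case_prod_unfold by (intro poly_intros)

lemma poly_checks [poly_intros]: "poly f ==> poly g ==> poly h ==> poly k ==> poly (%x. checks (f x) (g x) (h x) (k x))"
 unfolding checks_def Let_def by (intro poly_intros)

section \<open>The verifier of the stages\<close>

lemma poly_runs:
 assumes "poly f"
 shows "\<exists>F k. plain F \<and> (\<forall>x b. esize x + 2 \<le> b --> runs F (enc x) (enc (f x)) (b ^ k))"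
proof -
 obtain \<tau> where "pbound \<tau>" "ctime f \<tau>" using assms by (rule polyE)
 then obtain F C where F: "plain F" "\<And>x. runs F (enc x) (enc (f x)) (C * (\<tau> x + 1))" unfolding ctime_def by blast
 have "pbound (%x. C * (\<tau> x + 1))" by (intro pbound_intros \<open>pbound \<tau>\<close>)
 then obtain k where "\<And>x b. esize x + 2 \<le> b ==> C * (\<tau> x + 1) \<le> b ^ k" using pboundD by blast
 then show ?thesis using F runs_mono by (intro exI[of _ F] exI[of _ k]) blast
qed

lemma evals_loop:
 assumes "\<And>i. i < n ==> car (fst (c i)) \<noteq> Lf \<and> (\<exists>t\<le>T. evals A G (c i) (c (Suc i)) t)" "car (fst (c n)) = Lf"
 shows "\<exists>t\<le>n * (T + 4) + 2. evals A (FWhile G) (c 0) (c n) t"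
 using assms
proof (induction n arbitrary: c)
 case 0
 then have final: "evals A (FWhile G) (c 0) (c 0) 2"
  using evals_While_end[of "fst (c 0)" A G "fst (snd (c 0))" "snd (snd (c 0))"] by simp
 show ?case by (intro exI[of _ 2] conjI) (simp, rule final)
next
 case (Suc n)
 obtain t where t: "t \<le> n * (T + 4) + 2" "evals A (FWhile G) (c 1) (c (Suc n)) t"
  using Suc.IH[of "%i. c (Suc i)"] Suc.prems by auto
 obtain u where u: "u \<le> T" "evals A G (c 0) (c 1) u" "car (fst (c 0)) \<noteq> Lf" using Suc.prems(1)[of 0] by auto
 obtain x i q where c0: "c 0 = (x, i, q)" by (metis prod_cases3)
 have "evals A (FWhile G) (c 0) (c (Suc n)) (u + t + 4)"
  using evals_While[of x A G i q "c 1" u "c (Suc n)" t] u t c0 by simp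
 moreover have "u + t + 4 \<le> Suc n * (T + 4) + 2" using u(1) t(1) by simp
 ultimately show ?case by blast
qed

lemma runs_loop:
 assumes "\<And>i. i < n ==> car (c i) \<noteq> Lf \<and> runs G (c i) (c (Suc i)) T" "car (c n) = Lf"
 shows "runs (FWhile G) (c 0) (c n) (n * (T + 4) + 2)"
 unfolding runs_def
proof (intro allI)
 fix A i q
 show "\<exists>t\<le>n * (T + 4) + 2. evals A (FWhile G) (c 0, i, q) (c n, i, q) t"
  by (rule evals_loop[where c = "%j. (c j, i, q)"]) (use assms in \<open>auto simp: runs_def\<close>)
qed

definition evals_within :: "bits set => fn => fstate => fstate => nat => bool" where
 "evals_within A F s s' T \<longleftrightarrow> (\<exists>t\<le>T. evals A F s s' t)"

lemma evals_within_Comp: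
 "evals_within A F s s' T ==> evals_within A G s' s'' U ==> evals_within A (FComp F G) s s'' (T + U)"
 unfolding evals_within_def by (meson add_mono evals_Comp)

lemma evals_within_mono: "evals_within A F s s' T ==> T \<le> U ==> evals_within A F s s' U"
 unfolding evals_within_def by (meson le_trans)

lemma runs_evals_within: "runs F x y T ==> evals_within A F (x, i, q) (y, i, q) T"
 by (simp add: runs_def evals_within_def)

definition read_one :: fn where
 "read_one = FPair (FComp FCar FCdr) (FPair (FPair FNext (FComp FCdr FCar)) (FComp FCdr FCdr))"

lemma evals_read_one:
 "evals A read_one (enc (Suc n, bs, r), b # x, q) (enc (n, b # bs, r), x, q) 34" for n :: nat and bs :: bits
proof -
 let ?y = "enc (Suc n, bs, r)"
 have count: "evals A (FComp FCar FCdr) (?y, b # x, q) (enc n, b # x, q) (1 + 1)"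
  using evals_Comp[OF evals_Car[of A ?y "b # x" q] evals_Cdr] by simp
 have bit: "evals A FNext (?y, b # x, q) (enc b, x, q) 1"
  using evals_Next[of A ?y "b # x" q] by (simp add: tnext_def enc_bool_def)
 have old: "evals A (FComp FCdr FCar) (?y, x, q) (enc bs, x, q) (1 + 1)"
  using evals_Comp[OF evals_Cdr[of A ?y x q] evals_Car] by simp
 have rest: "evals A (FComp FCdr FCdr) (?y, x, q) (enc r, x, q) (1 + 1)"
  using evals_Comp[OF evals_Cdr[of A ?y x q] evals_Cdr] by simp
 from evals_Pair[OF count evals_Pair[OF evals_Pair[OF bit old] rest]] show ?thesis by (simp add: read_one_def)
qed

lemma evals_read:
 assumes "n \<le> length x"
 shows "evals_within A (FWhile read_one) (enc (n, [] :: bits, r), x, q) (enc (0 :: nat, rev (take n x), r), drop n x, q) (n * 100 + 2)"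
proof -
 let ?c = "%j. (enc (n - j, rev (take j x), r), drop j x, q)"
 have "\<exists>t\<le>96. evals A read_one (?c j) (?c (Suc j)) t" if j: "j < n" for j
 proof -
  have "n - j = Suc (n - Suc j)" "drop j x = x ! j # drop (Suc j) x" "rev (take (Suc j) x) = x ! j # rev (take j x)"
   using j assms by (simp_all add: Cons_nth_drop_Suc take_Suc_conv_app_nth)
  then have "evals A read_one (?c j) (?c (Suc j)) 34" using evals_read_one by simp
  moreover have "34 \<le> (96 :: nat)" by simp
  ultimately show ?thesis by blast
 qed
 then have "\<exists>t\<le>n * (96 + 4) + 2. evals A (FWhile read_one) (?c 0) (?c n) t" by (intro evals_loop) auto
 then show ?thesis unfolding evals_within_def by simp
qed

definition next_exp :: "bits => bits => nat" where
 "next_exp tk w = size_exp (tok_exp tk) (Suc (length w))"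

text \<open>Lists of length \<open>2 ^ n\<close> serve as unary numbers, so that the remaining computation is polynomial in its input.\<close>

definition unary_pow2 :: "nat => tree list" where
 "unary_pow2 n = replicate (2 ^ n) Lf"

lemma double_run:
 "\<exists>G k. plain G \<and> (\<forall>n (r :: bits \<times> bits) b. esize (n, unary_pow2 n, r) + 2 \<le> b -->
   runs G (enc (n, [Lf], r)) (enc (0 :: nat, unary_pow2 n, r)) (b * (b ^ k + 4) + 2))"
proof -
 let ?f = "%(n :: nat, U :: tree list, r :: bits \<times> bits). (n - 1, U @ U, r)"
 have "poly ?f" unfolding case_prod_unfold by (intro poly_intros)
 then obtain G k where G: "plain G" "\<And>s b. esize s + 2 \<le> b ==> runs G (enc s) (enc (?f s)) (b ^ k)" using poly_runs by blast
 have "runs (FWhile G) (enc (n, [Lf], r)) (enc (0 :: nat, unary_pow2 n, r)) (b * (b ^ k + 4) + 2)"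
  if b: "esize (n, unary_pow2 n, r) + 2 \<le> b" for n b and r :: "bits \<times> bits"
 proof -
  let ?c = "%j. enc (n - j, unary_pow2 j, r)"
  have "runs (FWhile G) (?c 0) (?c n) (n * (b ^ k + 4) + 2)"
  proof (rule runs_loop)
   fix j assume j: "j < n"
   then have "(2 :: nat) ^ j \<le> 2 ^ n" by (intro power_increasing) auto
   moreover have "n + 2 ^ n + esize r + 4 \<le> b" using b by (simp add: unary_pow2_def)
   ultimately have "n - j + 2 ^ j + esize r + 4 \<le> b" by linarith
   then have "esize (n - j, unary_pow2 j, r) + 2 \<le> b" by (simp add: unary_pow2_def)
   from G(2)[OF this] have "runs G (?c j) (?c (Suc j)) (b ^ k)"
    by (simp add: unary_pow2_def replicate_add[symmetric] mult_2)
   then show "car (?c j) \<noteq> Lf \<and> runs G (?c j) (?c (Suc j)) (b ^ k)" using j by simp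
  qed simp
  moreover have "n * (b ^ k + 4) + 2 \<le> b * (b ^ k + 4) + 2" using b by (intro add_mono mult_le_mono1) auto
  ultimately show ?thesis using runs_mono by (simp add: unary_pow2_def)
 qed
 moreover have "plain (FWhile G)" using G(1) by simp
 ultimately show ?thesis by blast
qed

subsection \<open>Asking the MAX-SAT program\<close>

definition out :: "ram => bits => nat" where
 "out P x = (SOME v. \<exists>t. computes_in P {} x v t)"

definition answers_within :: "ram => nat => (bits \<times> bits) list => bool" where
 "answers_within P B J \<longleftrightarrow> (\<forall>(x, b)\<in>set J. out P x \<le> length x \<and> (\<exists>t\<le>B. computes_in P {} x (out P x) t))"

definition hit :: "ram => (bits \<times> bits) list => bool" where
 "hit P J \<longleftrightarrow> (\<exists>(x, b)\<in>set J. bin (out P x) = b)"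

lemma check_run:
 "\<exists>G k. plain G \<and> (\<forall>x b J h (d :: bool) B c. answers_within P B [(x, b)] --> 10 * esize ((x, b) # J) + 20 \<le> c -->
   runs G (enc ((x, b) # J, h, d)) (enc (J, h \<or> bin (out P x) = b, d)) ((c + 2) ^ k * (B + 1)))"
proof -
 obtain R C k where R: "plain R" "\<And>x v t. computes_in P {} x v t ==> runs R (enc x) (enc (bin v)) (C * (t + (esize x + 2) ^ k))"
  using ram_simulation[of P] by blast
 let ?f = "%(v :: bits, J :: (bits \<times> bits) list, h :: bool, d :: bool). case J of [] => (J, h, d) | j # J' => (J', h \<or> v = snd j, d)"
 have "poly ?f" unfolding case_prod_unfold by (intro poly_intros)
 then obtain H l where H: "plain H" "\<And>s b. esize s + 2 \<le> b ==> runs H (enc s) (enc (?f s)) (b ^ l)" using poly_runs by blast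
 let ?R = "FComp FCar (FComp FCar (FComp FCar R))"
 have "pbound (%c :: nat. 12 + C * (1 + (c + 2) ^ k) + c ^ l)" by (intro pbound_intros pbound_nat poly_intros)
 then obtain m where m: "\<And>c :: nat. 12 + C * (1 + (c + 2) ^ k) + c ^ l \<le> (c + 2) ^ m" unfolding pbound_def by auto
 have "runs (FComp (FPair ?R FId) H) (enc ((x, b) # J, h, d)) (enc (J, h \<or> bin (out P x) = b, d)) ((c + 2) ^ m * (B + 1))"
  if ans: "answers_within P B [(x, b)]" and c: "10 * esize ((x, b) # J) + 20 \<le> c" for x b J h and d :: bool and B c
 proof -
  let ?v = "bin (out P x)" and ?s = "((x, b) # J, h, d)"
  obtain t where t: "t \<le> B" "computes_in P {} x (out P x) t" and v: "out P x \<le> length x"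
   using ans unfolding answers_within_def by auto
  let ?T = "C * (t + (esize x + 2) ^ k)"
  have x: "enc x = car (car (car (enc ?s)))" by (simp add: enc_prod_def)
  have "runs ?R (enc ?s) (enc ?v) (?T + 1 + 1 + 1)"
   using runs_Comp[OF runs_Car runs_Comp[OF runs_Car runs_Comp[OF runs_Car R(2)[OF t(2), unfolded x]]]] by (simp add: add.commute)
  then have pair: "runs (FPair ?R FId) (enc ?s) (enc (?v, ?s)) (?T + 1 + 1 + 1 + 0 + 9)"
   unfolding enc_Pair[of ?v] by (rule runs_Pair[OF _ runs_Id])
  have "esize ?v \<le> 2 * esize x" using esize_bin[of "out P x"] v length_le_esize[of x] by linarith
  then have "esize (?v, ?s) + 2 \<le> c" using c esize_bool[of h] esize_bool[of d] by simp
  from H(2)[OF this] have "runs H (enc (?v, ?s)) (enc (J, h \<or> ?v = b, d)) (c ^ l)" by simp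
  note run = runs_Comp[OF pair this]
  have "(esize x + 2) ^ k \<le> (c + 2) ^ k" using c by (intro power_mono) auto
  then have "t + (esize x + 2) ^ k \<le> B + (c + 2) ^ k" using t(1) by simp
  also have "\<dots> \<le> (1 + (c + 2) ^ k) * (B + 1)" by (simp add: distrib_left distrib_right)
  finally have "?T \<le> C * (1 + (c + 2) ^ k) * (B + 1)" by (simp only: mult.assoc mult_le_mono2)
  moreover have "c ^ l \<le> c ^ l * (B + 1)" "12 \<le> 12 * (B + 1)" by simp_all
  moreover have "(12 + C * (1 + (c + 2) ^ k) + c ^ l) * (B + 1) \<le> (c + 2) ^ m * (B + 1)" using m by (rule mult_le_mono1)
  ultimately have "?T + 1 + 1 + 1 + 0 + 9 + c ^ l \<le> (c + 2) ^ m * (B + 1)" unfolding distrib_right by linarith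
  with run show ?thesis by (rule runs_mono)
 qed
 moreover have "plain (FComp (FPair ?R FId) H)" using R(1) H(1) by simp
 ultimately show ?thesis by blast
qed

lemma checks_run:
 "\<exists>G k. plain G \<and> (\<forall>J (d :: bool) B b. answers_within P B J --> 10 * esize J + 22 \<le> b -->
   runs G (enc (J, False, d)) (enc ([] :: (bits \<times> bits) list, hit P J, d)) ((b * (b ^ k + 4) + 2) * (B + 1)))"
proof -
 obtain G k where G: "plain G" "\<And>x b J h d B c. answers_within P B [(x, b)] ==> 10 * esize ((x, b) # J) + 20 \<le> c ==>
   runs G (enc ((x, b) # J, h, d :: bool)) (enc (J, h \<or> bin (out P x) = b, d)) ((c + 2) ^ k * (B + 1))"
  using check_run[of P] by blast
 have "runs (FWhile G) (enc (J, False, d)) (enc ([] :: (bits \<times> bits) list, hit P J, d)) ((b * (b ^ k + 4) + 2) * (B + 1))"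
  if ans: "answers_within P B J" and b: "10 * esize J + 22 \<le> b" for J and d :: bool and B b
 proof -
  let ?c = "%i. enc (drop i J, hit P (take i J), d)"
  have "runs (FWhile G) (?c 0) (?c (length J)) (length J * (b ^ k * (B + 1) + 4) + 2)"
  proof (rule runs_loop)
   fix i assume i: "i < length J"
   obtain x v where J_i: "J ! i = (x, v)" by (cases "J ! i")
   have drop: "drop i J = (x, v) # drop (Suc i) J" using Cons_nth_drop_Suc[OF i] J_i by simp
   have "(x, v) \<in> set J" using i J_i nth_mem by metis
   then have "answers_within P B [(x, v)]" using ans unfolding answers_within_def by auto
   moreover have "10 * esize ((x, v) # drop (Suc i) J) + 20 \<le> b - 2" using esize_drop[of i J] b unfolding drop by simp
   ultimately have "runs G (?c i) (enc (drop (Suc i) J, hit P (take i J) \<or> bin (out P x) = v, d)) ((b - 2 + 2) ^ k * (B + 1))"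
    unfolding drop by (rule G(2))
   moreover have "hit P (take (Suc i) J) \<longleftrightarrow> hit P (take i J) \<or> bin (out P x) = v"
    using i J_i by (auto simp: hit_def take_Suc_conv_app_nth)
   moreover have "b - 2 + 2 = b" using b by simp
   ultimately show "car (?c i) \<noteq> Lf \<and> runs G (?c i) (?c (Suc i)) (b ^ k * (B + 1))" using i by simp
  qed simp
  moreover have "length J * (b ^ k * (B + 1) + 4) + 2 \<le> (b * (b ^ k + 4) + 2) * (B + 1)"
  proof -
   have "length J \<le> b" using length_le_esize[of J] b by simp
   then have "length J * (b ^ k * (B + 1) + 4) \<le> b * ((b ^ k + 4) * (B + 1))" by (intro mult_le_mono) (simp_all add: distrib_right)
   then have "length J * (b ^ k * (B + 1) + 4) + 2 \<le> b * ((b ^ k + 4) * (B + 1)) + 2 * (B + 1)" by (rule add_mono) simp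
   then show ?thesis by (simp only: distrib_right mult.assoc)
  qed
  ultimately show ?thesis using runs_mono by (simp add: hit_def)
 qed
 moreover have "plain (FWhile G)" using G(1) by simp
 ultimately show ?thesis by blast
qed

subsection \<open>The verifier\<close>

definition word_env :: "bits => bits => tree list \<times> nat \<times> bits \<times> bits" where
 "word_env tk w = (unary_pow2 (next_exp tk w), next_exp tk w, tk, w)"

definition guesses :: "bits => bits => nat" where
 "guesses tk w = guess_len (unary_pow2 (next_exp tk w)) tk w"

definition word_checks :: "bits => bits => bits => (bits \<times> bits) list" where
 "word_checks tk w x = checks (unary_pow2 (next_exp tk w)) tk w (take (guesses tk w) x)"

definition is_diag :: "bits => bits => bool" where
 "is_diag tk w = diag_word (unary_pow2 (next_exp tk w)) tk w"

definition accepts :: "ram => bits => bits => bits => bool" where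
 "accepts P tk w x \<longleftrightarrow> hit P (word_checks tk w x) = is_diag tk w"

lemma pbound_guess_len: "pbound (%(U :: tree list, n :: nat, tk, w). guess_len U tk w)"
 unfolding case_prod_unfold by (intro pbound_nat poly_intros)

lemma guess_run:
 "\<exists>G k. plain G \<and> (\<forall>tk w x b. guesses tk w \<le> length x --> esize (word_env tk w) + 2 * guesses tk w + 10 \<le> b -->
   evals_within {} G (enc (tk, w), x, [])
    (enc (0 :: nat, rev (take (guesses tk w) x), unary_pow2 (next_exp tk w), tk, w), drop (guesses tk w) x, []) ((b + 2) ^ k))"
proof -
 have "poly (%(tk, w). (next_exp tk w, [Lf], tk, w))" unfolding next_exp_def case_prod_unfold by (intro poly_intros)
 then obtain F1 k1 where F1: "plain F1" "\<And>s b. esize s + 2 \<le> b ==> runs F1 (enc s) (enc (case s of (tk, w) => (next_exp tk w, [Lf], tk, w))) (b ^ k1)"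
  using poly_runs by blast
 obtain F2 k2 where F2: "plain F2" "\<And>n (r :: bits \<times> bits) b. esize (n, unary_pow2 n, r) + 2 \<le> b ==>
   runs F2 (enc (n, [Lf], r)) (enc (0 :: nat, unary_pow2 n, r)) (b * (b ^ k2 + 4) + 2)" using double_run by blast
 have "poly (%(z :: nat, U, tk, w). (guess_len U tk w, [] :: bits, U, tk, w))" unfolding case_prod_unfold by (intro poly_intros)
 then obtain F3 k3 where F3: "plain F3" "\<And>s b. esize s + 2 \<le> b ==>
   runs F3 (enc s) (enc (case s of (z :: nat, U, tk, w) => (guess_len U tk w, [] :: bits, U, tk, w))) (b ^ k3)" using poly_runs by blast
 have "pbound (%b :: nat. b ^ k1 + (b * (b ^ k2 + 4) + 2 + (b ^ k3 + (b * 100 + 2))))" by (intro pbound_intros pbound_nat poly_intros)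
 then obtain k where k: "\<And>b :: nat. b ^ k1 + (b * (b ^ k2 + 4) + 2 + (b ^ k3 + (b * 100 + 2))) \<le> (b + 2) ^ k" unfolding pbound_def esize_simps by blast
 let ?G = "FComp F1 (FComp F2 (FComp F3 (FWhile read_one)))"
 have "evals_within {} ?G (enc (tk, w), x, [])
   (enc (0 :: nat, rev (take (guesses tk w) x), unary_pow2 (next_exp tk w), tk, w), drop (guesses tk w) x, []) ((b + 2) ^ k)"
  if x: "guesses tk w \<le> length x" and b: "esize (word_env tk w) + 2 * guesses tk w + 10 \<le> b" for tk w x b
 proof -
  have sizes: "esize (tk, w) + 2 \<le> b" "esize (next_exp tk w, unary_pow2 (next_exp tk w), tk, w) + 2 \<le> b"
    "esize (0 :: nat, unary_pow2 (next_exp tk w), tk, w) + 2 \<le> b" using b by (simp_all add: word_env_def)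
  have "guesses tk w * 100 + 2 \<le> b * 100 + 2" using b by simp
  note read = evals_within_mono[OF evals_read[OF x] this]
  show ?thesis
   by (rule evals_within_mono[OF evals_within_Comp[OF runs_evals_within[OF F1(2)[OF sizes(1), unfolded split_conv]]
     evals_within_Comp[OF runs_evals_within[OF F2(2)[OF sizes(2)]]
     evals_within_Comp[OF runs_evals_within[OF F3(2)[OF sizes(3), unfolded split_conv guesses_def[symmetric]]] read]]] k])
 qed
 moreover have "plain ?G" using F1(1) F2(1) F3(1) by (simp add: read_one_def)
 ultimately show ?thesis by blast
qed

lemma verifier:
 "\<exists>V k. plain V \<and> (\<forall>tk w x B. guesses tk w \<le> length x --> answers_within P B (word_checks tk w x) -->
   (\<exists>i. evals_within {} V (enc (tk, w), x, []) (enc (accepts P tk w x), i, []) ((esize (word_env tk w) + 2) ^ k * (B + 1))))"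
proof -
 obtain G k1 where G: "plain G" "\<And>tk w x b. guesses tk w \<le> length x ==> esize (word_env tk w) + 2 * guesses tk w + 10 \<le> b ==>
   evals_within {} G (enc (tk, w), x, [])
    (enc (0 :: nat, rev (take (guesses tk w) x), unary_pow2 (next_exp tk w), tk, w), drop (guesses tk w) x, []) ((b + 2) ^ k1)"
  using guess_run by blast
 define f where "f = (%(z :: nat, b, U, tk, w). (checks U tk w (rev b), False, diag_word U tk w))"
 have f: "poly f" unfolding f_def case_prod_unfold by (intro poly_intros)
 then obtain F2 k2 where F2: "plain F2" "\<And>s b. esize s + 2 \<le> b ==> runs F2 (enc s) (enc (f s)) (b ^ k2)" using poly_runs by blast
 obtain m where m: "\<And>s b. esize s + 2 \<le> b ==> esize (f s) \<le> b ^ m" using pboundD[OF poly_esize[OF f]] by blast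
 obtain F3 k3 where F3: "plain F3" "\<And>J d B b. answers_within P B J ==> 10 * esize J + 22 \<le> b ==>
   runs F3 (enc (J, False, d :: bool)) (enc ([] :: (bits \<times> bits) list, hit P J, d)) ((b * (b ^ k3 + 4) + 2) * (B + 1))"
  using checks_run[of P] by blast
 have "poly (%(J :: (bits \<times> bits) list, h :: bool, d). h = d)" unfolding case_prod_unfold by (intro poly_intros)
 then obtain F4 k4 where F4: "plain F4" "\<And>s b. esize s + 2 \<le> b ==> runs F4 (enc s) (enc (case s of (J :: (bits \<times> bits) list, h :: bool, d) => h = d)) (b ^ k4)"
  using poly_runs by blast
 let ?V = "FComp G (FComp F2 (FComp F3 F4))"
 define T where "T b = (b + 2) ^ k1 + (b ^ k2 + (((10 * b ^ m + 22) * ((10 * b ^ m + 22) ^ k3 + 4) + 2) + 10 ^ k4))" for b :: nat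
 have "pbound (%e. T (esize e + 2 * (case e of (U :: tree list, n :: nat, tk, w) => guess_len U tk w) + 10))"
  unfolding T_def by (intro pbound_intros pbound_esize pbound_guess_len)
 then obtain k where k: "\<And>e. T (esize e + 2 * (case e of (U :: tree list, n :: nat, tk, w) => guess_len U tk w) + 10) \<le> (esize e + 2) ^ k"
  unfolding pbound_def by blast
 have "evals_within {} ?V (enc (tk, w), x, []) (enc (accepts P tk w x), drop (guesses tk w) x, []) ((esize (word_env tk w) + 2) ^ k * (B + 1))"
  if x: "guesses tk w \<le> length x" and ans: "answers_within P B (word_checks tk w x)" for tk w x B
 proof -
  let ?J = "word_checks tk w x" and ?b = "esize (word_env tk w) + 2 * guesses tk w + 10"
  let ?s = "(0 :: nat, rev (take (guesses tk w) x), unary_pow2 (next_exp tk w), tk, w)"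
  have "esize (take (guesses tk w) x) \<le> 2 * guesses tk w" using esize_bits[of "take (guesses tk w) x"] by simp
  then have s: "esize ?s + 2 \<le> ?b" by (simp add: word_env_def)
  have f_s: "f ?s = (?J, False, is_diag tk w)" by (simp add: f_def word_checks_def is_diag_def)
  have J: "10 * esize ?J + 22 \<le> 10 * ?b ^ m + 22" using m[OF s] unfolding f_s by simp
  have last: "esize ([] :: (bits \<times> bits) list, hit P ?J, is_diag tk w) + 2 \<le> 10"
   using esize_bool[of "hit P ?J"] esize_bool[of "is_diag tk w"] by simp
  note check = runs_evals_within[OF F3(2)[OF ans J]]
   and compare = runs_evals_within[OF F4(2)[OF last, unfolded split_conv accepts_def[symmetric]]]
  let ?T = "(10 * ?b ^ m + 22) * ((10 * ?b ^ m + 22) ^ k3 + 4) + 2"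
  have "evals_within {} ?V (enc (tk, w), x, []) (enc (accepts P tk w x), drop (guesses tk w) x, [])
    ((?b + 2) ^ k1 + (?b ^ k2 + (?T * (B + 1) + 10 ^ k4)))"
   by (rule evals_within_Comp[OF G(2)[OF x order_refl]
     evals_within_Comp[OF runs_evals_within[OF F2(2)[OF s, unfolded f_s]] evals_within_Comp[OF check compare]]])
  moreover have "(?b + 2) ^ k1 + (?b ^ k2 + (?T * (B + 1) + 10 ^ k4)) \<le> T ?b * (B + 1)" unfolding T_def by (simp add: distrib_right)
  moreover have "T ?b * (B + 1) \<le> (esize (word_env tk w) + 2) ^ k * (B + 1)"
   using k[of "word_env tk w"] by (intro mult_le_mono1) (simp add: word_env_def guesses_def)
  ultimately show ?thesis using evals_within_mono le_trans by blast
 qed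
 moreover have "plain ?V" using G(1) F2(1) F3(1) F4(1) by simp
 ultimately show ?thesis by blast
qed

section \<open>Witnesses in E relative to NP\<close>

definition index_bits :: "nat => nat => bits" where
 "index_bits L i = take L (bin i @ replicate L False)"

definition table_bit :: "bits => bits => bool" where
 "table_bit W x \<longleftrightarrow> (\<exists>i\<in>set [0..<length W]. index_bits (length x) i = x \<and> nth_or False W i)"

definition table_dim :: "bits => nat => nat" where
 "table_dim tk K = K + tag_len tk K"

definition is_witness :: "bits => bits => bits => bool" where
 "is_witness tk w W \<longleftrightarrow> bin (length W) = replicate (table_dim tk (length w)) False @ [True] \<and>
   (\<forall>fam\<in>set (stage tk w). \<forall>i\<in>set [0..<length W]. \<exists>(\<pi>, b)\<in>set fam. table_bit W (inst \<pi> (index_bits (table_dim tk (length w)) i)) = b)"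

lemma index_bits_row: "index_bits L i = rev (row L i)"
proof (rule nth_equalityI)
 fix j assume "j < length (index_bits L i)"
 then have j: "j < L" by (simp add: index_bits_def)
 have "bit i j \<longleftrightarrow> False" if "floorlog 2 i \<le> j"
 proof -
  have "i < 2 ^ j" using floorlog_leD[of 2 i j] that by simp
  then show ?thesis by (simp add: bit_iff_odd)
 qed
 then show "index_bits L i ! j = rev (row L i) ! j" using j by (auto simp: index_bits_def row_def bin_bits nth_append)
qed (simp add: index_bits_def)

lemma length_index_bits [simp]: "length (index_bits L i) = L"
 by (simp add: index_bits_row)

lemma rows_index_bits: "rows L = index_bits L ` {..<2 ^ L}"
proof
 show "rows L \<subseteq> index_bits L ` {..<2 ^ L}"
 proof
  fix x assume "x \<in> rows L"
  then have rev_x: "rev x \<in> rows L" by (simp add: rows_def)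
  have "x = index_bits L (rnum (rev x))" using row_rnum[OF rev_x] by (simp add: index_bits_row)
  then show "x \<in> index_bits L ` {..<2 ^ L}" using rnum_less[OF rev_x] by blast
 qed
qed (auto simp: rows_def)

lemma index_bits_inj: "i < 2 ^ L ==> j < 2 ^ L ==> index_bits L i = index_bits L j ==> i = j"
 using row_inj[of i L j] by (simp add: index_bits_row)

lemma bin_power: "bin (2 ^ L) = replicate L False @ [True]"
proof (induction L)
 case (Suc L)
 have "bin (of_bool False + 2 * 2 ^ L) = False # bin (2 ^ L)" by (rule bin_double) simp
 then show ?case using Suc by simp
qed (simp add: bin_small)

lemma is_witness_iff:
 "is_witness tk w W \<longleftrightarrow> length W = 2 ^ table_dim tk (length w) \<and> sat (table_dim tk (length w)) (stage tk w) (table_bit W)"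
proof -
 have "sat L \<Phi> (table_bit W) \<longleftrightarrow>
   (\<forall>fam\<in>set \<Phi>. \<forall>i\<in>set [0..<length W]. \<exists>(\<pi>, b)\<in>set fam. table_bit W (inst \<pi> (index_bits L i)) = b)"
  if "length W = 2 ^ L" for L \<Phi>
  unfolding sat_def fam_ok_def rows_index_bits that by (simp add: atLeast0LessThan)
 then show ?thesis unfolding is_witness_def bin_power[symmetric] bin_inj by blast
qed

lemma fam_ok_cong:
 assumes "\<And>\<pi> b. (\<pi>, b) \<in> set fam ==> length \<pi> = L" "\<And>x. x \<in> rows L ==> W x = W' x"
 shows "fam_ok W L fam \<longleftrightarrow> fam_ok W' L fam"
proof -
 have "W (inst \<pi> y) = W' (inst \<pi> y)" if "(\<pi>, b) \<in> set fam" "y \<in> rows L" for \<pi> b y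
  using assms(1)[OF that(1)] assms(2) that(2) by (simp add: rows_def length_inst)
 then show ?thesis unfolding fam_ok_def by (intro ball_cong bex_cong refl) auto
qed

lemma sat_cong:
 assumes "\<And>fam \<pi> b. fam \<in> set \<Phi> ==> (\<pi>, b) \<in> set fam ==> length \<pi> = L" "\<And>x. x \<in> rows L ==> W x = W' x"
 shows "sat L \<Phi> W \<longleftrightarrow> sat L \<Phi> W'"
 unfolding sat_def using assms by (intro ball_cong refl fam_ok_cong) auto

lemma sat_is_witness:
 assumes "sat L (stage tk w) W" and L: "L = table_dim tk (length w)"
  and patterns: "\<And>fam \<pi> b. fam \<in> set (stage tk w) ==> (\<pi>, b) \<in> set fam ==> length \<pi> = L"
 shows "\<exists>V. is_witness tk w V"
proof -
 define V where "V = map (%i. W (index_bits L i)) [0..<2 ^ L]"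
 have length_V: "length V = 2 ^ L" by (simp add: V_def)
 have "table_bit V x = W x" if x: "x \<in> rows L" for x
 proof -
  obtain j where j: "j < 2 ^ L" "x = index_bits L j" using x unfolding rows_index_bits by auto
  have "table_bit V x \<longleftrightarrow> (\<exists>i<2 ^ L. index_bits L i = x \<and> V ! i)"
   using x length_V by (auto simp: table_bit_def rows_def nth_or_nth)
  also have "\<dots> \<longleftrightarrow> V ! j" using j index_bits_inj by blast
  finally show ?thesis using j by (simp add: V_def)
 qed
 then have "sat L (stage tk w) (table_bit V) \<longleftrightarrow> sat L (stage tk w) W" by (intro sat_cong patterns)
 then show ?thesis using assms(1) length_V unfolding is_witness_iff L by blast
qed

definition extendable :: "bits => bits => bits => bool" where
 "extendable tk w p \<longleftrightarrow> (\<exists>v. is_witness tk w (p @ v))"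

primrec first_witness :: "bits => bits => nat => bits" where
 "first_witness tk w 0 = []"
| "first_witness tk w (Suc n) = first_witness tk w n @ [extendable tk w (first_witness tk w n @ [True])]"

lemma length_first_witness [simp]: "length (first_witness tk w n) = n"
 by (induction n) auto

lemma extendable_first_witness:
 assumes "is_witness tk w V" "n \<le> 2 ^ table_dim tk (length w)"
 shows "extendable tk w (first_witness tk w n)"
 using assms(2)
proof (induction n)
 case 0
 then show ?case using assms(1) by (auto simp: extendable_def)
next
 case (Suc n)
 then obtain v where v: "is_witness tk w (first_witness tk w n @ v)" by (auto simp: extendable_def)
 then have "v \<noteq> []" using Suc.prems by (auto simp: is_witness_iff)
 then obtain b u where v_eq: "v = b # u" by (cases v) auto
 show ?case
 proof (cases "extendable tk w (first_witness tk w n @ [True])")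
  case False
  then have "\<not> b" using v unfolding v_eq extendable_def by (cases b) auto
  then have "is_witness tk w (first_witness tk w (Suc n) @ u)" using v False unfolding v_eq by simp
  then show ?thesis unfolding extendable_def by blast
 qed simp
qed

lemma first_witness_is_witness:
 assumes "is_witness tk w V"
 shows "is_witness tk w (first_witness tk w (2 ^ table_dim tk (length w)))"
proof -
 obtain v where v: "is_witness tk w (first_witness tk w (2 ^ table_dim tk (length w)) @ v)"
  using extendable_first_witness[OF assms order_refl] by (auto simp: extendable_def)
 then have "v = []" by (simp add: is_witness_iff)
 then show ?thesis using v by simp
qed

lemma poly_index_bits [poly_intros]: "poly f ==> poly g ==> poly (%x. index_bits (f x) (g x))"
 unfolding index_bits_def by (intro poly_intros)

lemma poly_table_bit [poly_intros]: assumes "poly f" "poly g" shows "poly (%x. table_bit (f x) (g x))"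
 by (rule poly2[OF _ assms]) (unfold table_bit_def, intro poly_intros)

lemma poly_table_dim [poly_intros]: "poly f ==> poly g ==> poly (%x. table_dim (f x) (g x))"
 unfolding table_dim_def by (intro poly_intros)

lemma poly_inst [poly_intros]: "poly f ==> poly g ==> poly (%x. inst (f x) (g x))"
 unfolding inst_def case_prod_unfold by (intro poly_intros)

lemma poly_is_witness [poly_intros]: assumes "poly f" "poly g" "poly h" shows "poly (%x. is_witness (f x) (g x) (h x))"
 by (rule poly3[OF _ assms]) (unfold is_witness_def case_prod_unfold, intro poly_intros)

lemma poly_pair_code [poly_intros]: "poly f ==> poly g ==> poly (%x. pair_code (f x) (g x))"
 unfolding pair_code_def by (intro poly_intros)

text \<open>Doubled bits of the first component are collected until the marker \<open>[False, True]\<close> has been read; all further bits belong to the second component.\<close>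

fun unpair_step :: "bool \<times> bits \<times> bits \<times> bits => bool => bool \<times> bits \<times> bits \<times> bits" where
 "unpair_step (marker_seen, half, a, r) b = (if marker_seen then (True, [], a, b # r)
   else case half of [] => (False, [b], a, r)
   | c # _ => if b = c then (False, [], b # a, []) else (True, [], a, r))"

definition unpair :: "bits => bits \<times> bits" where
 "unpair x = (case foldl unpair_step (False, [], [], []) x of (_, _, a, r) => (rev a, rev r))"

lemma unpair_pair_code [simp]: "unpair (pair_code x w) = (x, w)"
proof -
 have first: "foldl unpair_step (False, [], a, []) (concat (map (%b. [b, b]) x)) = (False, [], rev x @ a, [])" for a
  by (induction x arbitrary: a) auto
 have second: "foldl unpair_step (True, [], a, r) w = (True, [], a, rev w @ r)" for a r
  by (induction w arbitrary: r) auto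
 have "foldl unpair_step (False, [], [], []) (pair_code x w) = (True, [], rev x, rev w)"
  unfolding pair_code_def foldl_append first by (simp add: second)
 then show ?thesis by (simp add: unpair_def)
qed

lemma poly_unpair [poly_intros]: assumes "poly f" shows "poly (%x. unpair (f x))"
proof (rule poly_comp[OF _ assms])
 have step: "unpair_step s b = (if fst s then (True, [], fst (snd (snd s)), b # snd (snd (snd s)))
   else case fst (snd s) of [] => (False, [b], snd (snd s))
   | c # _ => if b = c then (False, [], b # fst (snd (snd s)), []) else (True, [], snd (snd s)))" for s b
  by (cases s) (auto split: list.split)
 have size: "esize (foldl unpair_step (False, [], [], []) ys) \<le> 10 * length ys + 10" for ys
 proof (induction ys rule: rev_induct)
  case (snoc b ys)
  have "esize (unpair_step s b) \<le> esize s + 10" for s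
   using esize_bool[of "fst s"] esize_bool[of b] esize_bool[of True] esize_bool[of False]
   by (cases s) (auto split: list.splits)
  from this[of "foldl unpair_step (False, [], [], []) ys"] snoc show ?case by simp
 qed (use esize_bool[of False] in simp)
 have "poly (%x. foldl unpair_step (False, [], [], []) x)"
 proof (rule poly_foldl[where B = "%x. 10 * length x + 10"])
  show "esize (foldl unpair_step (False, [], [], []) ys) \<le> 10 * length x + 10" if "x = ys @ zs" for x ys zs :: bits
   using size[of ys] that by simp
  show "poly (%p :: (bits \<times> bool \<times> bits \<times> bits \<times> bits) \<times> bool. unpair_step (snd (fst p)) (snd p))"
   unfolding step by (intro poly_intros)
 qed (intro poly_intros pbound_intros pbound_length)+
 then show "poly unpair" unfolding unpair_def case_prod_unfold by (intro poly_intros)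
qed

definition not_eof :: fn where "not_eof = FIf FEof FNil (FPair FNil FNil)"

lemma evals_not_eof: "\<exists>t\<le>20. evals A not_eof (y, i, q) (enc (i \<noteq> []), i, q) t"
proof (cases "i = []")
 case True
 have "evals A not_eof (y, i, q) (Lf, i, q) (1 + 1 + 6)" unfolding not_eof_def
  by (rule evals_If_True[OF evals_Eof _ evals_Nil]) (simp add: True tbool_def)
 then show ?thesis using True by (intro exI[of _ "1 + 1 + 6"]) simp
next
 case False
 have "evals A FEof (y, i, q) (Lf, i, q) 1" using evals_Eof[of A y i q] False by (simp add: tbool_def)
 from evals_If_False[OF this evals_Pair[OF evals_Nil evals_Nil]]
 have "evals A not_eof (y, i, q) (Nd Lf Lf, i, q) (1 + (1 + 1 + 9) + 4)" unfolding not_eof_def .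
 then show ?thesis using False by (intro exI[of _ "1 + (1 + 1 + 9) + 4"]) simp
qed

definition read_next :: fn where
 "read_next = FComp (FPair (FPair FNext FCdr) not_eof) (FPair FCdr FCar)"

definition read_all :: fn where
 "read_all = FComp (FPair not_eof FNil) (FWhile read_next)"

lemma evals_read_next:
 "\<exists>t\<le>90. evals A read_next (enc (c, bs), b # x, q) (enc (x \<noteq> [], b # bs), x, q) t" for c :: bool and bs :: bits
proof -
 let ?y = "enc (c, bs)"
 have bit: "evals A FNext (?y, b # x, q) (enc b, x, q) 1"
  using evals_Next[of A ?y "b # x" q] by (simp add: tnext_def enc_bool_def)
 have old: "evals A FCdr (?y, x, q) (enc bs, x, q) 1" using evals_Cdr[of A ?y x q] by simp
 obtain u where u: "u \<le> 20" "evals A not_eof (?y, x, q) (enc (x \<noteq> []), x, q) u" using evals_not_eof by blast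
 have "evals A read_next (?y, b # x, q) (enc (x \<noteq> [], b # bs), x, q) (1 + 1 + 9 + u + 9 + (1 + 1 + 9))"
  unfolding read_next_def
  using evals_Comp[OF evals_Pair[OF evals_Pair[OF bit old] u(2)] evals_Pair[OF evals_Cdr evals_Car]] by simp
 then show ?thesis using u(1) by (intro exI[of _ "1 + 1 + 9 + u + 9 + (1 + 1 + 9)"]) simp
qed

lemma evals_read_all: "evals_within A read_all (y, x, q) (enc (False, rev x), [], q) (length x * 100 + 50)"
proof -
 let ?c = "%j. (enc (drop j x \<noteq> [], rev (take j x)), drop j x, q)"
 have "\<exists>t\<le>90. evals A read_next (?c j) (?c (Suc j)) t" if j: "j < length x" for j
 proof -
  have "drop j x = x ! j # drop (Suc j) x" "rev (take (Suc j) x) = x ! j # rev (take j x)"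
   using j by (simp_all add: Cons_nth_drop_Suc take_Suc_conv_app_nth)
  then show ?thesis using evals_read_next[of A "drop j x \<noteq> []" "rev (take j x)" "x ! j" "drop (Suc j) x" q] by simp
 qed
 then have "\<exists>t\<le>length x * (90 + 4) + 2. evals A (FWhile read_next) (?c 0) (?c (length x)) t"
  by (intro evals_loop) auto
 then obtain t where t: "t \<le> length x * (90 + 4) + 2" "evals A (FWhile read_next) (?c 0) (?c (length x)) t" by blast
 obtain u where u: "u \<le> 20" "evals A not_eof (y, x, q) (enc (x \<noteq> []), x, q) u" using evals_not_eof by blast
 have "evals A read_all (y, x, q) (enc (False, rev x), [], q) (u + 1 + 9 + t)"
  unfolding read_all_def using evals_Comp[OF evals_Pair[OF u(2) evals_Nil], of _ "?c (length x)" t] t(2) by simp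
 then show ?thesis unfolding evals_within_def using u(1) t(1) by (intro exI[of _ "u + 1 + 9 + t"]) simp
qed

lemma power_bound: "\<exists>k'. \<forall>n. (a * n + b) ^ k \<le> n ^ k' + (k' :: nat)" for a b k :: nat
proof (intro exI allI)
 fix n :: nat
 let ?k = "(a + b) ^ k + (a + b + 1) * k"
 show "(a * n + b) ^ k \<le> n ^ ?k + ?k"
 proof (cases "n \<le> 1")
  case True
  then have "(a * n + b) ^ k \<le> (a + b) ^ k" by (intro power_mono) (cases n; simp)+
  then show ?thesis by linarith
 next
  case False
  have "a * n + b \<le> a * n + b * n" using False by (cases n) auto
  also have "\<dots> = (a + b) * n" by (simp add: distrib_right)
  also have "\<dots> \<le> n ^ (a + b) * n"
  proof (rule mult_le_mono1)
   have "a + b \<le> 2 ^ (a + b)" by (simp add: less_imp_le)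
   also have "\<dots> \<le> n ^ (a + b)" using False by (intro power_mono) auto
   finally show "a + b \<le> n ^ (a + b)" .
  qed
  finally have "a * n + b \<le> n ^ (a + b + 1)" by (simp add: mult.commute)
  then have "(a * n + b) ^ k \<le> (n ^ (a + b + 1)) ^ k" by (intro power_mono) auto
  also have "\<dots> = n ^ ((a + b + 1) * k)" by (simp only: power_mult)
  also have "\<dots> \<le> n ^ ?k" using False by (intro power_increasing) auto
  finally show ?thesis by linarith
 qed
qed

lemma pbound_nat_power: "pbound h ==> \<exists>k. \<forall>n :: nat. h n \<le> n ^ k + k"
proof -
 assume "pbound h"
 then obtain k where k: "\<And>n. h n \<le> (1 * n + 2) ^ k" unfolding pbound_def by auto
 obtain k' where k': "\<And>n. (1 * n + 2) ^ k \<le> n ^ k' + k'" using power_bound[of 1 2 k] by blast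
 show ?thesis using le_trans[OF k k'] by blast
qed

lemma evals_within_computes_in:
 assumes "evals_within A F (Lf, x, []) (enc (x \<in> L), x', q') T"
 shows "\<exists>t\<le>50 * (T + 30) ^ 2. computes_in (ram_of (fcode 0 F)) A x (of_bool (x \<in> L)) t"
proof -
 obtain n where n: "n \<le> T" "evals A F (Lf, x, []) (enc (x \<in> L), x', q') n" using assms unfolding evals_within_def by blast
 obtain t where t: "computes_in (ram_of (fcode 0 F)) A x (of_bool (enc (x \<in> L) \<noteq> Lf)) t" "t \<le> 50 * (n + 30) ^ 2"
  using ram_of_fcode[OF n(2)] by blast
 have "(n + 30) ^ 2 \<le> (T + 30) ^ 2" using n(1) by (intro power_mono) auto
 then have "t \<le> 50 * (T + 30) ^ 2" using t(2) by linarith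
 then show ?thesis using t(1) by auto
qed

lemma class_P_poly:
 assumes "poly (f :: bits => bool)"
 shows "{x. f x} \<in> class_P"
proof -
 have "poly (%s :: bool \<times> bits. f (rev (snd s)))" by (rule poly_comp[OF assms]) (intro poly_intros)
 then obtain F k where F: "\<And>(s :: bool \<times> bits) b. esize s + 2 \<le> b ==> runs F (enc s) (enc (f (rev (snd s)))) (b ^ k)"
  using poly_runs by blast
 let ?T = "%n :: nat. n * 100 + 50 + (2 * n + 4) ^ k"
 have "pbound (%n :: nat. 50 * (?T n + 30) ^ 2)" by (intro pbound_intros pbound_nat poly_intros)
 then obtain k' where k': "\<And>n :: nat. 50 * (?T n + 30) ^ 2 \<le> n ^ k' + k'" using pbound_nat_power by blast
 have "\<exists>t. computes_in (ram_of (fcode 0 (FComp read_all F))) {} x (of_bool (x \<in> {x. f x})) t \<and> real t \<le> real (length x ^ k' + k')" for x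
 proof -
  have "esize (False, rev x) + 2 \<le> 2 * length x + 4" using esize_bits[of x] esize_bool[of False] by simp
  from F[OF this] have "runs F (enc (False, rev x)) (enc (x \<in> {x. f x})) ((2 * length x + 4) ^ k)" by simp
  from evals_within_computes_in[OF evals_within_Comp[OF evals_read_all runs_evals_within[OF this]]] obtain t
   where t: "t \<le> 50 * (?T (length x) + 30) ^ 2" "computes_in (ram_of (fcode 0 (FComp read_all F))) {} x (of_bool (x \<in> {x. f x})) t"
   by blast
  have "t \<le> length x ^ k' + k'" using t(1) k' by (rule le_trans)
  then show ?thesis using t(2) of_nat_le_iff by blast
 qed
 then show ?thesis unfolding class_P_def decides_in_time_def by blast
qed

definition query :: "bits => bits => bits => tree list => bits" where
 "query tk w p U = pair_code w (pair_code p (map (%_. True) U))"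

definition extends_query :: "bits => bits => bool" where
 "extends_query tk x = (case unpair x of (wc, v) => case unpair wc of (w, c) => case unpair c of (p, _) => is_witness tk w (p @ v))"

definition extendable_set :: "bits => bits set" where
 "extendable_set tk = {x. \<exists>v. length v \<le> length x ^ 1 + 1 \<and> pair_code x v \<in> {x. extends_query tk x}}"

lemma extendable_set_NP: "extendable_set tk \<in> class_NP"
proof -
 have "poly (extends_query tk)" unfolding extends_query_def case_prod_unfold by (intro poly_intros)
 from class_P_poly[OF this] show ?thesis unfolding class_NP_def extendable_set_def by blast
qed

lemma extendable_set_query:
 assumes "length U = 2 ^ table_dim tk (length w)"
 shows "query tk w p U \<in> extendable_set tk \<longleftrightarrow> extendable tk w p"
proof -
 have "length v \<le> length (query tk w p U) ^ 1 + 1" if "is_witness tk w (p @ v)" for v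
  using that assms by (simp add: is_witness_iff query_def pair_code_def)
 then show ?thesis unfolding extendable_set_def extendable_def by (auto simp: query_def extends_query_def)
qed

definition send_one :: fn where
 "send_one = FComp (FPair (FComp FCar (FComp FCar FEmit)) (FPair (FComp FCar FCdr) FCdr)) FCdr"

lemma evals_send_one: "evals A send_one (enc (b # v, s), i, q) (enc (v, s), i, q @ [b]) 25" for v :: bits
proof -
 let ?y = "enc (b # v, s)"
 have bit: "evals A (FComp FCar (FComp FCar FEmit)) (?y, i, q) (enc b, i, q @ [b]) (1 + (1 + 1))"
  using evals_Comp[OF evals_Car[of A ?y i q] evals_Comp[OF evals_Car evals_Emit]] by simp
 have rest: "evals A (FComp FCar FCdr) (?y, i, q @ [b]) (enc v, i, q @ [b]) (1 + 1)"
  using evals_Comp[OF evals_Car[of A ?y i "q @ [b]"] evals_Cdr] by simp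
 have env: "evals A FCdr (?y, i, q @ [b]) (enc s, i, q @ [b]) 1" using evals_Cdr[of A ?y i "q @ [b]"] by simp
 from evals_Comp[OF evals_Pair[OF bit evals_Pair[OF rest env]] evals_Cdr] show ?thesis by (simp add: send_one_def)
qed

lemma evals_send:
 "evals_within A (FWhile send_one) (enc (v :: bits, s), i, q) (enc ([] :: bits, s), i, q @ v) (length v * 100 + 2)"
proof -
 let ?c = "%j. (enc (drop j v, s), i, q @ take j v)"
 have "\<exists>t\<le>96. evals A send_one (?c j) (?c (Suc j)) t" if j: "j < length v" for j
 proof -
  have "drop j v = v ! j # drop (Suc j) v" "q @ take (Suc j) v = (q @ take j v) @ [v ! j]"
   using j by (simp_all add: Cons_nth_drop_Suc take_Suc_conv_app_nth)
  then have "evals A send_one (?c j) (?c (Suc j)) 25" by (metis evals_send_one)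
  moreover have "25 \<le> (96 :: nat)" by simp
  ultimately show ?thesis by blast
 qed
 then have "\<exists>t\<le>length v * (96 + 4) + 2. evals A (FWhile send_one) (?c 0) (?c (length v)) t" by (intro evals_loop) auto
 then show ?thesis unfolding evals_within_def by simp
qed

definition witness_lang :: "bits => bits set" where
 "witness_lang tk = {z. \<exists>w y. z = w @ y \<and> length y = table_dim tk (length w) \<and> table_bit (first_witness tk w (2 ^ table_dim tk (length w))) y}"

definition search_state :: "bits => tree list => bits => bits => nat => tree list \<times> bits \<times> tree list \<times> bits \<times> bits" where
 "search_state tk U w y j = (drop j U, first_witness tk w j, U, w, y)"

lemma first_witness_step:
 "\<exists>G k. \<forall>U w y i j b. length U = 2 ^ table_dim tk (length w) --> j < length U --> 10 * esize (U, w, y) + 20 \<le> b -->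
   evals_within (extendable_set tk) G (enc (search_state tk U w y j), i, []) (enc (search_state tk U w y (Suc j)), i, []) ((b + 2) ^ k)"
proof -
 define f where "f = (%(U' :: tree list, p, U :: tree list, w, y :: bits). (query tk w (p @ [True]) U, U', p, U, w, y))"
 have f: "poly f" unfolding f_def query_def case_prod_unfold by (intro poly_intros)
 obtain F k where F: "\<And>s b. esize s + 2 \<le> b ==> runs F (enc s) (enc (f s)) (b ^ k)" using poly_runs[OF f] by blast
 obtain m where m: "\<And>s b. esize s + 2 \<le> b ==> esize (f s) \<le> b ^ m" using pboundD[OF poly_esize[OF f]] by blast
 let ?g = "%(c :: bool, U' :: tree list, p, r :: tree list \<times> bits \<times> bits). (tl U', p @ [c], r)"
 have "poly ?g" unfolding case_prod_unfold by (intro poly_intros)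
 then obtain G l where G: "\<And>s b. esize s + 2 \<le> b ==> runs G (enc s) (enc (?g s)) (b ^ l)" using poly_runs by blast
 have "pbound (%b :: nat. b ^ k + (b ^ m * 100 + 2 + (11 + b ^ l)))" by (intro pbound_intros pbound_nat poly_intros)
 then obtain n where n: "\<And>b :: nat. b ^ k + (b ^ m * 100 + 2 + (11 + b ^ l)) \<le> (b + 2) ^ n" unfolding pbound_def by auto
 let ?A = "extendable_set tk"
 have "evals_within ?A (FComp F (FComp (FWhile send_one) (FComp (FPair FAsk FCdr) G)))
   (enc (search_state tk U w y j), i, []) (enc (search_state tk U w y (Suc j)), i, []) ((b + 2) ^ n)"
  if U: "length U = 2 ^ table_dim tk (length w)" and j: "j < length U" and b: "10 * esize (U, w, y) + 20 \<le> b" for U w y i j b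
 proof -
  let ?s = "search_state tk U w y j" and ?p = "first_witness tk w j @ [True]"
  have "esize (first_witness tk w j) \<le> 2 * esize U"
   using esize_bits[of "first_witness tk w j"] j length_le_esize[of U] by simp
  then have sizes: "esize ?s + 2 \<le> b" "esize (extendable tk w ?p, ?s) + 2 \<le> b"
   using b esize_drop[of j U] esize_bool[of "extendable tk w ?p"] by (simp_all add: search_state_def)
  have f_s: "f ?s = (query tk w ?p U, ?s)" by (simp add: f_def search_state_def)
  have "length (query tk w ?p U) \<le> b ^ m"
   using m[OF sizes(1)] length_le_esize[of "query tk w ?p U"] unfolding f_s by simp
  then have send: "evals_within ?A (FWhile send_one) (enc (query tk w ?p U, ?s), i, []) (enc ([] :: bits, ?s), i, query tk w ?p U) (b ^ m * 100 + 2)"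
   using evals_within_mono[OF evals_send[of ?A "query tk w ?p U" ?s i "[]"]] by simp
  have "evals ?A (FPair FAsk FCdr) (enc ([] :: bits, ?s), i, query tk w ?p U) (enc (extendable tk w ?p, ?s), i, []) (1 + 1 + 9)"
   using evals_Pair[OF evals_Ask[of ?A "enc ([] :: bits, ?s)" i "query tk w ?p U"] evals_Cdr] extendable_set_query[OF U]
   by (simp add: enc_bool_def)
  then have ask: "evals_within ?A (FPair FAsk FCdr) (enc ([] :: bits, ?s), i, query tk w ?p U) (enc (extendable tk w ?p, ?s), i, []) 11"
   unfolding evals_within_def by (intro exI[of _ 11]) simp
  have g_s: "?g (extendable tk w ?p, ?s) = search_state tk U w y (Suc j)" by (simp add: search_state_def drop_Suc tl_drop)
  show ?thesis
   by (rule evals_within_mono[OF evals_within_Comp[OF runs_evals_within[OF F[OF sizes(1), unfolded f_s]] evals_within_Comp[OF send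
     evals_within_Comp[OF ask runs_evals_within[OF G[OF sizes(2), unfolded g_s]]]]] n])
 qed
 then show ?thesis by blast
qed

lemma first_witness_run:
 "\<exists>G k. \<forall>U w y i b. length U = 2 ^ table_dim tk (length w) --> 10 * esize (U, w, y) + 20 \<le> b -->
   evals_within (extendable_set tk) G (enc (search_state tk U w y 0), i, []) (enc (search_state tk U w y (length U)), i, [])
    (b * ((b + 2) ^ k + 4) + 2)"
proof -
 obtain G k where G: "\<And>U w y i j b. length U = 2 ^ table_dim tk (length w) ==> j < length U ==> 10 * esize (U, w, y) + 20 \<le> b ==>
   evals_within (extendable_set tk) G (enc (search_state tk U w y j), i, []) (enc (search_state tk U w y (Suc j)), i, []) ((b + 2) ^ k)"
  using first_witness_step[of tk] by blast
 have "evals_within (extendable_set tk) (FWhile G) (enc (search_state tk U w y 0), i, []) (enc (search_state tk U w y (length U)), i, [])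
    (b * ((b + 2) ^ k + 4) + 2)"
  if U: "length U = 2 ^ table_dim tk (length w)" and b: "10 * esize (U, w, y) + 20 \<le> b" for U w y i b
 proof -
  let ?c = "%j. (enc (search_state tk U w y j), i, [] :: bits)"
  have "evals_within (extendable_set tk) (FWhile G) (?c 0) (?c (length U)) (length U * ((b + 2) ^ k + 4) + 2)"
   unfolding evals_within_def
  proof (rule evals_loop)
   fix j assume j: "j < length U"
   show "car (fst (?c j)) \<noteq> Lf \<and> (\<exists>t\<le>(b + 2) ^ k. evals (extendable_set tk) G (?c j) (?c (Suc j)) t)"
    using G[OF U j b] j by (simp add: evals_within_def search_state_def)
  qed (simp add: search_state_def)
  moreover have "length U * ((b + 2) ^ k + 4) + 2 \<le> b * ((b + 2) ^ k + 4) + 2"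
   using b length_le_esize[of U] by (intro add_mono mult_le_mono1) auto
  ultimately show ?thesis by (rule evals_within_mono)
 qed
 then show ?thesis by blast
qed

definition split_pos :: "bits => bits => nat" where
 "split_pos tk z = (case filter (%K. K + table_dim tk K = length z) [0..<length z] of [] => 0 | K # _ => K)"

lemma split_pos_cases: "split_pos tk z = 0 \<or> split_pos tk z + table_dim tk (split_pos tk z) = length z"
proof (cases "filter (%K. K + table_dim tk K = length z) [0..<length z]")
 case (Cons K l)
 then have "K \<in> set (filter (%K. K + table_dim tk K = length z) [0..<length z])" unfolding Cons by simp
 then have "K + table_dim tk K = length z" by simp
 then show ?thesis using Cons by (simp add: split_pos_def)
qed (simp add: split_pos_def)

lemma split_pos_le: "split_pos tk z \<le> length z"
 using split_pos_cases[of tk z] by linarith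

lemma split_pos_bound: "table_dim tk (split_pos tk z) \<le> length z + tag_len tk 0"
 using split_pos_cases[of tk z] by (auto simp: table_dim_def)

lemma table_dim_mono: "J < K ==> J + table_dim tk J < K + table_dim tk K"
 by (simp add: table_dim_def tag_len_def)

lemma split_pos_append:
 assumes "length y = table_dim tk (length w)"
 shows "split_pos tk (w @ y) = length w"
proof -
 have unique: "K = length w" if "K + table_dim tk K = length (w @ y)" for K
  using table_dim_mono[of K "length w" tk] table_dim_mono[of "length w" K tk] assms that
  by (cases K "length w" rule: linorder_cases) auto
 have "length w \<in> set (filter (%K. K + table_dim tk K = length (w @ y)) [0..<length (w @ y)])"
  using assms by (simp add: table_dim_def tag_len_def)
 then have "filter (%K. K + table_dim tk K = length (w @ y)) [0..<length (w @ y)] \<noteq> []" by (metis empty_iff list.set(1))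
 then obtain K l where K: "filter (%K. K + table_dim tk K = length (w @ y)) [0..<length (w @ y)] = K # l"
  unfolding neq_Nil_conv by blast
 then have "K \<in> set (filter (%K. K + table_dim tk K = length (w @ y)) [0..<length (w @ y)])" unfolding K by simp
 then have "K = length w" using unique by simp
 then show ?thesis unfolding split_pos_def K by simp
qed

lemma append_in_witness_lang:
 assumes y: "length y = table_dim tk (length w)"
 shows "w @ y \<in> witness_lang tk \<longleftrightarrow> table_bit (first_witness tk w (2 ^ table_dim tk (length w))) y"
proof
 assume "w @ y \<in> witness_lang tk"
 then obtain w' y' where split: "w @ y = w' @ y'" "length y' = table_dim tk (length w')"
   and bit: "table_bit (first_witness tk w' (2 ^ table_dim tk (length w'))) y'"
  unfolding witness_lang_def by blast
 have "length w' = length w" using split_pos_append[OF y] split_pos_append[OF split(2)] split(1) by metis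
 then have "w' = w" "y' = y" using split(1) by (metis append_eq_append_conv)+
 then show "table_bit (first_witness tk w (2 ^ table_dim tk (length w))) y" using bit by metis
next
 assume "table_bit (first_witness tk w (2 ^ table_dim tk (length w))) y"
 then show "w @ y \<in> witness_lang tk" using y unfolding witness_lang_def by blast
qed

lemma witness_lang_iff:
 assumes w: "w = take (split_pos tk z) z" and y: "y = drop (split_pos tk z) z"
 shows "z \<in> witness_lang tk \<longleftrightarrow>
   length y = table_dim tk (length w) \<and> table_bit (first_witness tk w (2 ^ table_dim tk (length w))) y"
proof -
 have z: "w @ y = z" unfolding w y by (rule append_take_drop_id)
 have "length y = table_dim tk (length w)" if z_in: "z \<in> witness_lang tk"
 proof -
  obtain w' y' where split: "z = w' @ y'" "length y' = table_dim tk (length w')" using z_in unfolding witness_lang_def by blast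
  have "split_pos tk z = length w'" using split_pos_append[OF split(2)] unfolding split(1) .
  then show ?thesis using split by (simp add: w y)
 qed
 then show ?thesis using append_in_witness_lang[of y tk w] unfolding z by blast
qed

lemma poly_split_pos [poly_intros]: assumes "poly f" shows "poly (%x. split_pos tk (f x))"
 by (rule poly_comp[OF _ assms]) (unfold split_pos_def, intro poly_intros)

lemma search_sizes:
 assumes K: "K = split_pos tk z" and w: "w = take K z" and y: "y = drop K z" and U: "U = unary_pow2 (table_dim tk K)"
  and b: "b = 2 ^ (length z + tag_len tk 0 + 10)"
 shows "length z * 100 + 50 \<le> b" "esize (False, rev z) + 2 \<le> b" "esize (table_dim tk K, U, w, y) + 2 \<le> b"
  "esize (0 :: nat, U, w, y) + 2 \<le> b" "10 * esize (U, w, y) + 20 \<le> b" "esize (search_state tk U w y (length U)) + 2 \<le> b"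
proof -
 define M where "M = length z + tag_len tk 0"
 define D X where "D = (2 :: nat) ^ table_dim tk K" and "X = (2 :: nat) ^ M"
 have dim: "table_dim tk K \<le> M" using split_pos_bound[of tk z] by (simp add: K M_def)
 then have "D \<le> X" unfolding D_def X_def by (intro power_increasing) auto
 moreover have "esize w \<le> 2 * M" "esize y \<le> 2 * M" "length z \<le> M"
  using esize_bits[of w] esize_bits[of y] by (simp_all add: w y M_def)
 moreover have "M + 1 \<le> X" by (simp add: X_def Suc_leI)
 moreover have "b = 1024 * X" by (simp add: b X_def M_def power_add)
 moreover have "esize U = D" "esize (first_witness tk w (length U)) \<le> 2 * D"
  using esize_bits[of "first_witness tk w (length U)"] by (simp_all add: U D_def unary_pow2_def)
 ultimately show "length z * 100 + 50 \<le> b" "esize (False, rev z) + 2 \<le> b" "esize (table_dim tk K, U, w, y) + 2 \<le> b"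
   "esize (0 :: nat, U, w, y) + 2 \<le> b" "10 * esize (U, w, y) + 20 \<le> b" "esize (search_state tk U w y (length U)) + 2 \<le> b"
  using esize_bits[of z] esize_bool[of False] dim unfolding search_state_def esize_simps esize_rev by simp_all
qed

lemma witness_lang_run:
 "\<exists>F k. \<forall>z. evals_within (extendable_set tk) F (Lf, z, []) (enc (z \<in> witness_lang tk), [], [])
   ((2 ^ (length z + tag_len tk 0 + 11)) ^ k)"
proof -
 define split where "split = (%(c :: bool, x). let K = split_pos tk (rev x) in (table_dim tk K, [Lf], take K (rev x), drop K (rev x)))"
 have "poly split" unfolding split_def case_prod_unfold Let_def by (intro poly_intros)
 then obtain F1 k1 where F1: "\<And>s b. esize s + 2 \<le> b ==> runs F1 (enc s) (enc (split s)) (b ^ k1)" using poly_runs by blast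
 obtain F2 k2 where F2: "\<And>n (r :: bits \<times> bits) b. esize (n, unary_pow2 n, r) + 2 \<le> b ==>
   runs F2 (enc (n, [Lf], r)) (enc (0 :: nat, unary_pow2 n, r)) (b * (b ^ k2 + 4) + 2)" using double_run by blast
 have "poly (%(n :: nat, U, w, y). search_state tk U w y 0)" unfolding search_state_def case_prod_unfold by (simp, intro poly_intros)
 then obtain F3 k3 where F3: "\<And>s b. esize s + 2 \<le> b ==>
   runs F3 (enc s) (enc (case s of (n :: nat, U, w, y) => search_state tk U w y 0)) (b ^ k3)" using poly_runs by blast
 obtain F4 k4 where F4: "\<And>U w y i b. length U = 2 ^ table_dim tk (length w) ==> 10 * esize (U, w, y) + 20 \<le> b ==>
   evals_within (extendable_set tk) F4 (enc (search_state tk U w y 0), i, []) (enc (search_state tk U w y (length U)), i, [])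
    (b * ((b + 2) ^ k4 + 4) + 2)" using first_witness_run[of tk] by blast
 define test where "test = (%(U' :: tree list, p, U :: tree list, w :: bits, y). length y = table_dim tk (length w) \<and> table_bit p y)"
 have "poly test" unfolding test_def case_prod_unfold by (intro poly_intros)
 then obtain F5 k5 where F5: "\<And>s b. esize s + 2 \<le> b ==> runs F5 (enc s) (enc (test s)) (b ^ k5)" using poly_runs by blast
 define T where "T b = b + (b ^ k1 + (b * (b ^ k2 + 4) + 2 + (b ^ k3 + (b * ((b + 2) ^ k4 + 4) + 2 + b ^ k5))))" for b :: nat
 have "pbound T" unfolding T_def by (intro pbound_intros pbound_nat poly_intros)
 then obtain k where k: "\<And>b. T b \<le> (b + 2) ^ k" unfolding pbound_def by auto
 have "evals_within (extendable_set tk) (FComp read_all (FComp F1 (FComp F2 (FComp F3 (FComp F4 F5)))))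
   (Lf, z, []) (enc (z \<in> witness_lang tk), [], []) ((2 ^ (length z + tag_len tk 0 + 11)) ^ k)" for z
 proof -
  define K where "K = split_pos tk z"
  define w y U where "w = take K z" and "y = drop K z" and "U = unary_pow2 (table_dim tk K)"
  let ?b = "2 ^ (length z + tag_len tk 0 + 10) :: nat"
  have length_U: "length U = 2 ^ table_dim tk (length w)"
   using split_pos_le[of tk z] by (simp add: U_def w_def K_def unary_pow2_def)
  note sizes = search_sizes[OF K_def w_def y_def U_def refl]
  have split: "split (False, rev z) = (table_dim tk K, [Lf], w, y)" by (simp add: split_def K_def w_def y_def Let_def)
  have test: "test (search_state tk U w y (length U)) \<longleftrightarrow> z \<in> witness_lang tk"
   using witness_lang_iff[of w tk z y] by (simp add: test_def search_state_def length_U w_def y_def K_def)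
  have "evals_within (extendable_set tk) (FComp read_all (FComp F1 (FComp F2 (FComp F3 (FComp F4 F5)))))
    (Lf, z, []) (enc (z \<in> witness_lang tk), [], []) (T ?b)" unfolding T_def
   by (rule evals_within_Comp[OF evals_within_mono[OF evals_read_all sizes(1)]
     evals_within_Comp[OF runs_evals_within[OF F1[OF sizes(2), unfolded split]]
     evals_within_Comp[OF runs_evals_within[OF F2[OF sizes(3)[unfolded U_def], folded U_def]]
     evals_within_Comp[OF runs_evals_within[OF F3[OF sizes(4), unfolded split_conv]]
     evals_within_Comp[OF F4[OF length_U sizes(5)] runs_evals_within[OF F5[OF sizes(6), unfolded test]]]]]]])
  moreover have "T ?b \<le> (2 ^ (length z + tag_len tk 0 + 11)) ^ k"
  proof -
   have "?b + 2 \<le> 2 ^ (length z + tag_len tk 0 + 11)" by (simp add: power_add)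
   then have "(?b + 2) ^ k \<le> (2 ^ (length z + tag_len tk 0 + 11)) ^ k" by (intro power_mono) auto
   with k show ?thesis by (rule le_trans)
  qed
  ultimately show ?thesis by (rule evals_within_mono)
 qed
 then show ?thesis by blast
qed

lemma affine_bigo: "(%n. real ((n + a) * b)) \<in> O(%n. real n)"
proof (rule bigoI[where c = "real ((1 + a) * b)"])
 have "(n + a) * b \<le> (1 + a) * b * n" if "n \<ge> 1" for n
  using that by (cases n) (auto simp: algebra_simps)
 then have "real ((n + a) * b) \<le> real ((1 + a) * b) * real n" if "n \<ge> 1" for n
  using that by (metis of_nat_le_iff of_nat_mult)
 then show "\<forall>\<^sub>F n in at_top. norm (real ((n + a) * b)) \<le> real ((1 + a) * b) * norm (real n)"
  by (intro eventually_sequentiallyI[of 1]) simp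
qed

lemma witness_lang_E_NP: "witness_lang tk \<in> class_E_NP"
proof -
 obtain F k where F: "\<And>z. evals_within (extendable_set tk) F (Lf, z, []) (enc (z \<in> witness_lang tk), [], [])
   ((2 ^ (length z + tag_len tk 0 + 11)) ^ k)" using witness_lang_run[of tk] by blast
 let ?e = "%n. (n + (tag_len tk 0 + 11)) * (2 * k + 3)"
 have bound: "50 * ((2 ^ (n + tag_len tk 0 + 11)) ^ k + 30) ^ 2 \<le> (2 :: nat) ^ ?e n" for n
 proof -
  define Y where "Y = (2 :: nat) ^ (n + tag_len tk 0 + 11)"
  have "Y = 2048 * 2 ^ (n + tag_len tk 0)" by (simp add: Y_def power_add)
  moreover have "(1 :: nat) \<le> 2 ^ (n + tag_len tk 0)" by simp
  ultimately have Y: "50 \<le> Y" by linarith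
  then have "1 \<le> Y ^ k" by simp
  then have "Y ^ k + 30 \<le> 31 * Y ^ k" by linarith
  also have "\<dots> \<le> Y * Y ^ k" using Y by (intro mult_le_mono1) simp
  finally have "(Y ^ k + 30) ^ 2 \<le> (Y * Y ^ k) ^ 2" by (intro power_mono) auto
  then have "50 * (Y ^ k + 30) ^ 2 \<le> Y * (Y * Y ^ k) ^ 2" using Y by (intro mult_le_mono)
  also have "\<dots> = Y ^ (2 * k + 3)" unfolding power_add mult_2 by (simp add: power2_eq_square power3_eq_cube mult_ac)
  also have "\<dots> = 2 ^ ?e n" unfolding Y_def power_mult[symmetric] by (simp add: add.assoc)
  finally show ?thesis unfolding Y_def .
 qed
 have "\<exists>t. computes_in (ram_of (fcode 0 F)) (extendable_set tk) z (of_bool (z \<in> witness_lang tk)) t \<and>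
   real t \<le> 2 powr real (?e (length z))" for z
 proof -
  obtain t where t: "t \<le> 50 * ((2 ^ (length z + tag_len tk 0 + 11)) ^ k + 30) ^ 2"
    "computes_in (ram_of (fcode 0 F)) (extendable_set tk) z (of_bool (z \<in> witness_lang tk)) t"
   using evals_within_computes_in[OF F] by blast
  have "t \<le> 2 ^ ?e (length z)" using t(1) bound by (rule le_trans)
  then have "real t \<le> real (2 ^ ?e (length z))" by (simp only: of_nat_le_iff)
  also have "\<dots> = 2 powr real (?e (length z))" by (simp only: powr_realpow of_nat_power of_nat_numeral zero_less_numeral)
  finally show ?thesis using t(2) by blast
 qed
 then show ?thesis unfolding class_E_NP_def decides_in_time_def
  using extendable_set_NP[of tk] affine_bigo[of "tag_len tk 0 + 11" "2 * k + 3"]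
  by (intro CollectI bexI[of _ "extendable_set tk"] exI[of _ "ram_of (fcode 0 F)"] bexI[of _ "%n. real (?e n)"]) auto
qed

section \<open>The contradiction\<close>

subsection \<open>The answers of the solver\<close>

lemma exec_det: "exec P A x c v t ==> exec P A x c v' t' ==> v' = v"
proof (induction arbitrary: v' t' rule: exec.induct)
 case (halt pc M q)
 from halt(2) show ?case by cases (use halt(1) in auto)
next
 case (step pc M q v t)
 from step.prems show ?case by cases (use step.hyps(1) step.IH in auto)
qed

lemma out_eq:
 assumes "computes_in P {} x v t"
 shows "out P x = v"
 unfolding out_def by (rule some_equality) (use assms exec_det in \<open>unfold computes_in_def, blast+\<close>)

lemma length_cnf_code: "length F \<le> length (cnf_code n F)"
proof -
 have "length F \<le> length (concat (map clause_code F))" by (induction F) (simp_all add: clause_code_def)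
 then show ?thesis by (simp add: cnf_code_def)
qed

lemma max_sat_le: "max_sat F \<le> length F"
 unfolding max_sat_def by (rule Max.boundedI) (auto intro: finite_subset[of _ "{..length F}"])

locale max_sat_solver =
 fixes P :: ram and c :: real and k :: nat
 assumes c: "0 < c" "c \<le> 1"
  and solver: "cnf_on n F ==> \<exists>t. computes_in P {} (cnf_code n F) (max_sat F) t \<and>
    real t \<le> real (length (cnf_code n F) ^ k + k) * 2 powr (real n - c * (real n / log 2 (real (length F))))"
begin

lemma out_cnf: "cnf_on n F ==> out P (cnf_code n F) = max_sat F"
 using solver[of n F] out_eq by blast

lemma solver_time:
 assumes "cnf_on n F" and X: "length (cnf_code n F) \<le> X" and F: "2 \<le> length F" and n: "n \<le> N"
 shows "\<exists>t. computes_in P {} (cnf_code n F) (max_sat F) t \<and> real t \<le> real (X ^ k + k) * 2 powr (real N * (1 - c / log 2 (real X)))"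
proof -
 obtain t where t: "computes_in P {} (cnf_code n F) (max_sat F) t"
  "real t \<le> real (length (cnf_code n F) ^ k + k) * 2 powr (real n - c * (real n / log 2 (real (length F))))"
  using solver[OF assms(1)] by blast
 have "length F \<le> X" using length_cnf_code[of F n] X by linarith
 then have "log 2 (real (length F)) \<le> log 2 (real X)" using F by (intro log_mono) auto
 moreover have "log 2 2 \<le> log 2 (real (length F))" using F by (intro log_mono) auto
 ultimately have logs: "1 \<le> log 2 (real (length F))" "log 2 (real (length F)) \<le> log 2 (real X)" by simp_all
 then have "c / log 2 (real X) \<le> c / log 2 (real (length F))" using c by (intro divide_left_mono) auto
 then have "real n * (1 - c / log 2 (real (length F))) \<le> real n * (1 - c / log 2 (real X))" by (intro mult_left_mono) auto
 also have "\<dots> \<le> real N * (1 - c / log 2 (real X))" using n c logs by (intro mult_right_mono) (auto simp: field_simps)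
 finally have "2 powr (real n - c * (real n / log 2 (real (length F)))) \<le> 2 powr (real N * (1 - c / log 2 (real X)))"
  by (simp add: algebra_simps)
 moreover have "length (cnf_code n F) ^ k + k \<le> X ^ k + k" using X by (simp add: power_mono)
 ultimately have "real (length (cnf_code n F) ^ k + k) * 2 powr (real n - c * (real n / log 2 (real (length F))))
   \<le> real (X ^ k + k) * 2 powr (real N * (1 - c / log 2 (real X)))" by (intro mult_mono) (simp_all only: of_nat_le_iff of_nat_0_le_iff powr_ge_zero)
 then show ?thesis using t by fastforce
qed

end

subsection \<open>Growth\<close>

lemma log_le_sqrt:
 fixes s :: real and T :: nat
 assumes s: "s > 0"
 shows "\<forall>\<^sub>F K in sequentially. log 2 (20 * real K + real T + 1) \<le> s * sqrt (real K)"
proof -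
 have "filterlim (%K. 9 * sqrt (real K)) at_top sequentially"
  by (intro filterlim_tendsto_pos_mult_at_top[OF tendsto_const] filterlim_compose[OF sqrt_at_top filterlim_real_sequentially]) simp
 with ln_x_over_x_tendsto_0 have "(%K. ln (9 * sqrt (real K)) / (9 * sqrt (real K))) \<longlonglongrightarrow> 0" by (rule filterlim_compose)
 then have "\<forall>\<^sub>F K in sequentially. ln (9 * sqrt (real K)) / (9 * sqrt (real K)) < s / 36"
  by (rule order_tendstoD) (use s in simp)
 then show ?thesis using eventually_ge_at_top[of "T + 1"]
 proof eventually_elim
  case (elim K)
  define r where "r = sqrt (real K)"
  have r: "1 \<le> r" "r * r = real K" using elim(2) by (simp_all add: r_def)
  have "1 / 2 \<le> ln (2 :: real)" using ln_le_minus_one[of "1 / 2 :: real"] by (simp add: ln_div)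
  have "real T + 1 \<le> real K" using elim(2) by linarith
  then have "20 * real K + real T + 1 \<le> (9 * r)\<^sup>2" using r by (simp add: power2_eq_square)
  then have "log 2 (20 * real K + real T + 1) \<le> log 2 ((9 * r)\<^sup>2)" by (intro log_mono) auto
  also have "\<dots> = 2 * ln (9 * r) / ln 2" using r(1) by (subst log_def, subst ln_realpow) auto
  also have "\<dots> \<le> 2 * ln (9 * r) / (1 / 2)"
   using \<open>1 / 2 \<le> ln (2 :: real)\<close> r(1) by (intro divide_left_mono) auto
  also have "\<dots> \<le> s * r" using elim(1) r(1) by (simp add: r_def[symmetric] field_simps)
  finally show ?case unfolding r_def .
 qed
qed

lemma log_size_less:
 fixes s :: real and q T :: nat
 assumes s: "s > 0" and q: "4 / s \<le> real q"
 shows "\<exists>K0. \<forall>K\<ge>K0. \<forall>Z x. real x \<le> sqrt (real (K + 1)) / real q --> 2 \<le> Z --> Z \<le> 2 ^ x * (20 * K + T) -->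
  log 2 (real Z) < s * sqrt (real K)"
proof -
 obtain K0 where K0: "\<And>K. K \<ge> K0 ==> log 2 (20 * real K + real T + 1) \<le> s / 2 * sqrt (real K)"
  using log_le_sqrt[of "s / 2" T] s unfolding eventually_sequentially by auto
 have "log 2 (real Z) < s * sqrt (real K)"
  if K: "K \<ge> K0 + 1" and x: "real x \<le> sqrt (real (K + 1)) / real q" and Z: "2 \<le> Z" "Z \<le> 2 ^ x * (20 * K + T)" for K Z x
 proof -
  have sqrt_K: "0 < sqrt (real K)" using K by simp
  have "sqrt (real (K + 1)) \<le> 3 / 2 * sqrt (real K)"
   by (rule real_le_lsqrt) (use K in \<open>auto simp: power_mult_distrib power2_eq_square\<close>)
  moreover have "0 < 4 / s" using s by simp
  moreover have "0 < real q" using q \<open>0 < 4 / s\<close> by linarith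
  moreover have "sqrt (real (K + 1)) / real q \<le> sqrt (real (K + 1)) / (4 / s)" using q s \<open>0 < real q\<close> by (intro divide_left_mono) auto
  ultimately have "real x \<le> (3 / 2 * sqrt (real K)) / (4 / s)" using x by (meson divide_right_mono less_imp_le order_trans)
  then have x_le: "real x \<le> 3 / 8 * (s * sqrt (real K))" by (simp add: mult.commute)
  have "real Z \<le> real (2 ^ x * (20 * K + T))" using Z(2) of_nat_le_iff by blast
  also have "\<dots> \<le> 2 ^ x * (20 * real K + real T + 1)" by simp
  finally have "log 2 (real Z) \<le> log 2 (2 ^ x * (20 * real K + real T + 1))" using Z(1) by (intro log_mono) auto
  also have "\<dots> = real x + log 2 (20 * real K + real T + 1)"
   by (subst log_mult) (auto simp: add_nonneg_pos log_nat_power)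
  also have "\<dots> \<le> 7 / 8 * (s * sqrt (real K))" using K0[of K] K x_le by simp
  also have "\<dots> < s * sqrt (real K)" using s sqrt_K by simp
  finally show ?thesis .
 qed
 then show ?thesis by blast
qed

lemma power_times_powr_less:
 fixes c l :: real
 assumes c: "0 < c" and l: "1 \<le> l" and a: "1 \<le> a" and l_less: "real (A + 1) * real a * (l * l) < c * real K"
 shows "(2 powr l) ^ A * 2 powr (real (K + 1) * (1 - c / (real a * l))) < 2 ^ K"
proof -
 have al: "0 < real a * l" using a l by simp
 have "(real (A + 1) * l) * (real a * l) < c * real K" using l_less by (simp add: mult_ac)
 then have "real (A + 1) * l < c * real K / (real a * l)" using al by (simp add: pos_less_divide_eq)
 also have "\<dots> \<le> c * real (K + 1) / (real a * l)" using c al by (intro divide_right_mono mult_left_mono) auto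
 finally have "real A * l + 1 < c * real (K + 1) / (real a * l)" using l by (simp add: distrib_right)
 then have "real A * l + real (K + 1) * (1 - c / (real a * l)) < real K" by (simp add: algebra_simps)
 then have "2 powr (real A * l + real (K + 1) * (1 - c / (real a * l))) < 2 powr real K" by simp
 then show ?thesis by (simp add: powr_add powr_realpow powr_power mult.commute)
qed

text \<open>
  Since \<open>x\<close> is at most \<open>sqrt K / q\<close> up to lower-order terms, so is \<open>log Z\<close>, and the saving \<open>K / log Z\<close> in the exponent
  exceeds \<open>A log Z\<close> once \<open>q\<close> is large.
\<close>

lemma growth:
 fixes c :: real and a A :: nat
 assumes c: "0 < c" and a: "1 \<le> a"
 shows "\<exists>q\<ge>1. \<forall>T. \<exists>K0. \<forall>K\<ge>K0. \<forall>Z x. real x \<le> sqrt (real (K + 1)) / real q --> 2 \<le> Z --> Z \<le> 2 ^ x * (20 * K + T) -->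
  real Z ^ A * 2 powr (real (K + 1) * (1 - c / (real a * log 2 (real Z)))) < 2 ^ K"
proof -
 define d where "d = c / (real (A + 1) * real a)"
 have d: "d > 0" using c a by (simp add: d_def)
 define q where "q = nat \<lceil>4 / sqrt d\<rceil>"
 have q: "4 / sqrt d \<le> real q" unfolding q_def by linarith
 have "0 < 4 / sqrt d" using d by simp
 then have "q \<ge> 1" using q by linarith
 have "\<exists>K0. \<forall>K\<ge>K0. \<forall>Z x. real x \<le> sqrt (real (K + 1)) / real q --> 2 \<le> Z --> Z \<le> 2 ^ x * (20 * K + T) -->
  real Z ^ A * 2 powr (real (K + 1) * (1 - c / (real a * log 2 (real Z)))) < 2 ^ K" for T
 proof -
  obtain K0 where K0: "\<And>K Z x. K \<ge> K0 ==> real x \<le> sqrt (real (K + 1)) / real q ==> 2 \<le> Z ==> Z \<le> 2 ^ x * (20 * K + T) ==>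
    log 2 (real Z) < sqrt d * sqrt (real K)" using log_size_less[of "sqrt d" q T] d q by auto
  have "real Z ^ A * 2 powr (real (K + 1) * (1 - c / (real a * log 2 (real Z)))) < 2 ^ K"
   if that: "K \<ge> K0" "real x \<le> sqrt (real (K + 1)) / real q" "2 \<le> Z" "Z \<le> 2 ^ x * (20 * K + T)" for K Z x
  proof -
   define l where "l = log 2 (real Z)"
   have l: "1 \<le> l" "real Z = 2 powr l" using that(3) by (simp_all add: l_def le_log_iff)
   have "l < sqrt (d * real K)" using K0[OF that] by (simp add: l_def real_sqrt_mult)
   then have "l * l < sqrt (d * real K) * sqrt (d * real K)" using l(1) by (intro mult_strict_mono) linarith+
   then have "l * l < d * real K" using d by simp
   then have "real (A + 1) * real a * (l * l) < real (A + 1) * real a * (d * real K)"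
    using a by (intro mult_strict_left_mono) auto
   also have "\<dots> = c * real K" using a by (simp add: d_def)
   finally have "real (A + 1) * real a * (l * l) < c * real K" .
   from power_times_powr_less[OF c l(1) a this] show ?thesis unfolding l_def[symmetric] l(2)[symmetric] .
  qed
  then show ?thesis by blast
 qed
 then show ?thesis using \<open>q \<ge> 1\<close> by blast
qed

lemma powers_absorbed:
 assumes Z: "2 \<le> (Z :: nat)"
 shows "Z ^ 5 + Z ^ a * ((Z ^ a) ^ k + k + 1) \<le> Z ^ (a + a * k + k + 10)"
proof -
 have double: "2 * Z ^ i \<le> Z ^ (i + 1)" for i using mult_le_mono1[OF Z, of "Z ^ i"] by simp
 have mono: "Z ^ i \<le> Z ^ j" if "i \<le> j" for i j using that Z by (intro power_increasing) auto
 have "k + 1 \<le> 2 ^ (k + 1)" by (rule less_imp_le[OF less_exp])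
 also have "\<dots> \<le> Z ^ (k + 1)" using Z by (intro power_mono) auto
 also have "\<dots> \<le> Z ^ (a * k + k + 1)" by (rule mono) simp
 finally have "k + 1 \<le> Z ^ (a * k + k + 1)" .
 moreover have "(Z ^ a) ^ k \<le> Z ^ (a * k + k + 1)" unfolding power_mult[symmetric] by (rule mono) simp
 ultimately have "(Z ^ a) ^ k + k + 1 \<le> Z ^ (a * k + k + 1 + 1)" using double[of "a * k + k + 1"] by linarith
 then have "Z ^ a * ((Z ^ a) ^ k + k + 1) \<le> Z ^ a * Z ^ (a * k + k + 1 + 1)" by (rule mult_le_mono2)
 also have "\<dots> = Z ^ (a + (a * k + k + 1 + 1))" by (simp only: power_add)
 also have "\<dots> \<le> Z ^ (a + a * k + k + 9)" by (rule mono) simp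
 finally have "Z ^ a * ((Z ^ a) ^ k + k + 1) \<le> Z ^ (a + a * k + k + 9)" .
 moreover have "Z ^ 5 \<le> Z ^ (a + a * k + k + 9)" by (rule mono) simp
 ultimately have "Z ^ 5 + Z ^ a * ((Z ^ a) ^ k + k + 1) \<le> 2 * Z ^ (a + a * k + k + 9)" by linarith
 also have "\<dots> \<le> Z ^ (a + a * k + k + 9 + 1)" by (rule double)
 also have "a + a * k + k + 9 + 1 = a + a * k + k + 10" by simp
 finally show ?thesis .
qed

subsection \<open>Descriptions of stage tables\<close>

lemma length_filter_upt: "length (filter Q [0..<n]) = card {i. i < n \<and> Q i}"
 by (simp add: length_filter_conv_card cong: conj_cong)

lemma size_exp_eq:
 assumes "q \<ge> 1"
 shows "size_exp q K = nat \<lfloor>sqrt (real K) / real q\<rfloor>"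
proof -
 define m where "m = nat \<lfloor>sqrt (real K) / real q\<rfloor>"
 have "0 \<le> sqrt (real K) / real q" by simp
 then have m: "real m \<le> sqrt (real K) / real q" "sqrt (real K) / real q < real m + 1" unfolding m_def by linarith+
 have iff: "q * Suc x * (q * Suc x) \<le> K \<longleftrightarrow> x < m" for x
 proof -
  have "q * Suc x * (q * Suc x) \<le> K \<longleftrightarrow> (real (q * Suc x))\<^sup>2 \<le> real K"
   unfolding power2_eq_square of_nat_mult[symmetric] of_nat_le_iff ..
  also have "\<dots> \<longleftrightarrow> real (q * Suc x) \<le> sqrt (real K)" by (metis of_nat_0_le_iff real_le_rsqrt real_sqrt_le_iff real_sqrt_abs abs_of_nat)
  also have "\<dots> \<longleftrightarrow> real (Suc x) \<le> sqrt (real K) / real q" using assms by (simp add: field_simps)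
  also have "\<dots> \<longleftrightarrow> x < m" using m by linarith
  finally show ?thesis .
 qed
 have "m \<le> K"
 proof (cases m)
  case (Suc x)
  then have "q * Suc x * (q * Suc x) \<le> K" using iff[of x] by simp
  moreover have "1 * Suc x * (1 * 1) \<le> q * Suc x * (q * Suc x)" using assms by (intro mult_le_mono) auto
  ultimately show ?thesis using Suc by simp
 qed simp
 then have "{x. x < K \<and> x < m} = {..<m}" by auto
 then show ?thesis unfolding size_exp_def iff length_filter_upt m_def[symmetric] by simp
qed

lemma size_exp_mono: "K \<le> K' ==> size_exp q K \<le> size_exp q K'"
 unfolding size_exp_def length_filter_upt by (intro card_mono) auto

lemma max_gates_unary_pow2:
 assumes "x \<le> n"
 shows "max_gates (unary_pow2 n) x = 2 ^ x"
proof -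
 have "(2 :: nat) ^ x \<le> 2 ^ n" using assms by (intro power_increasing) auto
 from less_le_trans[OF _ this] have "{i. i < 2 ^ n \<and> length (bin i) \<le> x} = {..<2 ^ x}"
  by (auto simp: length_bin floorlog_le_iff)
 then show ?thesis by (simp add: max_gates_def unary_pow2_def length_filter_upt)
qed

lemma start_len_le: "start_len w \<le> Suc (length w)"
 unfolding start_len_def using length_filter_le[of _ "[0..<length w]"] by simp

lemma start_len_replicate: "start_len (replicate m True @ False # v) = Suc m"
proof -
 let ?w = "replicate m True @ False # v"
 have "(\<forall>b\<in>set (take (Suc i) ?w). b) \<longleftrightarrow> i < m" for i
 proof (cases "i < m")
  case False
  then have "take (Suc i) ?w = replicate m True @ False # take (i - m) v" by (simp add: Suc_diff_le)
  then show ?thesis using False by simp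
 qed auto
 then have "start_len ?w = Suc (card {i. i < length ?w \<and> i < m})" unfolding start_len_def length_filter_upt by presburger
 also have "{i. i < length ?w \<and> i < m} = {..<m}" by auto
 finally show ?thesis by simp
qed

definition code_len :: "bits => nat => nat" where
 "code_len tk K = desc_len (2 ^ size_exp (tok_exp tk) K) (table_dim tk K)"

definition desc_of :: "bits => nat => bits => gate list \<times> bits" where
 "desc_of tk K = decode_desc (2 ^ size_exp (tok_exp tk) K) (table_dim tk K)"

definition stage_sat :: "bits => bits => bool" where
 "stage_sat tk w \<longleftrightarrow> (\<exists>W. sat (table_dim tk (length w)) (stage tk w) W)"

definition desc_sat :: "bits => bits => bits => bool" where
 "desc_sat tk w b \<longleftrightarrow> sat (table_dim tk (length w)) (stage tk w) (desc_eval (desc_of tk (length w) b))"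

lemma is_desc_desc_of: "length b = code_len tk K ==> is_desc (2 ^ size_exp (tok_exp tk) K) (table_dim tk K) (desc_of tk K b)"
 unfolding desc_of_def code_len_def by (rule is_desc_decode_desc)

lemma stage_desc_unary_pow2:
 assumes "K \<le> Suc (length w)"
 shows "stage_desc_len (unary_pow2 (next_exp tk w)) tk K = code_len tk K" "stage_desc (unary_pow2 (next_exp tk w)) tk K = desc_of tk K"
proof -
 have "max_gates (unary_pow2 (next_exp tk w)) (size_exp (tok_exp tk) K) = 2 ^ size_exp (tok_exp tk) K"
  unfolding next_exp_def by (intro max_gates_unary_pow2 size_exp_mono assms)
 then show "stage_desc_len (unary_pow2 (next_exp tk w)) tk K = code_len tk K" "stage_desc (unary_pow2 (next_exp tk w)) tk K = desc_of tk K"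
  by (simp_all add: stage_desc_len_def stage_desc_def code_len_def desc_of_def table_dim_def fun_eq_iff)
qed

lemma is_diag_iff: "is_diag tk w \<longleftrightarrow> length w = start_len w + code_len tk (start_len w)"
 by (simp add: is_diag_def diag_word_def stage_desc_unary_pow2[OF start_len_le])

lemma guesses_eq: "guesses tk w = (if is_diag tk w then 0 else 2 * code_len tk (Suc (length w)))"
 by (simp add: guesses_def guess_len_def is_diag_def stage_desc_unary_pow2)

lemma word_checks_diag:
 "is_diag tk w ==> word_checks tk w x = stage_checks tk (take (start_len w) w) (desc_of tk (start_len w) (drop (start_len w) w))"
 by (simp add: word_checks_def checks_def is_diag_def stage_desc_unary_pow2[OF start_len_le])

lemma word_checks_branch:
 assumes "\<not> is_diag tk w" and s: "s = code_len tk (Suc (length w))"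
 shows "word_checks tk w x = stage_checks tk (w @ [False]) (desc_of tk (Suc (length w)) (take s x)) @
   stage_checks tk (w @ [True]) (desc_of tk (Suc (length w)) (take s (drop s x)))"
 using assms by (simp add: word_checks_def checks_def guesses_eq is_diag_def[symmetric] stage_desc_unary_pow2 Let_def drop_take)

subsection \<open>The MAX-SAT instances of a stage\<close>

definition self_token :: "fn => nat => bits" where
 "self_token V q = token q (map icode_of (fcode 0 V))"

lemma live_lits_free: "length g = length \<pi> ==> (i, b) \<in> set (live_lits g \<pi>) ==> i < length g \<and> \<not> fst (\<pi> ! i)"
 by (auto simp: live_lits_def zip_eq_map_nth split_def)

lemma slot_cnf_var:
 assumes "C \<in> set (slot_cnf (Gs, a))" "(i, b) \<in> set C"
 shows "\<exists>u\<in>set Gs. \<exists>b. (i, b) \<in> set u"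
proof -
 have negate: "\<exists>b. (i, b) \<in> set u" if "(i, b) \<in> set (negate u)" for u using that by (auto simp: negate_def)
 consider u v where "u \<in> set Gs" "v \<in> set Gs" "C = negate u @ negate v"
  | u j where "u \<in> set Gs" "C = negate (take j u) @ take 1 (drop j u)"
  using assms(1) by (auto simp: slot_cnf_def conj_cnf_def split: if_splits)
 then show ?thesis
 proof cases
  case 1
  then show ?thesis using assms(2) negate by auto
 next
  case 2
  then have "(i, b) \<in> set (negate (take j u)) \<or> (i, b) \<in> set u" using assms(2) by (auto dest: in_set_takeD in_set_dropD)
  then show ?thesis using 2(1) negate[of "take j u"] in_set_takeD by fast
 qed
qed

locale stages =
 fixes V :: fn and q :: nat
 assumes V: "plain V"
begin

abbreviation "tk \<equiv> self_token V q"

lemma tok_exp_self [simp]: "tok_exp tk = q" and tok_code_self [simp]: "tok_code tk = map icode_of (fcode 0 V)"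
 by (simp_all add: self_token_def)

lemma stage_self: "stage tk w = stage_csp (length w) (tag_len tk (length w)) (map icode_of (fcode 0 V)) tk w"
 by (simp add: stage_def)

lemma tag_len_self: "4 * length w + 3 * length tk + 3 * length w + flen V + 40 \<le> tag_len tk (length w)"
 by (simp add: tag_len_def)

lemma stage_families:
 assumes "length w \<ge> 1" "fam \<in> set (stage tk w)"
 shows "length fam \<le> 5" "\<And>\<pi> b. (\<pi>, b) \<in> set fam ==> length \<pi> = table_dim tk (length w)"
  "\<And>\<pi> b i. (\<pi>, b) \<in> set fam ==> length w \<le> i ==> i < table_dim tk (length w) ==> fst (\<pi> ! i)"
 using stage_csp_families[OF V assms(1) tag_len_self assms(2)[unfolded stage_self]] unfolding table_dim_def by auto

lemma slots_cnf_on: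
 assumes w: "length w \<ge> 1" and b: "length b = code_len tk (length w)"
  and fam: "fam \<in> set (stage tk w)" and S: "S \<in> set (tuples (desc_of tk (length w) b) fam)"
 shows "cnf_on (length w) (slots_cnf S)"
proof -
 have "i < length w" if C: "C \<in> set (slots_cnf S)" "(i, v) \<in> set C" for C i v
 proof -
  obtain Gs a where slot: "(Gs, a) \<in> set S" "C \<in> set (slot_cnf (Gs, a))" using C by (auto simp: slots_cnf_def)
  then obtain u v' where u: "u \<in> set Gs" "(i, v') \<in> set u" using slot_cnf_var[OF slot(2) C(2)] by blast
  obtain \<pi> d where lit: "(\<pi>, d) \<in> set fam" "(Gs, a) \<in> set (choices (desc_of tk (length w) b) (\<pi>, d))"
   using tuples_choices[OF S slot(1)] by auto
  then obtain g where g: "g \<in> set (fst (desc_of tk (length w) b))" "u = live_lits g \<pi>"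
   using u(1) choices_gates[OF lit(2)] by (auto simp: restrict_gates_def)
  have "length g = table_dim tk (length w)" using is_desc_desc_of[OF b] g(1) by (auto simp: is_desc_def)
  moreover have "length \<pi> = table_dim tk (length w)" by (rule stage_families(2)[OF w fam lit(1)])
  ultimately have "i < table_dim tk (length w)" "\<not> fst (\<pi> ! i)" using live_lits_free[of g \<pi> i v'] u(2) g(2) by auto
  then show ?thesis using stage_families(3)[OF w fam lit(1), of i] by (cases "length w \<le> i") auto
 qed
 then show ?thesis unfolding cnf_on_def by blast
qed

lemma stage_checks_cnf:
 assumes "length w \<ge> 1" "length b = code_len tk (length w)" "(y, v) \<in> set (stage_checks tk w (desc_of tk (length w) b))"
 shows "\<exists>F. y = cnf_code (length w) F \<and> cnf_on (length w) F \<and> 2 \<le> length F"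
proof -
 obtain fam S where S: "fam \<in> set (stage tk w)" "S \<in> set (tuples (desc_of tk (length w) b) fam)" "y = cnf_code (length w) (slots_cnf S)"
  using assms(3) by (auto simp: stage_checks_def)
 moreover have "2 \<le> length (slots_cnf S)" by (simp add: slots_cnf_def)
 ultimately show ?thesis using slots_cnf_on[OF assms(1,2)] by blast
qed

lemma word_checks_cnf:
 assumes x: "guesses tk w \<le> length x" and y: "(y, v) \<in> set (word_checks tk w x)"
 shows "\<exists>n F. y = cnf_code n F \<and> cnf_on n F \<and> 2 \<le> length F \<and> n \<le> Suc (length w)"
proof (cases "is_diag tk w")
 case True
 let ?w = "take (start_len w) w"
 have len: "length ?w = start_len w" "length (drop (start_len w) w) = code_len tk (start_len w)" "1 \<le> start_len w"
  using True by (auto simp: is_diag_iff start_len_def)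
 then have "1 \<le> length ?w" by linarith
 from stage_checks_cnf[OF this, unfolded len(1), OF len(2) y[unfolded word_checks_diag[OF True]]] show ?thesis
  using start_len_le by blast
next
 case False
 define s where "s = code_len tk (Suc (length w))"
 have len: "length (take s x) = s" "length (take s (drop s x)) = s" using x False by (simp_all add: guesses_eq s_def)
 have "\<exists>c b. length b = s \<and> (y, v) \<in> set (stage_checks tk (w @ [c]) (desc_of tk (Suc (length w)) b))"
  using y len unfolding word_checks_branch[OF False s_def] set_append by blast
 then obtain c b where "length b = s" "(y, v) \<in> set (stage_checks tk (w @ [c]) (desc_of tk (Suc (length w)) b))" by blast
 then show ?thesis using stage_checks_cnf[of "w @ [c]" b y v] by (auto simp: s_def)
qed

end

locale solver_stages = max_sat_solver P c k + stages V q for P c k V q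
begin

lemma hit_stage_checks:
 assumes w: "length w \<ge> 1" and b: "length b = code_len tk (length w)"
 shows "hit P (stage_checks tk w (desc_of tk (length w) b)) \<longleftrightarrow> \<not> desc_sat tk w b"
proof -
 let ?D = "desc_of tk (length w) b" and ?L = "table_dim tk (length w)"
 have "hit P (stage_checks tk w ?D) \<longleftrightarrow> (\<exists>fam\<in>set (stage tk w). \<exists>S\<in>set (tuples ?D fam).
   bin (out P (cnf_code (length w) (slots_cnf S))) = bin (length (slots_cnf S) - slots_loss S))"
  unfolding hit_def stage_checks_def by auto
 also have "\<dots> \<longleftrightarrow> (\<exists>fam\<in>set (stage tk w). \<exists>S\<in>set (tuples ?D fam). max_sat (slots_cnf S) = length (slots_cnf S) - slots_loss S)"
  by (intro bex_cong refl) (simp add: out_cnf slots_cnf_on[OF w b])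
 also have "\<dots> \<longleftrightarrow> (\<exists>fam\<in>set (stage tk w). \<not> fam_ok (desc_eval ?D) ?L fam)"
 proof (intro bex_cong refl)
  fix fam assume fam: "fam \<in> set (stage tk w)"
  have "\<forall>g\<in>set (fst ?D). length g = ?L" using is_desc_desc_of[OF b] by (auto simp: is_desc_def)
  moreover have "\<forall>(\<pi>, b)\<in>set fam. length \<pi> = ?L" using stage_families(2)[OF w fam] by blast
  ultimately show "(\<exists>S\<in>set (tuples ?D fam). max_sat (slots_cnf S) = length (slots_cnf S) - slots_loss S)
    \<longleftrightarrow> \<not> fam_ok (desc_eval ?D) ?L fam"
   using fam_ok_tuples[of ?D ?L fam] stage_families(1)[OF w fam] by blast
 qed
 finally show ?thesis unfolding desc_sat_def sat_def by blast
qed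

lemma answers_within_word_checks:
 assumes x: "guesses tk w \<le> length x" and X: "esize (word_checks tk w x) \<le> X"
 shows "answers_within P (nat \<lfloor>real (X ^ k + k) * 2 powr (real (length w + 1) * (1 - c / log 2 (real X)))\<rfloor>) (word_checks tk w x)"
  (is "answers_within P ?B _")
proof -
 have "out P y \<le> length y \<and> (\<exists>t\<le>?B. computes_in P {} y (out P y) t)" if y: "(y, v) \<in> set (word_checks tk w x)" for y v
 proof -
  obtain n F where F: "y = cnf_code n F" "cnf_on n F" "2 \<le> length F" "n \<le> length w + 1" using word_checks_cnf[OF x y] by auto
  have "esize (y, v) \<le> X" using esize_mem[OF y] X by linarith
  then have "length (cnf_code n F) \<le> X" using length_le_esize[of y] F(1) by simp
  from solver_time[OF F(2) this F(3,4)] obtain t where t: "computes_in P {} y (max_sat F) t"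
    "real t \<le> real (X ^ k + k) * 2 powr (real (length w + 1) * (1 - c / log 2 (real X)))" unfolding F(1) by blast
  have "t \<le> ?B" using t(2) by (rule le_nat_floor)
  moreover have "max_sat F \<le> length y" using max_sat_le[of F] length_cnf_code[of F n] F(1) by simp
  ultimately show ?thesis using t(1) out_cnf[OF F(2)] F(1) by auto
 qed
 then show ?thesis unfolding answers_within_def by blast
qed

end

subsection \<open>Stages express acceptance\<close>

lemma word_checks_size: "\<exists>k. \<forall>tk w x. esize (word_checks tk w x) \<le> (esize (word_env tk w) + 2) ^ k"
proof -
 define f where "f = (%(U :: tree list, b, tk, w). checks U tk w b)"
 have f: "poly f" unfolding f_def case_prod_unfold by (intro poly_intros)
 obtain m where m: "\<And>s b. esize s + 2 \<le> b ==> esize (f s) \<le> b ^ m" using pboundD[OF poly_esize[OF f]] by blast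
 have "pbound (%e. (esize e + 2 * (case e of (U, n :: nat, tk, w) => guess_len U tk w) + 5) ^ m)"
  by (intro pbound_intros pbound_esize pbound_guess_len)
 then obtain k where k: "\<And>e. (esize e + 2 * (case e of (U, n :: nat, tk, w) => guess_len U tk w) + 5) ^ m \<le> (esize e + 2) ^ k"
  unfolding pbound_def by blast
 have "esize (word_checks tk w x) \<le> (esize (word_env tk w) + 2) ^ k" for tk w x
 proof -
  have "esize (take (guesses tk w) x) \<le> 2 * guesses tk w" using esize_bits[of "take (guesses tk w) x"] by simp
  then have "esize (unary_pow2 (next_exp tk w), take (guesses tk w) x, tk, w) + 2 \<le> esize (word_env tk w) + 2 * guesses tk w + 5"
   by (simp add: word_env_def)
  from m[OF this] have "esize (word_checks tk w x) \<le> (esize (word_env tk w) + 2 * guesses tk w + 5) ^ m"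
   by (simp add: f_def word_checks_def)
  also have "\<dots> \<le> (esize (word_env tk w) + 2) ^ k" using k[of "word_env tk w"] by (simp add: word_env_def guesses_def)
  finally show ?thesis .
 qed
 then show ?thesis by blast
qed

lemma word_env_size: "esize (word_env tk w) + 2 \<le> 2 ^ next_exp tk w * (20 * length w + (4 * length tk + 20))"
proof -
 define Y where "Y = (2 :: nat) ^ next_exp tk w"
 have "1 \<le> Y" by (simp add: Y_def)
 have "esize (word_env tk w) = Y + next_exp tk w + esize tk + esize w + 3" by (simp add: word_env_def unary_pow2_def Y_def)
 moreover have "next_exp tk w \<le> Y" by (simp add: Y_def less_imp_le)
 ultimately have "esize (word_env tk w) + 2 \<le> Y + Y + (2 * length tk + 2 * length w + 5)"
  using esize_bits[of tk] esize_bits[of w] by linarith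
 also have "\<dots> \<le> Y + Y + Y * (2 * length tk + 2 * length w + 5)"
  using mult_le_mono1[OF \<open>1 \<le> Y\<close>, of "2 * length tk + 2 * length w + 5"] unfolding mult_1 by (rule add_left_mono)
 also have "\<dots> = Y * (2 * length tk + 2 * length w + 7)" by (simp add: distrib_left)
 also have "\<dots> \<le> Y * (20 * length w + (4 * length tk + 20))" by (intro mult_le_mono2) simp
 finally show ?thesis unfolding Y_def .
qed

lemma token_word_le: "3 * length tk + 3 * length w + 10 \<le> (esize (word_env tk w) + 2) ^ 5"
proof -
 define Z where "Z = esize (word_env tk w) + 2"
 have "3 * length tk + 3 * length w + 10 \<le> 2 ^ 4 * Z"
  using length_le_esize[of tk] length_le_esize[of w] by (simp add: Z_def word_env_def)
 also have "\<dots> \<le> Z ^ 4 * Z" by (intro mult_le_mono1 power_mono) (simp_all add: Z_def)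
 also have "\<dots> = Z ^ 5" by (simp add: eval_nat_numeral)
 finally show ?thesis unfolding Z_def .
qed

lemma powr_saving_ge_1:
 assumes c: "0 < c" "c \<le> 1" and l: "1 \<le> (l :: real)"
 shows "1 \<le> 2 powr (real n * (1 - c / l))"
 using assms by (intro ge_one_powr_ge_zero) (simp_all add: divide_le_eq)

lemma stage_time:
 fixes R :: real and Z :: nat
 assumes Z: "2 \<le> Z" and R: "1 \<le> R" and growth: "real Z ^ (a + a * k + k + 10) * R < 2 ^ K"
  and r: "r + 10 \<le> Z ^ 5" and t: "t \<le> Z ^ a * (nat \<lfloor>real ((Z ^ a) ^ k + k) * R\<rfloor> + 1)"
 shows "r + t + 10 < 2 ^ K"
proof -
 define B where "B = nat \<lfloor>real ((Z ^ a) ^ k + k) * R\<rfloor>"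
 have B: "real B \<le> real ((Z ^ a) ^ k + k) * R" unfolding B_def using R by simp
 have "real t \<le> real (Z ^ a) * (real B + 1)" using t unfolding B_def[symmetric] by (metis of_nat_1 of_nat_add of_nat_le_iff of_nat_mult)
 also have "\<dots> \<le> real (Z ^ a) * (real ((Z ^ a) ^ k + k) * R + R)" using B R by (intro mult_left_mono) auto
 also have "\<dots> = real (Z ^ a * ((Z ^ a) ^ k + k + 1)) * R" by (simp add: algebra_simps)
 finally have t_le: "real t \<le> real (Z ^ a * ((Z ^ a) ^ k + k + 1)) * R" .
 have "real (r + 10) \<le> real (Z ^ 5)" using r by (simp only: of_nat_le_iff)
 also have "\<dots> \<le> real (Z ^ 5) * R" using mult_left_mono[OF R, of "real (Z ^ 5)"] by simp
 finally have "real (r + 10) + real t \<le> real (Z ^ 5 + Z ^ a * ((Z ^ a) ^ k + k + 1)) * R"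
  using t_le unfolding of_nat_add[of "Z ^ 5"] distrib_right by linarith
 also have "\<dots> \<le> real (Z ^ (a + a * k + k + 10)) * R"
  by (rule mult_right_mono) (use powers_absorbed[OF Z, of a k] in \<open>simp only: of_nat_le_iff\<close>, use R in simp)
 also have "\<dots> < 2 ^ K" using growth by simp
 finally have "real (r + t + 10) < real (2 ^ K)" by simp
 then show ?thesis by (simp only: of_nat_less_iff)
qed

lemma (in max_sat_solver) verified_stages:
 "\<exists>V q K0. plain V \<and> 1 \<le> q \<and> (\<forall>w. K0 \<le> length w --> (stage_sat (self_token V q) w \<longleftrightarrow>
   (\<exists>x. guesses (self_token V q) w \<le> length x \<and> accepts P (self_token V q) w x)))"
proof -
 obtain V k1 where V: "plain V" and V_run: "\<And>tk w x B. guesses tk w \<le> length x ==> answers_within P B (word_checks tk w x) ==>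
   \<exists>i. evals_within {} V (enc (tk, w), x, []) (enc (accepts P tk w x), i, []) ((esize (word_env tk w) + 2) ^ k1 * (B + 1))"
  using verifier[of P] by blast
 obtain k2 where k2: "\<And>tk w x. esize (word_checks tk w x) \<le> (esize (word_env tk w) + 2) ^ k2" using word_checks_size by blast
 define a where "a = k1 + k2 + 1"
 have a: "1 \<le> a" by (simp add: a_def)
 obtain q where q: "1 \<le> q" and growth_q: "\<And>T. \<exists>K0. \<forall>K\<ge>K0. \<forall>Z x. real x \<le> sqrt (real (K + 1)) / real q --> 2 \<le> Z -->
   Z \<le> 2 ^ x * (20 * K + T) --> real Z ^ (a + a * k + k + 10) * 2 powr (real (K + 1) * (1 - c / (real a * log 2 (real Z)))) < 2 ^ K"
  using growth[OF c(1) a, of "a + a * k + k + 10"] by blast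
 interpret solver_stages P c k V q by unfold_locales (rule V)
 obtain K0 where K0: "\<And>K Z x. K \<ge> K0 ==> real x \<le> sqrt (real (K + 1)) / real q ==> 2 \<le> Z ==> Z \<le> 2 ^ x * (20 * K + (4 * length tk + 20)) ==>
   real Z ^ (a + a * k + k + 10) * 2 powr (real (K + 1) * (1 - c / (real a * log 2 (real Z)))) < 2 ^ K"
  using growth_q[of "4 * length tk + 20"] by blast
 have "stage_sat tk w \<longleftrightarrow> (\<exists>x. guesses tk w \<le> length x \<and> accepts P tk w x)" if w: "K0 + 1 \<le> length w" for w
 proof -
  define Z where "Z = esize (word_env tk w) + 2"
  define R where "R = 2 powr (real (length w + 1) * (1 - c / log 2 (real (Z ^ a))))"
  have Z: "2 \<le> Z" by (simp add: Z_def)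
  then have log_Z: "log 2 (real (Z ^ a)) = real a * log 2 (real Z)" "1 \<le> log 2 (real Z)" by (simp_all add: log_nat_power le_log_iff)
  have "1 * 1 \<le> real a * log 2 (real Z)" using a log_Z(2) by (intro mult_mono) auto
  then have R: "1 \<le> R" unfolding R_def log_Z(1) by (intro powr_saving_ge_1 c) simp
  have exp_le: "real (next_exp tk w) \<le> sqrt (real (length w + 1)) / real q" by (simp add: next_exp_def size_exp_eq[OF q])
  have growth_Z: "real Z ^ (a + a * k + k + 10) * R < 2 ^ length w" unfolding R_def log_Z(1)
   by (rule K0[OF _ exp_le Z]) (use w word_env_size[of tk w] in \<open>simp_all add: Z_def\<close>)
  have "\<exists>t y i q. evals {} V (enc (tk, w), x, []) (y, i, q) t \<and> (y \<noteq> Lf \<longleftrightarrow> accepts P tk w x) \<and>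
    3 * length tk + 3 * length w + t + 10 < 2 ^ length w" if x: "guesses tk w \<le> length x" for x
  proof -
   let ?B = "nat \<lfloor>real ((Z ^ a) ^ k + k) * R\<rfloor>"
   have powers: "Z ^ k1 \<le> Z ^ a" "Z ^ k2 \<le> Z ^ a" by (rule power_increasing; use Z in \<open>simp add: a_def\<close>)+
   have "esize (word_checks tk w x) \<le> Z ^ a" using k2[of tk w x] powers(2) unfolding Z_def by linarith
   from answers_within_word_checks[OF x this] have "answers_within P ?B (word_checks tk w x)" unfolding R_def .
   from V_run[OF x this] obtain i t where t: "t \<le> Z ^ k1 * (?B + 1)" and
    run: "evals {} V (enc (tk, w), x, []) (enc (accepts P tk w x), i, []) t" unfolding evals_within_def Z_def[symmetric] by blast
   have "t \<le> Z ^ a * (?B + 1)" using t mult_le_mono1[OF powers(1)] by (rule le_trans)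
   then have "3 * length tk + 3 * length w + t + 10 < 2 ^ length w" using stage_time[OF Z R growth_Z] token_word_le[of tk w] unfolding Z_def by blast
   moreover have "enc (accepts P tk w x) \<noteq> Lf \<longleftrightarrow> accepts P tk w x" by simp
   ultimately show ?thesis using run by blast
  qed
  then show ?thesis unfolding stage_sat_def table_dim_def stage_self
   using w by (intro stage_csp_correct[OF V _ tag_len_self]) auto
 qed
 then show ?thesis using V q by blast
qed

subsection \<open>Small circuits describe the first witness\<close>

context stages
begin

lemma size_exp_dominates:
 assumes g: "g \<in> o(%n. sqrt (real n))" and q: "1 \<le> q"
 shows "\<exists>K0. \<forall>K\<ge>K0. g (K + table_dim tk K) \<le> real (size_exp q K)"
proof -
 define a where "a = 3 * length tk + length (tok_code tk) + 40"
 have "\<forall>\<^sub>F n in sequentially. norm (g n) \<le> 1 / (8 * real q) * norm (sqrt (real n))"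
  by (rule landau_o.smallD[OF g]) (use q in simp)
 then obtain N where N: "\<And>n. n \<ge> N ==> norm (g n) \<le> 1 / (8 * real q) * norm (sqrt (real n))"
  unfolding eventually_sequentially by blast
 have "g (K + table_dim tk K) \<le> real (size_exp q K)" if K: "N + a + 4 * q * q \<le> K" for K
 proof -
  let ?n = "K + table_dim tk K"
  have n: "?n \<le> 16 * K" "N \<le> ?n" using K by (simp_all add: table_dim_def tag_len_def a_def)
  define r where "r = sqrt (real K) / real q"
  have "sqrt (real ?n) \<le> sqrt (16 * real K)" using n(1) by (intro real_sqrt_le_mono) linarith
  also have "\<dots> = 4 * sqrt (real K)" by (simp add: real_sqrt_mult)
  finally have "1 / (8 * real q) * sqrt (real ?n) \<le> 1 / (8 * real q) * (4 * sqrt (real K))" by (intro mult_left_mono) auto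
  then have g_le: "g ?n \<le> r / 2" using N[OF n(2)] by (simp add: r_def)
  have "real (4 * q * q) \<le> real K" using K by (simp only: of_nat_le_iff)
  then have "(2 * real q)\<^sup>2 \<le> real K" by (simp add: power2_eq_square)
  then have "2 * real q \<le> sqrt (real K)" by (rule real_le_rsqrt)
  then have "2 \<le> r" using q by (simp add: r_def field_simps)
  then show ?thesis using g_le unfolding size_exp_eq[OF q] r_def[symmetric] by linarith
 qed
 then show ?thesis by blast
qed

lemma circuit_desc_sat:
 assumes circuit: "has_sym_and_circuit (witness_lang tk) (length w + table_dim tk (length w)) (2 powr e)"
  and e: "e \<le> real (size_exp q (length w))" and w: "length w \<ge> 1" and satisfiable: "stage_sat tk w"
 shows "\<exists>b. length b = code_len tk (length w) \<and> desc_sat tk w b"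
proof -
 define L where "L = table_dim tk (length w)"
 obtain f Gs where C: "circuit_on (length w + L) (SymAnd f Gs)" "real (circuit_size (SymAnd f Gs)) \<le> 2 powr e"
  "\<And>x. length x = length w + L ==> circuit_eval (SymAnd f Gs) x \<longleftrightarrow> x \<in> witness_lang tk"
  using circuit unfolding has_sym_and_circuit_def L_def by (metis sym_and.exhaust)
 have "2 powr e \<le> 2 ^ size_exp q (length w)" using e by (simp add: powr_realpow[symmetric])
 moreover have "real (length Gs) + 1 \<le> 2 powr e" using C(2) by simp
 ultimately have "real (length Gs) \<le> 2 ^ size_exp q (length w)" by linarith
 then have "length Gs \<le> 2 ^ size_exp q (length w)" by (metis of_nat_le_iff of_nat_numeral of_nat_power)
 moreover have "1 \<le> L" using w by (simp add: L_def table_dim_def)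
 ultimately obtain D where D: "is_desc (2 ^ size_exp q (length w)) L D" "\<And>x. length x = L ==> desc_eval D x \<longleftrightarrow> circuit_eval (SymAnd f Gs) (w @ x)"
  using circuit_is_desc[OF C(1)] by blast
 have patterns: "length \<pi> = L" if "fam \<in> set (stage tk w)" "(\<pi>, b) \<in> set fam" for fam \<pi> b
  unfolding L_def by (rule stage_families(2)[OF w that])
 obtain W where W: "sat L (stage tk w) W" using satisfiable unfolding stage_sat_def L_def by blast
 have "\<exists>v. is_witness tk w v" by (rule sat_is_witness[OF W L_def]) (rule patterns)
 then have first: "sat L (stage tk w) (table_bit (first_witness tk w (2 ^ L)))"
  using first_witness_is_witness[of tk w] unfolding is_witness_iff L_def by blast
 have "desc_eval D x = table_bit (first_witness tk w (2 ^ L)) x" if "x \<in> rows L" for x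
  using that D(2)[of x] C(3)[of "w @ x"] append_in_witness_lang[of x tk w] by (simp add: rows_def L_def)
 with patterns have "sat L (stage tk w) (desc_eval D) \<longleftrightarrow> sat L (stage tk w) (table_bit (first_witness tk w (2 ^ L)))" by (rule sat_cong)
 moreover obtain b where "length b = code_len tk (length w)" "desc_of tk (length w) b = D"
  using decode_desc_surj[OF D(1)] unfolding code_len_def desc_of_def L_def tok_exp_self by blast
 ultimately show ?thesis using first unfolding desc_sat_def L_def by blast
qed

end

subsection \<open>The diagonal word\<close>

locale diagonal = solver_stages P c k V q for P c k V q +
 fixes K0 :: nat
 assumes succinct: "K0 \<le> length w ==> stage_sat (self_token V q) w ==> \<exists>b. length b = code_len (self_token V q) (length w) \<and> desc_sat (self_token V q) w b"
  and verified: "K0 \<le> length w ==> stage_sat (self_token V q) w \<longleftrightarrow>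
   (\<exists>x. guesses (self_token V q) w \<le> length x \<and> accepts P (self_token V q) w x)"
begin

lemma stage_sat_iff_desc: "K0 \<le> length w ==> stage_sat tk w \<longleftrightarrow> (\<exists>b. length b = code_len tk (length w) \<and> desc_sat tk w b)"
 using succinct unfolding stage_sat_def desc_sat_def by blast

lemma stage_sat_branch:
 assumes w: "K0 \<le> length w" and branch: "\<not> is_diag tk w"
 shows "stage_sat tk w \<longleftrightarrow> stage_sat tk (w @ [False]) \<and> stage_sat tk (w @ [True])"
proof -
 define s where "s = code_len tk (Suc (length w))"
 have accepts: "accepts P tk w x \<longleftrightarrow> desc_sat tk (w @ [False]) (take s x) \<and> desc_sat tk (w @ [True]) (take s (drop s x))"
  if "2 * s \<le> length x" for x
  using hit_stage_checks[of "w @ [False]" "take s x"] hit_stage_checks[of "w @ [True]" "take s (drop s x)"] branch that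
  by (simp add: accepts_def word_checks_branch[OF branch s_def] hit_def bex_Un s_def[symmetric])
 have "stage_sat tk w \<longleftrightarrow> (\<exists>x. 2 * s \<le> length x \<and> desc_sat tk (w @ [False]) (take s x) \<and> desc_sat tk (w @ [True]) (take s (drop s x)))"
  using verified[OF w] branch accepts by (auto simp: guesses_eq s_def[symmetric])
 also have "\<dots> \<longleftrightarrow> (\<exists>b. length b = s \<and> desc_sat tk (w @ [False]) b) \<and> (\<exists>b. length b = s \<and> desc_sat tk (w @ [True]) b)"
 proof (intro iffI; elim exE conjE)
  fix x assume "2 * s \<le> length x" "desc_sat tk (w @ [False]) (take s x)" "desc_sat tk (w @ [True]) (take s (drop s x))"
  moreover from this(1) have "length (take s x) = s" "length (take s (drop s x)) = s" by simp_all
  ultimately show "(\<exists>b. length b = s \<and> desc_sat tk (w @ [False]) b) \<and> (\<exists>b. length b = s \<and> desc_sat tk (w @ [True]) b)" by blast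
 next
  fix b b' assume "length b = s" "desc_sat tk (w @ [False]) b" "length b' = s" "desc_sat tk (w @ [True]) b'"
  then show "\<exists>x. 2 * s \<le> length x \<and> desc_sat tk (w @ [False]) (take s x) \<and> desc_sat tk (w @ [True]) (take s (drop s x))"
   by (intro exI[of _ "b @ b'"]) simp
 qed
 also have "\<dots> \<longleftrightarrow> stage_sat tk (w @ [False]) \<and> stage_sat tk (w @ [True])"
  using stage_sat_iff_desc[of "w @ [False]"] stage_sat_iff_desc[of "w @ [True]"] w by (simp add: s_def)
 finally show ?thesis .
qed

definition root :: bits where
 "root = replicate K0 True @ [False]"

lemma length_root [simp]: "length root = Suc K0"
 by (simp add: root_def)

lemma start_len_root: "start_len (root @ v) = length root"
 using start_len_replicate[of K0 v] by (simp add: root_def)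

lemma is_diag_root: "is_diag tk (root @ v) \<longleftrightarrow> length v = code_len tk (length root)"
 unfolding is_diag_iff start_len_root by simp

lemma stage_sat_leaf:
 assumes v: "length v = code_len tk (length root)"
 shows "stage_sat tk (root @ v) \<longleftrightarrow> \<not> desc_sat tk root v"
proof -
 have diag: "is_diag tk (root @ v)" using v by (simp only: is_diag_root)
 then have "stage_sat tk (root @ v) \<longleftrightarrow> (\<exists>x. accepts P tk (root @ v) x)" using verified[of "root @ v"] by (simp add: guesses_eq)
 also have "\<dots> \<longleftrightarrow> hit P (stage_checks tk root (desc_of tk (length root) v))"
  unfolding accepts_def word_checks_diag[OF diag] start_len_root using diag by simp
 also have "\<dots> \<longleftrightarrow> \<not> desc_sat tk root v" by (rule hit_stage_checks[OF _ v]) simp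
 finally show ?thesis .
qed

lemma stage_sat_subtree:
 "length v + j = code_len tk (length root) ==> stage_sat tk (root @ v) \<longleftrightarrow> (\<forall>u. length u = j --> stage_sat tk (root @ v @ u))"
proof (induction j arbitrary: v)
 case (Suc j)
 then have "\<not> is_diag tk (root @ v)" unfolding is_diag_root by simp
 then have "stage_sat tk (root @ v) \<longleftrightarrow> (\<forall>b. stage_sat tk (root @ (v @ [b])))" using stage_sat_branch[of "root @ v"] by (auto simp: all_bool_eq)
 also have "\<dots> \<longleftrightarrow> (\<forall>b u. length u = j --> stage_sat tk (root @ (v @ [b]) @ u))" using Suc.IH[of "v @ [_]"] Suc.prems by simp
 also have "\<dots> \<longleftrightarrow> (\<forall>u. length u = Suc j --> stage_sat tk (root @ v @ u))" by (auto simp: length_Suc_conv)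
 finally show ?case .
qed simp

lemma contradiction: False
proof -
 have "stage_sat tk root \<longleftrightarrow> (\<forall>u. length u = code_len tk (length root) --> stage_sat tk (root @ u))"
  using stage_sat_subtree[of "[]" "code_len tk (length root)"] by simp
 also have "\<dots> \<longleftrightarrow> \<not> (\<exists>u. length u = code_len tk (length root) \<and> desc_sat tk root u)" using stage_sat_leaf by blast
 also have "\<dots> \<longleftrightarrow> \<not> stage_sat tk root" using stage_sat_iff_desc[of root] by simp
 finally show False by blast
qed

end

lemma max_sat_solver_exists:
 assumes "\<exists>P c. c > 0 \<and> solves_MAX_SAT_in_time P (\<lambda>n m. 2 powr (real n - c * (real n / log 2 (real m))))"
 shows "\<exists>P c k. max_sat_solver P c k"
proof -
 obtain P c k where c: "c > 0" and solver: "\<And>n F. cnf_on n F ==> \<exists>t. computes_in P {} (cnf_code n F) (max_sat F) t \<and>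
   real t \<le> real (length (cnf_code n F) ^ k + k) * 2 powr (real n - c * (real n / log 2 (real (length F))))"
  using assms unfolding solves_MAX_SAT_in_time_def by blast
 have "max_sat_solver P (min c 1) k"
 proof
  fix n F assume "cnf_on n F"
  then obtain t where t: "computes_in P {} (cnf_code n F) (max_sat F) t"
   "real t \<le> real (length (cnf_code n F) ^ k + k) * 2 powr (real n - c * (real n / log 2 (real (length F))))" using solver by blast
  have "0 \<le> real n / log 2 (real (length F))" by (cases F) (auto simp: log_def)
  then have "min c 1 * (real n / log 2 (real (length F))) \<le> c * (real n / log 2 (real (length F)))" by (intro mult_right_mono) auto
  then have "real (length (cnf_code n F) ^ k + k) * 2 powr (real n - c * (real n / log 2 (real (length F))))
    \<le> real (length (cnf_code n F) ^ k + k) * 2 powr (real n - min c 1 * (real n / log 2 (real (length F))))"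
   by (intro mult_left_mono) auto
  then show "\<exists>t. computes_in P {} (cnf_code n F) (max_sat F) t \<and>
    real t \<le> real (length (cnf_code n F) ^ k + k) * 2 powr (real n - min c 1 * (real n / log 2 (real (length F))))" using t by fastforce
 qed (use c in auto)
 then show ?thesis by blast
qed

theorem theorem1p17:
  assumes "\<exists>P c. c > 0 \<and>
    solves_MAX_SAT_in_time P (\<lambda>n m. 2 powr (real n - c * (real n / log 2 (real m))))"
  shows "\<forall>g. g \<in> o(\<lambda>n. sqrt (real n)) \<longrightarrow> E_NP_lacks_sym_and_circuits (\<lambda>n. 2 powr g n)"
proof (intro allI impI, rule ccontr)
 fix g :: "nat => real"
 assume g: "g \<in> o(\<lambda>n. sqrt (real n))" and small: "\<not> E_NP_lacks_sym_and_circuits (\<lambda>n. 2 powr g n)"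
 obtain P c k where "max_sat_solver P c k" using max_sat_solver_exists[OF assms] by blast
 then interpret max_sat_solver P c k .
 obtain V q K1 where V: "plain V" and q: "1 \<le> q" and verified: "\<And>w. K1 \<le> length w ==> stage_sat (self_token V q) w \<longleftrightarrow>
   (\<exists>x. guesses (self_token V q) w \<le> length x \<and> accepts P (self_token V q) w x)" using verified_stages by blast
 interpret solver_stages P c k V q by unfold_locales (rule V)
 have "\<forall>\<^sub>\<infinity>n. has_sym_and_circuit (witness_lang tk) n (2 powr g n)"
  using small witness_lang_E_NP[of tk] unfolding E_NP_lacks_sym_and_circuits_def by (auto simp: not_frequently)
 then obtain N where circuits: "\<And>n. N \<le> n ==> has_sym_and_circuit (witness_lang tk) n (2 powr g n)"
  unfolding cofinite_eq_sequentially eventually_sequentially by blast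
 obtain K2 where size: "\<And>K. K2 \<le> K ==> g (K + table_dim tk K) \<le> real (size_exp q K)" using size_exp_dominates[OF g q] by blast
 interpret diagonal P c k V q "K1 + K2 + N + 1"
  by unfold_locales (auto intro!: verified circuit_desc_sat circuits size)
 show False by (rule contradiction)
qed
end
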